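(* Let $W$ be any finite dimensional $I\times\mathbb Z$-graded vector space, of dimension $w=\sum_{r=1}^s\delta_{i_r,k_r}$ with $(i_r,k_r)\in I\times\mathbb Z$, and let $I_W=\bigoplus_{r=1}^sI_{i_r,k_r}$. There is a homeomorphism $$\mathrm{crit}(\hat f_2^\bullet)=\widetilde{\mathrm{Gr}}{}^\bullet(I_W),$$ and $\mathrm{crit}(\hat f_2^\bullet)\subset\widehat{\mathfrak L}^\bullet(W)$.
   Context: **Quiver varieties.** $\mathbf c=(c_{ij})_{i,j\in I}$ is the Cartan matrix of a simple complex Lie algebra, $(d_i)$ its minimal symmetrizer, $b_{ij}=d_ic_{ij}=b_{ji}$, and $\delta_{i,k}$ is the Dirac function at $(i,k)\in I\times\mathbb Z$. Fix an orientation $O\subset I\times I$: for $i\ne j$ with $c_{ij}<0$ exactly one of $(i,j),(j,i)$ is in $O$, and no other pairs are; $o_{ij}=1$ if $(i,j)\in O$, $-1$ if $(j,i)\in O$, $0$ otherwise. For $I\times\mathbb Z$-graded finite dimensional $V,W$ consider tuples $x=(\alpha_{ij},a_i,\varepsilon_i)$ with $\alpha_{ij}:V_j\to V_i$ (for $c_{ij}<0$), $a_i:V_i\to W_i$, $\varepsilon_i:V_i\to V_i$ homogeneous of degrees $b_{ij},-d_i,2d_i$. The tuple $x$ is stable if no non-zero graded subspace of $V$ is preserved by all $\alpha_{ij},\varepsilon_i$ and contained in $\bigoplus_i\mathrm{Ker}(a_i)$. $\widehat{\mathfrak M}^\bullet(v,W)$ is the quotient of the stable locus by the degree $0$ automorphisms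 of $V$ ($\dim V=v\in\mathbb N(I\times\mathbb Z)$), $\widehat{\mathfrak M}^\bullet(W)=\bigsqcup_v\widehat{\mathfrak M}^\bullet(v,W)$, and $\widehat{\mathfrak L}^\bullet(W)$ is the fibre over $0$ of its map to the affine (categorical) quotients of the spaces of all tuples. The function $\hat f_2^\bullet$ on $\widehat{\mathfrak M}^\bullet(W)$ is $\hat f_2^\bullet(x)=\sum_{i,j}o_{ij}\mathrm{Tr}(\varepsilon_i^{-c_{ij}}\alpha_{ij}\alpha_{ji})$, and $\mathrm{crit}(\hat f_2^\bullet)$ is its critical set. **Preprojective algebra.** $\widetilde\Pi$ is the quotient of the path algebra of the quiver with vertices $I$, arrows $\alpha_{ij}:j\to i$ ($c_{ij}<0$) and loops $\varepsilon_i:i\to i$, by the relations $\varepsilon_i^{-c_{ij}}\alpha_{ij}=\alpha_{ij}\varepsilon_j^{-c_{ji}}$ and, for each $i$, $\sum_j\sum_{k=0}^{-c_{ij}-1}o_{ij}\varepsilon_i^k\alpha_{ij}\alpha_{ji}\varepsilon_i^{-c_{ij}-1-k}=0$. It is graded by $\deg\alpha_{ij}=b_{ij}$, $\deg\varepsilon_i=2d_i$; $e_i$ is the trivial path at $i$. Let $t\in\{1,2,3\}$ be the lacing number and $t_i=t/d_i$; the element $\omega=\sum_i\varepsilon_i^{t_i}$ is central; $\widetilde\Pi_l=\widetilde\Pi/\widetilde\Pi\omega^l$. $\tau$ is the anti-automorphism of $\widetilde\Pi$ with $\tau(e_i)=e_i$, $\tau(\varepsilon_i)=\varepsilon_i$,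 $\tau(\alpha_{ij})=\alpha_{ji}$. For a graded module $M$, $M^\vee$ is the graded dual, $(M^\vee)_k=(M_{-k})^\vee$, with the transposed action twisted by $\tau$, and $M[n]$ is the grading shift, $M[n]_m=M_{n+m}$. Set $I_i=\bigcup_{l>0}(\widetilde\Pi_le_i)^\vee$ and $I_{i,k}=I_i[-k]$. For a graded $\widetilde\Pi$-module $M$ that is a finite direct sum of modules $I_{i,k}$, $\widetilde{\mathrm{Gr}}{}^\bullet(M)=\bigsqcup_{v\in\mathbb N(I\times\mathbb Z)}\widetilde{\mathrm{Gr}}{}^\bullet_v(M)$, where $\widetilde{\mathrm{Gr}}{}^\bullet_v(M)$ is the Grassmannian of all graded $\widetilde\Pi$-submodules of $M$ of dimension $v$.
   Formalization: I_W is taken as the direct sum of I_{i_r, k_r+d_{i_r}} instead of I_{i_r,k_r}, since a_i has degree -d_i; with the printed I_W the homeomorphism fails for some W when the d_{i_r} differ (e.g. type B_2), and for equal d_{i_r} the two forms agree up to relabelling v. *)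

theory Defs
  imports
    "HOL-Analysis.Function_Topology"
    "HOL-Analysis.Sum_Topology"
    "HOL-Library.Function_Algebras"
    "Jordan_Normal_Form.Matrix"
begin

section \<open>Cartan data\<close>

definition symmetrizer :: "('i::finite \<Rightarrow> 'i \<Rightarrow> int) \<Rightarrow> ('i \<Rightarrow> int) \<Rightarrow> bool" where
  "symmetrizer c d \<longleftrightarrow> (\<forall>i. d i > 0) \<and> (\<forall>i j. d i * c i j = d j * c j i)"

text \<open>The Cartan matrices of the simple complex Lie algebras, as the indecomposable generalized
  Cartan matrices of finite type: the symmetrized matrix is positive definite.\<close>

definition simple_cartan_matrix :: "('i::finite \<Rightarrow> 'i \<Rightarrow> int) \<Rightarrow> bool" where
  "simple_cartan_matrix c \<longleftrightarrow>
     (\<forall>i. c i i = 2) \<and>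
     (\<forall>i j. i \<noteq> j \<longrightarrow> c i j \<le> 0) \<and>
     (\<forall>i j. c i j = 0 \<longleftrightarrow> c j i = 0) \<and>
     (\<forall>J. J \<noteq> {} \<and> J \<noteq> UNIV \<longrightarrow> (\<exists>i\<in>J. \<exists>j\<in>-J. c i j \<noteq> 0)) \<and>
     (\<exists>d. symmetrizer c d \<and>
        (\<forall>x::'i \<Rightarrow> real. (\<exists>i. x i \<noteq> 0) \<longrightarrow>
           (\<Sum>i\<in>UNIV. \<Sum>j\<in>UNIV. real_of_int (d i * c i j) * x i * x j) > 0))"

definition minimal_symmetrizer :: "('i::finite \<Rightarrow> 'i \<Rightarrow> int) \<Rightarrow> ('i \<Rightarrow> int) \<Rightarrow> bool" where
  "minimal_symmetrizer c d \<longleftrightarrow>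
     symmetrizer c d \<and> (\<forall>d'. symmetrizer c d' \<longrightarrow> (\<forall>i. d i \<le> d' i))"

definition orientation :: "('i::finite \<Rightarrow> 'i \<Rightarrow> int) \<Rightarrow> ('i \<times> 'i) set \<Rightarrow> bool" where
  "orientation c Or \<longleftrightarrow>
     Or \<subseteq> {(i, j). i \<noteq> j \<and> c i j < 0} \<and>
     (\<forall>i j. i \<noteq> j \<and> c i j < 0 \<longrightarrow> ((i, j) \<in> Or \<longleftrightarrow> (j, i) \<notin> Or))"

definition dirac :: "'p \<Rightarrow> 'p \<Rightarrow> nat" where
  "dirac p q = (if q = p then 1 else 0)"

section \<open>Linear algebra and topology\<close>

text \<open>Unlike \<open>vector_space.dim S = n\<close>, this forces \<open>S\<close> to be a finite dimensional subspace.\<close>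

definition has_dim :: "(complex \<Rightarrow> 'w::ab_group_add \<Rightarrow> 'w) \<Rightarrow> 'w set \<Rightarrow> nat \<Rightarrow> bool" where
  "has_dim sc S n \<longleftrightarrow>
     (\<exists>B. finite B \<and> card B = n \<and> \<not> Modules.module.dependent sc B \<and> Modules.module.span sc B = S)"

definition graded_space :: "(complex \<Rightarrow> 'w::ab_group_add \<Rightarrow> 'w) \<Rightarrow> ('i \<times> int \<Rightarrow> 'w set) \<Rightarrow> bool" where
  "graded_space sc W \<longleftrightarrow>
     Vector_Spaces.vector_space sc \<and> (\<forall>p. \<exists>n. has_dim sc (W p) n) \<and> finite {p. W p \<noteq> {0}}"

definition vec_subspace :: "nat \<Rightarrow> complex vec set \<Rightarrow> bool" where
  "vec_subspace n U \<longleftrightarrow>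
     U \<subseteq> carrier_vec n \<and> 0\<^sub>v n \<in> U \<and> (\<forall>u\<in>U. \<forall>u'\<in>U. u + u' \<in> U) \<and> (\<forall>z. \<forall>u\<in>U. z \<cdot>\<^sub>v u \<in> U)"

definition mat_trace :: "complex mat \<Rightarrow> complex" where
  "mat_trace A = (\<Sum>r<dim_row A. A $$ (r, r))"

inductive_set polys :: "('x \<Rightarrow> complex) set \<Rightarrow> ('x \<Rightarrow> complex) set" for X where
  const: "(\<lambda>_. z) \<in> polys X"
| coord: "f \<in> X \<Longrightarrow> f \<in> polys X"
| add: "f \<in> polys X \<Longrightarrow> g \<in> polys X \<Longrightarrow> (\<lambda>x. f x + g x) \<in> polys X"
| mult: "f \<in> polys X \<Longrightarrow> g \<in> polys X \<Longrightarrow> (\<lambda>x. f x * g x) \<in> polys X"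

definition initial_topology :: "'x set \<Rightarrow> ('x \<Rightarrow> complex) set \<Rightarrow> 'x topology" where
  "initial_topology S X =
     pullback_topology S (\<lambda>x. \<lambda>f\<in>X. f x) (product_topology (\<lambda>_. euclidean) X)"

definition final_topology :: "'x topology \<Rightarrow> ('x \<Rightarrow> 'y) \<Rightarrow> 'y topology" where
  "final_topology T q =
     topology (\<lambda>U. U \<subseteq> q ` topspace T \<and> openin T {x \<in> topspace T. q x \<in> U})"

lemma openin_final_topology:
  "openin (final_topology T q) U \<longleftrightarrow> U \<subseteq> q ` topspace T \<and> openin T {x \<in> topspace T. q x \<in> U}"
proof -
  let ?P = "\<lambda>U. U \<subseteq> q ` topspace T \<and> openin T {x \<in> topspace T. q x \<in> U}"
  have "istopology ?P"
    unfolding istopology_def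
  proof (intro conjI allI impI)
    fix S S' assume "?P S" "?P S'"
    moreover have "{x \<in> topspace T. q x \<in> S \<inter> S'} =
        {x \<in> topspace T. q x \<in> S} \<inter> {x \<in> topspace T. q x \<in> S'}" by auto
    ultimately show "S \<inter> S' \<subseteq> q ` topspace T" "openin T {x \<in> topspace T. q x \<in> S \<inter> S'}"
      by (auto intro: openin_Int)
  next
    fix K assume K: "\<forall>S\<in>K. ?P S"
    have "{x \<in> topspace T. q x \<in> \<Union>K} = \<Union>((\<lambda>S. {x \<in> topspace T. q x \<in> S}) ` K)" by auto
    with K show "\<Union>K \<subseteq> q ` topspace T" "openin T {x \<in> topspace T. q x \<in> \<Union>K}"
      by (auto intro!: openin_Union)
  qed
  then show ?thesis
    by (simp add: final_topology_def topology_inverse')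
qed

lemma topspace_final_topology: "topspace (final_topology T q) = q ` topspace T"
proof (rule subset_antisym)
  show "topspace (final_topology T q) \<subseteq> q ` topspace T"
    using openin_final_topology openin_topspace by metis
  have "{x \<in> topspace T. q x \<in> q ` topspace T} = topspace T" by auto
  then show "q ` topspace T \<subseteq> topspace (final_topology T q)"
    by (intro openin_subset) (simp add: openin_final_topology)
qed

lemma topspace_initial_topology: "topspace (initial_topology S X) = S"
  by (auto simp: initial_topology_def topspace_pullback_topology)

section \<open>Tuples and paths\<close>

text \<open>\<open>V\<close> is the graded space with components \<open>carrier_vec (v (i, k))\<close>, and \<open>W\<close> is an arbitrary
  finite dimensional graded space, given by subspaces of a complex vector space. For a tuple \<open>x\<close>,
  \<open>al x i j k\<close> maps the component \<open>(j, k)\<close> of \<open>V\<close> to the component \<open>(i, k + b i j)\<close>,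
  \<open>ar x i k\<close> maps the component \<open>(i, k)\<close> of \<open>V\<close> to the component \<open>(i, k - d i)\<close> of \<open>W\<close>, and
  \<open>ep x i k\<close> maps the component \<open>(i, k)\<close> of \<open>V\<close> to the component \<open>(i, k + 2 * d i)\<close>.\<close>

record ('i, 'w) tuple =
  al :: "'i \<Rightarrow> 'i \<Rightarrow> int \<Rightarrow> complex mat"
  ar :: "'i \<Rightarrow> int \<Rightarrow> complex vec \<Rightarrow> 'w"
  ep :: "'i \<Rightarrow> int \<Rightarrow> complex mat"

datatype 'i arrow = Alpha 'i 'i | Eps 'i

primrec arrow_src :: "'i arrow \<Rightarrow> 'i" where
  "arrow_src (Alpha i j) = j"
| "arrow_src (Eps i) = i"

primrec arrow_tgt :: "'i arrow \<Rightarrow> 'i" where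
  "arrow_tgt (Alpha i j) = i"
| "arrow_tgt (Eps i) = i"

primrec arrow_op :: "'i arrow \<Rightarrow> 'i arrow" where
  "arrow_op (Alpha i j) = Alpha j i"
| "arrow_op (Eps i) = Eps i"

text \<open>A path is a pair \<open>(i, as)\<close> of its source \<open>i\<close> and its word \<open>as\<close>, written as a product in the
  path algebra: the last letter of \<open>as\<close> is the arrow leaving \<open>i\<close>.\<close>

type_synonym 'i path = "'i \<times> 'i arrow list"

fun path_tgt :: "'i path \<Rightarrow> 'i" where
  "path_tgt (i, []) = i"
| "path_tgt (i, a # as) = arrow_tgt a"

definition path_op :: "'i path \<Rightarrow> 'i path" where
  "path_op p = (path_tgt p, rev (map arrow_op (snd p)))"

definition single :: "'i path \<Rightarrow> 'i path \<Rightarrow> complex" where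
  "single p = (\<lambda>q. if q = p then 1 else 0)"

text \<open>The product of the path algebra: the coefficient of a path in \<open>x * y\<close> is the sum over all ways
  to cut it in two.\<close>

definition pa_mult :: "('i path \<Rightarrow> complex) \<Rightarrow> ('i path \<Rightarrow> complex) \<Rightarrow> 'i path \<Rightarrow> complex" where
  "pa_mult x y = (\<lambda>(i, as). \<Sum>m\<le>length as.
      x (path_tgt (i, drop m as), take m as) * y (i, drop m as))"

definition pairing :: "('i path \<Rightarrow> complex) \<Rightarrow> ('i path \<Rightarrow> complex) \<Rightarrow> complex" where
  "pairing f x = (\<Sum>p | x p \<noteq> 0. f p * x p)"

definition scale_fam :: "complex \<Rightarrow> (nat \<Rightarrow> 'i path \<Rightarrow> complex) \<Rightarrow> nat \<Rightarrow> 'i path \<Rightarrow> complex" where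
  "scale_fam z u = (\<lambda>r p. z * u r p)"

lemma vector_space_scale_fam: "Vector_Spaces.vector_space scale_fam"
  by unfold_locales (auto simp: scale_fam_def fun_eq_iff algebra_simps)

section \<open>The preprojective algebra and the Grassmannian\<close>

locale cartan_datum =
  fixes c :: "'i::finite \<Rightarrow> 'i \<Rightarrow> int" and d :: "'i \<Rightarrow> int" and Or :: "('i \<times> 'i) set"
  assumes cartan: "simple_cartan_matrix c"
    and symm: "minimal_symmetrizer c d"
    and orient: "orientation c Or"
begin

definition b :: "'i \<Rightarrow> 'i \<Rightarrow> int" where
  "b i j = d i * c i j"

definition osign :: "'i \<Rightarrow> 'i \<Rightarrow> complex" where
  "osign i j = (if (i, j) \<in> Or then 1 else if (j, i) \<in> Or then -1 else 0)"

fun is_arrow :: "'i arrow \<Rightarrow> bool" where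
  "is_arrow (Alpha i j) \<longleftrightarrow> c i j < 0"
| "is_arrow (Eps i) \<longleftrightarrow> True"

fun is_path :: "'i path \<Rightarrow> bool" where
  "is_path (i, []) \<longleftrightarrow> True"
| "is_path (i, a # as) \<longleftrightarrow> is_arrow a \<and> arrow_src a = path_tgt (i, as) \<and> is_path (i, as)"

fun arrow_deg :: "'i arrow \<Rightarrow> int" where
  "arrow_deg (Alpha i j) = b i j"
| "arrow_deg (Eps i) = 2 * d i"

definition path_deg :: "'i path \<Rightarrow> int" where
  "path_deg p = sum_list (map arrow_deg (snd p))"

definition path_algebra :: "('i path \<Rightarrow> complex) set" where
  "path_algebra = {x. finite {p. x p \<noteq> 0} \<and> (\<forall>p. x p \<noteq> 0 \<longrightarrow> is_path p)}"

definition pa_one :: "'i path \<Rightarrow> complex" where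
  "pa_one = (\<Sum>i\<in>UNIV. single (i, []))"

primrec pa_power :: "('i path \<Rightarrow> complex) \<Rightarrow> nat \<Rightarrow> 'i path \<Rightarrow> complex" where
  "pa_power x 0 = pa_one"
| "pa_power x (Suc n) = pa_mult x (pa_power x n)"

definition pa_tau :: "('i path \<Rightarrow> complex) \<Rightarrow> 'i path \<Rightarrow> complex" where
  "pa_tau x = (\<lambda>p. if is_path p then x (path_op p) else 0)"

definition rel_comm :: "'i \<Rightarrow> 'i \<Rightarrow> 'i path \<Rightarrow> complex" where
  "rel_comm i j =
     single (j, replicate (nat (- c i j)) (Eps i) @ [Alpha i j])
     - single (j, Alpha i j # replicate (nat (- c j i)) (Eps j))"

definition rel_mesh :: "'i \<Rightarrow> 'i path \<Rightarrow> complex" where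
  "rel_mesh i = (\<lambda>p. \<Sum>j | c i j < 0. \<Sum>k<nat (- c i j). osign i j *
     single (i, replicate k (Eps i) @ [Alpha i j, Alpha j i]
                @ replicate (nat (- c i j) - 1 - k) (Eps i)) p)"

inductive_set rel_ideal :: "('i path \<Rightarrow> complex) set" where
  comm: "c i j < 0 \<Longrightarrow> rel_comm i j \<in> rel_ideal"
| mesh: "rel_mesh i \<in> rel_ideal"
| zero: "0 \<in> rel_ideal"
| add: "x \<in> rel_ideal \<Longrightarrow> y \<in> rel_ideal \<Longrightarrow> x + y \<in> rel_ideal"
| left: "x \<in> rel_ideal \<Longrightarrow> y \<in> path_algebra \<Longrightarrow> pa_mult y x \<in> rel_ideal"
| right: "x \<in> rel_ideal \<Longrightarrow> y \<in> path_algebra \<Longrightarrow> pa_mult x y \<in> rel_ideal"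

definition lacing :: int where
  "lacing = Max (range d)"

definition omega :: "'i path \<Rightarrow> complex" where
  "omega = (\<Sum>i\<in>UNIV. single (i, replicate (nat (lacing div d i)) (Eps i)))"

text \<open>The kernel of the surjection of the path algebra onto the truncation of the preprojective
  algebra by the \<open>l\<close>-th power of \<open>omega\<close>.\<close>

definition trunc_kernel :: "nat \<Rightarrow> ('i path \<Rightarrow> complex) set" where
  "trunc_kernel l = {x + pa_mult y (pa_power omega l) | x y. x \<in> rel_ideal \<and> y \<in> path_algebra}"

text \<open>A linear form on a quotient of the left ideal spanned by the paths with source \<open>i\<close> is stored as
  its function of values on paths, extended by zero to all other paths. The finiteness condition
  expresses that the graded dual is the direct sum of the duals of the homogeneous components.
  The inclusions between the duals of the successive truncations are inclusions of sets.\<close>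

definition trunc_dual :: "nat \<Rightarrow> 'i \<Rightarrow> ('i path \<Rightarrow> complex) set" where
  "trunc_dual l i = {f.
     (\<forall>p. f p \<noteq> 0 \<longrightarrow> is_path p \<and> fst p = i) \<and>
     finite (path_deg ` {p. f p \<noteq> 0}) \<and>
     (\<forall>x\<in>trunc_kernel l. pairing f x = 0)}"

definition I_mod :: "'i \<Rightarrow> ('i path \<Rightarrow> complex) set" where
  "I_mod i = (\<Union>l\<in>{0<..}. trunc_dual l i)"

definition I_act :: "('i path \<Rightarrow> complex) \<Rightarrow> ('i path \<Rightarrow> complex) \<Rightarrow> 'i path \<Rightarrow> complex" where
  "I_act x f = (\<lambda>q. if is_path q then pairing f (pa_mult (pa_tau x) (single q)) else 0)"

text \<open>The component of degree \<open>(j, m)\<close> of \<open>I\<^sub>i[-k]\<close>, that is, the component of \<open>I\<^sub>i\<close> of degree \<open>(j, m - k)\<close>: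
  the forms supported on the paths from \<open>i\<close> to \<open>j\<close> of degree \<open>k - m\<close>.\<close>

definition I_comp :: "'i \<Rightarrow> int \<Rightarrow> 'i \<times> int \<Rightarrow> ('i path \<Rightarrow> complex) set" where
  "I_comp i k = (\<lambda>(j, m). {f \<in> I_mod i. \<forall>q. f q \<noteq> 0 \<longrightarrow> path_tgt q = j \<and> - path_deg q = m - k})"

text \<open>The direct sum of the modules \<open>I\<close> with parameters \<open>(ii r, kk r)\<close>, \<open>r = 1, \<dots>, s\<close>; the underlying
  ungraded module does not depend on \<open>kk\<close>. The socle of \<open>I\<^sub>i[-k]\<close> has degree \<open>(i, k)\<close>, whereas the
  component \<open>(i, k)\<close> of \<open>W\<close> receives the component \<open>(i, k + d i)\<close> of \<open>V\<close>; hence a Dirac summand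
  of \<open>dim W\<close> at \<open>(i, k)\<close> corresponds to the parameters \<open>(i, k + d i)\<close>.\<close>

definition sum_mod :: "nat \<Rightarrow> (nat \<Rightarrow> 'i) \<Rightarrow> (nat \<Rightarrow> 'i path \<Rightarrow> complex) set" where
  "sum_mod s ii = {u. (\<forall>r\<in>{1..s}. u r \<in> I_mod (ii r)) \<and> (\<forall>r. r \<notin> {1..s} \<longrightarrow> u r = 0)}"

definition sum_comp ::
    "nat \<Rightarrow> (nat \<Rightarrow> 'i) \<Rightarrow> (nat \<Rightarrow> int) \<Rightarrow> 'i \<times> int \<Rightarrow> (nat \<Rightarrow> 'i path \<Rightarrow> complex) set" where
  "sum_comp s ii kk q = {u \<in> sum_mod s ii. \<forall>r\<in>{1..s}. u r \<in> I_comp (ii r) (kk r) q}"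

definition graded_submodule ::
    "nat \<Rightarrow> (nat \<Rightarrow> 'i) \<Rightarrow> (nat \<Rightarrow> int) \<Rightarrow> (nat \<Rightarrow> 'i path \<Rightarrow> complex) set \<Rightarrow> bool" where
  "graded_submodule s ii kk N \<longleftrightarrow>
     N \<subseteq> sum_mod s ii \<and>
     Modules.module.subspace scale_fam N \<and>
     (\<forall>x\<in>path_algebra. \<forall>u\<in>N. (\<lambda>r. I_act x (u r)) \<in> N) \<and>
     N = Modules.module.span scale_fam (\<Union>q. N \<inter> sum_comp s ii kk q)"

definition Gr :: "nat \<Rightarrow> (nat \<Rightarrow> 'i) \<Rightarrow> (nat \<Rightarrow> int) \<Rightarrow> ('i \<times> int \<Rightarrow> nat)
    \<Rightarrow> (nat \<Rightarrow> 'i path \<Rightarrow> complex) set set" where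
  "Gr s ii kk v =
     {N. graded_submodule s ii kk N \<and> (\<forall>q. has_dim scale_fam (N \<inter> sum_comp s ii kk q) (v q))}"

text \<open>Homogeneous bases of the points of the Grassmannian. They carry the topology of pointwise
  convergence, which is the usual one on the finite dimensional components, and the
  Grassmannian carries the quotient topology.\<close>

definition Gr_frames :: "nat \<Rightarrow> (nat \<Rightarrow> 'i) \<Rightarrow> (nat \<Rightarrow> int) \<Rightarrow> ('i \<times> int \<Rightarrow> nat)
    \<Rightarrow> ('i \<times> int \<Rightarrow> nat \<Rightarrow> nat \<Rightarrow> 'i path \<Rightarrow> complex) set" where
  "Gr_frames s ii kk v = {F. \<exists>N\<in>Gr s ii kk v. \<forall>q.
     inj_on (F q) {..<v q} \<and>
     \<not> Modules.module.dependent scale_fam (F q ` {..<v q}) \<and>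
     Modules.module.span scale_fam (F q ` {..<v q}) = N \<inter> sum_comp s ii kk q \<and>
     (\<forall>n\<ge>v q. F q n = 0)}"

definition Gr_component :: "nat \<Rightarrow> (nat \<Rightarrow> 'i) \<Rightarrow> (nat \<Rightarrow> int) \<Rightarrow> ('i \<times> int \<Rightarrow> nat)
    \<Rightarrow> (nat \<Rightarrow> 'i path \<Rightarrow> complex) set topology" where
  "Gr_component s ii kk v =
     final_topology (subtopology euclidean (Gr_frames s ii kk v))
       (\<lambda>F. Modules.module.span scale_fam (\<Union>q. F q ` {..<v q}))"

definition Gr_space :: "nat \<Rightarrow> (nat \<Rightarrow> 'i) \<Rightarrow> (nat \<Rightarrow> int)
    \<Rightarrow> (('i \<times> int \<Rightarrow> nat) \<times> (nat \<Rightarrow> 'i path \<Rightarrow> complex) set) topology" where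
  "Gr_space s ii kk = sum_topology (Gr_component s ii kk) {v. finite {q. v q \<noteq> 0}}"

end

section \<open>Graded quiver varieties\<close>

locale quiver_datum = cartan_datum c d Or
  for c :: "'i::finite \<Rightarrow> 'i \<Rightarrow> int" and d :: "'i \<Rightarrow> int" and Or :: "('i \<times> 'i) set" +
  fixes sc :: "complex \<Rightarrow> 'w::ab_group_add \<Rightarrow> 'w" and W :: "'i \<times> int \<Rightarrow> 'w set"
  assumes framing: "graded_space sc W"
begin

text \<open>The entries which are not part of the data have a fixed value, so that equality of tuples
  is equality of the underlying linear maps.\<close>

definition tuples :: "('i \<times> int \<Rightarrow> nat) \<Rightarrow> ('i, 'w) tuple set" where
  "tuples v = {x.
     (\<forall>i j k. if c i j < 0 then al x i j k \<in> carrier_mat (v (i, k + b i j)) (v (j, k))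
              else al x i j k = 0\<^sub>m 0 0) \<and>
     (\<forall>i k. ep x i k \<in> carrier_mat (v (i, k + 2 * d i)) (v (i, k))) \<and>
     (\<forall>i k. \<forall>u\<in>carrier_vec (v (i, k)). ar x i k u \<in> W (i, k - d i)) \<and>
     (\<forall>i k. \<forall>u\<in>carrier_vec (v (i, k)). \<forall>u'\<in>carrier_vec (v (i, k)).
        ar x i k (u + u') = ar x i k u + ar x i k u') \<and>
     (\<forall>i k z. \<forall>u\<in>carrier_vec (v (i, k)). ar x i k (z \<cdot>\<^sub>v u) = sc z (ar x i k u)) \<and>
     (\<forall>i k u. u \<notin> carrier_vec (v (i, k)) \<longrightarrow> ar x i k u = 0)}"

definition zero_tuple :: "('i \<times> int \<Rightarrow> nat) \<Rightarrow> ('i, 'w) tuple" where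
  "zero_tuple v = \<lparr>
     al = (\<lambda>i j k. if c i j < 0 then 0\<^sub>m (v (i, k + b i j)) (v (j, k)) else 0\<^sub>m 0 0),
     ar = (\<lambda>i k u. 0),
     ep = (\<lambda>i k. 0\<^sub>m (v (i, k + 2 * d i)) (v (i, k)))\<rparr>"

definition stable :: "('i \<times> int \<Rightarrow> nat) \<Rightarrow> ('i, 'w) tuple set" where
  "stable v = {x \<in> tuples v. \<forall>U.
     (\<forall>q. vec_subspace (v q) (U q)) \<and>
     (\<forall>i j k. c i j < 0 \<longrightarrow> (\<forall>u\<in>U (j, k). al x i j k *\<^sub>v u \<in> U (i, k + b i j))) \<and>
     (\<forall>i k. \<forall>u\<in>U (i, k). ep x i k *\<^sub>v u \<in> U (i, k + 2 * d i)) \<and>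
     (\<forall>i k. \<forall>u\<in>U (i, k). ar x i k u = 0)
     \<longrightarrow> (\<forall>q. U q = {0\<^sub>v (v q)})}"

text \<open>The degree \<open>0\<close> automorphisms of \<open>V\<close>, paired with their inverses.\<close>

definition automorphisms ::
    "('i \<times> int \<Rightarrow> nat) \<Rightarrow> (('i \<times> int \<Rightarrow> complex mat) \<times> ('i \<times> int \<Rightarrow> complex mat)) set" where
  "automorphisms v = {(g, h). \<forall>q.
     g q \<in> carrier_mat (v q) (v q) \<and> h q \<in> carrier_mat (v q) (v q) \<and>
     g q * h q = 1\<^sub>m (v q) \<and> h q * g q = 1\<^sub>m (v q)}"

definition act :: "('i \<times> int \<Rightarrow> nat) \<Rightarrow> ('i \<times> int \<Rightarrow> complex mat) \<times> ('i \<times> int \<Rightarrow> complex mat)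
    \<Rightarrow> ('i, 'w) tuple \<Rightarrow> ('i, 'w) tuple" where
  "act v = (\<lambda>(g, h) x. \<lparr>
     al = (\<lambda>i j k. if c i j < 0 then g (i, k + b i j) * al x i j k * h (j, k) else 0\<^sub>m 0 0),
     ar = (\<lambda>i k u. if u \<in> carrier_vec (v (i, k)) then ar x i k (h (i, k) *\<^sub>v u) else 0),
     ep = (\<lambda>i k. g (i, k + 2 * d i) * ep x i k * h (i, k))\<rparr>)"

definition orbit :: "('i \<times> int \<Rightarrow> nat) \<Rightarrow> ('i, 'w) tuple \<Rightarrow> ('i, 'w) tuple set" where
  "orbit v x = (\<lambda>gh. act v gh x) ` automorphisms v"

text \<open>Linear coordinates on the space of tuples, without choosing a basis of \<open>W\<close>.\<close>

definition coords :: "('i \<times> int \<Rightarrow> nat) \<Rightarrow> (('i, 'w) tuple \<Rightarrow> complex) set" where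
  "coords v =
     {\<lambda>x. al x i j k $$ (m, n) | i j k m n. c i j < 0 \<and> m < v (i, k + b i j) \<and> n < v (j, k)} \<union>
     {\<lambda>x. ep x i k $$ (m, n) | i k m n. m < v (i, k + 2 * d i) \<and> n < v (i, k)} \<union>
     {\<lambda>x. \<phi> (ar x i k u) | \<phi> i k u. Vector_Spaces.linear sc (*) \<phi> \<and> u \<in> carrier_vec (v (i, k))}"

text \<open>The quiver variety, as the set of orbits in the stable locus, with its classical topology.\<close>

definition M :: "('i \<times> int \<Rightarrow> nat) \<Rightarrow> ('i, 'w) tuple set set" where
  "M v = orbit v ` stable v"

definition M_component :: "('i \<times> int \<Rightarrow> nat) \<Rightarrow> ('i, 'w) tuple set topology" where
  "M_component v = final_topology (initial_topology (stable v) (coords v)) (orbit v)"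

definition M_space :: "(('i \<times> int \<Rightarrow> nat) \<times> ('i, 'w) tuple set) topology" where
  "M_space = sum_topology M_component {v. finite {q. v q \<noteq> 0}}"

text \<open>The points of the categorical quotient are the characters of the algebra of invariant
  polynomials, so the fibre over \<open>0\<close> consists of the orbits on which every invariant
  polynomial takes its value at the zero tuple.\<close>

definition invariant_polys :: "('i \<times> int \<Rightarrow> nat) \<Rightarrow> (('i, 'w) tuple \<Rightarrow> complex) set" where
  "invariant_polys v =
     {P \<in> polys (coords v). \<forall>gh\<in>automorphisms v. \<forall>x\<in>tuples v. P (act v gh x) = P x}"

definition L_space :: "(('i \<times> int \<Rightarrow> nat) \<times> ('i, 'w) tuple set) set" where
  "L_space = {(v, orbit v x) | v x. finite {q. v q \<noteq> 0} \<and> x \<in> stable v \<and>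
     (\<forall>P\<in>invariant_polys v. P x = P (zero_tuple v))}"

text \<open>The structure sheaf of the quotient variety: its Zariski open subsets and regular functions are
  those which pull back to open subsets and regular functions on the stable locus.\<close>

definition zariski_open :: "('i \<times> int \<Rightarrow> nat) \<Rightarrow> ('i, 'w) tuple set set \<Rightarrow> bool" where
  "zariski_open v N \<longleftrightarrow> N \<subseteq> M v \<and>
     (\<forall>x\<in>stable v. orbit v x \<in> N \<longrightarrow>
        (\<exists>P\<in>polys (coords v). P x \<noteq> 0 \<and> (\<forall>y\<in>stable v. P y \<noteq> 0 \<longrightarrow> orbit v y \<in> N)))"

definition regular_on ::
    "('i \<times> int \<Rightarrow> nat) \<Rightarrow> ('i, 'w) tuple set set \<Rightarrow> (('i, 'w) tuple set \<Rightarrow> complex) \<Rightarrow> bool" where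
  "regular_on v N g \<longleftrightarrow>
     (\<forall>x\<in>stable v. orbit v x \<in> N \<longrightarrow>
        (\<exists>P\<in>polys (coords v). \<exists>Q\<in>polys (coords v). Q x \<noteq> 0 \<and>
           (\<forall>y\<in>stable v. orbit v y \<in> N \<and> Q y \<noteq> 0 \<longrightarrow> g (orbit v y) = P y / Q y)))"

text \<open>The differential of \<open>f\<close> at \<open>p\<close> is the class of \<open>f - f p\<close> in the cotangent space, the quotient of
  the maximal ideal of the local ring at \<open>p\<close> by its square.\<close>

definition critical_point ::
    "('i \<times> int \<Rightarrow> nat) \<Rightarrow> (('i, 'w) tuple set \<Rightarrow> complex) \<Rightarrow> ('i, 'w) tuple set \<Rightarrow> bool" where
  "critical_point v f p \<longleftrightarrow> p \<in> M v \<and>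
     (\<exists>N n g h. zariski_open v N \<and> p \<in> N \<and>
        (\<forall>m<(n::nat). regular_on v N (g m) \<and> regular_on v N (h m) \<and> g m p = 0 \<and> h m p = 0) \<and>
        (\<forall>q\<in>N. f q - f p = (\<Sum>m<n. g m q * h m q)))"

text \<open>\<open>ep_power v x i k n\<close> is the restriction of the \<open>n\<close>-th power of \<open>ep x i\<close> to the component \<open>(i, k)\<close>.\<close>

primrec ep_power ::
    "('i \<times> int \<Rightarrow> nat) \<Rightarrow> ('i, 'w) tuple \<Rightarrow> 'i \<Rightarrow> int \<Rightarrow> nat \<Rightarrow> complex mat" where
  "ep_power v x i k 0 = 1\<^sub>m (v (i, k))"
| "ep_power v x i k (Suc n) = ep x i (k + 2 * d i * int n) * ep_power v x i k n"

definition f2_tuple :: "('i \<times> int \<Rightarrow> nat) \<Rightarrow> ('i, 'w) tuple \<Rightarrow> complex" where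
  "f2_tuple v x = (\<Sum>i\<in>UNIV. \<Sum>j\<in>UNIV. osign i j * (\<Sum>k | v (i, k) \<noteq> 0.
     mat_trace (ep_power v x i (k + b i j + b i j) (nat (- c i j))
                * al x i j (k + b i j) * al x j i k)))"

definition f2 :: "('i \<times> int \<Rightarrow> nat) \<Rightarrow> ('i, 'w) tuple set \<Rightarrow> complex" where
  "f2 v p = (THE z. \<forall>x\<in>p. f2_tuple v x = z)"

definition crit_f2 :: "(('i \<times> int \<Rightarrow> nat) \<times> ('i, 'w) tuple set) set" where
  "crit_f2 = {(v, p). finite {q. v q \<noteq> 0} \<and> critical_point v (f2 v) p}"

end

end

(* A tuple x sends u in V to the family of linear forms p |-> phi_r (a (p u)) on the paths p, where
   phi_r runs through the coordinates of W and paths act through alpha and epsilon. The tuple is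
   stable iff this map Psi is injective, and if x satisfies the relations of the preprojective
   algebra, then Psi embeds V as a graded submodule of I_W, where truncation by a power of omega is
   automatic since V is finite dimensional. Conversely, the transposed multiplication by
   the arrows and evaluation at the trivial paths recover x from a homogeneous basis of the submodule.
   So the stable tuples with relations are homeomorphic to the frames of the Grassmannian, orbits
   correspond to submodules, and both sides are topological quotients.

   The partial derivatives of f_2 on the space of tuples are the entries of the relations. Functionals
   dual to the frame of a stable tuple give a regular slice of the action near it, so criticality in
   the local ring of the quotient is the vanishing of these derivatives.

   Forms in I_i have support of bounded path length, because by the relations a long path is equal to
   one with a large power of omega. In a basis adapted to the filtration of the submodule by path length
   the tuple is strictly triangular, so a one-parameter subgroup of diagonal automorphisms contracts it to
   zero and every invariant polynomial takes its value at zero. *)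
theory Submission imports Defs "Jordan_Normal_Form.Determinant" begin

section \<open>Cartan matrices of finite type\<close>

text \<open>Finite type enters through the lengths \<open>d\<close>. Positive definiteness rules out
  two multiple edges in a chain, so every \<open>d i\<close> is 1 or t. This makes \<omega> commute
  with every arrow, and it yields a degree estimate in which the arrows pay for the loops that they
  block. The estimate is needed because loops have positive and arrows negative degree: a bound on
  the degrees of a form says nothing by itself about the lengths of the paths in its support.

  The action is written with reversed paths, so that the transposition and the twist by \<tau> in
  I_i are absorbed and Psi commutes with prepending a letter. Identities between stable tuples are
  then tested on Psi, which determines the tuple.

  On the geometric side the points are orbits without local coordinates, while the cotangent space
  is defined by fractions of polynomials. Varying single matrix entries of the arrows suffices
  there: f_2 does not involve the framing maps, and there are only finitely many arrow entries,
  whereas the coordinates of the framing maps run over all linear forms on the ambient space of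
  W.\<close>

context cartan_datum
begin

lemma d_pos: "d i > 0"
  using symm by (auto simp: minimal_symmetrizer_def symmetrizer_def)

lemma b_sym: "b i j = b j i"
  using symm by (auto simp: minimal_symmetrizer_def symmetrizer_def b_def)

lemma c_diag: "c i i = 2"
  using cartan by (auto simp: simple_cartan_matrix_def)

lemma c_nonpos: "i \<noteq> j \<Longrightarrow> c i j \<le> 0"
  using cartan by (auto simp: simple_cartan_matrix_def)

lemma c_neg_neq: "c i j < 0 \<Longrightarrow> i \<noteq> j"
  using c_diag by force

lemma c_neg_sym: "c i j < 0 \<longleftrightarrow> c j i < 0"
proof -
  have "c i j = 0 \<longleftrightarrow> c j i = 0" using cartan unfolding simple_cartan_matrix_def by fast
  then show ?thesis using c_nonpos[of i j] c_nonpos[of j i] by (cases "i = j") auto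
qed

lemma b_nonpos: "i \<noteq> j \<Longrightarrow> b i j \<le> 0"
  using c_nonpos[of i j] d_pos[of i] by (simp add: b_def mult_le_0_iff)

lemma cut: "J \<noteq> {} \<Longrightarrow> J \<noteq> UNIV \<Longrightarrow> \<exists>i\<in>J. \<exists>j\<in>-J. c i j < 0"
proof -
  assume "J \<noteq> {}" "J \<noteq> UNIV"
  then have "\<exists>i\<in>J. \<exists>j\<in>-J. c i j \<noteq> 0"
    using cartan unfolding simple_cartan_matrix_def by presburger
  then obtain i j where "i \<in> J" "j \<in> -J" "c i j \<noteq> 0" by blast
  then show ?thesis using c_nonpos[of i j] by force
qed

text \<open>The definition of finite type provides positivity for some symmetrizer
  \<open>d'\<close>. As the Dynkin diagram is connected, any two symmetrizers are proportional, so
  positivity passes to \<open>d\<close>.\<close>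

lemma positive_definite:
  fixes x :: "'i \<Rightarrow> real"
  assumes "x k \<noteq> 0"
  shows "(\<Sum>i\<in>UNIV. \<Sum>j\<in>UNIV. real_of_int (b i j) * x i * x j) > 0"
proof -
  obtain d' where d': "symmetrizer c d'"
    and "\<forall>x::'i \<Rightarrow> real. (\<exists>i. x i \<noteq> 0) \<longrightarrow>
           (\<Sum>i\<in>UNIV. \<Sum>j\<in>UNIV. real_of_int (d' i * c i j) * x i * x j) > 0"
    using cartan unfolding simple_cartan_matrix_def by (elim conjE exE)
  then have pos: "(\<Sum>i\<in>UNIV. \<Sum>j\<in>UNIV. real_of_int (d' i * c i j) * x i * x j) > 0"
    using assms by blast
  have d'_pos: "d' i > 0" for i using d' by (auto simp: symmetrizer_def)
  have d'_sym: "d' i * c i j = d' j * c j i" for i j using d' by (auto simp: symmetrizer_def)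
  have d_sym: "d i * c i j = d j * c j i" for i j using b_sym by (simp add: b_def)
  \<comment> \<open>The vertices where the ratio of \<open>d\<close> to \<open>d'\<close> is the one
    at \<open>k\<close>. The symmetry of both symmetrized matrices carries this ratio across every
    edge.\<close>
  define J where "J = {j. d k * d' j = d j * d' k}"
  have "J = UNIV"
  proof (rule ccontr)
    assume "J \<noteq> UNIV"
    moreover have "k \<in> J" by (simp add: J_def)
    ultimately obtain i j where ij: "i \<in> J" "j \<in> -J" "c i j < 0" using cut by blast
    have "c j i \<noteq> 0" using ij c_neg_sym[of i j] by simp
    have "c j i * (d i * d' j) = d i * (d' j * c j i)" by (simp only: ac_simps)
    also have "\<dots> = d' i * (d i * c i j)" by (simp only: d'_sym[of i j, symmetric] ac_simps)
    also have "\<dots> = c j i * (d j * d' i)" by (simp only: d_sym[of i j] ac_simps)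
    finally have "c j i * (d i * d' j) = c j i * (d j * d' i)" .
    then have e: "d i * d' j = d j * d' i" using \<open>c j i \<noteq> 0\<close> by simp
    have e': "d k * d' i = d i * d' k" using ij(1) by (simp add: J_def)
    have "d i * (d k * d' j) = d k * (d i * d' j)" by (simp only: ac_simps)
    also have "\<dots> = d j * (d k * d' i)" by (simp only: e ac_simps)
    also have "\<dots> = d i * (d j * d' k)" by (simp only: e' ac_simps)
    finally have "d i * (d k * d' j) = d i * (d j * d' k)" .
    then have "j \<in> J" using d_pos[of i] by (simp add: J_def)
    then show False using ij by simp
  qed
  then have eq: "real_of_int (d k) * real_of_int (d' i) = real_of_int (d i) * real_of_int (d' k)" for i
  proof -
    have "i \<in> J" using \<open>J = UNIV\<close> by simp
    then have "d k * d' i = d i * d' k" by (simp add: J_def)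
    then show ?thesis by (metis of_int_mult)
  qed
  have "real_of_int (d' k) * (\<Sum>i\<in>UNIV. \<Sum>j\<in>UNIV. real_of_int (b i j) * x i * x j)
      = real_of_int (d k) * (\<Sum>i\<in>UNIV. \<Sum>j\<in>UNIV. real_of_int (d' i * c i j) * x i * x j)"
    unfolding sum_distrib_left b_def
  proof (intro sum.cong refl)
    fix i j
    have "real_of_int (d' k) * (real_of_int (d i * c i j) * x i * x j)
        = (real_of_int (d i) * real_of_int (d' k)) * (real_of_int (c i j) * x i * x j)" by simp
    also have "\<dots> = real_of_int (d k) * (real_of_int (d' i * c i j) * x i * x j)"
      by (simp add: eq[symmetric])
    finally show "real_of_int (d' k) * (real_of_int (d i * c i j) * x i * x j)
        = real_of_int (d k) * (real_of_int (d' i * c i j) * x i * x j)" .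
  qed
  also have "\<dots> > 0" using pos d_pos[of k] by simp
  finally show ?thesis using d'_pos[of k] by (simp add: zero_less_mult_iff)
qed

lemma positive_definite_on:
  fixes x :: "'i \<Rightarrow> real"
  assumes "k \<in> S" "x k \<noteq> 0"
  shows "(\<Sum>i\<in>S. \<Sum>j\<in>S. real_of_int (b i j) * x i * x j) > 0"
proof -
  define y where "y i = (if i \<in> S then x i else 0)" for i
  have "(\<Sum>i\<in>S. \<Sum>j\<in>S. real_of_int (b i j) * x i * x j)
      = (\<Sum>i\<in>UNIV. \<Sum>j\<in>UNIV. real_of_int (b i j) * y i * y j)"
  proof (rule sum.mono_neutral_cong_left)
    show "(\<Sum>j\<in>S. real_of_int (b i j) * x i * x j) = (\<Sum>j\<in>UNIV. real_of_int (b i j) * y i * y j)"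
      if "i \<in> S" for i
      by (rule sum.mono_neutral_cong_left) (auto simp: y_def that)
  qed (auto simp: y_def)
  with positive_definite[of y k] assms show ?thesis by (simp add: y_def)
qed

section \<open>Edges and their multiplicities\<close>

lemma c_mult_less_4:
  assumes "i \<noteq> j"
  shows "c i j * c j i < 4"
proof -
  \<comment> \<open>The vector in the span of the two vertices that the form makes orthogonal to the
    vertex \<open>i\<close>; its value is 2 d_i (4 d_i d_j - b_ij^2).\<close>
  define x :: "'i \<Rightarrow> real" where "x l = (if l = i then - real_of_int (b i j) else 2 * d i)" for l
  have "(\<Sum>k\<in>{i,j}. \<Sum>l\<in>{i,j}. real_of_int (b k l) * x k * x l) > 0"
    using d_pos[of i] assms by (intro positive_definite_on[of j]) (auto simp: x_def)
  then have "2 * real_of_int (d i) * (real_of_int (4 * d i * d j) - real_of_int (b i j)^2) > 0"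
    using assms b_sym[of j i] by (simp add: x_def b_def[of i i] b_def[of j j] c_diag power2_eq_square algebra_simps)
  then have "real_of_int (b i j * b i j) < real_of_int (4 * d i * d j)"
    using d_pos[of i] by (simp add: zero_less_mult_iff power2_eq_square)
  then have "b i j * b j i < 4 * d i * d j"
    using b_sym by (simp only: of_int_less_iff)
  then have "(d i * d j) * (c i j * c j i) < (d i * d j) * 4"
    by (simp add: b_def algebra_simps)
  then show ?thesis
    using d_pos[of i] d_pos[of j] by (metis mult_less_cancel_left_pos mult_pos_pos)
qed

lemma c_eq_minus1:
  assumes "c i j < 0"
  shows "c i j = -1 \<or> c j i = -1"
proof (rule ccontr)
  assume "\<not> ?thesis"
  then have "c i j \<le> -2" "c j i \<le> -2" using assms c_neg_sym[of i j] by auto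
  then have "2 * 2 \<le> (- c i j) * (- c j i)" by (intro mult_mono) auto
  then show False using c_mult_less_4[OF c_neg_neq[OF assms]] by simp
qed

text \<open>If the entry at the longer end were not -1, the opposite entry would be, and the
  symmetry of \<open>b\<close> would make that end the shorter one.\<close>

lemma d_le_edge:
  assumes "c i j < 0" "d j \<le> d i"
  shows "c i j = -1" "d i = d j * (- c j i)" "b i j = - d i"
proof -
  have s: "d i * c i j = d j * c j i" using b_sym by (simp add: b_def)
  have n: "c j i < 0" using assms(1) c_neg_sym by simp
  show c: "c i j = -1"
  proof (rule ccontr)
    assume "c i j \<noteq> -1"
    then have *: "c j i = -1" "c i j \<le> -2" using c_eq_minus1[OF assms(1)] assms(1) by auto
    then have "d i * c i j \<le> d i * (-2)" using d_pos[of i] by (intro mult_left_mono) auto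
    then show False using s * assms(2) d_pos[of i] by simp
  qed
  show "d i = d j * (- c j i)" using s c by simp
  show "b i j = - d i" by (simp add: b_def c)
qed

lemma b_edge: "c i j < 0 \<Longrightarrow> b i j = - max (d i) (d j)"
  using d_le_edge(3)[of i j] d_le_edge(3)[of j i] c_neg_sym[of i j] b_sym[of i j]
  by (cases "d j \<le> d i") auto

section \<open>Chains of vertices and the values of the symmetrizer\<close>

text \<open>The quadratic form restricted to a chain, with only the edges between consecutive
  vertices. All other edges have nonpositive coefficients, so on nonnegative vectors this bounds the
  true form from above.\<close>

fun chain_form :: "('i \<Rightarrow> real) \<Rightarrow> 'i list \<Rightarrow> real" where
  "chain_form x [] = 0"
| "chain_form x [i] = 2 * real_of_int (d i) * x i * x i"
| "chain_form x (i # j # us) = 2 * real_of_int (d i) * x i * x i + 2 * real_of_int (b i j) * x i * x j + chain_form x (j # us)"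

lemma form_le_chain_form:
  assumes "distinct is" "\<forall>i. x i \<ge> 0"
  shows "(\<Sum>i\<in>set is. \<Sum>j\<in>set is. real_of_int (b i j) * x i * x j) \<le> chain_form x is"
  using assms
proof (induction x "is" rule: chain_form.induct)
  case (2 x i)
  then show ?case by (simp add: b_def c_diag)
next
  case (3 x i j us)
  let ?S = "set (j # us)"
  have "i \<notin> ?S" "j \<notin> set us" using 3 by auto
  have "(\<Sum>k\<in>?S. real_of_int (b i k) * x i * x k)
      = real_of_int (b i j) * x i * x j + (\<Sum>k\<in>set us. real_of_int (b i k) * x i * x k)"
    using \<open>j \<notin> set us\<close> by simp
  also have "(\<Sum>k\<in>set us. real_of_int (b i k) * x i * x k) \<le> 0"
    using \<open>i \<notin> ?S\<close> 3
    by (intro sum_nonpos mult_nonpos_nonneg) (auto intro: b_nonpos)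
  finally have 1: "(\<Sum>k\<in>?S. real_of_int (b i k) * x i * x k) \<le> real_of_int (b i j) * x i * x j" by simp
  have "(\<Sum>k\<in>set (i # j # us). \<Sum>l\<in>set (i # j # us). real_of_int (b k l) * x k * x l) =
      real_of_int (b i i) * x i * x i + (\<Sum>k\<in>?S. real_of_int (b i k) * x i * x k)
       + (\<Sum>k\<in>?S. real_of_int (b k i) * x k * x i) + (\<Sum>k\<in>?S. \<Sum>l\<in>?S. real_of_int (b k l) * x k * x l)"
    using \<open>i \<notin> ?S\<close> by (simp only: list.set(2)[of i] sum.insert finite_set sum.distrib) (simp add: sum.distrib)
  also have "(\<Sum>k\<in>?S. real_of_int (b k i) * x k * x i) = (\<Sum>k\<in>?S. real_of_int (b i k) * x i * x k)"
    by (intro sum.cong) (auto simp: b_sym)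
  also have "(\<Sum>k\<in>?S. \<Sum>l\<in>?S. real_of_int (b k l) * x k * x l) \<le> chain_form x (j # us)"
    using 3 by simp
  finally show ?case using 1 by (simp add: b_def c_diag)
qed auto

text \<open>As for the affine diagrams with two multiple edges, a nonzero nonnegative vector is
  exhibited on which the form is not positive.\<close>

lemma no_two_multiple_edges:
  assumes dist: "distinct (p # us @ [q])" and ne: "us \<noteq> []"
    and walk: "successively (\<lambda>i j. c i j < 0) (p # us @ [q])"
    and D: "\<And>i. i \<in> set us \<Longrightarrow> d i = D" and dp: "d p \<noteq> D" and dq: "d q \<noteq> D"
  shows False
proof -
  \<comment> \<open>The minimizer of 2 d_i w^2 + 2 b_ij w for an end \<open>i\<close> attached to a
    vertex \<open>j\<close> with \<open>d j = D\<close>: here b_ij is - \<open>D\<close> at a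
    shorter end and - \<open>d i\<close> at a longer one. The minimum is at most - \<open>D\<close>
    because the two lengths differ at least by a factor 2.\<close>
  define w where "w i = (if d i \<le> D then real_of_int D / (2 * d i) else 1/2)" for i
  define x :: "'i \<Rightarrow> real" where "x i = (if d i = D then 1 else w i)" for i
  have w: "2 * d i * w i * w i + 2 * b i j * w i \<le> - real_of_int D" if "c i j < 0" "d i \<noteq> D" "d j = D" for i j
  proof (cases "d i < D")
    case True
    have "c j i < 0" using that c_neg_sym by simp
    then have e: "D = d i * (- c i j)" "b i j = - D"
      using d_le_edge[of j i] that True b_sym[of i j] by auto
    have "- c i j \<ge> 2"
    proof (rule ccontr)
      assume "\<not> - c i j \<ge> 2"
      then have "c i j = -1" using that by simp
      then show False using e True by simp
    qed
    then have "real_of_int (d i) * 2 \<le> real_of_int D" 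
      using e(1) d_pos[of i] by (metis mult_le_cancel_left_pos of_int_le_iff of_int_mult of_int_numeral)
    moreover have "2 * d i * w i * w i + 2 * b i j * w i = - (real_of_int D * real_of_int D / (2 * d i))"
      using True d_pos[of i] e(2) by (simp add: w_def field_simps)
    moreover have "real_of_int D * (d i * 2) \<le> real_of_int D * real_of_int D"
      using calculation(1) d_pos[of i] True by (intro mult_left_mono) auto
    ultimately show ?thesis using d_pos[of i] by (simp add: pos_le_divide_eq)
  next
    case False
    then have e: "d i = D * (- c j i)" "b i j = - d i" using d_le_edge[of i j] that by auto
    have "c j i < 0" using that c_neg_sym by simp
    have "- c j i \<ge> 2"
    proof (rule ccontr)
      assume "\<not> - c j i \<ge> 2"
      then have "c j i = -1" using \<open>c j i < 0\<close> by simp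
      then show False using e that by simp
    qed
    then have "D * 2 \<le> d i" using e(1) d_pos[of j] that by (metis mult_le_cancel_left_pos)
    then have "real_of_int D * 2 \<le> real_of_int (d i)" by linarith
    then show ?thesis using e(2) False that by (simp add: w_def)
  qed
  have tl: "distinct (us @ [q])" "successively (\<lambda>i j. c i j < 0) (us @ [q])" "\<forall>i\<in>set us. d i = D"
    using dist walk D by (auto simp: successively_Cons)
  \<comment> \<open>Each inner vertex contributes 2 \<open>D\<close> and each inner edge -2
    \<open>D\<close>, which leaves 2 \<open>D\<close> for the inner chain. Each end removes
    \<open>D\<close>; here only \<open>q\<close> is attached yet.\<close>
  have "chain_form x (us @ [q]) \<le> D"
    using ne tl
  proof (induction us)
    case (Cons j us)
    show ?case
    proof (cases us)
      case Nil
      have "c q j < 0" using Cons.prems Nil c_neg_sym by simp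
      then show ?thesis using w[of q j] Cons.prems Nil dq by (simp add: x_def b_sym[of j q])
    next
      case (Cons k vs)
      have *: "chain_form x (us @ [q]) \<le> D"
        by (rule Cons.IH) (use Cons Cons.prems in \<open>auto simp: successively_Cons\<close>)
      have ca: "d j = D" "d k = D" "c j k < 0" using Cons.prems Cons by auto
      moreover have "x j = 1" "x k = 1" using ca by (auto simp: x_def)
      ultimately show ?thesis using * Cons b_edge[of j k] by simp
    qed
  qed simp
  moreover obtain j vs where us: "us = j # vs" using ne by (cases us) auto
  moreover have "c p j < 0" "d j = D" using walk us D by auto
  ultimately have "chain_form x (p # us @ [q]) \<le> 0"
    using w[of p j] dp by (simp add: x_def)
  moreover have "(\<Sum>i\<in>set (p # us @ [q]). \<Sum>j\<in>set (p # us @ [q]). real_of_int (b i j) * x i * x j)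
      \<le> chain_form x (p # us @ [q])"
  proof (rule form_le_chain_form[OF dist], rule allI)
    have "D > 0" using d_pos[of j] \<open>d j = D\<close> by simp
    then show "x i \<ge> 0" for i using d_pos[of i] by (simp add: x_def w_def)
  qed
  moreover have "(\<Sum>i\<in>set (p # us @ [q]). \<Sum>j\<in>set (p # us @ [q]). real_of_int (b i j) * x i * x j) > 0"
    by (rule positive_definite_on[of j]) (auto simp: us x_def \<open>d j = D\<close>)
  ultimately show False by linarith
qed

lemma connected_walk:
  obtains us where "us \<noteq> []" "hd us = i" "last us = j" "successively (\<lambda>i j. c i j < 0) us"
proof -
  define J where "J = {j. \<exists>us. us \<noteq> [] \<and> hd us = i \<and> last us = j \<and> successively (\<lambda>i j. c i j < 0) us}"
  have "i \<in> J" unfolding J_def by (auto intro: exI[of _ "[i]"])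
  moreover have False if "k \<in> J" "l \<in> -J" "c k l < 0" for k l
  proof -
    obtain us where "us \<noteq> []" "hd us = i" "last us = k" "successively (\<lambda>i j. c i j < 0) us"
      using \<open>k \<in> J\<close> by (auto simp: J_def)
    then have "l \<in> J" using \<open>c k l < 0\<close>
      unfolding J_def by (auto intro!: exI[of _ "us @ [l]"] simp: successively_append_iff)
    then show False using that by simp
  qed
  ultimately have "J = UNIV" using cut[of J] by auto
  then show ?thesis using that unfolding J_def by blast
qed

text \<open>A shortest walk that meets three values of \<open>d\<close> has one constant value in
  its interior and two other values at its ends. This is the configuration excluded by
  \<open>no_two_multiple_edges\<close>.\<close>

lemma card_range_d_le_2: "card (range d) \<le> 2"
proof (rule ccontr)
  let ?W = "\<lambda>us. successively (\<lambda>i j. c i j < 0) us \<and> card (d ` set us) \<ge> 3"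
  assume "\<not> ?thesis"
  then obtain A where "A \<subseteq> range d" "card A = 3" by (metis not_less_eq_eq numeral_2_eq_2 numeral_3_eq_3 obtain_subset_with_card_n)
  then obtain i j k where ijk: "d i \<noteq> d j" "d i \<noteq> d k" "d j \<noteq> d k"
    by (auto simp: card_3_iff)
  obtain us where us: "us \<noteq> []" "hd us = i" "last us = j" "successively (\<lambda>i j. c i j < 0) us"
    by (rule connected_walk)
  obtain vs where vs: "vs \<noteq> []" "hd vs = j" "last vs = k" "successively (\<lambda>i j. c i j < 0) vs"
    by (rule connected_walk)
  have "successively (\<lambda>i j. c i j < 0) (us @ tl vs)"
  proof (cases vs)
    case (Cons a ws)
    then show ?thesis using us vs by (auto simp: successively_append_iff successively_Cons)
  qed (use vs in auto)
  moreover have sub: "{i, j, k} \<subseteq> set (us @ tl vs)"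
  proof -
    have "k \<in> set (us @ tl vs)"
      by (metis Un_iff last_in_set last_tl list.exhaust_sel set_append us(1,3) vs ijk(3) last_ConsL)
    then show ?thesis using us by auto
  qed
  moreover have "card (d ` set (us @ tl vs)) \<ge> 3"
  proof -
    have "card {d i, d j, d k} = 3" using ijk by auto
    then show ?thesis using sub card_mono[of "d ` set (us @ tl vs)" "{d i, d j, d k}"] by fastforce
  qed
  ultimately have ex: "\<exists>n us. ?W us \<and> length us = n" by blast
  define n where "n = (LEAST n. \<exists>us. ?W us \<and> length us = n)"
  obtain us where us: "successively (\<lambda>i j. c i j < 0) us" "card (d ` set us) \<ge> 3" "length us = n"
    using LeastI_ex[OF ex] unfolding n_def by blast
  have min: "card (d ` set vs) \<le> 2" if "successively (\<lambda>i j. c i j < 0) vs" "length vs < n" for vs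
    using not_less_Least[OF that(2)[unfolded n_def]] that(1)
    by (metis Suc_leI not_less numeral_2_eq_2 numeral_3_eq_3)
  have "us \<noteq> []" using us(2) by auto
  then obtain p rest where p: "us = p # rest" by (cases us) auto
  have "rest \<noteq> []" using us(2) p by auto
  then obtain S q where S: "rest = S @ [q]" by (metis append_butlast_last_id)
  have r: "card (d ` set rest) \<le> 2" by (rule min) (use us p in \<open>auto simp: successively_Cons\<close>)
  have ins: "card (d ` set us) = card (insert (d p) (d ` set rest))" by (simp add: p)
  \<comment> \<open>Without its first vertex the walk meets at most two values, so the value at the
    first vertex does not recur. The same argument is applied to the last vertex below.\<close>
  have dp: "d p \<notin> d ` set rest"
    using us(2) r ins by (auto simp: insert_absorb)
  then have c2: "card (d ` set rest) = 2" using us(2) r ins by simp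
  have "S \<noteq> []" using c2 S by auto
  have "card (d ` set (p # S)) \<le> 2"
    by (rule min) (use us \<open>S \<noteq> []\<close> p S in \<open>auto simp: successively_append_iff successively_Cons\<close>)
  moreover have "d p \<notin> d ` set S" using dp S by auto
  ultimately have S1: "card (d ` set S) \<le> 1" by simp
  obtain s0 where s0: "s0 \<in> set S" using \<open>S \<noteq> []\<close> by (cases S) auto
  define D where "D = d s0"
  have D: "d i = D" if "i \<in> set S" for i
    using S1 that s0 unfolding D_def
    by (metis One_nat_def card_le_Suc0_iff_eq finite_imageI finite_set imageI)
  have DS: "d ` set S = {D}" using D s0 by force
  then have dq: "d q \<noteq> D" using c2 S by (auto simp: insert_absorb)
  have dpD: "d p \<noteq> D" "d p \<noteq> d q" using dp S s0 by (auto simp: D_def)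
  \<comment> \<open>At a repeated vertex a loop could be cut out, and the shorter walk would still
    meet the values at \<open>p\<close>, at \<open>q\<close> and in the interior.\<close>
  have "distinct S"
  proof (rule ccontr)
    assume "\<not> distinct S"
    then obtain A y B C where A: "S = A @ [y] @ B @ [y] @ C" using not_distinct_decomp by blast
    let ?vs = "p # A @ [y] @ C @ [q]"
    have "successively (\<lambda>i j. c i j < 0) ?vs"
      using us(1) unfolding p S A
      by (auto simp: successively_append_iff successively_Cons hd_append split: if_splits)
    moreover have "length ?vs < n" using us(3) p S A by simp
    ultimately have "card (d ` set ?vs) \<le> 2" by (rule min)
    moreover have "{d p, D, d q} \<subseteq> d ` set ?vs" using D[of y] A by auto
    moreover have "card {d p, D, d q} = 3" using dpD dq by auto
    ultimately show False using card_mono[of "d ` set ?vs" "{d p, D, d q}"] by fastforce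
  qed
  moreover have "p \<notin> set S" "q \<notin> set S" "p \<noteq> q" using D dpD dq by auto
  ultimately show False
    using no_two_multiple_edges[of p S q D] us p S \<open>S \<noteq> []\<close> D dpD dq by auto
qed

lemma lacing_ge: "d i \<le> lacing"
  unfolding lacing_def by (intro Max_ge) auto

lemma lacing_pos: "lacing > 0"
  using lacing_ge[of undefined] d_pos[of undefined] by linarith

text \<open>There are at most two values, and an edge between them shows that the smaller divides
  the larger. Division by the smaller value gives another symmetrizer, so minimality forces that
  value to be 1.\<close>

lemma d_cases: "d i = 1 \<or> d i = lacing"
proof -
  define m where "m = Min (range d)"
  have mle: "m \<le> d i" for i unfolding m_def by (intro Min_le) auto
  obtain i0 where i0: "d i0 = m" using Min_in[of "range d"] unfolding m_def by fastforce
  obtain i1 where i1: "d i1 = lacing" using Max_in[of "range d"] unfolding lacing_def by fastforce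
  have mpos: "m > 0" using i0 d_pos by metis
  have two: "d i = m \<or> d i = lacing" for i
  proof (rule ccontr)
    assume "\<not> ?thesis"
    then have 3: "card {m, d i, lacing} = 3" if "m \<noteq> lacing" using that by auto
    have "{m, d i, lacing} \<subseteq> range d" using i0 i1 by (metis empty_subsetI insert_subset rangeI)
    moreover have "m \<noteq> lacing" using mle[of i] lacing_ge[of i] \<open>\<not> (d i = m \<or> d i = lacing)\<close> by auto
    ultimately have "card (range d) \<ge> 3" using 3 card_mono[of "range d" "{m, d i, lacing}"] by simp
    then show False using card_range_d_le_2 by simp
  qed
  have "m dvd lacing"
  proof (cases "m = lacing")
    case False
    define J where "J = {i. d i = m}"
    have "i0 \<in> J" "i1 \<notin> J" using i0 i1 False by (auto simp: J_def)
    then obtain i j where "i \<in> J" "j \<in> -J" "c i j < 0" using cut[of J] by auto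
    then have "d i = m" "d j = lacing" "c j i < 0" using two[of j] c_neg_sym by (auto simp: J_def)
    then show ?thesis using d_le_edge(2)[of j i] lacing_ge[of i] by auto
  qed simp
  then have dvd: "m dvd d i" for i using two[of i] by auto
  have "symmetrizer c (\<lambda>i. d i div m)"
    unfolding symmetrizer_def
  proof (intro conjI allI)
    show "d i div m > 0" for i using mle[of i] mpos by (simp add: pos_imp_zdiv_pos_iff)
    fix i j
    have "m * (d i div m * c i j) = m * (d j div m * c j i)"
      using b_sym[of i j] dvd[of i] dvd[of j] by (simp add: b_def mult.assoc[symmetric])
    then show "d i div m * c i j = d j div m * c j i" using mpos by simp
  qed
  then have "d i0 \<le> d i0 div m" using symm by (auto simp: minimal_symmetrizer_def)
  then have "m = 1" using i0 mpos by simp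
  then show ?thesis using two by simp
qed

lemma edge_cases:
  assumes "c i j < 0"
  obtains (same) "d i = d j" "c i j = -1" "c j i = -1"
  | (down) "d i = lacing" "d j = 1" "lacing > 1" "c i j = -1" "c j i = - lacing"
  | (up) "d i = 1" "d j = lacing" "lacing > 1" "c i j = - lacing" "c j i = -1"
proof -
  have n: "c j i < 0" using assms c_neg_sym by simp
  consider "d i = d j" | "d j < d i" | "d i < d j" by linarith
  then show ?thesis
  proof cases
    case 1
    then show ?thesis using same d_le_edge[OF assms] d_le_edge[OF n] by simp
  next
    case 2
    then have "d i = lacing" "d j = 1" using d_cases[of i] d_cases[of j] d_pos[of j] lacing_ge[of j] by auto
    then show ?thesis using down d_le_edge[OF assms] 2 by simp
  next
    case 3
    then have "d j = lacing" "d i = 1" using d_cases[of i] d_cases[of j] d_pos[of i] lacing_ge[of i] by auto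
    then show ?thesis using up d_le_edge[OF n] 3 by simp
  qed
qed

end

section \<open>The path algebra\<close>

lemma sum_fun_apply: "(\<Sum>i\<in>A. f i) x = (\<Sum>i\<in>A. f i x)"
  by (induction A rule: infinite_finite_induct) auto

lemma path_tgt_append: "path_tgt (i, as @ bs) = path_tgt (path_tgt (i, bs), as)"
  by (cases as) auto

lemma arrow_op_op [simp]: "arrow_op (arrow_op a) = a"
  by (cases a) auto

lemma arrow_src_op [simp]: "arrow_src (arrow_op a) = arrow_tgt a"
  and arrow_tgt_op [simp]: "arrow_tgt (arrow_op a) = arrow_src a"
  by (cases a; simp)+

lemma single_refl [simp]: "single p p = 1"
  and single_neq: "p \<noteq> q \<Longrightarrow> single p q = 0"
  by (auto simp: single_def)

definition support :: "('i path \<Rightarrow> complex) \<Rightarrow> 'i path set" where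
  "support x = {p. x p \<noteq> 0}"

lemma support_add: "support (x + y) \<subseteq> support x \<union> support y"
  by (auto simp: support_def)

lemma finite_support_add: "finite (support x) \<Longrightarrow> finite (support y) \<Longrightarrow> finite (support (x + y))"
  by (meson finite_Un finite_subset support_add)

lemma finite_support_single [simp]: "finite (support (single p))"
  by (rule finite_subset[of _ "{p}"]) (auto simp: support_def single_def)

lemma finite_support_0 [simp]: "finite (support 0)"
  by (simp add: support_def)

lemma finite_support_sum:
  assumes "finite S" "\<And>p. p \<in> S \<Longrightarrow> finite (support (X p))"
  shows "finite (support (\<lambda>q. \<Sum>p\<in>S. k p * X p q))"
proof (rule finite_subset)
  show "support (\<lambda>q. \<Sum>p\<in>S. k p * X p q) \<subseteq> (\<Union>p\<in>S. support (X p))"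
    by (auto simp: support_def intro: sum.neutral)
qed (use assms in auto)

lemma support_expand:
  assumes "finite (support x)"
  shows "x = (\<lambda>q. \<Sum>p\<in>support x. x p * single p q)"
proof
  fix q
  have "(\<Sum>p\<in>support x. x p * single p q) = (\<Sum>p\<in>support x. if p = q then x q else 0)"
    by (intro sum.cong) (auto simp: single_def)
  also have "\<dots> = x q" using assms by (auto simp: support_def)
  finally show "x q = (\<Sum>p\<in>support x. x p * single p q)" ..
qed

lemma pa_mult_sum_left:
  "pa_mult (\<lambda>q. \<Sum>p\<in>S. k p * X p q) z = (\<lambda>q. \<Sum>p\<in>S. k p * pa_mult (X p) z q)"
  unfolding pa_mult_def
  by (auto simp: fun_eq_iff sum_distrib_left sum_distrib_right mult.assoc intro: sum.swap)

lemma pa_mult_sum_right: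
  "pa_mult z (\<lambda>q. \<Sum>p\<in>S. k p * X p q) = (\<lambda>q. \<Sum>p\<in>S. k p * pa_mult z (X p) q)"
  unfolding pa_mult_def
  by (auto simp: fun_eq_iff sum_distrib_left sum_distrib_right mult_ac intro: sum.swap)

lemma pa_mult_0 [simp]: "pa_mult 0 z = 0" "pa_mult z 0 = 0"
  by (auto simp: pa_mult_def fun_eq_iff)

lemma pa_mult_diff_left: "pa_mult (x - y) z = pa_mult x z - pa_mult y z"
  and pa_mult_diff_right: "pa_mult z (x - y) = pa_mult z x - pa_mult z y"
  by (auto simp: pa_mult_def fun_eq_iff algebra_simps sum_subtractf)

lemma pa_mult_single:
  "pa_mult (single p) (single q) = (if fst p = path_tgt q then single (fst q, snd p @ snd q) else 0)"
proof
  fix r :: "'a path"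
  obtain i "as" where r: "r = (i, as)" by (cases r)
  obtain j u where p: "p = (j, u)" by (cases p)
  obtain k w where q: "q = (k, w)" by (cases q)
  have "pa_mult (single p) (single q) r = (\<Sum>m\<le>length as.
      if m = length u \<and> i = k \<and> as = u @ w \<and> j = path_tgt (k, w) then 1 else 0)"
    unfolding pa_mult_def r p q prod.case
  proof (intro sum.cong refl)
    fix m assume m: "m \<in> {..length as}"
    have "(take m as = u \<and> drop m as = w) \<longleftrightarrow> (m = length u \<and> as = u @ w)"
      using m by (metis append_eq_conv_conj append_take_drop_id atMost_iff length_take min.absorb2)
    then show "single (j, u) (path_tgt (i, drop m as), take m as) * single (k, w) (i, drop m as) =
        (if m = length u \<and> i = k \<and> as = u @ w \<and> j = path_tgt (k, w) then 1 else 0)"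
      by (auto simp: single_def)
  qed
  also have "\<dots> = (if i = k \<and> as = u @ w \<and> j = path_tgt (k, w) then 1 else 0)"
    by (cases "i = k \<and> as = u @ w \<and> j = path_tgt (k, w)") (auto simp: sum.delta)
  also have "\<dots> = (if fst p = path_tgt q then single (fst q, snd p @ snd q) else 0) r"
    by (auto simp: single_def p q r)
  finally show "pa_mult (single p) (single q) r
      = (if fst p = path_tgt q then single (fst q, snd p @ snd q) else 0) r" .
qed

lemma pairing_superset:
  assumes "finite S" "support x \<subseteq> S"
  shows "pairing f x = (\<Sum>p\<in>S. f p * x p)"
  unfolding pairing_def by (rule sum.mono_neutral_left) (use assms in \<open>auto simp: support_def\<close>)

lemma pairing_support: "pairing f x = (\<Sum>p\<in>support x. f p * x p)"
  by (simp add: pairing_def support_def)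

lemma pairing_single [simp]: "pairing f (single p) = f p"
  using pairing_superset[of "{p}" "single p" f] by (auto simp: support_def single_def)

lemma pairing_0 [simp]: "pairing f 0 = 0" "pairing 0 x = 0" "pairing (\<lambda>_. 0) x = 0"
  by (auto simp: pairing_def)

lemma pairing_sum:
  assumes "finite S" "\<And>p. p \<in> S \<Longrightarrow> finite (support (X p))"
  shows "pairing f (\<lambda>q. \<Sum>p\<in>S. k p * X p q) = (\<Sum>p\<in>S. k p * pairing f (X p))"
proof -
  let ?T = "\<Union>p\<in>S. support (X p)"
  have T: "finite ?T" using assms by auto
  have "pairing f (\<lambda>q. \<Sum>p\<in>S. k p * X p q) = (\<Sum>q\<in>?T. f q * (\<Sum>p\<in>S. k p * X p q))"
    by (rule pairing_superset[OF T]) (auto simp: support_def intro: sum.neutral)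
  also have "\<dots> = (\<Sum>p\<in>S. k p * (\<Sum>q\<in>?T. f q * X p q))"
    unfolding sum_distrib_left by (subst sum.swap) (simp add: mult_ac)
  also have "\<dots> = (\<Sum>p\<in>S. k p * pairing f (X p))"
    by (intro sum.cong refl) (subst pairing_superset[OF T], auto)
  finally show ?thesis .
qed

lemma pairing_add:
  assumes "finite (support x)" "finite (support y)"
  shows "pairing f (x + y) = pairing f x + pairing f y"
proof -
  let ?S = "support x \<union> support y"
  have S: "finite ?S" using assms by simp
  have "pairing f (x + y) = (\<Sum>p\<in>?S. f p * x p) + (\<Sum>p\<in>?S. f p * y p)"
    unfolding pairing_superset[OF S support_add] by (simp add: sum.distrib distrib_left)
  then show ?thesis by (simp add: pairing_superset[OF S])
qed

lemma pairing_diff: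
  assumes "finite (support x)" "finite (support y)"
  shows "pairing f (x - y) = pairing f x - pairing f y"
proof -
  let ?S = "support x \<union> support y"
  have S: "finite ?S" using assms by simp
  have "support (x - y) \<subseteq> ?S" by (auto simp: support_def)
  then have "pairing f (x - y) = (\<Sum>p\<in>?S. f p * x p) - (\<Sum>p\<in>?S. f p * y p)"
    by (simp add: pairing_superset[OF S] sum_subtractf right_diff_distrib)
  then show ?thesis by (simp add: pairing_superset[OF S])
qed

lemma pairing_linear_left:
  "pairing (\<lambda>p. f p + g p) x = pairing f x + pairing g x"
  "pairing (\<lambda>p. k * f p) x = k * pairing f x"
  by (auto simp: pairing_def sum.distrib algebra_simps sum_distrib_left)

lemma pairing_pa_mult:
  assumes "finite (support y)" "finite (support x)"
  shows "pairing f (pa_mult y x) = (\<Sum>p\<in>support y. \<Sum>q\<in>support x.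
    y p * (x q * (if fst p = path_tgt q then f (fst q, snd p @ snd q) else 0)))"
proof -
  have s: "finite (support (pa_mult (single p) (single q)))" for p q :: "'a path"
    by (simp add: pa_mult_single)
  have "pa_mult y x = pa_mult (\<lambda>q. \<Sum>p\<in>support y. y p * single p q) (\<lambda>q. \<Sum>p\<in>support x. x p * single p q)"
    using support_expand[OF assms(1)] support_expand[OF assms(2)] by simp
  also have "\<dots> = (\<lambda>r. \<Sum>p\<in>support y. y p * (\<Sum>q\<in>support x. x q * pa_mult (single p) (single q) r))"
    unfolding pa_mult_sum_left pa_mult_sum_right ..
  finally have "pairing f (pa_mult y x) = (\<Sum>p\<in>support y. y p * (\<Sum>q\<in>support x. x q * pairing f (pa_mult (single p) (single q))))"
    using assms s by (simp add: pairing_sum finite_support_sum)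
  also have "\<dots> = (\<Sum>p\<in>support y. \<Sum>q\<in>support x.
    y p * (x q * (if fst p = path_tgt q then f (fst q, snd p @ snd q) else 0)))"
    unfolding sum_distrib_left by (intro sum.cong refl) (simp add: pa_mult_single)
  finally show ?thesis .
qed

section \<open>Translates of linear forms by paths\<close>

text \<open>The transpose of left multiplication by the path \<open>p\<close>: the value of the
  translate on \<open>q\<close> is the value of \<open>f\<close> on the product of \<open>p\<close>
  and \<open>q\<close>, or 0 if they do not compose. The next definition is its mirror
  image.\<close>

definition left_translate :: "'i path \<Rightarrow> ('i path \<Rightarrow> complex) \<Rightarrow> 'i path \<Rightarrow> complex" where
  "left_translate p f = (\<lambda>q. if fst p = path_tgt q then f (fst q, snd p @ snd q) else 0)"

definition right_translate :: "'i path \<Rightarrow> ('i path \<Rightarrow> complex) \<Rightarrow> 'i path \<Rightarrow> complex" where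
  "right_translate p f = (\<lambda>q. if fst q = path_tgt p then f (fst p, snd q @ snd p) else 0)"

lemma pairing_pa_mult_left:
  assumes "finite (support y)" "finite (support x)"
  shows "pairing f (pa_mult y x) = (\<Sum>p\<in>support y. y p * pairing (left_translate p f) x)"
  unfolding pairing_pa_mult[OF assms] pairing_support[of _ x] left_translate_def sum_distrib_left
  by (intro sum.cong refl) simp

lemma pairing_pa_mult_right:
  assumes "finite (support y)" "finite (support x)"
  shows "pairing f (pa_mult y x) = (\<Sum>p\<in>support x. x p * pairing (right_translate p f) y)"
  unfolding pairing_pa_mult[OF assms] pairing_support[of _ y] right_translate_def sum_distrib_left
  by (subst sum.swap, intro sum.cong refl) simp

context cartan_datum
begin

lemma is_path_append: "is_path (i, as @ bs) \<longleftrightarrow> is_path (i, bs) \<and> is_path (path_tgt (i, bs), as)"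
  by (induction "as") (auto simp: path_tgt_append)

lemma path_deg_simps [simp]:
  "path_deg (i, []) = 0" "path_deg (i, a # as) = arrow_deg a + path_deg (i, as)"
  "path_deg (i, as @ bs) = path_deg (i, as) + path_deg (i, bs)"
  by (auto simp: path_deg_def)

lemma path_deg_src: "path_deg (i, as) = path_deg (j, as)"
  by (simp add: path_deg_def)

lemma is_arrow_op [simp]: "is_arrow (arrow_op a) = is_arrow a"
  using c_neg_sym by (cases a) auto

lemma arrow_deg_op [simp]: "arrow_deg (arrow_op a) = arrow_deg a"
  using b_sym by (cases a) auto

lemma path_op_path:
  assumes "is_path p"
  shows "is_path (path_op p)" "path_tgt (path_op p) = fst p" "path_op (path_op p) = p"
    "path_deg (path_op p) = path_deg p" "fst (path_op p) = path_tgt p"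
proof -
  have *: "is_path (path_op (i, as)) \<and> path_tgt (path_op (i, as)) = i" if "is_path (i, as)" for i "as"
    using that
  proof (induction "as")
    case (Cons a "as")
    then show ?case by (auto simp: path_op_def is_path_append path_tgt_append)
  qed (auto simp: path_op_def)
  obtain i "as" where p: "p = (i, as)" by (cases p)
  show "is_path (path_op p)" and tgt: "path_tgt (path_op p) = fst p" using *[of i "as"] assms p by auto
  have inv: "arrow_op \<circ> arrow_op = id" by auto
  show "path_op (path_op p) = p"
    using tgt unfolding path_op_def p by (simp add: rev_map inv)
  show "path_deg (path_op p) = path_deg p"
  proof -
    have "sum_list (map arrow_deg (map arrow_op w)) = sum_list (map arrow_deg w)" for w
      by (induction w) auto
    then show ?thesis unfolding path_op_def path_deg_def by (metis rev_map snd_conv sum_list_rev)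
  qed
  show "fst (path_op p) = path_tgt p" by (simp add: path_op_def)
qed

lemma path_algebra_finite: "x \<in> path_algebra \<Longrightarrow> finite (support x)"
  by (auto simp: path_algebra_def support_def)

lemma path_algebra_single: "is_path p \<Longrightarrow> single p \<in> path_algebra"
  using finite_support_single[of p] by (auto simp: path_algebra_def support_def single_def)

lemma path_algebra_0: "0 \<in> path_algebra"
  by (simp add: path_algebra_def)

lemma path_algebra_add: "x \<in> path_algebra \<Longrightarrow> y \<in> path_algebra \<Longrightarrow> x + y \<in> path_algebra"
proof -
  assume *: "x \<in> path_algebra" "y \<in> path_algebra"
  have "is_path p" if "(x + y) p \<noteq> 0" for p
  proof -
    have "x p \<noteq> 0 \<or> y p \<noteq> 0" using that by auto
    then show ?thesis using * unfolding path_algebra_def by blast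
  qed
  then show ?thesis
    using * finite_support_add[of x y] unfolding path_algebra_def support_def by blast
qed

lemma path_algebra_diff: "x \<in> path_algebra \<Longrightarrow> y \<in> path_algebra \<Longrightarrow> x - y \<in> path_algebra"
proof -
  assume *: "x \<in> path_algebra" "y \<in> path_algebra"
  then have "- y \<in> path_algebra" by (simp add: path_algebra_def)
  then show ?thesis using path_algebra_add[of x "- y"] * by (simp add: fun_eq_iff)
qed

lemma path_algebra_sum:
  assumes "finite S" "\<And>p. p \<in> S \<Longrightarrow> X p \<in> path_algebra"
  shows "(\<lambda>q. \<Sum>p\<in>S. k p * X p q) \<in> path_algebra"
proof -
  have "is_path q" if "(\<Sum>p\<in>S. k p * X p q) \<noteq> 0" for q
  proof (rule ccontr)
    assume "\<not> is_path q"
    then have "(\<Sum>p\<in>S. k p * X p q) = 0"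
    proof (intro sum.neutral ballI)
      fix p assume "p \<in> S"
      then have "X p q = 0" using assms(2)[of p] \<open>\<not> is_path q\<close> unfolding path_algebra_def by blast
      then show "k p * X p q = 0" by simp
    qed
    then show False using that by simp
  qed
  moreover have "finite (support (\<lambda>q. \<Sum>p\<in>S. k p * X p q))"
    using assms path_algebra_finite by (intro finite_support_sum) auto
  ultimately show ?thesis by (auto simp: path_algebra_def support_def)
qed

lemma path_algebra_expand:
  assumes "x \<in> path_algebra"
  shows "x = (\<lambda>q. \<Sum>p\<in>support x. x p * single p q)" "\<And>p. p \<in> support x \<Longrightarrow> is_path p"
  using support_expand[OF path_algebra_finite[OF assms]] assms
  by (auto simp: path_algebra_def support_def)

lemma path_algebra_mult:
  assumes x: "x \<in> path_algebra" and y: "y \<in> path_algebra"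
  shows "pa_mult x y \<in> path_algebra"
proof -
  have "pa_mult x y = pa_mult (\<lambda>q. \<Sum>p\<in>support x. x p * single p q) (\<lambda>q. \<Sum>p\<in>support y. y p * single p q)"
    using path_algebra_expand(1)[OF x] path_algebra_expand(1)[OF y] by simp
  also have "\<dots> \<in> path_algebra"
    unfolding pa_mult_sum_left pa_mult_sum_right
  proof (intro path_algebra_sum path_algebra_finite x y)
    fix p q assume "p \<in> support x" "q \<in> support y"
    then have "is_path p" "is_path q" using x y path_algebra_expand(2) by auto
    then show "pa_mult (single p) (single q) \<in> path_algebra"
      by (cases p) (auto simp: pa_mult_single path_algebra_0 is_path_append intro!: path_algebra_single)
  qed
  finally show ?thesis .
qed

lemma is_path_replicate [simp]: "is_path (i, replicate n (Eps i))"
  and path_tgt_replicate [simp]: "path_tgt (i, replicate n (Eps i)) = i"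
  by (induction n) auto

lemma path_deg_replicate [simp]: "path_deg (j, replicate n (Eps i)) = 2 * d i * int n"
  by (induction n) (auto simp: algebra_simps)

definition mesh_word :: "'i \<Rightarrow> 'i \<Rightarrow> nat \<Rightarrow> 'i arrow list" where
  "mesh_word i j k = replicate k (Eps i) @ [Alpha i j, Alpha j i]
                @ replicate (nat (- c i j) - 1 - k) (Eps i)"

lemma rel_mesh_alt:
  "rel_mesh i = (\<lambda>p. \<Sum>(j, k)\<in>(SIGMA j:{j. c i j < 0}. {..<nat (- c i j)}). osign i j * single (i, mesh_word i j k) p)"
  unfolding rel_mesh_def mesh_word_def by (auto simp: fun_eq_iff sum.Sigma)

lemma is_path_mesh_word: "c i j < 0 \<Longrightarrow> is_path (i, mesh_word i j k)"
  and path_tgt_mesh_word: "path_tgt (i, mesh_word i j k) = i"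
  using c_neg_sym by (cases k; auto simp: mesh_word_def is_path_append path_tgt_append)+

lemma pairing_rel_mesh:
  "pairing f (rel_mesh i) = (\<Sum>j | c i j < 0. \<Sum>k<nat (- c i j). osign i j * f (i, mesh_word i j k))"
proof -
  have "pairing f (rel_mesh i) = (\<Sum>(j, k)\<in>(SIGMA j:{j. c i j < 0}. {..<nat (- c i j)}).
      osign i j * f (i, mesh_word i j k))"
    unfolding rel_mesh_alt case_prod_unfold by (subst pairing_sum) auto
  also have "\<dots> = (\<Sum>j | c i j < 0. \<Sum>k<nat (- c i j). osign i j * f (i, mesh_word i j k))"
    by (rule sum.Sigma[symmetric]) auto
  finally show ?thesis .
qed

lemma pairing_rel_comm:
  "pairing f (rel_comm i j) = f (j, replicate (nat (- c i j)) (Eps i) @ [Alpha i j])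
     - f (j, Alpha i j # replicate (nat (- c j i)) (Eps j))"
  unfolding rel_comm_def by (simp add: pairing_diff)

lemma rel_comm_paths:
  assumes "c i j < 0"
  shows "is_path (j, replicate n (Eps i) @ [Alpha i j])" "is_path (j, Alpha i j # replicate n (Eps j))"
  using assms by (auto simp: is_path_append)

lemma rel_ideal_induct [consumes 1, case_names comm mesh zero add left right]:
  assumes "x \<in> rel_ideal"
    and comm: "\<And>i j. c i j < 0 \<Longrightarrow> P (rel_comm i j)"
    and mesh: "\<And>i. P (rel_mesh i)"
    and zero: "P 0"
    and add: "\<And>x y. x \<in> rel_ideal \<Longrightarrow> P x \<Longrightarrow> y \<in> rel_ideal \<Longrightarrow> P y \<Longrightarrow> P (x + y)"
    and left: "\<And>x y. x \<in> rel_ideal \<Longrightarrow> P x \<Longrightarrow> y \<in> path_algebra \<Longrightarrow> P (pa_mult y x)"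
    and right: "\<And>x y. x \<in> rel_ideal \<Longrightarrow> P x \<Longrightarrow> y \<in> path_algebra \<Longrightarrow> P (pa_mult x y)"
  shows "P x"
  using assms(1)
proof (induction rule: rel_ideal.induct)
  case zero
  then show ?case using assms(4) by (simp only: zero_fun_def)
next
  case (add x y)
  then show ?case using assms(5)[of x y] by (simp only: plus_fun_def)
qed (use comm mesh left right in blast)+

lemma rel_ideal_path_algebra: "x \<in> rel_ideal \<Longrightarrow> x \<in> path_algebra"
proof (induction rule: rel_ideal_induct)
  case (comm i j)
  then show ?case unfolding rel_comm_def
    by (intro path_algebra_diff path_algebra_single rel_comm_paths)
next
  case (mesh i)
  show ?case unfolding rel_mesh_alt case_prod_unfold
    by (rule path_algebra_sum) (auto intro!: path_algebra_single is_path_mesh_word)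
qed (blast intro: path_algebra_0 path_algebra_add path_algebra_mult)+

text \<open>An induction for one form breaks down, since multiplication inside the ideal becomes a
  translate of the form. The generators are therefore tested on a whole family that is closed under
  both kinds of translation.\<close>

lemma pairing_rel_ideal:
  assumes x: "x \<in> rel_ideal" and f: "f \<in> F"
    and left: "\<And>f p. f \<in> F \<Longrightarrow> is_path p \<Longrightarrow> left_translate p f \<in> F"
    and right: "\<And>f p. f \<in> F \<Longrightarrow> is_path p \<Longrightarrow> right_translate p f \<in> F"
    and comm: "\<And>f i j. f \<in> F \<Longrightarrow> c i j < 0 \<Longrightarrow>
      f (j, replicate (nat (- c i j)) (Eps i) @ [Alpha i j]) = f (j, Alpha i j # replicate (nat (- c j i)) (Eps j))"
    and mesh: "\<And>f i. f \<in> F \<Longrightarrow>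
      (\<Sum>j | c i j < 0. \<Sum>k<nat (- c i j). osign i j * f (i, mesh_word i j k)) = 0"
  shows "pairing f x = 0"
  using x f
proof (induction x arbitrary: f rule: rel_ideal_induct)
  case (add x y)
  then show ?case by (metis pairing_add path_algebra_finite rel_ideal_path_algebra add_0)
next
  case (left x y)
  have "pairing f (pa_mult y x) = (\<Sum>p\<in>support y. y p * pairing (left_translate p f) x)"
    using left by (intro pairing_pa_mult_left path_algebra_finite) (auto intro: rel_ideal_path_algebra)
  also have "\<dots> = 0"
    using left assms(3) path_algebra_expand(2)[of y] by (intro sum.neutral) auto
  finally show ?case .
next
  case (right x y)
  have "pairing f (pa_mult x y) = (\<Sum>p\<in>support y. y p * pairing (right_translate p f) x)"
    using right by (intro pairing_pa_mult_right path_algebra_finite) (auto intro: rel_ideal_path_algebra)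
  also have "\<dots> = 0"
    using right assms(4) path_algebra_expand(2)[of y] by (intro sum.neutral) auto
  finally show ?case .
qed (simp_all only: pairing_rel_comm pairing_rel_mesh comm mesh pairing_0, simp)

text \<open>Scalars are not among the closure rules of the ideal. Multiplication by \<open>k\<close>
  is the product with \<open>k\<close> times the sum of the trivial paths, the unit of the path
  algebra.\<close>

lemma rel_ideal_scale:
  assumes "x \<in> rel_ideal"
  shows "(\<lambda>p. k * x p) \<in> rel_ideal"
proof -
  let ?e = "\<lambda>q. \<Sum>i\<in>(UNIV::'i set). k * single (i, []) q :: complex"
  have e: "?e (j, w) = (if w = [] then k else 0)" for j w
  proof -
    have "?e (j, w) = (\<Sum>i\<in>UNIV. if i = j then (if w = [] then k else 0) else 0)"
      by (intro sum.cong) (auto simp: single_def)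
    also have "\<dots> = (if w = [] then k else 0)" by (subst sum.delta) auto
    finally show ?thesis .
  qed
  have "pa_mult ?e x = (\<lambda>p. k * x p)"
  proof
    fix p :: "'i path" obtain i "as" where p: "p = (i, as)" by (cases p)
    have "pa_mult ?e x p = (\<Sum>m\<le>length as. if m = 0 then k * x (i, as) else 0)"
      unfolding pa_mult_def p prod.case e by (intro sum.cong refl) auto
    then show "pa_mult ?e x p = k * x p" by (simp add: p)
  qed
  moreover have "?e \<in> path_algebra"
    by (rule path_algebra_sum) (auto intro: path_algebra_single)
  ultimately show ?thesis using rel_ideal.left[OF assms, of ?e] by simp
qed

section \<open>Nilpotency\<close>

text \<open>Equality of two paths with common ends in the preprojective algebra. It turns
  computations modulo the ideal into rewriting of words.\<close>

definition word_eq :: "'i \<Rightarrow> 'i arrow list \<Rightarrow> 'i arrow list \<Rightarrow> bool" where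
  "word_eq i u w \<longleftrightarrow> is_path (i, u) \<and> is_path (i, w) \<and> path_tgt (i, u) = path_tgt (i, w) \<and>
     single (i, u) - single (i, w) \<in> rel_ideal"

lemma word_eq_refl: "is_path (i, u) \<Longrightarrow> word_eq i u u"
  by (simp add: word_eq_def rel_ideal.zero)

lemma word_eq_sym: "word_eq i u w \<Longrightarrow> word_eq i w u"
proof -
  assume "word_eq i u w"
  moreover from this have "single (i, u) - single (i, w) \<in> rel_ideal" unfolding word_eq_def by blast
  from rel_ideal_scale[OF this, of "-1"]
  have "(\<lambda>p. (-1) * (single (i, u) - single (i, w)) p) \<in> rel_ideal" .
  moreover have "(\<lambda>p. (-1) * (single (i, u) - single (i, w)) p) = single (i, w) - single (i, u)"
    by (simp add: fun_eq_iff)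
  ultimately show ?thesis unfolding word_eq_def by metis
qed

lemma word_eq_trans [trans]: "word_eq i u w \<Longrightarrow> word_eq i w y \<Longrightarrow> word_eq i u y"
  using rel_ideal.add[of "single (i, u) - single (i, w)" "single (i, w) - single (i, y)"]
  by (auto simp: word_eq_def)

lemma word_eq_append:
  assumes e: "word_eq j u w" and y: "is_path (path_tgt (j, u), y)" and z: "is_path (i, z)" "path_tgt (i, z) = j"
  shows "word_eq i (y @ u @ z) (y @ w @ z)"
proof -
  let ?x = "single (j, u) - single (j, w)"
  have "pa_mult (single (path_tgt (j, u), y)) (pa_mult ?x (single (i, z))) \<in> rel_ideal"
    using e y z by (intro rel_ideal.left rel_ideal.right path_algebra_single) (auto simp: word_eq_def)
  also have "pa_mult (single (path_tgt (j, u), y)) (pa_mult ?x (single (i, z))) = single (i, y @ u @ z) - single (i, y @ w @ z)"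
    using e z unfolding pa_mult_diff_left pa_mult_diff_right pa_mult_single
    by (simp add: path_tgt_append word_eq_def pa_mult_diff_right pa_mult_single)
  finally show ?thesis
    using e y z unfolding word_eq_def by (metis is_path_append path_tgt_append)
qed

lemma word_eq_comm:
  "c i j < 0 \<Longrightarrow> word_eq j (replicate (nat (- c i j)) (Eps i) @ [Alpha i j]) (Alpha i j # replicate (nat (- c j i)) (Eps j))"
  using rel_ideal.comm[of i j]
  by (auto simp: word_eq_def rel_comm_def is_path_append path_tgt_append)
    (metis path_tgt_replicate arrow_tgt.simps(1))?

lemma word_eq_Cons: "word_eq i u w \<Longrightarrow> is_path (i, a # u) \<Longrightarrow> word_eq i (a # u) (a # w)"
  using word_eq_append[of i u w "[a]" i "[]"] by simp

abbreviation om :: "'i \<Rightarrow> nat" where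
  "om i \<equiv> nat (lacing div d i)"

lemma om_cases: "d i = 1 \<and> om i = nat lacing \<or> d i = lacing \<and> om i = 1"
  using d_cases[of i] lacing_pos by auto

lemma om_pos: "om i > 0" "d i * int (om i) = lacing"
  using om_cases[of i] lacing_pos by auto

lemma word_eq_same:
  assumes "c i j = -1" "c j i = -1"
  shows "word_eq j (replicate n (Eps i) @ [Alpha i j]) (Alpha i j # replicate n (Eps j))"
proof (induction n)
  case 0
  then show ?case using assms by (auto intro!: word_eq_refl)
next
  case (Suc n)
  have "word_eq j (Eps i # (replicate n (Eps i) @ [Alpha i j])) (Eps i # (Alpha i j # replicate n (Eps j)))"
    using Suc assms by (intro word_eq_Cons) (auto simp: is_path_append path_tgt_append word_eq_def)
  also have "word_eq j (Eps i # (Alpha i j # replicate n (Eps j))) (Alpha i j # Eps j # replicate n (Eps j))"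
    using word_eq_append[of j "[Eps i, Alpha i j]" "[Alpha i j, Eps j]" "[]" j "replicate n (Eps j)"]
      word_eq_comm[of i j] assms by (simp add: word_eq_def)
  finally show ?case by simp
qed

text \<open>Across a multiple edge the commutation relation exchanges one loop at the long vertex
  with t loops at the short one, which are exactly the summands of \<omega>. Across a simple edge
  single loops commute with the arrow and both exponents agree.\<close>

lemma word_eq_omega:
  assumes "c i j < 0"
  shows "word_eq j (replicate (om i) (Eps i) @ [Alpha i j]) (Alpha i j # replicate (om j) (Eps j))"
  using assms
proof (cases rule: edge_cases)
  case same
  then show ?thesis using word_eq_same[of i j "om i"] by simp
next
  case down
  then show ?thesis using word_eq_comm[OF assms] om_cases[of i] om_cases[of j] by auto
next
  case up
  then show ?thesis using word_eq_comm[OF assms] om_cases[of i] om_cases[of j] by auto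
qed

lemma word_eq_central:
  assumes "is_path (i, w)" "path_tgt (i, w) = j"
  shows "word_eq i (replicate (om j) (Eps j) @ w) (w @ replicate (om i) (Eps i))"
  using assms
proof (induction w arbitrary: j)
  case Nil
  then show ?case by (auto intro: word_eq_refl)
next
  case (Cons a w)
  define k where "k = path_tgt (i, w)"
  have a: "is_arrow a" "arrow_src a = k" "arrow_tgt a = j" "is_path (i, w)" using Cons by (auto simp: k_def)
  have "word_eq k (replicate (om j) (Eps j) @ [a]) (a # replicate (om k) (Eps k))"
  proof (cases a)
    case (Eps l)
    then show ?thesis using a by (auto intro!: word_eq_refl simp: replicate_append_same[symmetric] is_path_append)
  qed (use a word_eq_omega in auto)
  then have "word_eq i ([] @ (replicate (om j) (Eps j) @ [a]) @ w) ([] @ (a # replicate (om k) (Eps k)) @ w)"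
    using a by (intro word_eq_append) (auto simp: k_def)
  then have "word_eq i (replicate (om j) (Eps j) @ a # w) (a # replicate (om k) (Eps k) @ w)" by simp
  also have "word_eq i (a # replicate (om k) (Eps k) @ w) (a # w @ replicate (om i) (Eps i))"
    using a Cons.IH[of k] by (intro word_eq_Cons) (auto simp: k_def path_tgt_append is_path_append)
  finally show ?case by simp
qed

section \<open>Normal form of paths and the degree estimate\<close>

fun alphas :: "'i arrow list \<Rightarrow> nat" where
  "alphas [] = 0"
| "alphas (Alpha i j # w) = Suc (alphas w)"
| "alphas (Eps i # w) = alphas w"

lemma alphas_append [simp]: "alphas (u @ w) = alphas u + alphas w"
  by (induction u rule: alphas.induct) auto

lemma alphas_replicate [simp]: "alphas (replicate n (Eps i)) = 0"
  by (induction n) auto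

text \<open>Every loop has degree at least 2 and every other arrow degree at least -2t. Hence the
  degree and the number of \<open>Alpha\<close> letters together bound the length.\<close>

lemma path_deg_ge: "2 * (int (length w) - int (alphas w)) - (2 * lacing) * alphas w \<le> path_deg (i, w)" if "is_path (i, w)"
  using that
proof (induction w rule: alphas.induct)
  case (2 j k w)
  have "c j k < 0" using 2(2) by (simp only: is_path.simps is_arrow.simps)
  then have "b j k \<ge> - lacing" using b_edge[of j k] lacing_ge[of j] lacing_ge[of k] by simp
  then have "b j k \<ge> - 2 * lacing" using lacing_pos by simp
  then show ?case using 2 by (simp add: algebra_simps)
next
  case (3 j w)
  then show ?case using d_pos[of j] by simp
qed simp

text \<open>Moving the loops towards the end of the word until they meet a vertex with a smaller loop bound
  writes every path as \<open>\<epsilon>\<^sup>e y \<omega>\<^sup>m\<close>; between an arrow into the short vertices and an arrow out of them,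
  of total degree \<open>-2t\<close>, the word \<open>y\<close> has at most \<open>t - 1\<close> loops, of degree \<open>2\<close>.\<close>

lemma normal_form:
  assumes "is_path (i, w)" "path_tgt (i, w) = j"
  shows "\<exists>e y m. word_eq i w (replicate e (Eps j) @ y @ replicate (om i * m) (Eps i)) \<and>
    is_path (i, y) \<and> path_tgt (i, y) = j \<and> e < om j \<and> alphas y = alphas w \<and>
    path_deg (i, y) \<le> - int (alphas y) + d j - 1 \<and>
    path_deg (i, w) = 2 * d j * int e + path_deg (i, y) + 2 * lacing * int m"
  using assms
proof (induction w arbitrary: j)
  case Nil
  then show ?case using om_pos[of j] d_pos[of j]
    by (intro exI[of _ 0] exI[of _ "[]"]) (auto intro!: word_eq_refl)
next
  case (Cons a w)
  define k where "k = path_tgt (i, w)"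
  have a: "is_arrow a" "arrow_src a = k" "arrow_tgt a = j" "is_path (i, w)" using Cons by (auto simp: k_def)
  obtain e y m where IH: "word_eq i w (replicate e (Eps k) @ y @ replicate (om i * m) (Eps i))"
    "is_path (i, y)" "path_tgt (i, y) = k" "e < om k" "alphas y = alphas w"
    "path_deg (i, y) \<le> - int (alphas y) + d k - 1"
    "path_deg (i, w) = 2 * d k * int e + path_deg (i, y) + 2 * lacing * int m"
    using Cons.IH[of k] a(4) k_def by blast
  define z where "z = replicate (om i * m) (Eps i)"
  have z: "is_path (i, z)" "path_tgt (i, z) = i" unfolding z_def by auto
  have yz: "is_path (i, y @ z)" "path_tgt (i, y @ z) = k" using IH z by (auto simp: is_path_append path_tgt_append)
  have E: "word_eq i (a # w) (a # replicate e (Eps k) @ y @ z)"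
    unfolding z_def by (intro word_eq_Cons IH Cons.prems)
  show ?case
  proof (cases a)
    case (Eps l)
    then have l: "l = k" "j = k" using a by auto
    show ?thesis
    proof (cases "Suc e < om k")
      case True
      show ?thesis
        by (rule exI[of _ "Suc e"], rule exI[of _ y], rule exI[of _ m])
          (use E IH True Eps l in \<open>auto simp: z_def algebra_simps\<close>)
    next
      case False
      \<comment> \<open>The loops at the head now complete a factor \<omega>, which moves to the end
        of the word.\<close>
      then have e: "Suc e = om k" using IH by simp
      have "word_eq i (a # w) (replicate (om k) (Eps k) @ y @ z)"
        using E Eps l by (simp add: e[symmetric])
      also have "word_eq i (replicate (om k) (Eps k) @ (y @ z)) ((y @ z) @ replicate (om i) (Eps i))"
        using yz by (rule word_eq_central)
      also have "(y @ z) @ replicate (om i) (Eps i) = y @ replicate (om i * Suc m) (Eps i)"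
        by (simp add: z_def replicate_add[symmetric] add.commute)
      finally have 1: "word_eq i (a # w) (y @ replicate (om i * Suc m) (Eps i))" .
      have "d k * int (Suc e) = lacing" using om_pos(2)[of k] e by simp
      then have 2: "path_deg (i, a # w) = path_deg (i, y) + 2 * lacing * int (Suc m)"
        using IH(7) Eps l by (simp add: algebra_simps)
      show ?thesis
        by (rule exI[of _ 0], rule exI[of _ y], rule exI[of _ "Suc m"])
          (use 1 2 IH Eps l om_pos[of j] in \<open>auto simp del: of_nat_Suc mult_Suc_right\<close>)
    qed
  next
    case (Alpha j' k')
    then have A: "a = Alpha j k" "c j k < 0" using a by auto
    show ?thesis
      using A(2)
    proof (cases rule: edge_cases)
      case same
      have "word_eq i ([] @ (Alpha j k # replicate e (Eps k)) @ (y @ z)) ([] @ (replicate e (Eps j) @ [Alpha j k]) @ (y @ z))"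
        using same yz A word_eq_sym[OF word_eq_same[of j k e]] by (intro word_eq_append) auto
      then have 1: "word_eq i (a # w) (replicate e (Eps j) @ (Alpha j k # y) @ z)"
        using word_eq_trans[OF E] A by simp
      have om: "om j = om k" using same by simp
      have bb: "b j k = - d k" using b_edge[OF A(2)] same by simp
      show ?thesis
        by (rule exI[of _ e], rule exI[of _ "Alpha j k # y"], rule exI[of _ m])
          (use 1 IH A om same bb d_pos[of k] in \<open>auto simp: z_def\<close>)
    next
      case up
      \<comment> \<open>At a long vertex \<open>k\<close> there are no loops left over. The arrow of
        degree -t turns the slack t - 1 in the bound for \<open>y\<close> into exactly the -1 that
        one more arrow has to contribute.\<close>
      then have "e = 0" using IH(4) om_cases[of k] by auto
      then have 1: "word_eq i (a # w) ((Alpha j k # y) @ z)" using E A by simp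
      have bb: "b j k = - lacing" using b_edge[OF A(2)] up by simp
      show ?thesis
        by (rule exI[of _ 0], rule exI[of _ "Alpha j k # y"], rule exI[of _ m])
          (use 1 IH A up bb om_pos[of j] \<open>e = 0\<close> in \<open>auto simp: z_def\<close>)
    next
      case down
      \<comment> \<open>The leftover loops cannot cross this arrow and stay in the middle word.
        Their degree is at most 2t - 2, so together with the arrow the degree grows by at most t -
        2; the larger bound at the long vertex \<open>j\<close> allows just this.\<close>
      then have "int e \<le> lacing - 1" using IH(4) om_cases[of k] by auto
      then have e: "2 * int e \<le> 2 * lacing - 2" by simp
      have 1: "word_eq i (a # w) ((Alpha j k # replicate e (Eps k) @ y) @ z)" using E A by simp
      have bb: "b j k = - lacing" using b_edge[OF A(2)] down by simp
      show ?thesis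
        by (rule exI[of _ 0], rule exI[of _ "Alpha j k # replicate e (Eps k) @ y"], rule exI[of _ m])
          (use 1 IH A down bb om_pos[of j] e in \<open>auto simp: z_def is_path_append path_tgt_append\<close>)
    qed
  qed
qed

section \<open>Powers of \<omega> and the truncated duals\<close>

lemma omega_alt: "omega = (\<lambda>q. \<Sum>i\<in>UNIV. 1 * single (i, replicate (om i) (Eps i)) q)"
  by (simp add: omega_def fun_eq_iff sum_fun_apply)

lemma pa_power_omega: "pa_power omega l = (\<lambda>q. \<Sum>i\<in>UNIV. 1 * single (i, replicate (om i * l) (Eps i)) q)"
proof (induction l)
  case 0
  then show ?case by (simp add: pa_one_def fun_eq_iff sum_fun_apply)
next
  case (Suc l)
  have "(\<Sum>j\<in>UNIV. pa_mult (single (i, replicate (om i) (Eps i))) (single (j, replicate (om j * l) (Eps j))) q)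
      = single (i, replicate (om i * Suc l) (Eps i)) q" for i q
  proof -
    have "(\<Sum>j\<in>UNIV. pa_mult (single (i, replicate (om i) (Eps i))) (single (j, replicate (om j * l) (Eps j))) q)
      = (\<Sum>j\<in>UNIV. if j = i then single (i, replicate (om i * Suc l) (Eps i)) q else 0)"
      by (intro sum.cong refl) (auto simp: pa_mult_single replicate_add)
    then show ?thesis by simp
  qed
  then show ?case
    unfolding pa_power.simps Suc by (subst omega_alt, simp only: pa_mult_sum_left pa_mult_sum_right) simp
qed

lemma pairing_mult_omega_power:
  assumes "y \<in> path_algebra"
  shows "pairing f (pa_mult y (pa_power omega l)) =
    (\<Sum>p\<in>support y. y p * f (fst p, snd p @ replicate (om (fst p) * l) (Eps (fst p))))"
proof -
  have om: "pa_power omega l \<in> path_algebra"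
    unfolding pa_power_omega by (rule path_algebra_sum) (auto intro: path_algebra_single)
  have "pairing (left_translate p f) (pa_power omega l) = f (fst p, snd p @ replicate (om (fst p) * l) (Eps (fst p)))" for p
  proof -
    have "pairing (left_translate p f) (pa_power omega l)
       = (\<Sum>i\<in>UNIV. left_translate p f (i, replicate (om i * l) (Eps i)))"
      unfolding pa_power_omega by (subst pairing_sum) auto
    also have "\<dots> = (\<Sum>i\<in>UNIV. if i = fst p then f (fst p, snd p @ replicate (om (fst p) * l) (Eps (fst p))) else 0)"
      by (intro sum.cong refl) (auto simp: left_translate_def)
    finally show ?thesis by simp
  qed
  then show ?thesis
    using assms om by (subst pairing_pa_mult_left) (auto intro: path_algebra_finite)
qed

lemma trunc_kernel_rel_ideal: "x \<in> rel_ideal \<Longrightarrow> x \<in> trunc_kernel l"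
  unfolding trunc_kernel_def using path_algebra_0 by (force intro: exI[of _ x] exI[of _ 0])

lemma trunc_dual_support: "f \<in> trunc_dual l i \<Longrightarrow> f p \<noteq> 0 \<Longrightarrow> is_path p \<and> fst p = i"
  unfolding trunc_dual_def by blast

lemma trunc_dual_rel_ideal: "f \<in> trunc_dual l i \<Longrightarrow> x \<in> rel_ideal \<Longrightarrow> pairing f x = 0"
  using trunc_kernel_rel_ideal by (auto simp: trunc_dual_def)

lemma trunc_dual_omega_power:
  assumes f: "f \<in> trunc_dual l i" and p: "is_path (i, w)"
  shows "f (i, w @ replicate (om i * l) (Eps i)) = 0"
proof -
  have "pa_mult (single (i, w)) (pa_power omega l) \<in> trunc_kernel l"
    unfolding trunc_kernel_def using rel_ideal.zero path_algebra_single[OF p]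
    by (force intro: exI[of _ 0] exI[of _ "single (i, w)"])
  then have "pairing f (pa_mult (single (i, w)) (pa_power omega l)) = 0"
    using f by (auto simp: trunc_dual_def)
  moreover have "support (single (i, w)) = {(i, w)}" by (auto simp: support_def single_def)
  ultimately show ?thesis
    by (simp add: pairing_mult_omega_power path_algebra_single p)
qed

lemma word_eq_trunc_dual:
  assumes "f \<in> trunc_dual l i" "word_eq i u w"
  shows "f (i, u) = f (i, w)"
  using trunc_dual_rel_ideal[OF assms(1), of "single (i, u) - single (i, w)"] assms(2)
  by (simp add: word_eq_def pairing_diff)

text \<open>The graded dual only bounds the degrees on the support. In normal form the truncation
  bounds the exponent of \<omega>, then the lower bound on the degree limits the number of
  \<open>Alpha\<close> letters, and the upper bound limits the number of loops.\<close>

lemma I_mod_bounded: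
  assumes "f \<in> I_mod i"
  shows "\<exists>L. \<forall>p. f p \<noteq> 0 \<longrightarrow> length (snd p) \<le> L"
proof -
  obtain l where f: "f \<in> trunc_dual l i" using assms by (auto simp: I_mod_def)
  have fin: "finite (path_deg ` {p. f p \<noteq> 0})" using f by (auto simp: trunc_dual_def)
  define R where "R = nat (Max (insert 0 ((\<lambda>x. \<bar>x\<bar>) ` path_deg ` {p. f p \<noteq> 0})))"
  have R: "\<bar>path_deg p\<bar> \<le> int R" if "f p \<noteq> 0" for p
    using Max_ge[of "insert 0 ((\<lambda>x. \<bar>x\<bar>) ` path_deg ` {p. f p \<noteq> 0})" "\<bar>path_deg p\<bar>"] fin that
    unfolding R_def by (force simp: nat_le_iff)
  \<comment> \<open>Bounds the number of \<open>Alpha\<close> letters. The degree is at least -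
    \<open>R\<close>; the loops in front contribute at most 2t, the power of \<omega> at most 2t
    times \<open>l\<close>, and the middle word less than t minus that number.\<close>
  define A where "A = int R + 4 * lacing + 2 * lacing * int l"
  have "int (length (snd p)) \<le> int R + (1 + lacing) * A" if fp: "f p \<noteq> 0" for p
  proof -
    have p: "is_path p" "fst p = i" using trunc_dual_support[OF f fp] by auto
    define j where "j = path_tgt p"
    obtain w where w: "p = (i, w)" using p by (cases p) auto
    obtain e y m where nf: "word_eq i w (replicate e (Eps j) @ y @ replicate (om i * m) (Eps i))"
      "is_path (i, y)" "path_tgt (i, y) = j" "e < om j" "alphas y = alphas w"
      "path_deg (i, y) \<le> - int (alphas y) + d j - 1"
      "path_deg (i, w) = 2 * d j * int e + path_deg (i, y) + 2 * lacing * int m"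
      using normal_form[of i w j] p w j_def by auto
    have "m < l"
    proof (rule ccontr)
      assume "\<not> m < l"
      then have "replicate (om i * m) (Eps i) = replicate (om i * (m - l)) (Eps i) @ replicate (om i * l) (Eps i)"
        by (simp add: replicate_add[symmetric] algebra_simps diff_mult_distrib2)
      moreover have "is_path (i, replicate e (Eps j) @ y @ replicate (om i * (m - l)) (Eps i))"
        using nf by (auto simp: is_path_append path_tgt_append)
      ultimately have "f (i, replicate e (Eps j) @ y @ replicate (om i * m) (Eps i)) = 0"
        using trunc_dual_omega_power[OF f] by fastforce
      then show False using word_eq_trunc_dual[OF f nf(1)] fp w by simp
    qed
    have "d j * int e \<le> d j * int (om j)" using nf(4) d_pos[of j] by (intro mult_left_mono) auto
    then have 1: "d j * int e \<le> lacing" using om_pos(2)[of j] by simp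
    have 2: "lacing * int m \<le> lacing * int l" using \<open>m < l\<close> lacing_pos by (intro mult_left_mono) auto
    have "- int R \<le> path_deg (i, w)" using R[OF fp] w by simp
    then have aw: "int (alphas w) \<le> A"
      using nf(5-7) 1 2 lacing_ge[of j] lacing_pos unfolding A_def by linarith
    have "lacing * int (alphas w) \<le> lacing * A" using aw lacing_pos by (intro mult_left_mono) auto
    moreover have "path_deg (i, w) \<le> int R" using R[OF fp] w by simp
    moreover have "2 * (int (length w) - int (alphas w)) - (2 * lacing) * alphas w \<le> path_deg (i, w)"
      using path_deg_ge[of i w] p w by simp
    ultimately show ?thesis using aw w by (simp add: algebra_simps)
  qed
  then show ?thesis by (intro exI[of _ "nat (int R + (1 + lacing) * A)"]) (force simp: le_nat_iff nat_le_iff)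
qed

section \<open>The action on the dual modules\<close>

text \<open>As \<tau> reverses paths, a path \<open>p\<close> acts on a form by evaluating it on
  words with \<open>path_op p\<close> put in front.\<close>

lemma I_act_eq:
  assumes y: "y \<in> path_algebra"
  shows "I_act y f q = (if is_path q then
    (\<Sum>p\<in>support y. y p * (if path_tgt p = path_tgt q then f (fst q, snd (path_op p) @ snd q) else 0)) else 0)"
proof -
  have "pa_tau y = (\<lambda>q. \<Sum>p\<in>support y. y p * single (path_op p) q)"
  proof
    fix q
    have "(\<Sum>p\<in>support y. y p * single (path_op p) q)
        = (\<Sum>p\<in>support y. if p = path_op q then (if is_path q then y p else 0) else 0)"
    proof (intro sum.cong refl)
      fix p assume "p \<in> support y"
      then have p: "is_path p" using path_algebra_expand(2)[OF y] by simp
      then have "q = path_op p \<longleftrightarrow> p = path_op q \<and> is_path q" using path_op_path by metis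
      then show "y p * single (path_op p) q = (if p = path_op q then (if is_path q then y p else 0) else 0)"
        by (auto simp: single_def)
    qed
    also have "\<dots> = pa_tau y q"
      using path_algebra_finite[OF y] by (auto simp: pa_tau_def support_def)
    finally show "pa_tau y q = (\<Sum>p\<in>support y. y p * single (path_op p) q)" ..
  qed
  then have "pairing f (pa_mult (pa_tau y) (single q)) = (\<Sum>p\<in>support y. y p * pairing f (pa_mult (single (path_op p)) (single q)))"
    using path_algebra_finite[OF y] by (simp add: pa_mult_sum_left pairing_sum pa_mult_single)
  then show ?thesis
    unfolding I_act_def
    by (auto simp: pa_mult_single path_op_def intro!: sum.cong)
qed

end

section \<open>Linear forms on coordinate spaces\<close>

text \<open>Linearity is required on \<open>carrier_vec n\<close> alone, since the type of vectors
  comprises all dimensions and the values elsewhere are arbitrary.\<close>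

definition linear_form :: "nat \<Rightarrow> (complex vec \<Rightarrow> complex) \<Rightarrow> bool" where
  "linear_form n l \<longleftrightarrow>
     (\<forall>u\<in>carrier_vec n. \<forall>u'\<in>carrier_vec n. l (u + u') = l u + l u') \<and>
     (\<forall>z. \<forall>u\<in>carrier_vec n. l (z \<cdot>\<^sub>v u) = z * l u)"

lemma linear_form_0 [simp]: "linear_form n (\<lambda>_. 0)"
  by (simp add: linear_form_def)

lemma linear_form_index: "r < n \<Longrightarrow> linear_form n (\<lambda>u. u $ r)"
  by (auto simp: linear_form_def)

lemma linear_form_expand:
  assumes l: "linear_form n l" and u: "u \<in> carrier_vec n"
  shows "l u = (\<Sum>r<n. u $ r * l (unit_vec n r))"
proof -
  have "l (vec n (\<lambda>r. if r < k then u $ r else 0)) = (\<Sum>r<k. u $ r * l (unit_vec n r))" if "k \<le> n" for k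
    using that
  proof (induction k)
    case 0
    have "l (0 \<cdot>\<^sub>v 0\<^sub>v n) = 0" using l unfolding linear_form_def by (metis zero_carrier_vec mult_zero_left)
    moreover have "vec n (\<lambda>r. if r < 0 then u $ r else 0) = 0 \<cdot>\<^sub>v 0\<^sub>v n" by auto
    ultimately show ?case by simp
  next
    case (Suc k)
    have "vec n (\<lambda>r. if r < Suc k then u $ r else 0)
        = vec n (\<lambda>r. if r < k then u $ r else 0) + u $ k \<cdot>\<^sub>v unit_vec n k"
      using Suc.prems by (intro eq_vecI) (auto simp: less_Suc_eq)
    then have "l (vec n (\<lambda>r. if r < Suc k then u $ r else 0))
        = l (vec n (\<lambda>r. if r < k then u $ r else 0)) + u $ k * l (unit_vec n k)"
      using l unfolding linear_form_def by simp
    then show ?case using Suc by simp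
  qed
  from this[of n] moreover have "vec n (\<lambda>r. if r < n then u $ r else 0) = u"
    using u by (intro eq_vecI) auto
  ultimately show ?thesis by simp
qed

lemma linear_form_dim_0: "linear_form 0 l \<Longrightarrow> u \<in> carrier_vec 0 \<Longrightarrow> l u = 0"
  using linear_form_expand[of 0 l u] by simp

section \<open>Paths acting on a tuple\<close>

context quiver_datum
begin

text \<open>\<open>Alpha i j\<close> acts through \<alpha>_ji, the map of the opposite arrow. This
  builds \<tau> into the action, so that the word of a path can be applied to a vector starting from
  its head.\<close>

primrec op_mat :: "('i, 'w) tuple \<Rightarrow> 'i arrow \<Rightarrow> int \<Rightarrow> complex mat" where
  "op_mat x (Alpha i j) m = al x j i m"
| "op_mat x (Eps i) m = ep x i m"

text \<open>The action of the reversed path: the head of the word acts first, starting in degree \<open>m\<close>.\<close>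

primrec move :: "('i, 'w) tuple \<Rightarrow> int \<Rightarrow> 'i arrow list \<Rightarrow> complex vec \<Rightarrow> complex vec" where
  "move x m [] u = u"
| "move x m (a # w) u = move x (m + arrow_deg a) w (op_mat x a m *\<^sub>v u)"

lemma op_mat_carrier:
  assumes "x \<in> tuples v" "is_arrow a"
  shows "op_mat x a m \<in> carrier_mat (v (arrow_src a, m + arrow_deg a)) (v (arrow_tgt a, m))"
  using assms c_neg_sym b_sym unfolding tuples_def by (cases a) (auto, metis)

lemma op_mat_mult_carrier:
  assumes "x \<in> tuples v" "is_arrow a" "u \<in> carrier_vec (v (arrow_tgt a, m))"
  shows "op_mat x a m *\<^sub>v u \<in> carrier_vec (v (arrow_src a, m + arrow_deg a))"
  using op_mat_carrier[OF assms(1,2)] assms(3) by (rule mult_mat_vec_carrier)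

lemma move_carrier:
  assumes "x \<in> tuples v" "is_path (i, w)" "u \<in> carrier_vec (v (path_tgt (i, w), m))"
  shows "move x m w u \<in> carrier_vec (v (i, m + path_deg (i, w)))"
  using assms
proof (induction w arbitrary: u m)
  case (Cons a w)
  have "op_mat x a m *\<^sub>v u \<in> carrier_vec (v (path_tgt (i, w), m + arrow_deg a))"
    using Cons.prems op_mat_mult_carrier[of x v a u m] by simp
  from Cons.IH[OF Cons.prems(1) _ this] show ?case using Cons.prems by (simp add: add.assoc)
qed simp

lemma move_append: "move x m (w @ w') u = move x (m + path_deg (i, w)) w' (move x m w u)"
  by (induction w arbitrary: m u) (auto simp: add.assoc)

lemma move_add:
  assumes "x \<in> tuples v" "is_path (i, w)" "u \<in> carrier_vec (v (path_tgt (i, w), m))"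
    "u' \<in> carrier_vec (v (path_tgt (i, w), m))"
  shows "move x m w (u + u') = move x m w u + move x m w u'"
  using assms
proof (induction w arbitrary: u u' m)
  case (Cons a w)
  have c: "op_mat x a m *\<^sub>v u \<in> carrier_vec (v (path_tgt (i, w), m + arrow_deg a))"
    "op_mat x a m *\<^sub>v u' \<in> carrier_vec (v (path_tgt (i, w), m + arrow_deg a))"
    using Cons.prems op_mat_mult_carrier[of x v a _ m] by simp_all
  have "op_mat x a m *\<^sub>v (u + u') = op_mat x a m *\<^sub>v u + op_mat x a m *\<^sub>v u'"
    using mult_add_distrib_mat_vec[OF op_mat_carrier[of x v a m]] Cons.prems by auto
  then show ?case using Cons.IH[OF Cons.prems(1) _ c] Cons.prems by simp
qed simp

lemma move_smult:
  assumes "x \<in> tuples v" "is_path (i, w)" "u \<in> carrier_vec (v (path_tgt (i, w), m))"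
  shows "move x m w (z \<cdot>\<^sub>v u) = z \<cdot>\<^sub>v move x m w u"
  using assms
proof (induction w arbitrary: u m)
  case (Cons a w)
  have c: "op_mat x a m *\<^sub>v u \<in> carrier_vec (v (path_tgt (i, w), m + arrow_deg a))"
    using Cons.prems op_mat_mult_carrier[of x v a _ m] by simp
  have "op_mat x a m *\<^sub>v (z \<cdot>\<^sub>v u) = z \<cdot>\<^sub>v (op_mat x a m *\<^sub>v u)"
    using mult_mat_vec[OF op_mat_carrier[of x v a m]] Cons.prems by auto
  then show ?case using Cons.IH[OF Cons.prems(1) _ c] Cons.prems by simp
qed simp

lemma linear_form_move:
  assumes "x \<in> tuples v" "is_path (i, w)" "linear_form (v (i, m + path_deg (i, w))) l"
  shows "linear_form (v (path_tgt (i, w), m)) (\<lambda>u. l (move x m w u))"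
  using assms(3) move_add[OF assms(1,2)] move_smult[OF assms(1,2)] move_carrier[OF assms(1,2)]
  unfolding linear_form_def by metis

lemma path_deg_mesh_word:
  assumes "c i j < 0" "k < nat (- c i j)"
  shows "path_deg (i, mesh_word i j k) = - 2 * d i"
proof -
  have "int (nat (- c i j) - 1 - k) = - c i j - 1 - int k" using assms by simp
  moreover have "d i * c i j = b i j" by (simp add: b_def)
  ultimately show ?thesis unfolding mesh_word_def by (simp add: b_sym[of j i] algebra_simps)
qed

text \<open>The words act reversed, but reversal permutes the commutation relations and preserves
  the mesh relations, so these are the relations of the algebra itself. The mesh sum is stated entry
  by entry because vectors of different dimensions have no common zero.\<close>

definition relations :: "('i \<times> int \<Rightarrow> nat) \<Rightarrow> ('i, 'w) tuple \<Rightarrow> bool" where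
  "relations v x \<longleftrightarrow>
     (\<forall>i j m. c i j < 0 \<longrightarrow> (\<forall>u\<in>carrier_vec (v (i, m)).
        move x m (replicate (nat (- c i j)) (Eps i) @ [Alpha i j]) u
      = move x m (Alpha i j # replicate (nat (- c j i)) (Eps j)) u)) \<and>
     (\<forall>i m. \<forall>u\<in>carrier_vec (v (i, m)). \<forall>r<v (i, m - 2 * d i).
        (\<Sum>j | c i j < 0. \<Sum>k<nat (- c i j). osign i j * move x m (mesh_word i j k) u $ r) = 0)"

lemma relations_mesh_form:
  assumes x: "x \<in> tuples v" "relations v x" and l: "linear_form (v (i, m - 2 * d i)) l"
    and u: "u \<in> carrier_vec (v (i, m))"
  shows "(\<Sum>j | c i j < 0. \<Sum>k<nat (- c i j). osign i j * l (move x m (mesh_word i j k) u)) = 0"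
proof -
  let ?n = "v (i, m - 2 * d i)"
  let ?I = "SIGMA j:{j. c i j < 0}. {..<nat (- c i j)}"
  have expand: "l (move x m (mesh_word i j k) u) = (\<Sum>r<?n. move x m (mesh_word i j k) u $ r * l (unit_vec ?n r))"
    if "c i j < 0" "k < nat (- c i j)" for j k
  proof (rule linear_form_expand[OF l])
    show "move x m (mesh_word i j k) u \<in> carrier_vec ?n"
      using move_carrier[OF x(1) is_path_mesh_word[OF that(1), of k], of u m] u path_deg_mesh_word[OF that]
      by (simp add: path_tgt_mesh_word)
  qed
  have "(\<Sum>j | c i j < 0. \<Sum>k<nat (- c i j). osign i j * l (move x m (mesh_word i j k) u))
      = (\<Sum>(j, k)\<in>?I. osign i j * l (move x m (mesh_word i j k) u))"
    by (rule sum.Sigma) auto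
  also have "\<dots> = (\<Sum>(j, k)\<in>?I. \<Sum>r<?n. l (unit_vec ?n r) * (osign i j * move x m (mesh_word i j k) u $ r))"
    by (intro sum.cong refl) (auto simp only: split_paired_all prod.case mem_Sigma_iff mem_Collect_eq
        lessThan_iff expand sum_distrib_left mult_ac)
  also have "\<dots> = (\<Sum>r<?n. l (unit_vec ?n r) * (\<Sum>(j, k)\<in>?I. osign i j * move x m (mesh_word i j k) u $ r))"
    unfolding case_prod_unfold sum_distrib_left by (rule sum.swap)
  also have "\<dots> = 0"
  proof (intro sum.neutral ballI)
    fix r assume "r \<in> {..<?n}"
    have "(\<Sum>(j, k)\<in>?I. osign i j * move x m (mesh_word i j k) u $ r)
        = (\<Sum>j | c i j < 0. \<Sum>k<nat (- c i j). osign i j * move x m (mesh_word i j k) u $ r)"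
      by (rule sum.Sigma[symmetric]) auto
    then show "l (unit_vec ?n r) * (\<Sum>(j, k)\<in>?I. osign i j * move x m (mesh_word i j k) u $ r) = 0"
      using x(2) u \<open>r \<in> {..<?n}\<close> unfolding relations_def by auto
  qed
  finally show ?thesis .
qed

section \<open>Matrix coefficients as elements of the dual modules\<close>

text \<open>A matrix coefficient of the representation on V: the path \<open>p\<close> goes to
  \<open>l\<close> of its action on \<open>u\<close>. The source degree (j, m) and the target degree
  (i, n) are part of the data, so that the support lies in a single degree.\<close>

definition coeff :: "('i, 'w) tuple \<Rightarrow> 'i \<Rightarrow> int \<Rightarrow> (complex vec \<Rightarrow> complex) \<Rightarrow> 'i \<Rightarrow> int \<Rightarrow> complex vec
    \<Rightarrow> 'i path \<Rightarrow> complex" where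
  "coeff x i n l j m u = (\<lambda>p. if is_path p \<and> fst p = i \<and> path_tgt p = j \<and> m + path_deg p = n
     then l (move x m (snd p) u) else 0)"

lemma pairing_coeff_rel_ideal:
  assumes x: "x \<in> tuples v" "relations v x" and y: "y \<in> rel_ideal"
    and l: "linear_form (v (i, n)) l" and u: "u \<in> carrier_vec (v (j, m))"
  shows "pairing (coeff x i n l j m u) y = 0"
proof -
  \<comment> \<open>The class of all matrix coefficients is closed under translations: a path on the
    left is absorbed by the vector \<open>u\<close>, a path on the right by the linear form
    \<open>l\<close>.\<close>
  define F where "F = {coeff x i n l j m u | i n l j m u.
    linear_form (v (i, n)) l \<and> u \<in> carrier_vec (v (j, m))}"
  have zero: "(\<lambda>_. 0) \<in> F" unfolding F_def
    by (intro CollectI exI[of _ i] exI[of _ n] exI[of _ "\<lambda>_. 0"] exI[of _ j] exI[of _ m] exI[of _ u])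
      (auto simp: coeff_def u)
  show ?thesis
  proof (rule pairing_rel_ideal[OF y, of _ F])
    show "coeff x i n l j m u \<in> F" using l u unfolding F_def by blast
  next
    fix f p assume "f \<in> F" "is_path p"
    then obtain i n l j m u where f: "f = coeff x i n l j m u"
      and l: "linear_form (v (i, n)) l" and u: "u \<in> carrier_vec (v (j, m))" unfolding F_def by blast
    obtain k w where p: "p = (k, w)" by (cases p)
    show "left_translate p f \<in> F"
    proof (cases "path_tgt p = j")
      case True
      have "left_translate p f = coeff x i n l k (m + path_deg p) (move x m w u)"
      proof
        fix q :: "'i path" obtain k' w' where q: "q = (k', w')" by (cases q)
        have "path_deg (k', w) = path_deg (k, w)" by (rule path_deg_src)
        then show "left_translate p f q = coeff x i n l k (m + path_deg p) (move x m w u) q"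
          using True \<open>is_path p\<close> unfolding left_translate_def f coeff_def p q
          by (auto simp: is_path_append path_tgt_append add.assoc move_append[of x m w w' u k])
      qed
      moreover have "move x m w u \<in> carrier_vec (v (k, m + path_deg p))"
        using move_carrier[OF x(1), of k w u m] \<open>is_path p\<close> u True p by simp
      ultimately show ?thesis using l unfolding F_def by blast
    next
      case False
      have "left_translate p f = (\<lambda>_. 0)"
        using False unfolding left_translate_def f coeff_def p by (auto simp: path_tgt_append fun_eq_iff)
      then show ?thesis using zero by simp
    qed
    show "right_translate p f \<in> F"
    proof (cases "fst p = i")
      case True
      let ?l = "\<lambda>u. l (move x (n - path_deg p) w u)"
      have "right_translate p f = coeff x (path_tgt p) (n - path_deg p) ?l j m u"
      proof
        fix q :: "'i path" obtain k' w' where q: "q = (k', w')" by (cases q)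
        have "path_deg (k, w') = path_deg (k', w')" by (rule path_deg_src)
        then show "right_translate p f q = coeff x (path_tgt p) (n - path_deg p) ?l j m u q"
          using True \<open>is_path p\<close> unfolding right_translate_def f coeff_def p q
          by (auto simp: is_path_append path_tgt_append algebra_simps move_append[of x m w' w u k])
      qed
      moreover have "linear_form (v (path_tgt p, n - path_deg p)) ?l"
        using linear_form_move[OF x(1), of k w "n - path_deg p" l] \<open>is_path p\<close> l True p by simp
      ultimately show ?thesis using u unfolding F_def by blast
    next
      case False
      have "right_translate p f = (\<lambda>_. 0)"
        using False unfolding right_translate_def f coeff_def p by (auto simp: fun_eq_iff)
      then show ?thesis using zero by simp
    qed
  next
    fix f i' j' assume "f \<in> F" and c: "c i' j' < 0"
    then obtain i n l j m u where f: "f = coeff x i n l j m u"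
      and l: "linear_form (v (i, n)) l" and u: "u \<in> carrier_vec (v (j, m))" unfolding F_def by blast
    have "2 * d i' * int (nat (- c i' j')) = 2 * d j' * int (nat (- c j' i'))"
      using b_sym[of i' j'] c c_neg_sym[of i' j'] by (simp add: b_def)
    then have deg: "path_deg (j', replicate (nat (- c i' j')) (Eps i') @ [Alpha i' j'])
        = path_deg (j', Alpha i' j' # replicate (nat (- c j' i')) (Eps j'))" by simp
    have tgt: "path_tgt (j', replicate (nat (- c i' j')) (Eps i') @ [Alpha i' j']) = i'"
      by (simp add: path_tgt_append)
    have "u \<in> carrier_vec (v (i', m)) \<Longrightarrow> move x m (replicate (nat (- c i' j')) (Eps i') @ [Alpha i' j']) u
      = move x m (Alpha i' j' # replicate (nat (- c j' i')) (Eps j')) u"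
      using x(2) c unfolding relations_def by blast
    then show "f (j', replicate (nat (- c i' j')) (Eps i') @ [Alpha i' j'])
        = f (j', Alpha i' j' # replicate (nat (- c j' i')) (Eps j'))"
      using u c unfolding f coeff_def deg tgt
      by (cases "i' = j") (simp_all only: rel_comm_paths fst_conv snd_conv path_tgt.simps arrow_tgt.simps simp_thms if_False)
  next
    fix f i' assume "f \<in> F"
    then obtain i n l j m u where f: "f = coeff x i n l j m u"
      and l: "linear_form (v (i, n)) l" and u: "u \<in> carrier_vec (v (j, m))" unfolding F_def by blast
    have "(\<Sum>j | c i' j < 0. \<Sum>k<nat (- c i' j). osign i' j * f (i', mesh_word i' j k)) =
      (if i' = i \<and> i' = j \<and> m - 2 * d i' = n then
        (\<Sum>j | c i' j < 0. \<Sum>k<nat (- c i' j). osign i' j * l (move x m (mesh_word i' j k) u)) else 0)"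
      by (auto simp: f coeff_def is_path_mesh_word path_tgt_mesh_word path_deg_mesh_word
        intro!: sum.cong sum.neutral)
    also have "\<dots> = 0" using relations_mesh_form[OF x, of i' m l u] l u by auto
    finally show "(\<Sum>j | c i' j < 0. \<Sum>k<nat (- c i' j). osign i' j * f (i', mesh_word i' j k)) = 0" .
  qed
qed

text \<open>The power of \<omega> at the end of the word acts last and shifts the degree by 2t times
  \<open>N\<close>. By the assumption on \<open>v\<close>, either the component where it starts or
  the one where it ends is zero.\<close>

lemma coeff_omega_power:
  assumes x: "x \<in> tuples v" and l: "linear_form (v (i, n)) l" and u: "u \<in> carrier_vec (v (j, m))"
    and N: "\<And>i n. v (i, n) = 0 \<or> v (i, n - 2 * lacing * int N) = 0"
  shows "coeff x i n l j m u (k, w @ replicate (om k * N) (Eps k)) = 0"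
proof (rule ccontr)
  let ?e = "replicate (om k * N) (Eps k)"
  assume nz: "coeff x i n l j m u (k, w @ ?e) \<noteq> 0"
  then have p: "is_path (k, w @ ?e)" "k = i" "path_tgt (k, w @ ?e) = j" "m + path_deg (k, w @ ?e) = n"
    and val: "coeff x i n l j m u (k, w @ ?e) = l (move x m (w @ ?e) u)"
    by (auto simp: coeff_def split: if_splits)
  have e: "2 * d k * int (om k * N) = 2 * lacing * int N" using om_pos(2)[of k]
    by (simp only: of_nat_mult mult.assoc[symmetric]) (metis mult.assoc)
  then have dg: "m + path_deg (k, w) = n - 2 * lacing * int N" using p(4)
    by (simp only: path_deg_simps(3) path_deg_replicate)
  have w: "is_path (k, w)" "path_tgt (k, w) = j" using p by (auto simp: is_path_append path_tgt_append)
  define y where "y = move x m w u"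
  have y: "y \<in> carrier_vec (v (i, n - 2 * lacing * int N))"
    using move_carrier[OF x w(1), of u m] w u p(2) dg by (simp add: y_def)
  have mv: "move x m (w @ ?e) u = move x (n - 2 * lacing * int N) ?e y"
    using move_append[of x m w ?e u k] dg by (simp add: y_def)
  have lf: "linear_form (v (path_tgt (k, ?e), n - 2 * lacing * int N)) (\<lambda>u. l (move x (n - 2 * lacing * int N) ?e u))"
    using l e p(2) by (intro linear_form_move[OF x is_path_replicate]) (simp only: path_deg_replicate diff_add_cancel)
  have "v (i, n) = 0 \<or> v (i, n - 2 * lacing * int N) = 0" by (rule N)
  then have "l (move x m (w @ ?e) u) = 0"
  proof
    assume "v (i, n) = 0"
    then show ?thesis using linear_form_dim_0[of l] l move_carrier[OF x p(1), of u m] u p by simp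
  next
    assume "v (i, n - 2 * lacing * int N) = 0"
    then show ?thesis unfolding mv using linear_form_dim_0[of "\<lambda>u. l (move x (n - 2 * lacing * int N) ?e u)" y] lf y p(2) by simp
  qed
  then show False using nz val by simp
qed

lemma omega_bound:
  assumes "finite {q. v q \<noteq> (0::nat)}"
  obtains N where "N > 0" "\<And>i n. v (i::'i, n) = 0 \<or> v (i, n - 2 * lacing * int N) = 0"
proof -
  define R where "R = nat (Max (insert 0 ((\<lambda>q. \<bar>snd q\<bar>) ` {q. v q \<noteq> 0})))"
  have R: "\<bar>snd q\<bar> \<le> int R" if "v q \<noteq> 0" for q
    using Max_ge[of "insert 0 ((\<lambda>q. \<bar>snd q\<bar>) ` {q. v q \<noteq> 0})" "\<bar>snd q\<bar>"] assms that
    unfolding R_def by (force simp: nat_le_iff)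
  show ?thesis
  proof (rule that)
    \<comment> \<open>Degrees in the support of \<open>v\<close> differ by at most 2
      \<open>R\<close>, hence never by 2t times \<open>K\<close>.\<close>
    define K where "K = 2 * R + 1"
    show "K > 0" by (simp add: K_def)
    fix i n
    have "1 * int K \<le> (2 * lacing) * int K"
      using lacing_pos by (intro mult_right_mono) auto
    moreover have "int K > 2 * int R" by (simp add: K_def)
    ultimately show "v (i, n) = 0 \<or> v (i, n - 2 * lacing * int K) = 0"
      using R[of "(i, n)"] R[of "(i, n - 2 * lacing * int K)"] by (simp only: snd_conv) arith
  qed
qed

lemma coeff_trunc_dual:
  assumes x: "x \<in> tuples v" "relations v x"
    and l: "linear_form (v (i, n)) l" and u: "u \<in> carrier_vec (v (j, m))"
    and N: "\<And>i n. v (i, n) = 0 \<or> v (i, n - 2 * lacing * int N) = 0"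
  shows "coeff x i n l j m u \<in> trunc_dual N i"
proof -
  let ?f = "coeff x i n l j m u"
  have "path_deg ` {p. ?f p \<noteq> 0} \<subseteq> {n - m}" by (auto simp: coeff_def split: if_splits)
  then have "finite (path_deg ` {p. ?f p \<noteq> 0})" by (rule finite_subset) simp
  moreover have "pairing ?f y = 0" if yk: "y \<in> trunc_kernel N" for y
  proof -
    obtain y1 y2 where y: "y = y1 + pa_mult y2 (pa_power omega N)" "y1 \<in> rel_ideal" "y2 \<in> path_algebra"
      using yk unfolding trunc_kernel_def by blast
    have om: "pa_power omega N \<in> path_algebra"
      unfolding pa_power_omega by (rule path_algebra_sum) (auto intro: path_algebra_single)
    have "pairing ?f y = pairing ?f y1 + pairing ?f (pa_mult y2 (pa_power omega N))"
      unfolding y(1) using y om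
      by (intro pairing_add path_algebra_finite) (auto intro: rel_ideal_path_algebra path_algebra_mult)
    also have "\<dots> = 0"
      using pairing_coeff_rel_ideal[OF x y(2) l u] pairing_mult_omega_power[OF y(3)]
        coeff_omega_power[OF x(1) l u N] by simp
    finally show ?thesis .
  qed
  ultimately show ?thesis unfolding trunc_dual_def by (auto simp: coeff_def split: if_splits)
qed

lemma framing_vector_space: "Vector_Spaces.vector_space sc"
  using framing by (simp add: graded_space_def)

sublocale framing: vector_space sc
  by (rule framing_vector_space)

lemma framing_subspace: "framing.subspace (W q)"
proof -
  obtain n where "has_dim sc (W q) n" using framing unfolding graded_space_def by blast
  then show ?thesis unfolding has_dim_def using framing.subspace_span by metis
qed

end

section \<open>Indexed families in a vector space\<close>

context vector_space
begin

lemma span_image_lessThan: "span (G ` {..<n::nat}) = range (\<lambda>u. \<Sum>k<n. scale (u k) (G k))"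
proof
  show "span (G ` {..<n}) \<subseteq> range (\<lambda>u. \<Sum>k<n. scale (u k) (G k))"
  proof (rule span_minimal)
    show "G ` {..<n} \<subseteq> range (\<lambda>u. \<Sum>k<n. scale (u k) (G k))"
    proof
      fix y assume "y \<in> G ` {..<n}"
      then obtain m where m: "m < n" "y = G m" by auto
      have "(\<Sum>k<n. scale ((\<lambda>k. if k = m then 1 else 0) k) (G k)) = (\<Sum>k<n. if k = m then G k else 0)"
        by (intro sum.cong) auto
      also have "\<dots> = y" using m by simp
      finally show "y \<in> range (\<lambda>u. \<Sum>k<n. scale (u k) (G k))"
        by (intro range_eqI[of _ _ "\<lambda>k. if k = m then 1 else 0"]) simp
    qed
    show "subspace (range (\<lambda>u. \<Sum>k<n. scale (u k) (G k)))"
    proof (rule subspaceI)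
      show "0 \<in> range (\<lambda>u. \<Sum>k<n. scale (u k) (G k))"
        by (rule range_eqI[of _ _ "\<lambda>_. 0"]) simp
    next
      fix x y assume "x \<in> range (\<lambda>u. \<Sum>k<n. scale (u k) (G k))" "y \<in> range (\<lambda>u. \<Sum>k<n. scale (u k) (G k))"
      then obtain u w where "x = (\<Sum>k<n. scale (u k) (G k))" "y = (\<Sum>k<n. scale (w k) (G k))" by auto
      then show "x + y \<in> range (\<lambda>u. \<Sum>k<n. scale (u k) (G k))"
        by (intro range_eqI[of _ _ "\<lambda>k. u k + w k"]) (simp add: scale_left_distrib sum.distrib)
    next
      fix z x assume "x \<in> range (\<lambda>u. \<Sum>k<n. scale (u k) (G k))"
      then obtain u where "x = (\<Sum>k<n. scale (u k) (G k))" by auto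
      then show "scale z x \<in> range (\<lambda>u. \<Sum>k<n. scale (u k) (G k))"
        by (intro range_eqI[of _ _ "\<lambda>k. z * u k"]) (simp add: scale_sum_right)
    qed
  qed
  show "range (\<lambda>u. \<Sum>k<n. scale (u k) (G k)) \<subseteq> span (G ` {..<n})"
    by (auto intro!: span_sum span_scale intro: span_base)
qed

text \<open>The image set alone would overlook repeated members of the family, so its independence
  is coupled with injectivity.\<close>

lemma independent_image_lessThan:
  "inj_on G {..<n::nat} \<and> independent (G ` {..<n}) \<longleftrightarrow>
     (\<forall>u. (\<Sum>k<n. scale (u k) (G k)) = 0 \<longrightarrow> (\<forall>k<n. u k = 0))" (is "?L \<longleftrightarrow> ?R")
proof
  assume L: ?L
  show ?R
  proof (intro allI impI)
    fix u k assume u: "(\<Sum>k<n. scale (u k) (G k)) = 0" and k: "k < n"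
    have inj: "inj_on G {..<n}" using L by simp
    define w where "w y = u (the_inv_into {..<n} G y)" for y
    have "(\<Sum>y\<in>G ` {..<n}. scale (w y) y) = (\<Sum>k<n. scale (u k) (G k))"
      unfolding w_def by (subst sum.reindex[OF inj]) (auto intro!: sum.cong simp: the_inv_into_f_f[OF inj])
    then have "w (G k) = 0"
      using independentD[of "G ` {..<n}" "G ` {..<n}" w "G k"] L u k by auto
    then show "u k = 0" using k by (simp add: w_def the_inv_into_f_f[OF inj])
  qed
next
  assume R: ?R
  have inj: "inj_on G {..<n}"
  proof (rule inj_onI, rule ccontr)
    fix k m assume km: "k \<in> {..<n}" "m \<in> {..<n}" "G k = G m" "k \<noteq> m"
    define u where "u l = (if l = k then 1 else if l = m then -1 else 0 :: 'a)" for l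
    have "(\<Sum>l<n. scale (u l) (G l)) = (\<Sum>l\<in>{k, m}. scale (u l) (G l))"
      by (rule sum.mono_neutral_right) (use km in \<open>auto simp: u_def\<close>)
    also have "\<dots> = 0" using km by (simp add: u_def)
    finally have "u k = 0" using R km(1) by auto
    then show False by (simp add: u_def)
  qed
  have "independent (G ` {..<n})"
  proof (rule independent_if_scalars_zero)
    fix w y assume w: "(\<Sum>y\<in>G ` {..<n}. scale (w y) y) = 0" and y: "y \<in> G ` {..<n}"
    then have "(\<Sum>k<n. scale (w (G k)) (G k)) = 0" by (simp add: sum.reindex[OF inj])
    then show "w y = 0" using spec[OF R, of "\<lambda>k. w (G k)"] y by auto
  qed simp
  with inj show ?L by simp
qed

end

interpretation fam: vector_space scale_fam
  by (rule vector_space_scale_fam)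

lemma scale_fam_apply [simp]: "scale_fam z u r p = z * u r p"
  by (simp add: scale_fam_def)

lemma sum_scale_fam_apply: "(\<Sum>k<(n::nat). scale_fam (u k) (G k)) r p = (\<Sum>k<n. u k * G k r p)"
  by (simp add: sum_fun_apply)

lemma mult_mat_vec_index:
  assumes "A \<in> carrier_mat nr nc" "u \<in> carrier_vec nc" "r < nr"
  shows "(A *\<^sub>v u) $ r = (\<Sum>n<nc. A $$ (r, n) * u $ n)"
  using assms by (simp add: scalar_prod_def atLeast0LessThan)

lemma mult_mat_unit_vec_index:
  fixes A :: "complex mat"
  assumes "A \<in> carrier_mat nr nc" "r < nr" "n < nc"
  shows "(A *\<^sub>v unit_vec nc n) $ r = A $$ (r, n)"
proof -
  have "(A *\<^sub>v unit_vec nc n) $ r = (\<Sum>m<nc. A $$ (r, m) * unit_vec nc n $ m)"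
    using assms by (intro mult_mat_vec_index) auto
  also have "\<dots> = (\<Sum>m<nc. if m = n then A $$ (r, m) else 0)"
    using assms by (intro sum.cong) auto
  finally show ?thesis using assms by simp
qed

context cartan_datum
begin

text \<open>Transposed left multiplication by the arrow \<open>a\<close>, applied to all summands at
  once; by \<open>I_act_arrow\<close> it is the action of the opposite arrow. It removes one letter
  from the paths in the support, which is the source of nilpotency.\<close>

definition shift :: "'i arrow \<Rightarrow> (nat \<Rightarrow> 'i path \<Rightarrow> complex) \<Rightarrow> nat \<Rightarrow> 'i path \<Rightarrow> complex" where
  "shift a f = (\<lambda>r p. if is_path (fst p, a # snd p) then f r (fst p, a # snd p) else 0)"

lemma shift_sum: "shift a (\<lambda>r p. \<Sum>n\<in>A. u n * G n r p) = (\<lambda>r p. \<Sum>n\<in>A. u n * shift a (G n) r p)"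
  by (auto simp: shift_def fun_eq_iff intro!: sum.neutral)

lemma I_act_arrow:
  assumes "is_arrow a"
  shows "(\<lambda>r. I_act (single (arrow_tgt a, [arrow_op a])) (f r)) = shift a f"
proof (rule ext)+
  fix r and q :: "'i path"
  obtain j w where q: "q = (j, w)" by (cases q)
  have p: "is_path (arrow_tgt a, [arrow_op a])" using assms by simp
  have "support (single (arrow_tgt a, [arrow_op a])) = {(arrow_tgt a, [arrow_op a])}"
    by (auto simp: support_def single_def)
  then show "I_act (single (arrow_tgt a, [arrow_op a])) (f r) q = shift a f r q"
    using assms unfolding I_act_eq[OF path_algebra_single[OF p]] q
    by (auto simp: shift_def path_op_def)
qed

definition homogeneous_part :: "(nat \<Rightarrow> int) \<Rightarrow> 'i \<times> int \<Rightarrow> (nat \<Rightarrow> 'i path \<Rightarrow> complex) \<Rightarrow> nat \<Rightarrow> 'i path \<Rightarrow> complex" where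
  "homogeneous_part k q u = (\<lambda>r p. if path_tgt p = fst q \<and> - path_deg p = snd q - k r then u r p else 0)"

lemma sum_comp_support:
  assumes "u \<in> sum_comp s ii k q" "u r p \<noteq> 0"
  shows "r \<in> {1..s}" "is_path p" "fst p = ii r" "path_tgt p = fst q" "- path_deg p = snd q - k r"
proof -
  show r: "r \<in> {1..s}"
  proof (rule ccontr)
    assume "r \<notin> {1..s}"
    then have "u r = 0" using assms(1) unfolding sum_comp_def sum_mod_def by blast
    then show False using assms(2) by simp
  qed
  have c: "u r \<in> I_comp (ii r) (k r) q" using assms(1) r unfolding sum_comp_def by blast
  then have "u r \<in> I_mod (ii r)" unfolding I_comp_def by (cases q) auto
  then show "is_path p" "fst p = ii r" using assms(2) unfolding I_mod_def by (auto dest: trunc_dual_support)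
  have "\<forall>p. u r p \<noteq> 0 \<longrightarrow> path_tgt p = fst q \<and> - path_deg p = snd q - k r"
    using c unfolding I_comp_def case_prod_unfold mem_Collect_eq by (rule conjunct2)
  then show "path_tgt p = fst q" "- path_deg p = snd q - k r" using assms(2) by blast+
qed

lemma homogeneous_part_eq:
  assumes "u \<in> sum_comp s ii k q"
  shows "homogeneous_part k q u = u"
proof (rule ext)+
  fix r p
  show "homogeneous_part k q u r p = u r p"
    using sum_comp_support(4,5)[OF assms, of r p] by (cases "u r p = 0") (simp_all add: homogeneous_part_def)
qed

lemma homogeneous_part_neq:
  assumes "u \<in> sum_comp s ii k q'" "q' \<noteq> q"
  shows "homogeneous_part k q u = 0"
proof (rule ext)+
  fix r p
  have "u r p = 0" if "path_tgt p = fst q" "- path_deg p = snd q - k r"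
    using sum_comp_support(4,5)[OF assms(1), of r p] that assms(2) by (metis diff_add_cancel prod_eqI)
  then show "homogeneous_part k q u r p = 0 r p" by (simp add: homogeneous_part_def)
qed

text \<open>The projection to degree \<open>q\<close> is the identity on \<open>G q\<close> and
  kills the other components, so it maps the whole span into \<open>G q\<close>. On elements of
  degree \<open>q\<close> it changes nothing.\<close>

lemma span_graded_Int:
  assumes sub: "\<And>q. fam.subspace (G q)" and comp: "\<And>q. G q \<subseteq> sum_comp s ii k q"
  shows "fam.span (\<Union>q. G q) \<inter> sum_comp s ii k q = G q"
proof
  show "G q \<subseteq> fam.span (\<Union>q. G q) \<inter> sum_comp s ii k q"
    using comp by (auto intro: fam.span_base)
  have "homogeneous_part k q w \<in> G q" if "w \<in> fam.span (\<Union>q. G q)" for w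
    using that
  proof (induction rule: fam.span_induct)
    case base
    show ?case
    proof (rule fam.subspaceI)
      show "0 \<in> {a. homogeneous_part k q a \<in> G q}"
        using fam.subspace_0[OF sub[of q]] by (simp add: homogeneous_part_def zero_fun_def)
    next
      fix x y assume "x \<in> {a. homogeneous_part k q a \<in> G q}" "y \<in> {a. homogeneous_part k q a \<in> G q}"
      then have "homogeneous_part k q x + homogeneous_part k q y \<in> G q" using fam.subspace_add[OF sub] by blast
      also have "homogeneous_part k q x + homogeneous_part k q y = homogeneous_part k q (x + y)"
        by (simp add: homogeneous_part_def fun_eq_iff)
      finally show "x + y \<in> {a. homogeneous_part k q a \<in> G q}" by simp
    next
      fix z x assume "x \<in> {a. homogeneous_part k q a \<in> G q}"
      then have "scale_fam z (homogeneous_part k q x) \<in> G q" using fam.subspace_scale[OF sub] by blast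
      also have "scale_fam z (homogeneous_part k q x) = homogeneous_part k q (scale_fam z x)"
        by (simp add: homogeneous_part_def fun_eq_iff)
      finally show "scale_fam z x \<in> {a. homogeneous_part k q a \<in> G q}" by simp
    qed
  next
    case (step w)
    then obtain q' where q': "w \<in> G q'" by auto
    then have w: "w \<in> sum_comp s ii k q'" using comp by blast
    show ?case
    proof (cases "q' = q")
      case True
      then show ?thesis using q' homogeneous_part_eq[OF w] by simp
    next
      case False
      then show ?thesis using fam.subspace_0[OF sub[of q]] homogeneous_part_neq[OF w False] by metis
    qed
  qed
  then show "fam.span (\<Union>q. G q) \<inter> sum_comp s ii k q \<subseteq> G q"
    using homogeneous_part_eq by (metis IntD1 IntD2 subsetI)
qed

end

section \<open>The correspondence between tuples and frames\<close>

text \<open>One dimension vector \<open>v\<close> is fixed together with homogeneous bases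
  \<open>e\<close> of the components of W. The coordinate forms \<open>ph\<close> live on the whole
  ambient space. Since the components of W may overlap there, duality is demanded only between
  indices of equal degree.\<close>

locale framed_quiver = quiver_datum c d Or sc W
  for c :: "'i::finite \<Rightarrow> 'i \<Rightarrow> int" and d :: "'i \<Rightarrow> int" and Or :: "('i \<times> 'i) set"
    and sc :: "complex \<Rightarrow> 'w::ab_group_add \<Rightarrow> 'w" and W :: "'i \<times> int \<Rightarrow> 'w set" +
  fixes s :: nat and ii :: "nat \<Rightarrow> 'i" and kk :: "nat \<Rightarrow> int"
    and e :: "nat \<Rightarrow> 'w" and ph :: "nat \<Rightarrow> 'w \<Rightarrow> complex" and v :: "'i \<times> int \<Rightarrow> nat"
  assumes e_in: "r \<in> {1..s} \<Longrightarrow> e r \<in> W (ii r, kk r)"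
    and ph_linear: "Vector_Spaces.linear sc (*) (ph r)"
    and ph_e: "r \<in> {1..s} \<Longrightarrow> r' \<in> {1..s} \<Longrightarrow> ii r = ii r' \<Longrightarrow> kk r = kk r' \<Longrightarrow>
      ph r (e r') = (if r = r' then 1 else 0)"
    and W_expand: "y \<in> W q \<Longrightarrow> y = (\<Sum>r\<in>{r\<in>{1..s}. (ii r, kk r) = q}. sc (ph r y) (e r))"
    and finite_v: "finite {q. v q \<noteq> 0}"
begin

abbreviation dg :: "nat \<Rightarrow> int" where
  "dg r \<equiv> kk r + d (ii r)"

lemma ph_add: "ph r (x + y) = ph r x + ph r y"
  and ph_scale: "ph r (sc z x) = z * ph r x"
  and ph_0: "ph r 0 = 0"
  and ph_sum: "ph r (\<Sum>n\<in>A. f n) = (\<Sum>n\<in>A. ph r (f n))"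
proof -
  interpret ph: Vector_Spaces.linear sc "(*)" "ph r" by (rule ph_linear)
  show "ph r (x + y) = ph r x + ph r y" "ph r (sc z x) = z * ph r x" "ph r 0 = 0"
    "ph r (\<Sum>n\<in>A. f n) = (\<Sum>n\<in>A. ph r (f n))"
    by (rule ph.add ph.scale ph.zero ph.sum)+
qed

definition frame_form :: "('i, 'w) tuple \<Rightarrow> nat \<Rightarrow> complex vec \<Rightarrow> complex" where
  "frame_form x r u = ph r (ar x (ii r) (dg r) u)"

lemma linear_form_ar:
  assumes "x \<in> tuples v"
  shows "linear_form (v (i, k)) (\<lambda>u. ph r (ar x i k u))"
  using assms unfolding linear_form_def tuples_def by (auto simp: ph_add ph_scale)

lemma linear_form_frame_form: "x \<in> tuples v \<Longrightarrow> linear_form (v (ii r, dg r)) (frame_form x r)"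
  using linear_form_ar[of x "ii r" "dg r" r] by (simp add: frame_form_def[abs_def])

definition Psi :: "('i, 'w) tuple \<Rightarrow> 'i \<times> int \<Rightarrow> complex vec \<Rightarrow> nat \<Rightarrow> 'i path \<Rightarrow> complex" where
  "Psi x q u = (\<lambda>r. if r \<in> {1..s} then coeff x (ii r) (dg r) (frame_form x r) (fst q) (snd q) u else 0)"

text \<open>The images of the standard basis under \<open>Psi\<close>, padded by zero in the way the
  frames of the Grassmannian are.\<close>

definition psi :: "('i, 'w) tuple \<Rightarrow> 'i \<times> int \<Rightarrow> nat \<Rightarrow> nat \<Rightarrow> 'i path \<Rightarrow> complex" where
  "psi x q n = (if n < v q then Psi x q (unit_vec (v q) n) else 0)"

definition comb :: "('i \<times> int \<Rightarrow> nat \<Rightarrow> nat \<Rightarrow> 'i path \<Rightarrow> complex) \<Rightarrow> 'i \<times> int \<Rightarrow> complex vec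
    \<Rightarrow> nat \<Rightarrow> 'i path \<Rightarrow> complex" where
  "comb F q u = (\<lambda>r p. \<Sum>n<v q. u $ n * F q n r p)"

lemma comb_eq_sum: "comb F q u = (\<Sum>n<v q. scale_fam (u $ n) (F q n))"
  by (simp add: comb_def sum_scale_fam_apply fun_eq_iff)

lemma linear_form_Psi:
  assumes "x \<in> tuples v"
  shows "linear_form (v q) (\<lambda>u. Psi x q u r p)"
proof (cases "r \<in> {1..s} \<and> is_path p \<and> fst p = ii r \<and> path_tgt p = fst q \<and> snd q + path_deg p = dg r")
  case True
  then have "linear_form (v (path_tgt (ii r, snd p), snd q)) (\<lambda>u. frame_form x r (move x (snd q) (snd p) u))"
    using linear_form_frame_form[OF assms, of r] by (intro linear_form_move[OF assms]) (cases p; auto)+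
  moreover have "(path_tgt (ii r, snd p), snd q) = q" using True by (cases q; cases p) auto
  ultimately show ?thesis using True by (simp add: Psi_def coeff_def)
next
  case False
  then have "(\<lambda>u. Psi x q u r p) = (\<lambda>_. 0)" by (auto simp: Psi_def coeff_def fun_eq_iff)
  then show ?thesis by simp
qed

lemma Psi_eq_comb:
  assumes "x \<in> tuples v" "u \<in> carrier_vec (v q)"
  shows "Psi x q u = comb (psi x) q u"
  using linear_form_expand[OF linear_form_Psi[OF assms(1)] assms(2)]
  by (auto simp: comb_def psi_def fun_eq_iff intro!: sum.cong)

lemma comb_unit_vec:
  assumes "n < v q"
  shows "comb F q (unit_vec (v q) n) = F q n"
proof (rule ext)+
  fix r p
  have "comb F q (unit_vec (v q) n) r p = (\<Sum>k<v q. if k = n then F q k r p else 0)"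
    unfolding comb_def using assms by (intro sum.cong) auto
  then show "comb F q (unit_vec (v q) n) r p = F q n r p" using assms by simp
qed

text \<open>Equivariance of \<open>Psi\<close>: evaluation at a word with the letter
  \<open>a\<close> in front means that \<open>a\<close> acts on the vector before the rest of the
  word.\<close>

lemma shift_Psi:
  assumes "is_arrow a"
  shows "shift a (Psi x (arrow_tgt a, m) u) = Psi x (arrow_src a, m + arrow_deg a) (op_mat x a m *\<^sub>v u)"
proof (rule ext)+
  fix r and p :: "'i path"
  obtain k w where p: "p = (k, w)" by (cases p)
  show "shift a (Psi x (arrow_tgt a, m) u) r p = Psi x (arrow_src a, m + arrow_deg a) (op_mat x a m *\<^sub>v u) r p"
    using assms unfolding shift_def Psi_def p
    by (cases "r \<in> {1..s}"; cases "k = ii r"; cases "is_path (k, w)"; cases "path_tgt (k, w) = arrow_src a")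
      (simp_all add: coeff_def add.assoc del: atLeastAtMost_iff)
qed

lemma Psi_Nil:
  assumes "r \<in> {1..s}"
  shows "Psi x (ii r, dg r) u r (ii r, []) = ph r (ar x (ii r) (dg r) u)"
  using assms by (simp add: Psi_def coeff_def frame_form_def)

lemma ar_expand:
  assumes x: "x \<in> tuples v" and u: "u \<in> carrier_vec (v (i, k))"
  shows "ar x i k u = (\<Sum>r\<in>{r\<in>{1..s}. (ii r, kk r) = (i, k - d i)}. sc (Psi x (i, k) u r (i, [])) (e r))"
proof -
  have "ar x i k u \<in> W (i, k - d i)" using x u unfolding tuples_def by auto
  then have "ar x i k u = (\<Sum>r\<in>{r\<in>{1..s}. (ii r, kk r) = (i, k - d i)}. sc (ph r (ar x i k u)) (e r))"
    by (rule W_expand)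
  also have "\<dots> = (\<Sum>r\<in>{r\<in>{1..s}. (ii r, kk r) = (i, k - d i)}. sc (Psi x (i, k) u r (i, [])) (e r))"
  proof (intro sum.cong refl)
    fix r assume r: "r \<in> {r \<in> {1..s}. (ii r, kk r) = (i, k - d i)}"
    then have "Psi x (ii r, dg r) u r (ii r, []) = ph r (ar x (ii r) (dg r) u)" by (intro Psi_Nil) simp
    moreover have "ii r = i" "dg r = k" using r by auto
    ultimately show "sc (ph r (ar x i k u)) (e r) = sc (Psi x (i, k) u r (i, [])) (e r)" by simp
  qed
  finally show ?thesis .
qed

text \<open>The kernel of \<open>Psi\<close> is the largest graded subspace that is preserved by the
  operators and killed by the framing maps: these are recovered from the values at trivial paths,
  and prepending letters gives invariance.\<close>

lemma stable_iff:
  "x \<in> stable v \<longleftrightarrow> x \<in> tuples v \<and> (\<forall>q. \<forall>u\<in>carrier_vec (v q). Psi x q u = 0 \<longrightarrow> u = 0\<^sub>v (v q))"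
    (is "_ \<longleftrightarrow> _ \<and> ?R")
proof
  assume st: "x \<in> stable v"
  then have x: "x \<in> tuples v" by (simp add: stable_def)
  define U where "U q = {u \<in> carrier_vec (v q). Psi x q u = 0}" for q
  have lin: "Psi x q (u + u') = Psi x q u + Psi x q u'" "Psi x q (z \<cdot>\<^sub>v u) = scale_fam z (Psi x q u)"
    if "u \<in> carrier_vec (v q)" "u' \<in> carrier_vec (v q)" for q u u' z
    using linear_form_Psi[OF x, of q] that unfolding linear_form_def by (auto simp: fun_eq_iff)
  have sub: "vec_subspace (v q) (U q)" for q
  proof -
    have "Psi x q (0\<^sub>v (v q)) = 0"
      using Psi_eq_comb[OF x, of "0\<^sub>v (v q)" q] by (simp add: comb_def fun_eq_iff)
    then show ?thesis
      unfolding vec_subspace_def U_def by (auto simp: lin)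
  qed
  have op: "op_mat x a m *\<^sub>v u \<in> U (arrow_src a, m + arrow_deg a)"
    if "is_arrow a" "u \<in> U (arrow_tgt a, m)" for a m u
    using shift_Psi[OF that(1), of x m u] that(2) op_mat_mult_carrier[OF x that(1), of u m]
    by (simp add: U_def shift_def zero_fun_def if_distrib cong: if_cong)
  have "U q = {0\<^sub>v (v q)}" for q
  proof -
    have "\<forall>q. U q = {0\<^sub>v (v q)}"
    proof (rule mp[OF spec[OF conjunct2[OF st[unfolded stable_def mem_Collect_eq]]]], intro conjI allI impI ballI)
      show "al x i j k *\<^sub>v u \<in> U (i, k + b i j)" if "c i j < 0" "u \<in> U (j, k)" for i j k u
        using op[of "Alpha j i" u k] that c_neg_sym[of i j] b_sym[of i j] by simp
      show "ep x i k *\<^sub>v u \<in> U (i, k + 2 * d i)" if "u \<in> U (i, k)" for i k u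
        using op[of "Eps i" u k] that by simp
      show "ar x i k u = 0" if "u \<in> U (i, k)" for i k u
        using ar_expand[OF x, of u i k] that by (simp add: U_def)
    qed (rule sub)
    then show ?thesis by blast
  qed
  then show "x \<in> tuples v \<and> ?R" using x unfolding U_def by blast
next
  assume R: "x \<in> tuples v \<and> ?R"
  then have x: "x \<in> tuples v" by simp
  show "x \<in> stable v"
    unfolding stable_def
  proof (intro CollectI conjI x allI impI, elim conjE)
    fix U q assume sub: "\<forall>q. vec_subspace (v q) (U q)"
      and al: "\<forall>i j k. c i j < 0 \<longrightarrow> (\<forall>u\<in>U (j, k). al x i j k *\<^sub>v u \<in> U (i, k + b i j))"
      and ep: "\<forall>i k. \<forall>u\<in>U (i, k). ep x i k *\<^sub>v u \<in> U (i, k + 2 * d i)"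
      and ar: "\<forall>i k. \<forall>u\<in>U (i, k). ar x i k u = 0"
    have op: "op_mat x a m *\<^sub>v u \<in> U (arrow_src a, m + arrow_deg a)"
      if "is_arrow a" "u \<in> U (arrow_tgt a, m)" for a m u
      using al ep that c_neg_sym b_sym by (cases a) (auto, metis)
    have mv: "move x m w u \<in> U (i, m + path_deg (i, w))" if "is_path (i, w)" "u \<in> U (path_tgt (i, w), m)" for i m w u
      using that
    proof (induction w arbitrary: m u)
      case (Cons a w)
      then show ?case using Cons.IH[of "op_mat x a m *\<^sub>v u" "m + arrow_deg a"] op[of a u m]
        by (simp add: add.assoc)
    qed simp
    have "u = 0\<^sub>v (v q)" if u: "u \<in> U q" for u
    proof -
      have "Psi x q u r p = 0" for r p
      proof (cases "r \<in> {1..s} \<and> is_path p \<and> fst p = ii r \<and> path_tgt p = fst q \<and> snd q + path_deg p = dg r")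
        case True
        then have "move x (snd q) (snd p) u \<in> U (ii r, dg r)"
          using mv[of "ii r" "snd p" u "snd q"] u by (cases p; cases q) auto
        then have "frame_form x r (move x (snd q) (snd p) u) = 0" using ar by (simp add: frame_form_def ph_0)
        then show ?thesis by (simp add: Psi_def coeff_def)
      qed (auto simp: Psi_def coeff_def)
      then have "Psi x q u = 0" by (simp add: fun_eq_iff)
      moreover have "u \<in> carrier_vec (v q)" using sub u unfolding vec_subspace_def by blast
      ultimately show ?thesis using R by blast
    qed
    moreover have "0\<^sub>v (v q) \<in> U q" using sub unfolding vec_subspace_def by blast
    ultimately show "U q = {0\<^sub>v (v q)}" by blast
  qed
qed

lemma stable_tuples: "x \<in> stable v \<Longrightarrow> x \<in> tuples v"
  by (simp add: stable_def)

lemma comb_diff: "u \<in> carrier_vec (v q) \<Longrightarrow> u' \<in> carrier_vec (v q) \<Longrightarrow> comb F q (u - u') = comb F q u - comb F q u'"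
  by (auto simp: comb_def fun_eq_iff algebra_simps sum_subtractf)

definition independent_frame :: "('i \<times> int \<Rightarrow> nat \<Rightarrow> nat \<Rightarrow> 'i path \<Rightarrow> complex) \<Rightarrow> bool" where
  "independent_frame F \<longleftrightarrow> (\<forall>q. \<forall>u\<in>carrier_vec (v q). comb F q u = 0 \<longrightarrow> u = 0\<^sub>v (v q))"

lemma independent_frame_iff:
  "independent_frame F \<longleftrightarrow> (\<forall>q. inj_on (F q) {..<v q} \<and> fam.independent (F q ` {..<v q}))"
  unfolding independent_frame_def fam.independent_image_lessThan
proof (intro iff_allI, intro iffI ballI impI allI)
  fix q f k assume *: "\<forall>u\<in>carrier_vec (v q). comb F q u = 0 \<longrightarrow> u = 0\<^sub>v (v q)"
    "(\<Sum>k<v q. scale_fam (f k) (F q k)) = 0" "k < v q"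
  have "comb F q (vec (v q) f) = 0" unfolding *(2)[symmetric] comb_eq_sum by (intro sum.cong) auto
  then have "vec (v q) f = 0\<^sub>v (v q)" using *(1) by auto
  then show "f k = 0" using *(3) by (metis index_vec index_zero_vec(1))
next
  fix q u assume *: "\<forall>f. (\<Sum>k<v q. scale_fam (f k) (F q k)) = 0 \<longrightarrow> (\<forall>k<v q. f k = 0)"
    "u \<in> carrier_vec (v q)" "comb F q u = 0"
  then show "u = 0\<^sub>v (v q)"
    using spec[OF *(1), of "\<lambda>k. u $ k"] by (intro eq_vecI) (auto simp: comb_eq_sum)
qed

lemma comb_inject:
  assumes "independent_frame F" "u \<in> carrier_vec (v q)" "u' \<in> carrier_vec (v q)" "comb F q u = comb F q u'"
  shows "u = u'"
proof -
  have "u - u' = 0\<^sub>v (v q)"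
  proof -
    have "comb F q (u - u') = 0" using assms(4) comb_diff[OF assms(2,3), of F] by simp
    moreover have "u - u' \<in> carrier_vec (v q)" using assms(2,3) by simp
    ultimately show ?thesis using assms(1) unfolding independent_frame_def by blast
  qed
  then have "(u - u') $ n = 0" if "n < v q" for n using that by simp
  then show ?thesis using assms(2,3) by (intro eq_vecI) auto
qed

lemma span_frame: "fam.span (F q ` {..<v q}) = comb F q ` carrier_vec (v q)"
  unfolding fam.span_image_lessThan
proof (intro subset_antisym subsetI)
  fix y assume "y \<in> range (\<lambda>u. \<Sum>k<v q. scale_fam (u k) (F q k))"
  then obtain u where "y = (\<Sum>k<v q. scale_fam (u k) (F q k))" by auto
  then have "y = comb F q (vec (v q) u)" unfolding comb_eq_sum by (auto intro!: sum.cong)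
  then show "y \<in> comb F q ` carrier_vec (v q)" by auto
qed (auto simp: comb_eq_sum)

lemma independent_psi:
  assumes "x \<in> stable v"
  shows "independent_frame (psi x)"
  using assms Psi_eq_comb[OF stable_tuples[OF assms]] unfolding stable_iff independent_frame_def by metis

text \<open>The operators of a stable tuple are recovered from \<open>Psi\<close>, which is injective and equivariant.\<close>

lemma tuple_eqI:
  assumes x: "x \<in> stable v" and y: "y \<in> tuples v" and eq: "psi x = psi y"
  shows "x = y"
proof -
  have xt: "x \<in> tuples v" using x by (rule stable_tuples)
  have Psi: "Psi x q u = Psi y q u" if "u \<in> carrier_vec (v q)" for q u
    using Psi_eq_comb[OF xt that] Psi_eq_comb[OF y that] eq by simp
  have op: "op_mat x a m = op_mat y a m" if a: "is_arrow a" for a m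
  proof (rule eq_matI)
    note cx = op_mat_carrier[OF xt a, of m] and cy = op_mat_carrier[OF y a, of m]
    show "dim_row (op_mat x a m) = dim_row (op_mat y a m)" "dim_col (op_mat x a m) = dim_col (op_mat y a m)"
      using cx cy by auto
    fix r n assume "r < dim_row (op_mat y a m)" "n < dim_col (op_mat y a m)"
    then have rn: "r < v (arrow_src a, m + arrow_deg a)" "n < v (arrow_tgt a, m)" using cy by auto
    let ?u = "unit_vec (v (arrow_tgt a, m)) n :: complex vec"
    have u: "?u \<in> carrier_vec (v (arrow_tgt a, m))" by simp
    have "Psi x (arrow_src a, m + arrow_deg a) (op_mat x a m *\<^sub>v ?u)
        = Psi x (arrow_src a, m + arrow_deg a) (op_mat y a m *\<^sub>v ?u)"
      using shift_Psi[OF a, of x m ?u] shift_Psi[OF a, of y m ?u] Psi[OF u]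
        Psi[OF op_mat_mult_carrier[OF y a u]] by simp
    then have "op_mat x a m *\<^sub>v ?u = op_mat y a m *\<^sub>v ?u"
      unfolding Psi_eq_comb[OF xt op_mat_mult_carrier[OF xt a u]] Psi_eq_comb[OF xt op_mat_mult_carrier[OF y a u]]
      by (rule comb_inject[OF independent_psi[OF x] op_mat_mult_carrier[OF xt a u] op_mat_mult_carrier[OF y a u]])
    then show "op_mat x a m $$ (r, n) = op_mat y a m $$ (r, n)"
      using mult_mat_unit_vec_index[OF cx rn] mult_mat_unit_vec_index[OF cy rn] by simp
  qed
  have "al x i j k = al y i j k" for i j k
    using op[of "Alpha j i" k] xt y c_neg_sym[of i j] unfolding tuples_def by (cases "c i j < 0") auto
  moreover have "ep x i k = ep y i k" for i k using op[of "Eps i" k] by simp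
  moreover have "ar x i k u = ar y i k u" for i k u
  proof (cases "u \<in> carrier_vec (v (i, k))")
    case True
    then show ?thesis using ar_expand[OF xt True] ar_expand[OF y True] Psi[OF True] by simp
  next
    case False
    then show ?thesis using xt y unfolding tuples_def by auto
  qed
  ultimately show ?thesis by (intro tuple.equality ext) auto
qed

section \<open>From critical tuples to graded submodules\<close>

abbreviation Frames :: "('i \<times> int \<Rightarrow> nat \<Rightarrow> nat \<Rightarrow> 'i path \<Rightarrow> complex) set" where
  "Frames \<equiv> Gr_frames s ii dg v"

abbreviation frame_span :: "('i \<times> int \<Rightarrow> nat \<Rightarrow> nat \<Rightarrow> 'i path \<Rightarrow> complex) \<Rightarrow> (nat \<Rightarrow> 'i path \<Rightarrow> complex) set" where
  "frame_span F \<equiv> fam.span (\<Union>q. F q ` {..<v q})"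

text \<open>The name anticipates \<open>critical_locus\<close>, which identifies the critical points
  with the orbits in this set.\<close>

definition crit_locus :: "('i, 'w) tuple set" where
  "crit_locus = {x \<in> stable v. relations v x}"

lemma crit_locus_stable: "x \<in> crit_locus \<Longrightarrow> x \<in> stable v"
  and crit_locus_tuples: "x \<in> crit_locus \<Longrightarrow> x \<in> tuples v"
  and crit_locus_relations: "x \<in> crit_locus \<Longrightarrow> relations v x"
  by (auto simp: crit_locus_def stable_tuples)

lemma Psi_trunc_dual:
  assumes x: "x \<in> crit_locus" and u: "u \<in> carrier_vec (v q)"
    and N: "\<And>i n. v (i, n) = 0 \<or> v (i, n - 2 * lacing * int N) = 0" and r: "r \<in> {1..s}"
  shows "Psi x q u r \<in> trunc_dual N (ii r)"
  using coeff_trunc_dual[OF crit_locus_tuples[OF x] crit_locus_relations[OF x]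
      linear_form_frame_form[OF crit_locus_tuples[OF x], of r], of u "fst q" "snd q" N] u N r
  by (simp add: Psi_def)

lemma Psi_sum_comp:
  assumes x: "x \<in> crit_locus" and u: "u \<in> carrier_vec (v q)"
  shows "Psi x q u \<in> sum_comp s ii dg q"
proof -
  obtain N where N: "N > 0" "\<And>i n. v (i, n) = 0 \<or> v (i, n - 2 * lacing * int N) = 0"
    using omega_bound[OF finite_v] by blast
  have I: "Psi x q u r \<in> I_mod (ii r)" if "r \<in> {1..s}" for r
    using Psi_trunc_dual[OF x u N(2) that] N(1) unfolding I_mod_def by blast
  have "Psi x q u r \<in> I_comp (ii r) (dg r) q" if "r \<in> {1..s}" for r
    using I[OF that] that unfolding I_comp_def by (cases q) (auto simp: Psi_def coeff_def split: if_splits)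
  moreover have "Psi x q u r = 0" if "r \<notin> {1..s}" for r using that by (auto simp: Psi_def fun_eq_iff)
  ultimately show ?thesis using I unfolding sum_comp_def sum_mod_def by blast
qed

lemma span_psi:
  assumes x: "x \<in> tuples v"
  shows "fam.span (psi x q ` {..<v q}) = Psi x q ` carrier_vec (v q)"
  unfolding span_frame using Psi_eq_comb[OF x] by (intro image_cong) auto

lemma frame_span_alt: "frame_span F = fam.span (\<Union>q. fam.span (F q ` {..<v q}))"
proof (rule subset_antisym)
  show "frame_span F \<subseteq> fam.span (\<Union>q. fam.span (F q ` {..<v q}))"
    by (intro fam.span_mono) (auto intro: fam.span_base)
  have "fam.span (F q ` {..<v q}) \<subseteq> frame_span F" for q by (intro fam.span_mono) auto
  then show "fam.span (\<Union>q. fam.span (F q ` {..<v q})) \<subseteq> frame_span F"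
    by (intro fam.span_minimal) auto
qed

lemma frame_span_psi_Int:
  assumes x: "x \<in> crit_locus"
  shows "frame_span (psi x) \<inter> sum_comp s ii dg q = fam.span (psi x q ` {..<v q})"
  unfolding frame_span_alt
proof (rule span_graded_Int)
  fix q
  show "fam.subspace (fam.span (psi x q ` {..<v q}))" by (rule fam.subspace_span)
  show "fam.span (psi x q ` {..<v q}) \<subseteq> sum_comp s ii dg q"
    unfolding span_psi[OF crit_locus_tuples[OF x]] using Psi_sum_comp[OF x] by blast
qed

text \<open>A path acts on the image of \<open>Psi\<close> by moving the vector along the reversed
  word. This is why the image is stable under the whole algebra and not only under arrows.\<close>

lemma I_act_path_Psi:
  assumes y: "is_path y"
  shows "(\<lambda>r. (\<lambda>p. if path_tgt y = path_tgt p \<and> is_path p then Psi x q u r (fst p, snd (path_op y) @ snd p) else 0))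
    = (if fst y = fst q then Psi x (path_tgt y, snd q + path_deg y) (move x (snd q) (snd (path_op y)) u) else 0)"
proof (rule ext)+
  fix r and p :: "'i path"
  obtain k w where p: "p = (k, w)" by (cases p)
  define z where "z = snd (path_op y)"
  have yo: "path_op y = (path_tgt y, z)" by (simp add: path_op_def z_def)
  have z: "is_path (path_tgt y, z)" "path_tgt (path_tgt y, z) = fst y" "path_deg (path_tgt y, z) = path_deg y"
    using path_op_path[OF y] yo by auto
  have dz: "path_deg (k, z) = path_deg y" using z(3) path_deg_src by metis
  show "(if path_tgt y = path_tgt p \<and> is_path p then Psi x q u r (fst p, snd (path_op y) @ snd p) else 0)
    = (if fst y = fst q then Psi x (path_tgt y, snd q + path_deg y) (move x (snd q) (snd (path_op y)) u) else 0) r p"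
    unfolding z_def[symmetric] Psi_def p using z dz
    by (cases "r \<in> {1..s}"; cases "path_tgt y = path_tgt (k, w)"; cases "is_path (k, w)"; cases "fst y = fst q")
      (auto simp: coeff_def is_path_append path_tgt_append add.assoc move_append[of x "snd q" z w u "path_tgt (k, w)"]
        simp del: atLeastAtMost_iff)
qed

lemma frame_span_psi_I_act:
  assumes x: "x \<in> tuples v" and y: "y \<in> path_algebra" and f: "f \<in> frame_span (psi x)"
  shows "(\<lambda>r. I_act y (f r)) \<in> frame_span (psi x)"
proof -
  let ?N = "frame_span (psi x)"
  have eq: "(\<lambda>r. I_act y (f r)) = (\<Sum>p\<in>support y. scale_fam (y p)
      (\<lambda>r. (\<lambda>q. if path_tgt p = path_tgt q \<and> is_path q then f r (fst q, snd (path_op p) @ snd q) else 0)))" for f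
    unfolding I_act_eq[OF y] by (auto simp: fun_eq_iff sum_fun_apply intro!: sum.cong)
  have Psi_N: "Psi x q u \<in> ?N" if "u \<in> carrier_vec (v q)" for q u
  proof -
    have "Psi x q u \<in> fam.span (psi x q ` {..<v q})" using that span_psi[OF x, of q] by blast
    then show ?thesis using fam.span_mono[of "psi x q ` {..<v q}" "\<Union>q. psi x q ` {..<v q}"] by blast
  qed
  from f show ?thesis
  proof (induction rule: fam.span_induct)
    case base
    show ?case
    proof (rule fam.subspaceI)
      have "I_act y 0 p = 0" for p unfolding I_act_eq[OF y] by (auto intro!: sum.neutral)
      then have "(\<lambda>r. I_act y ((0::nat \<Rightarrow> 'i path \<Rightarrow> complex) r)) = 0" by (simp add: fun_eq_iff)
      then show "0 \<in> {a. (\<lambda>r. I_act y (a r)) \<in> ?N}" using fam.span_zero by (simp only: mem_Collect_eq)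
    next
      fix f g assume "f \<in> {a. (\<lambda>r. I_act y (a r)) \<in> ?N}" "g \<in> {a. (\<lambda>r. I_act y (a r)) \<in> ?N}"
      then have "(\<lambda>r. I_act y (f r)) + (\<lambda>r. I_act y (g r)) \<in> ?N" using fam.span_add by blast
      also have "(\<lambda>r. I_act y (f r)) + (\<lambda>r. I_act y (g r)) = (\<lambda>r. I_act y ((f + g) r))"
        by (auto simp: fun_eq_iff I_act_eq[OF y] sum.distrib[symmetric] algebra_simps intro!: sum.cong)
      finally show "f + g \<in> {a. (\<lambda>r. I_act y (a r)) \<in> ?N}" by (simp only: mem_Collect_eq)
    next
      fix z f assume "f \<in> {a. (\<lambda>r. I_act y (a r)) \<in> ?N}"
      then have "scale_fam z (\<lambda>r. I_act y (f r)) \<in> ?N" using fam.span_scale by blast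
      also have "scale_fam z (\<lambda>r. I_act y (f r)) = (\<lambda>r. I_act y (scale_fam z f r))"
        by (auto simp: fun_eq_iff I_act_eq[OF y] sum_distrib_left intro!: sum.cong)
      finally show "scale_fam z f \<in> {a. (\<lambda>r. I_act y (a r)) \<in> ?N}" by (simp only: mem_Collect_eq)
    qed
  next
    case (step f)
    then obtain q n where n: "n < v q" "f = psi x q n" by blast
    then have f: "f = Psi x q (unit_vec (v q) n)" by (simp add: psi_def)
    show ?case unfolding eq
    proof (intro fam.span_sum fam.span_scale)
      fix p assume "p \<in> support y"
      then have p: "is_path p" using path_algebra_expand(2)[OF y] by simp
      show "(\<lambda>r. (\<lambda>q. if path_tgt p = path_tgt q \<and> is_path q then f r (fst q, snd (path_op p) @ snd q) else 0)) \<in> ?N"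
        unfolding f I_act_path_Psi[OF p]
      proof (cases "fst p = fst q")
        case True
        have "path_op p = (path_tgt p, snd (path_op p))" by (simp add: path_op_def)
        then have "is_path (path_tgt p, snd (path_op p))" "path_tgt (path_tgt p, snd (path_op p)) = fst q"
          "path_deg (path_tgt p, snd (path_op p)) = path_deg p" using path_op_path[OF p] True by metis+
        then have "move x (snd q) (snd (path_op p)) (unit_vec (v q) n) \<in> carrier_vec (v (path_tgt p, snd q + path_deg p))"
          using move_carrier[OF x, of "path_tgt p" "snd (path_op p)" "unit_vec (v q) n" "snd q"] by simp
        then show "(if fst p = fst q then Psi x (path_tgt p, snd q + path_deg p)
            (move x (snd q) (snd (path_op p)) (unit_vec (v q) n)) else 0) \<in> ?N"
          using True Psi_N by simp
      qed (simp add: fam.span_zero)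
    qed
  qed
qed

text \<open>\<open>sum_mod\<close> is a union over truncations. Fixing one truncation gives an
  honest subspace, in which the span of a frame with a common bound \<open>N\<close> can be
  confined.\<close>

lemma sum_mod_subspace: "fam.subspace {u. (\<forall>r\<in>{1..s}. u r \<in> trunc_dual N (ii r)) \<and> (\<forall>r. r \<notin> {1..s} \<longrightarrow> u r = 0)}"
proof (rule fam.subspaceI, goal_cases)
  case 1
  then show ?case by (auto simp: trunc_dual_def)
next
  case (2 x y)
  have "x r + y r \<in> trunc_dual N i" if "x r \<in> trunc_dual N i" "y r \<in> trunc_dual N i" for r i
  proof -
    have "{p. (x r + y r) p \<noteq> 0} \<subseteq> {p. x r p \<noteq> 0} \<union> {p. y r p \<noteq> 0}" by auto
    then have "path_deg ` {p. (x r + y r) p \<noteq> 0} \<subseteq> path_deg ` {p. x r p \<noteq> 0} \<union> path_deg ` {p. y r p \<noteq> 0}" by blast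
    then have "finite (path_deg ` {p. (x r + y r) p \<noteq> 0})"
      using that unfolding trunc_dual_def by (auto intro: finite_subset)
    moreover have "is_path p \<and> fst p = i" if "(x r + y r) p \<noteq> 0" for p
    proof -
      have "x r p \<noteq> 0 \<or> y r p \<noteq> 0" using that by auto
      then show ?thesis using \<open>x r \<in> _\<close> \<open>y r \<in> _\<close> trunc_dual_support by blast
    qed
    moreover have "pairing (x r + y r) z = pairing (x r) z + pairing (y r) z" for z
      unfolding plus_fun_def by (rule pairing_linear_left)
    ultimately show ?thesis using that unfolding trunc_dual_def by auto
  qed
  then show ?case using 2 by auto
next
  case (3 k x)
  have "(\<lambda>p. k * x r p) \<in> trunc_dual N i" if "x r \<in> trunc_dual N i" for r i
  proof -
    have "path_deg ` {p. k * x r p \<noteq> 0} \<subseteq> path_deg ` {p. x r p \<noteq> 0}" by auto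
    then have "finite (path_deg ` {p. k * x r p \<noteq> 0})"
      using that unfolding trunc_dual_def by (auto intro: finite_subset)
    then show ?thesis using that unfolding trunc_dual_def by (auto simp: pairing_linear_left)
  qed
  then show ?case using 3 by (auto simp: scale_fam_def fun_eq_iff)
qed

lemma frame_span_psi_sum_mod:
  assumes x: "x \<in> crit_locus"
  shows "frame_span (psi x) \<subseteq> sum_mod s ii"
proof -
  obtain N where N: "N > 0" "\<And>i n. v (i, n) = 0 \<or> v (i, n - 2 * lacing * int N) = 0"
    using omega_bound[OF finite_v] by blast
  have "frame_span (psi x) \<subseteq> {u. (\<forall>r\<in>{1..s}. u r \<in> trunc_dual N (ii r)) \<and> (\<forall>r. r \<notin> {1..s} \<longrightarrow> u r = 0)}"
  proof (rule fam.span_minimal[OF _ sum_mod_subspace], rule subsetI)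
    fix f assume "f \<in> (\<Union>q. psi x q ` {..<v q})"
    then obtain q n where n: "n < v q" "f = psi x q n" by blast
    then have f: "f = Psi x q (unit_vec (v q) n)" by (simp add: psi_def)
    have u: "unit_vec (v q) n \<in> carrier_vec (v q)" by simp
    show "f \<in> {u. (\<forall>r\<in>{1..s}. u r \<in> trunc_dual N (ii r)) \<and> (\<forall>r. r \<notin> {1..s} \<longrightarrow> u r = 0)}"
      using Psi_trunc_dual[OF x u N(2)] Psi_sum_comp[OF x u] unfolding f sum_comp_def sum_mod_def by blast
  qed
  then show ?thesis using N(1) unfolding sum_mod_def I_mod_def by blast
qed

lemma frame_span_psi_Gr:
  assumes x: "x \<in> crit_locus"
  shows "frame_span (psi x) \<in> Gr s ii dg v"
proof -
  let ?N = "frame_span (psi x)"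
  have int: "?N \<inter> sum_comp s ii dg q = fam.span (psi x q ` {..<v q})" for q by (rule frame_span_psi_Int[OF x])
  have ind: "inj_on (psi x q) {..<v q}" "fam.independent (psi x q ` {..<v q})" for q
    using independent_psi[OF crit_locus_stable[OF x]] unfolding independent_frame_iff by blast+
  have "has_dim scale_fam (?N \<inter> sum_comp s ii dg q) (v q)" for q
    unfolding int has_dim_def using ind[of q]
    by (intro exI[of _ "psi x q ` {..<v q}"]) (auto simp: card_image)
  moreover have "?N = fam.span (\<Union>q. ?N \<inter> sum_comp s ii dg q)"
    unfolding int by (rule frame_span_alt)
  ultimately show ?thesis
    unfolding Gr_def graded_submodule_def
    using frame_span_psi_sum_mod[OF x] frame_span_psi_I_act[OF crit_locus_tuples[OF x]] fam.subspace_span by auto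
qed

lemma psi_Frames:
  assumes x: "x \<in> crit_locus"
  shows "psi x \<in> Frames"
  unfolding Gr_frames_def
proof (intro CollectI bexI[OF _ frame_span_psi_Gr[OF x]] allI)
  fix q
  show "inj_on (psi x q) {..<v q} \<and> fam.independent (psi x q ` {..<v q}) \<and>
     fam.span (psi x q ` {..<v q}) = frame_span (psi x) \<inter> sum_comp s ii dg q \<and> (\<forall>n\<ge>v q. psi x q n = 0)"
    using independent_psi[OF crit_locus_stable[OF x]] frame_span_psi_Int[OF x, of q]
    unfolding independent_frame_iff by (intro conjI allI impI) (blast | simp add: psi_def)+
qed

lemma FramesE:
  assumes "F \<in> Frames"
  shows "independent_frame F" "frame_span F \<in> Gr s ii dg v"
    "\<And>q. fam.span (F q ` {..<v q}) = frame_span F \<inter> sum_comp s ii dg q" "\<And>q n. n \<ge> v q \<Longrightarrow> F q n = 0"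
proof -
  obtain N where N: "N \<in> Gr s ii dg v" and F: "\<And>q. inj_on (F q) {..<v q} \<and> fam.independent (F q ` {..<v q}) \<and>
     fam.span (F q ` {..<v q}) = N \<inter> sum_comp s ii dg q \<and> (\<forall>n\<ge>v q. F q n = 0)"
    using assms unfolding Gr_frames_def by blast
  have "frame_span F = fam.span (\<Union>q. N \<inter> sum_comp s ii dg q)"
    unfolding frame_span_alt using F by simp
  also have "\<dots> = N" using N unfolding Gr_def graded_submodule_def by blast
  finally have eq: "frame_span F = N" .
  show "independent_frame F" "frame_span F \<in> Gr s ii dg v"
    "\<And>q. fam.span (F q ` {..<v q}) = frame_span F \<inter> sum_comp s ii dg q" "\<And>q n. n \<ge> v q \<Longrightarrow> F q n = 0"
    unfolding independent_frame_iff eq using F N by blast+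
qed

section \<open>From frames back to tuples\<close>

lemma comb_in_comp:
  assumes "F \<in> Frames" "u \<in> carrier_vec (v q)"
  shows "comb F q u \<in> frame_span F \<inter> sum_comp s ii dg q"
  using FramesE(3)[OF assms(1), of q] assms(2) unfolding span_frame by blast

lemma shift_comp:
  assumes F: "F \<in> Frames" and a: "is_arrow a" and f: "f \<in> frame_span F \<inter> sum_comp s ii dg (arrow_tgt a, m)"
  shows "shift a f \<in> frame_span F \<inter> sum_comp s ii dg (arrow_src a, m + arrow_deg a)"
proof -
  have N: "\<And>x u. x \<in> path_algebra \<Longrightarrow> u \<in> frame_span F \<Longrightarrow> (\<lambda>r. I_act x (u r)) \<in> frame_span F"
    "frame_span F \<subseteq> sum_mod s ii"
    using FramesE(2)[OF F] unfolding Gr_def graded_submodule_def by auto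
  have "is_path (arrow_tgt a, [arrow_op a])" using a by simp
  then have 1: "shift a f \<in> frame_span F"
    using N(1)[OF path_algebra_single, of "(arrow_tgt a, [arrow_op a])" f] f I_act_arrow[OF a, of f] by simp
  then have sm: "shift a f \<in> sum_mod s ii" using N(2) by blast
  have "path_tgt p = arrow_src a \<and> - path_deg p = (m + arrow_deg a) - dg r" if "shift a f r p \<noteq> 0" for r p
  proof -
    obtain k w where p: "p = (k, w)" by (cases p)
    then have nz: "f r (k, a # w) \<noteq> 0" "is_path (k, a # w)" using that by (auto simp: shift_def split: if_splits)
    then have "- path_deg (k, a # w) = m - dg r"
      using sum_comp_support(5)[of f s ii dg "(arrow_tgt a, m)" r "(k, a # w)"] f by simp
    then show ?thesis using nz(2) p by auto
  qed
  then have "shift a f \<in> sum_comp s ii dg (arrow_src a, m + arrow_deg a)"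
    using sm unfolding sum_comp_def I_comp_def sum_mod_def by auto
  with 1 show ?thesis by blast
qed

definition coords_in :: "('i \<times> int \<Rightarrow> nat \<Rightarrow> nat \<Rightarrow> 'i path \<Rightarrow> complex) \<Rightarrow> 'i \<times> int
    \<Rightarrow> (nat \<Rightarrow> 'i path \<Rightarrow> complex) \<Rightarrow> complex vec" where
  "coords_in F q f = (SOME u. u \<in> carrier_vec (v q) \<and> comb F q u = f)"

lemma coords_in:
  assumes "f \<in> fam.span (F q ` {..<v q})"
  shows "coords_in F q f \<in> carrier_vec (v q)" "comb F q (coords_in F q f) = f"
proof -
  have "\<exists>u. u \<in> carrier_vec (v q) \<and> comb F q u = f" using assms unfolding span_frame by blast
  from someI_ex[OF this] show "coords_in F q f \<in> carrier_vec (v q)" "comb F q (coords_in F q f) = f"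
    unfolding coords_in_def by auto
qed

definition arrow_mat :: "('i \<times> int \<Rightarrow> nat \<Rightarrow> nat \<Rightarrow> 'i path \<Rightarrow> complex) \<Rightarrow> 'i arrow \<Rightarrow> int \<Rightarrow> complex mat" where
  "arrow_mat F a m = mat (v (arrow_src a, m + arrow_deg a)) (v (arrow_tgt a, m))
     (\<lambda>(r, n). coords_in F (arrow_src a, m + arrow_deg a) (shift a (F (arrow_tgt a, m) n)) $ r)"

definition theta :: "('i \<times> int \<Rightarrow> nat \<Rightarrow> nat \<Rightarrow> 'i path \<Rightarrow> complex) \<Rightarrow> ('i, 'w) tuple" where
  "theta F = \<lparr>
     al = (\<lambda>i j k. if c i j < 0 then arrow_mat F (Alpha j i) k else 0\<^sub>m 0 0),
     ar = (\<lambda>i k u. if u \<in> carrier_vec (v (i, k)) then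
        (\<Sum>r\<in>{r\<in>{1..s}. (ii r, kk r) = (i, k - d i)}. sc (comb F (i, k) u r (i, [])) (e r)) else 0),
     ep = (\<lambda>i k. arrow_mat F (Eps i) k)\<rparr>"

lemma op_mat_theta: "is_arrow a \<Longrightarrow> op_mat (theta F) a m = arrow_mat F a m"
  using c_neg_sym by (cases a) (auto simp: theta_def)

lemma theta_tuples: "theta F \<in> tuples v"
proof -
  have 1: "ar (theta F) i k u \<in> W (i, k - d i)" if "u \<in> carrier_vec (v (i, k))" for i k u
  proof -
    have "sc z (e r) \<in> W (i, k - d i)" if "r \<in> {r\<in>{1..s}. (ii r, kk r) = (i, k - d i)}" for r z
      using e_in[of r] that by (intro framing.subspace_scale[OF framing_subspace]) auto
    then have "(\<Sum>r\<in>{r\<in>{1..s}. (ii r, kk r) = (i, k - d i)}. sc (comb F (i, k) u r (i, [])) (e r)) \<in> W (i, k - d i)"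
      by (intro framing.subspace_sum[OF framing_subspace])
    then show ?thesis using that by (simp add: theta_def)
  qed
  have 2: "comb F q (u + u') = comb F q u + comb F q u'" "comb F q (z \<cdot>\<^sub>v u) = scale_fam z (comb F q u)"
    if "u \<in> carrier_vec (v q)" "u' \<in> carrier_vec (v q)" for q u u' z
    using that by (auto simp: comb_def fun_eq_iff algebra_simps sum.distrib sum_distrib_left)
  show ?thesis
    unfolding tuples_def
  proof (intro CollectI conjI allI ballI)
    show "ar (theta F) i k u \<in> W (i, k - d i)" if "u \<in> carrier_vec (v (i, k))" for i k u
      using 1[OF that] .
    show "ar (theta F) i k (u + u') = ar (theta F) i k u + ar (theta F) i k u'"
      if "u \<in> carrier_vec (v (i, k))" "u' \<in> carrier_vec (v (i, k))" for i k u u'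
      using that 2 by (simp add: theta_def framing.scale_left_distrib sum.distrib)
    show "ar (theta F) i k (z \<cdot>\<^sub>v u) = sc z (ar (theta F) i k u)"
      if "u \<in> carrier_vec (v (i, k))" for i k u z
      using that 2[of u "(i, k)"] by (simp add: theta_def framing.scale_sum_right)
  qed (auto simp: theta_def arrow_mat_def b_sym)
qed

lemma shift_comb:
  assumes F: "F \<in> Frames" and a: "is_arrow a" and u: "u \<in> carrier_vec (v (arrow_tgt a, m))"
  shows "comb F (arrow_src a, m + arrow_deg a) (op_mat (theta F) a m *\<^sub>v u) = shift a (comb F (arrow_tgt a, m) u)"
proof (rule ext)+
  fix r p
  let ?q = "(arrow_src a, m + arrow_deg a)" and ?q' = "(arrow_tgt a, m)"
  have A: "op_mat (theta F) a m \<in> carrier_mat (v ?q) (v ?q')" by (rule op_mat_carrier[OF theta_tuples a])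
  have col: "(\<Sum>k<v ?q. op_mat (theta F) a m $$ (k, n) * F ?q k r p) = shift a (F ?q' n) r p" if n: "n < v ?q'" for n
  proof -
    have "F ?q' n \<in> frame_span F \<inter> sum_comp s ii dg ?q'"
      using comb_in_comp[OF F, of "unit_vec (v ?q') n" ?q'] comb_unit_vec[OF n, of F] by simp
    then have "shift a (F ?q' n) \<in> fam.span (F ?q ` {..<v ?q})"
      unfolding FramesE(3)[OF F] by (rule shift_comp[OF F a])
    from coords_in(2)[where F = F and q = ?q, OF this] have "comb F ?q (coords_in F ?q (shift a (F ?q' n))) r p = shift a (F ?q' n) r p" by simp
    then show ?thesis using n unfolding comb_def op_mat_theta[OF a] arrow_mat_def by simp
  qed
  have "comb F ?q (op_mat (theta F) a m *\<^sub>v u) r p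
      = (\<Sum>k<v ?q. (\<Sum>n<v ?q'. op_mat (theta F) a m $$ (k, n) * u $ n) * F ?q k r p)"
    unfolding comb_def by (intro sum.cong refl) (simp only: lessThan_iff mult_mat_vec_index[OF A u])
  also have "\<dots> = (\<Sum>n<v ?q'. u $ n * (\<Sum>k<v ?q. op_mat (theta F) a m $$ (k, n) * F ?q k r p))"
    unfolding sum_distrib_right sum_distrib_left by (subst sum.swap) (simp add: mult_ac)
  also have "\<dots> = (\<Sum>n<v ?q'. u $ n * shift a (F ?q' n) r p)"
    by (intro sum.cong refl) (simp only: lessThan_iff col)
  also have "\<dots> = shift a (comb F ?q' u) r p"
    unfolding comb_def shift_sum ..
  finally show "comb F ?q (op_mat (theta F) a m *\<^sub>v u) r p = shift a (comb F ?q' u) r p" .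
qed

text \<open>The coordinate vector follows the transposed multiplication letter by letter, so letters
  of \<open>w\<close> that have acted reappear in front of the path \<open>p\<close> at which the
  form is evaluated.\<close>

lemma move_comb:
  assumes F: "F \<in> Frames" and w: "is_path (i, w)" and u: "u \<in> carrier_vec (v (path_tgt (i, w), m))"
    and p: "is_path p" "path_tgt p = i"
  shows "comb F (i, m + path_deg (i, w)) (move (theta F) m w u) r p
    = comb F (path_tgt (i, w), m) u r (fst p, w @ snd p)"
  using w u
proof (induction w arbitrary: m u)
  case Nil
  then show ?case by simp
next
  case (Cons a w)
  have a: "is_arrow a" "is_path (i, w)" "arrow_src a = path_tgt (i, w)" using Cons.prems by auto
  have u: "u \<in> carrier_vec (v (arrow_tgt a, m))" using Cons.prems by simp
  have c: "op_mat (theta F) a m *\<^sub>v u \<in> carrier_vec (v (path_tgt (i, w), m + arrow_deg a))"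
    using op_mat_mult_carrier[OF theta_tuples a(1) u] a(3) by simp
  have "comb F (i, m + path_deg (i, a # w)) (move (theta F) m (a # w) u) r p
      = comb F (path_tgt (i, w), m + arrow_deg a) (op_mat (theta F) a m *\<^sub>v u) r (fst p, w @ snd p)"
    using Cons.IH[OF a(2) c] by (simp add: add.assoc)
  also have "\<dots> = shift a (comb F (arrow_tgt a, m) u) r (fst p, w @ snd p)"
    using shift_comb[OF F a(1) u] a(3) by simp
  also have "\<dots> = comb F (arrow_tgt a, m) u r (fst p, a # w @ snd p)"
  proof -
    have "is_path (fst p, a # w @ snd p)"
      using a p by (cases p) (simp add: is_path_append path_tgt_append)
    then show ?thesis by (simp add: shift_def)
  qed
  finally show ?case by simp
qed

lemma ph_ar_theta:
  assumes "r \<in> {1..s}" "u \<in> carrier_vec (v (ii r, dg r))"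
  shows "ph r (ar (theta F) (ii r) (dg r) u) = comb F (ii r, dg r) u r (ii r, [])"
proof -
  let ?R = "{r' \<in> {1..s}. (ii r', kk r') = (ii r, dg r - d (ii r))}"
  have "ph r (ar (theta F) (ii r) (dg r) u) = (\<Sum>r'\<in>?R. comb F (ii r, dg r) u r' (ii r, []) * ph r (e r'))"
    using assms(2) by (simp add: theta_def ph_sum ph_scale)
  also have "\<dots> = (\<Sum>r'\<in>?R. if r' = r then comb F (ii r, dg r) u r (ii r, []) else 0)"
    by (intro sum.cong refl) (use assms(1) in \<open>auto simp: ph_e\<close>)
  also have "\<dots> = comb F (ii r, dg r) u r (ii r, [])" using assms(1) by simp
  finally show ?thesis .
qed

lemma Psi_theta:
  assumes F: "F \<in> Frames" and u: "u \<in> carrier_vec (v q)"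
  shows "Psi (theta F) q u = comb F q u"
proof (rule ext)+
  fix r and p :: "'i path"
  obtain k w where p: "p = (k, w)" by (cases p)
  obtain j m where q: "q = (j, m)" by (cases q)
  show "Psi (theta F) q u r p = comb F q u r p"
  proof (cases "r \<in> {1..s} \<and> is_path p \<and> fst p = ii r \<and> path_tgt p = j \<and> m + path_deg p = dg r")
    case True
    then have w: "is_path (ii r, w)" "path_tgt (ii r, w) = j" "m + path_deg (ii r, w) = dg r" using p by auto
    have u': "u \<in> carrier_vec (v (path_tgt (ii r, w), m))" using u w q by simp
    have "Psi (theta F) q u r p = ph r (ar (theta F) (ii r) (dg r) (move (theta F) m w u))"
      using True w p q by (simp add: Psi_def coeff_def frame_form_def del: atLeastAtMost_iff)
    also have "\<dots> = comb F (ii r, dg r) (move (theta F) m w u) r (ii r, [])"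
      using move_carrier[OF theta_tuples w(1) u'] w(3) True by (intro ph_ar_theta) auto
    also have "\<dots> = comb F q u r p"
      using move_comb[OF F w(1) u', of "(ii r, [])" r] w p q True by simp
    finally show ?thesis .
  next
    case False
    then have "Psi (theta F) q u r p = 0" using q by (auto simp: Psi_def coeff_def)
    moreover have "comb F q u r p = 0"
    proof (rule ccontr)
      assume nz: "comb F q u r p \<noteq> 0"
      have "comb F q u \<in> sum_comp s ii dg q" using comb_in_comp[OF F u] by blast
      note sup = sum_comp_support[OF this nz]
      have "m + path_deg p = dg r" using sup(5) q by simp
      then show False using sup False q by simp
    qed
    ultimately show ?thesis by simp
  qed
qed

lemma psi_theta:
  assumes F: "F \<in> Frames"
  shows "psi (theta F) = F"
proof (rule ext)+
  fix q n r p
  show "psi (theta F) q n r p = F q n r p"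
    using Psi_theta[OF F, of "unit_vec (v q) n" q] comb_unit_vec[of n q F] FramesE(4)[OF F, of q n]
    by (cases "n < v q") (auto simp: psi_def)
qed

lemma theta_stable:
  assumes F: "F \<in> Frames"
  shows "theta F \<in> stable v"
  unfolding stable_iff using theta_tuples FramesE(1)[OF F] Psi_theta[OF F] unfolding independent_frame_def by simp

lemma comb_sum:
  assumes "finite A" "\<And>z. z \<in> A \<Longrightarrow> U z \<in> carrier_vec (v q)"
  shows "comb F q (vec (v q) (\<lambda>n. \<Sum>z\<in>A. k z * U z $ n)) r p = (\<Sum>z\<in>A. k z * comb F q (U z) r p)"
  unfolding comb_def by (simp add: sum_distrib_left sum_distrib_right mult_ac) (subst sum.swap, simp add: mult_ac)

text \<open>Both combinations are homogeneous elements of degree \<open>q\<close>, hence vanish on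
  all paths other than those tested.\<close>

lemma comb_eqI:
  assumes F: "F \<in> Frames" and u: "u \<in> carrier_vec (v q)" "u' \<in> carrier_vec (v q)"
    and eq: "\<And>r p. r \<in> {1..s} \<Longrightarrow> is_path p \<Longrightarrow> fst p = ii r \<Longrightarrow> path_tgt p = fst q \<Longrightarrow> comb F q u r p = comb F q u' r p"
  shows "u = u'"
proof (rule comb_inject[OF FramesE(1)[OF F] u], (rule ext)+)
  fix r p
  show "comb F q u r p = comb F q u' r p"
  proof (rule ccontr)
    assume ne: "comb F q u r p \<noteq> comb F q u' r p"
    then have "comb F q u r p \<noteq> 0 \<or> comb F q u' r p \<noteq> 0" by auto
    then have "r \<in> {1..s}" "is_path p" "fst p = ii r" "path_tgt p = fst q"
      using sum_comp_support[of _ s ii dg q r p] comb_in_comp[OF F u(1)] comb_in_comp[OF F u(2)] by blast+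
    then show False using eq ne by blast
  qed
qed

text \<open>A relation applied to \<open>u\<close> and evaluated at a path \<open>p\<close> is the
  form of \<open>u\<close> evaluated on the relation times \<open>p\<close>. This product lies in
  the ideal, on which the elements of the dual modules vanish, and the evaluations determine the
  coordinate vector.\<close>

lemma theta_relations:
  assumes F: "F \<in> Frames"
  shows "relations v (theta F)"
proof -
  have td: "\<exists>l. comb F q u r \<in> trunc_dual l (ii r)" if "u \<in> carrier_vec (v q)" "r \<in> {1..s}" for q u r
  proof -
    have "comb F q u \<in> sum_mod s ii" using comb_in_comp[OF F that(1)] unfolding sum_comp_def by blast
    then show ?thesis using that(2) unfolding sum_mod_def I_mod_def by blast
  qed
  have comm: "move (theta F) m (replicate (nat (- c i j)) (Eps i) @ [Alpha i j]) u
      = move (theta F) m (Alpha i j # replicate (nat (- c j i)) (Eps j)) u"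
    if c: "c i j < 0" and u: "u \<in> carrier_vec (v (i, m))" for i j m u
  proof -
    define w w' where "w = replicate (nat (- c i j)) (Eps i) @ [Alpha i j]"
      and "w' = Alpha i j # replicate (nat (- c j i)) (Eps j)"
    have we: "word_eq j w w'" unfolding w_def w'_def by (rule word_eq_comm[OF c])
    have w: "is_path (j, w)" "path_tgt (j, w) = i" "is_path (j, w')" "path_tgt (j, w') = i"
      using we by (auto simp: word_eq_def w'_def)
    have "2 * d i * int (nat (- c i j)) = 2 * d j * int (nat (- c j i))"
      using b_sym[of i j] c c_neg_sym[of i j] by (simp add: b_def)
    then have dw: "path_deg (j, w) = path_deg (j, w')" by (simp add: w_def w'_def)
    have "move (theta F) m w u = move (theta F) m w' u"
    proof (rule comb_eqI[OF F, of _ "(j, m + path_deg (j, w))"])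
      show "move (theta F) m w u \<in> carrier_vec (v (j, m + path_deg (j, w)))"
        "move (theta F) m w' u \<in> carrier_vec (v (j, m + path_deg (j, w)))"
        using move_carrier[OF theta_tuples w(1), of u m] move_carrier[OF theta_tuples w(3), of u m] u w(2,4) dw by simp_all
      fix r p assume r: "r \<in> {1..s}" and p: "is_path p" "fst p = ii r" "path_tgt p = fst (j, m + path_deg (j, w))"
      have p': "is_path (ii r, snd p)" "path_tgt (ii r, snd p) = j" using p by (cases p; simp)+
      obtain l where l: "comb F (i, m) u r \<in> trunc_dual l (ii r)" using td[OF u r] by blast
      have "word_eq (ii r) ([] @ w @ snd p) ([] @ w' @ snd p)"
        by (rule word_eq_append[OF we _ p']) simp
      then have "comb F (i, m) u r (ii r, w @ snd p) = comb F (i, m) u r (ii r, w' @ snd p)"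
        using word_eq_trunc_dual[OF l] by simp
      then show "comb F (j, m + path_deg (j, w)) (move (theta F) m w u) r p
          = comb F (j, m + path_deg (j, w)) (move (theta F) m w' u) r p"
        using move_comb[OF F w(1), of u m p r] move_comb[OF F w(3), of u m p r] u w(2,4) p dw by simp
    qed
    then show ?thesis unfolding w_def w'_def .
  qed
  moreover have "(\<Sum>j | c i j < 0. \<Sum>k<nat (- c i j). osign i j * move (theta F) m (mesh_word i j k) u $ n) = 0"
    if u: "u \<in> carrier_vec (v (i, m))" and n: "n < v (i, m - 2 * d i)" for i m u n
  proof -
    let ?I = "SIGMA j:{j. c i j < 0}. {..<nat (- c i j)}"
    let ?q = "(i, m - 2 * d i)"
    define U where "U z = move (theta F) m (mesh_word i (fst z) (snd z)) u" for z
    have U: "U z \<in> carrier_vec (v ?q)" if "z \<in> ?I" for z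
    proof -
      have z: "c i (fst z) < 0" "snd z < nat (- c i (fst z))" using that by auto
      show ?thesis
        using move_carrier[OF theta_tuples is_path_mesh_word[OF z(1), of "snd z"], of u m] u path_deg_mesh_word[OF z]
        by (simp add: path_tgt_mesh_word U_def)
    qed
    let ?y = "vec (v ?q) (\<lambda>n. \<Sum>z\<in>?I. osign i (fst z) * U z $ n)"
    have "?y = 0\<^sub>v (v ?q)"
    proof (rule comb_eqI[OF F, of _ ?q])
      fix r p assume r: "r \<in> {1..s}" and p: "is_path p" "fst p = ii r" "path_tgt p = fst ?q"
      define f where "f = comb F (i, m) u r"
      obtain l where l: "f \<in> trunc_dual l (ii r)" using td[OF u r] f_def by blast
      have "comb F ?q ?y r p = (\<Sum>z\<in>?I. osign i (fst z) * comb F ?q (U z) r p)"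
        using U by (intro comb_sum) auto
      also have "\<dots> = (\<Sum>z\<in>?I. osign i (fst z) * right_translate p f (i, mesh_word i (fst z) (snd z)))"
      proof (intro sum.cong refl)
        fix z assume "z \<in> ?I"
        then have z: "c i (fst z) < 0" "snd z < nat (- c i (fst z))" by auto
        show "osign i (fst z) * comb F ?q (U z) r p = osign i (fst z) * right_translate p f (i, mesh_word i (fst z) (snd z))"
          using move_comb[OF F is_path_mesh_word[OF z(1), of "snd z"], of u m p r] u p path_deg_mesh_word[OF z]
          by (simp add: path_tgt_mesh_word U_def right_translate_def f_def)
      qed
      also have "\<dots> = (\<Sum>j | c i j < 0. \<Sum>k<nat (- c i j). osign i j * right_translate p f (i, mesh_word i j k))"
        by (subst sum.Sigma) (auto simp: case_prod_unfold)
      also have "\<dots> = pairing (right_translate p f) (rel_mesh i)" by (simp add: pairing_rel_mesh)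
      also have "\<dots> = pairing f (pa_mult (rel_mesh i) (single p))"
      proof -
        have "support (single p) = {p}" by (auto simp: support_def single_def)
        then show ?thesis
          by (simp add: pairing_pa_mult_right path_algebra_finite rel_ideal_path_algebra rel_ideal.mesh)
      qed
      also have "\<dots> = 0"
        by (rule trunc_dual_rel_ideal[OF l], rule rel_ideal.right[OF rel_ideal.mesh path_algebra_single[OF p(1)]])
      also have "0 = comb F ?q (0\<^sub>v (v ?q)) r p" by (simp add: comb_def)
      finally show "comb F ?q ?y r p = comb F ?q (0\<^sub>v (v ?q)) r p" .
    qed auto
    then have "?y $ n = 0" using n by simp
    then have "(\<Sum>z\<in>?I. osign i (fst z) * U z $ n) = 0" using n by simp
    then show ?thesis
      by (subst sum.Sigma) (auto simp: case_prod_unfold U_def)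
  qed
  ultimately show ?thesis unfolding relations_def by blast
qed

lemma theta_crit_locus: "F \<in> Frames \<Longrightarrow> theta F \<in> crit_locus"
  by (simp add: crit_locus_def theta_stable theta_relations)

lemma theta_psi:
  assumes x: "x \<in> crit_locus"
  shows "theta (psi x) = x"
  using tuple_eqI[OF theta_stable[OF psi_Frames[OF x]] crit_locus_tuples[OF x]] psi_theta[OF psi_Frames[OF x]] by simp

end

section \<open>Orbits\<close>

lemma mult_inverse_mat:
  assumes A: "A \<in> carrier_mat n n" and B: "B \<in> carrier_mat n n" and A': "A' \<in> carrier_mat n n"
    and B': "B' \<in> carrier_mat n n" and "A * B = 1\<^sub>m n" "A' * B' = 1\<^sub>m n"
  shows "(A' * A) * (B * B') = (1\<^sub>m n :: 'a::semiring_1 mat)"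
proof -
  have "(A' * A) * (B * B') = A' * (A * (B * B'))"
    by (rule assoc_mult_mat[OF A' A mult_carrier_mat[OF B B']])
  also have "A * (B * B') = (A * B) * B'" by (rule assoc_mult_mat[OF A B B', symmetric])
  finally show ?thesis using assms by simp
qed

lemma mult3_mat_vec:
  assumes A: "A \<in> carrier_mat n n1" and B: "B \<in> carrier_mat n1 n2" and C: "C \<in> carrier_mat n2 n3"
    and u: "(u :: 'a::comm_semiring_0 vec) \<in> carrier_vec n3"
  shows "(A * B * C) *\<^sub>v u = A *\<^sub>v (B *\<^sub>v (C *\<^sub>v u))"
  using assoc_mult_mat_vec[OF mult_carrier_mat[OF A B] C u]
    assoc_mult_mat_vec[OF A B mult_mat_vec_carrier[OF C u]] by simp

context framed_quiver
begin

lemma automorphismsD: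
  assumes "(g, h) \<in> automorphisms v"
  shows "g q \<in> carrier_mat (v q) (v q)" "h q \<in> carrier_mat (v q) (v q)"
    "g q * h q = 1\<^sub>m (v q)" "h q * g q = 1\<^sub>m (v q)"
  using assms unfolding automorphisms_def by blast+

lemma automorphisms_cancel:
  assumes "(g, h) \<in> automorphisms v" "u \<in> carrier_vec (v q)"
  shows "g q *\<^sub>v (h q *\<^sub>v u) = u" "h q *\<^sub>v (g q *\<^sub>v u) = u"
  using assoc_mult_mat_vec[of "g q" "v q" "v q" "h q" "v q" u] assoc_mult_mat_vec[of "h q" "v q" "v q" "g q" "v q" u]
    automorphismsD[OF assms(1), of q] assms(2) by auto

lemma automorphisms_swap: "(g, h) \<in> automorphisms v \<Longrightarrow> (h, g) \<in> automorphisms v"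
  unfolding automorphisms_def by blast

lemma automorphisms_one: "(\<lambda>q. 1\<^sub>m (v q), \<lambda>q. 1\<^sub>m (v q)) \<in> automorphisms v"
  by (simp add: automorphisms_def)

lemma automorphisms_mult:
  assumes "(g, h) \<in> automorphisms v" "(g', h') \<in> automorphisms v"
  shows "(\<lambda>q. g' q * g q, \<lambda>q. h q * h' q) \<in> automorphisms v"
proof -
  have "(g' q * g q) * (h q * h' q) = 1\<^sub>m (v q) \<and> (h q * h' q) * (g' q * g q) = 1\<^sub>m (v q) \<and>
      g' q * g q \<in> carrier_mat (v q) (v q) \<and> h q * h' q \<in> carrier_mat (v q) (v q)" for q
    using automorphismsD[OF assms(1), of q] automorphismsD[OF assms(2), of q]
    by (simp add: mult_inverse_mat mult_carrier_mat)
  then show ?thesis unfolding automorphisms_def by simp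
qed

lemma op_mat_act:
  assumes "is_arrow a"
  shows "op_mat (act v (g, h) x) a m = g (arrow_src a, m + arrow_deg a) * op_mat x a m * h (arrow_tgt a, m)"
  using assms c_neg_sym b_sym by (cases a) (auto simp: act_def)

lemma act_tuples:
  assumes x: "x \<in> tuples v" and gh: "(g, h) \<in> automorphisms v"
  shows "act v (g, h) x \<in> tuples v"
proof -
  have h: "h q *\<^sub>v u \<in> carrier_vec (v q)" if "u \<in> carrier_vec (v q)" for q u
    using mult_mat_vec_carrier[OF automorphismsD(2)[OF gh, of q] that] .
  have hl: "h q *\<^sub>v (u + u') = h q *\<^sub>v u + h q *\<^sub>v u'" "h q *\<^sub>v (z \<cdot>\<^sub>v u) = z \<cdot>\<^sub>v (h q *\<^sub>v u)"
    if "u \<in> carrier_vec (v q)" "u' \<in> carrier_vec (v q)" for q u u' z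
    using mult_add_distrib_mat_vec[OF automorphismsD(2)[OF gh, of q] that]
      mult_mat_vec[OF automorphismsD(2)[OF gh, of q] that(1)] by auto
  note X = x[unfolded tuples_def mem_Collect_eq]
  show ?thesis
    unfolding tuples_def
  proof (intro CollectI conjI allI ballI impI)
    fix i j k
    show "if c i j < 0 then al (act v (g, h) x) i j k \<in> carrier_mat (v (i, k + b i j)) (v (j, k))
        else al (act v (g, h) x) i j k = 0\<^sub>m 0 0"
      using X automorphismsD(1,2)[OF gh] by (auto simp: act_def intro!: mult_carrier_mat)
  next
    fix i k show "ep (act v (g, h) x) i k \<in> carrier_mat (v (i, k + 2 * d i)) (v (i, k))"
      using X automorphismsD(1,2)[OF gh] by (auto simp: act_def intro!: mult_carrier_mat)
  next
    fix i k and u :: "complex vec" assume "u \<in> carrier_vec (v (i, k))"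
    then show "ar (act v (g, h) x) i k u \<in> W (i, k - d i)" using X h by (simp add: act_def)
  next
    fix i k and u u' :: "complex vec" assume "u \<in> carrier_vec (v (i, k))" "u' \<in> carrier_vec (v (i, k))"
    then show "ar (act v (g, h) x) i k (u + u') = ar (act v (g, h) x) i k u + ar (act v (g, h) x) i k u'"
      using X h by (simp add: act_def hl)
  next
    fix i k z and u :: "complex vec" assume "u \<in> carrier_vec (v (i, k))"
    then show "ar (act v (g, h) x) i k (z \<cdot>\<^sub>v u) = sc z (ar (act v (g, h) x) i k u)"
      using X h by (simp add: act_def hl)
  next
    fix i k and u :: "complex vec" assume "u \<notin> carrier_vec (v (i, k))"
    then show "ar (act v (g, h) x) i k u = 0" by (simp add: act_def)
  qed
qed

lemma move_act:
  assumes x: "x \<in> tuples v" and gh: "(g, h) \<in> automorphisms v"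
    and w: "is_path (i, w)" and u: "u \<in> carrier_vec (v (path_tgt (i, w), m))"
  shows "move (act v (g, h) x) m w u
    = g (i, m + path_deg (i, w)) *\<^sub>v move x m w (h (path_tgt (i, w), m) *\<^sub>v u)"
  using w u
proof (induction w arbitrary: m u)
  case Nil
  then show ?case using automorphisms_cancel(1)[OF gh] by simp
next
  case (Cons a w)
  have a: "is_arrow a" "is_path (i, w)" "arrow_src a = path_tgt (i, w)" using Cons.prems by auto
  let ?q = "(path_tgt (i, w), m + arrow_deg a)" and ?q' = "(arrow_tgt a, m)"
  have A: "op_mat x a m \<in> carrier_mat (v ?q) (v ?q')" using op_mat_carrier[OF x a(1), of m] a(3) by simp
  have u: "u \<in> carrier_vec (v ?q')" using Cons.prems by simp
  have hu: "h ?q' *\<^sub>v u \<in> carrier_vec (v ?q')" using automorphismsD(2)[OF gh, of ?q'] u by (rule mult_mat_vec_carrier)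
  have Ahu: "op_mat x a m *\<^sub>v (h ?q' *\<^sub>v u) \<in> carrier_vec (v ?q)" using A hu by (rule mult_mat_vec_carrier)
  have e: "op_mat (act v (g, h) x) a m *\<^sub>v u = g ?q *\<^sub>v (op_mat x a m *\<^sub>v (h ?q' *\<^sub>v u))"
    unfolding op_mat_act[OF a(1)] a(3)
    by (rule mult3_mat_vec[OF automorphismsD(1)[OF gh] A automorphismsD(2)[OF gh] u])
  have "op_mat (act v (g, h) x) a m *\<^sub>v u \<in> carrier_vec (v ?q)"
    unfolding e using automorphismsD(1)[OF gh, of ?q] Ahu by (rule mult_mat_vec_carrier)
  from Cons.IH[OF a(2) this]
  have "move (act v (g, h) x) m (a # w) u = g (i, m + path_deg (i, a # w)) *\<^sub>v
      move x (m + arrow_deg a) w (h ?q *\<^sub>v (op_mat (act v (g, h) x) a m *\<^sub>v u))"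
    by (simp add: add.assoc)
  also have "h ?q *\<^sub>v (op_mat (act v (g, h) x) a m *\<^sub>v u) = op_mat x a m *\<^sub>v (h ?q' *\<^sub>v u)"
    unfolding e by (rule automorphisms_cancel(2)[OF gh Ahu])
  finally show ?case by simp
qed

lemma Psi_act:
  assumes x: "x \<in> tuples v" and gh: "(g, h) \<in> automorphisms v" and u: "u \<in> carrier_vec (v q)"
  shows "Psi (act v (g, h) x) q u = Psi x q (h q *\<^sub>v u)"
proof (rule ext)+
  fix r and p :: "'i path"
  obtain k w where p: "p = (k, w)" by (cases p)
  obtain j m where q: "q = (j, m)" by (cases q)
  show "Psi (act v (g, h) x) q u r p = Psi x q (h q *\<^sub>v u) r p"
  proof (cases "r \<in> {1..s} \<and> is_path (k, w) \<and> k = ii r \<and> path_tgt (k, w) = j \<and> m + path_deg (k, w) = dg r")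
    case True
    then have w: "is_path (ii r, w)" "path_tgt (ii r, w) = j" "m + path_deg (ii r, w) = dg r" by auto
    have u': "u \<in> carrier_vec (v (path_tgt (ii r, w), m))" using u w q by simp
    have hu: "h q *\<^sub>v u \<in> carrier_vec (v (path_tgt (ii r, w), m))"
      using mult_mat_vec_carrier[OF automorphismsD(2)[OF gh, of q] u] w q by simp
    have y: "move x m w (h q *\<^sub>v u) \<in> carrier_vec (v (ii r, dg r))"
      using move_carrier[OF x w(1) hu] w(3) by simp
    have "move (act v (g, h) x) m w u = g (ii r, dg r) *\<^sub>v move x m w (h q *\<^sub>v u)"
      using move_act[OF x gh w(1) u'] w q by simp
    then have "frame_form (act v (g, h) x) r (move (act v (g, h) x) m w u) = frame_form x r (move x m w (h q *\<^sub>v u))"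
      using y mult_mat_vec_carrier[OF automorphismsD(1)[OF gh, of "(ii r, dg r)"] y] automorphisms_cancel(2)[OF gh y]
      by (simp add: frame_form_def act_def)
    then show ?thesis using True w unfolding p q Psi_def by (simp add: coeff_def del: atLeastAtMost_iff)
  next
    case False
    then show ?thesis unfolding p q Psi_def by (auto simp: coeff_def)
  qed
qed

lemma act_stable:
  assumes x: "x \<in> stable v" and gh: "(g, h) \<in> automorphisms v"
  shows "act v (g, h) x \<in> stable v"
  unfolding stable_iff
proof (intro conjI allI ballI impI)
  have xt: "x \<in> tuples v" using x by (rule stable_tuples)
  show "act v (g, h) x \<in> tuples v" by (rule act_tuples[OF xt gh])
  fix q u assume u: "u \<in> carrier_vec (v q)" "Psi (act v (g, h) x) q u = 0"
  then have "Psi x q (h q *\<^sub>v u) = 0" using Psi_act[OF xt gh] by simp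
  moreover have "h q *\<^sub>v u \<in> carrier_vec (v q)" using automorphismsD(2)[OF gh] u(1) by (rule mult_mat_vec_carrier)
  ultimately have "h q *\<^sub>v u = 0\<^sub>v (v q)" using x unfolding stable_iff by blast
  then have "g q *\<^sub>v 0\<^sub>v (v q) = u" using automorphisms_cancel(1)[OF gh u(1)] by simp
  moreover have "g q *\<^sub>v 0\<^sub>v (v q) = 0\<^sub>v (v q)"
    using automorphismsD(1)[OF gh, of q] by auto
  ultimately show "u = 0\<^sub>v (v q)" by simp
qed

lemma psi_eqI: "(\<And>q u. u \<in> carrier_vec (v q) \<Longrightarrow> Psi x q u = Psi y q u) \<Longrightarrow> psi x = psi y"
  unfolding psi_def by (intro ext) auto

text \<open>Like the composition law below, this is tested on \<open>psi\<close>, which determines a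
  stable tuple. There the action is only a substitution in the argument of
  \<open>Psi\<close>.\<close>

lemma act_one:
  assumes x: "x \<in> stable v"
  shows "act v (\<lambda>q. 1\<^sub>m (v q), \<lambda>q. 1\<^sub>m (v q)) x = x"
proof (rule tuple_eqI[symmetric, OF x act_tuples[OF stable_tuples[OF x] automorphisms_one]], rule psi_eqI)
  fix q and u :: "complex vec" assume "u \<in> carrier_vec (v q)"
  then show "Psi x q u = Psi (act v (\<lambda>q. 1\<^sub>m (v q), \<lambda>q. 1\<^sub>m (v q)) x) q u"
    using Psi_act[OF stable_tuples[OF x] automorphisms_one] by simp
qed

lemma act_act:
  assumes x: "x \<in> stable v" and gh: "(g, h) \<in> automorphisms v" and gh': "(g', h') \<in> automorphisms v"
  shows "act v (g', h') (act v (g, h) x) = act v (\<lambda>q. g' q * g q, \<lambda>q. h q * h' q) x"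
proof (rule tuple_eqI)
  have xt: "x \<in> tuples v" using x by (rule stable_tuples)
  show "act v (g', h') (act v (g, h) x) \<in> stable v" by (intro act_stable x gh gh')
  show "act v (\<lambda>q. g' q * g q, \<lambda>q. h q * h' q) x \<in> tuples v"
    by (intro act_tuples xt automorphisms_mult gh gh')
  show "psi (act v (g', h') (act v (g, h) x)) = psi (act v (\<lambda>q. g' q * g q, \<lambda>q. h q * h' q) x)"
  proof (rule psi_eqI)
    fix q and u :: "complex vec" assume u: "u \<in> carrier_vec (v q)"
    have hu: "h' q *\<^sub>v u \<in> carrier_vec (v q)" using automorphismsD(2)[OF gh'] u by (rule mult_mat_vec_carrier)
    have "h q *\<^sub>v (h' q *\<^sub>v u) = (h q * h' q) *\<^sub>v u"
      using assoc_mult_mat_vec[OF automorphismsD(2)[OF gh] automorphismsD(2)[OF gh'] u] by simp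
    then show "Psi (act v (g', h') (act v (g, h) x)) q u = Psi (act v (\<lambda>q. g' q * g q, \<lambda>q. h q * h' q) x) q u"
      using Psi_act[OF act_tuples[OF xt gh] gh' u] Psi_act[OF xt gh hu]
        Psi_act[OF xt automorphisms_mult[OF gh gh'] u] by simp
  qed
qed

lemma orbit_refl: "x \<in> stable v \<Longrightarrow> x \<in> orbit v x"
  unfolding orbit_def using act_one automorphisms_one by (metis image_eqI)

lemma orbitE:
  assumes "y \<in> orbit v x"
  obtains g h where "(g, h) \<in> automorphisms v" "y = act v (g, h) x"
  using assms unfolding orbit_def by (metis imageE prod.exhaust)

lemma orbitI: "(g, h) \<in> automorphisms v \<Longrightarrow> act v (g, h) x \<in> orbit v x"
  unfolding orbit_def by (rule imageI)

lemma orbit_subset: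
  assumes x: "x \<in> stable v" and y: "y \<in> orbit v x"
  shows "orbit v y \<subseteq> orbit v x"
proof
  fix z assume z: "z \<in> orbit v y"
  obtain g h where gh: "(g, h) \<in> automorphisms v" "y = act v (g, h) x" using y by (rule orbitE)
  obtain g' h' where gh': "(g', h') \<in> automorphisms v" "z = act v (g', h') y" using z by (rule orbitE)
  show "z \<in> orbit v x"
    unfolding gh' gh act_act[OF x gh(1) gh'(1)] by (intro orbitI automorphisms_mult gh(1) gh'(1))
qed

lemma orbit_stable: "x \<in> stable v \<Longrightarrow> y \<in> orbit v x \<Longrightarrow> y \<in> stable v"
  by (elim orbitE) (simp add: act_stable)

lemma orbit_sym:
  assumes x: "x \<in> stable v" and y: "y \<in> orbit v x"
  shows "x \<in> orbit v y"
proof -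
  obtain g h where gh: "(g, h) \<in> automorphisms v" "y = act v (g, h) x" using y by (rule orbitE)
  have "act v (h, g) y = act v (\<lambda>q. 1\<^sub>m (v q), \<lambda>q. 1\<^sub>m (v q)) x"
    unfolding gh act_act[OF x gh(1) automorphisms_swap[OF gh(1)]] using automorphismsD(4)[OF gh(1)] by simp
  then have "act v (h, g) y = x" using act_one[OF x] by simp
  then show ?thesis using orbitI[OF automorphisms_swap[OF gh(1)], of y] by simp
qed

lemma orbit_eq: "x \<in> stable v \<Longrightarrow> y \<in> orbit v x \<Longrightarrow> orbit v y = orbit v x"
  using orbit_subset orbit_sym orbit_stable by blast

lemma relations_act:
  assumes x: "x \<in> tuples v" "relations v x" and gh: "(g, h) \<in> automorphisms v"
  shows "relations v (act v (g, h) x)"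
proof -
  let ?y = "act v (g, h) x"
  have hu: "h q *\<^sub>v u \<in> carrier_vec (v q)" if "u \<in> carrier_vec (v q)" for q u
    using automorphismsD(2)[OF gh] that by (rule mult_mat_vec_carrier)
  have "move ?y m (replicate (nat (- c i j)) (Eps i) @ [Alpha i j]) u
      = move ?y m (Alpha i j # replicate (nat (- c j i)) (Eps j)) u"
    if c: "c i j < 0" and u: "u \<in> carrier_vec (v (i, m))" for i j m u
  proof -
    define w w' where "w = replicate (nat (- c i j)) (Eps i) @ [Alpha i j]"
      and "w' = Alpha i j # replicate (nat (- c j i)) (Eps j)"
    have we: "word_eq j w w'" unfolding w_def w'_def by (rule word_eq_comm[OF c])
    have w: "is_path (j, w)" "path_tgt (j, w) = i" "is_path (j, w')" "path_tgt (j, w') = i"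
      using we by (auto simp: word_eq_def w'_def)
    have "2 * d i * int (nat (- c i j)) = 2 * d j * int (nat (- c j i))"
      using b_sym[of i j] c c_neg_sym[of i j] by (simp add: b_def)
    then have dw: "path_deg (j, w) = path_deg (j, w')" by (simp add: w_def w'_def)
    have "move x m w (h (i, m) *\<^sub>v u) = move x m w' (h (i, m) *\<^sub>v u)"
      using x(2) c hu[OF u] unfolding relations_def w_def w'_def by blast
    then have "move ?y m w u = move ?y m w' u"
      using move_act[OF x(1) gh w(1), of u m] move_act[OF x(1) gh w(3), of u m] u w(2,4) dw by simp
    then show ?thesis unfolding w_def w'_def .
  qed
  moreover have "(\<Sum>j | c i j < 0. \<Sum>k<nat (- c i j). osign i j * move ?y m (mesh_word i j k) u $ n) = 0"
    if u: "u \<in> carrier_vec (v (i, m))" and n: "n < v (i, m - 2 * d i)" for i m u n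
  proof -
    let ?q = "(i, m - 2 * d i)"
    have l: "linear_form (v ?q) (\<lambda>y. (g ?q *\<^sub>v y) $ n)"
    proof -
      note gq = automorphismsD(1)[OF gh, of ?q]
      have "dim_vec (g ?q *\<^sub>v y) = v ?q" for y using gq by simp
      then show ?thesis
        unfolding linear_form_def
        using mult_add_distrib_mat_vec[OF gq] mult_mat_vec[OF gq] n by (simp add: index_add_vec)
    qed
    have "(\<Sum>j | c i j < 0. \<Sum>k<nat (- c i j). osign i j * move ?y m (mesh_word i j k) u $ n)
      = (\<Sum>j | c i j < 0. \<Sum>k<nat (- c i j). osign i j * (g ?q *\<^sub>v move x m (mesh_word i j k) (h (i, m) *\<^sub>v u)) $ n)"
    proof (intro sum.cong refl)
      fix j k assume "j \<in> {j. c i j < 0}" "k \<in> {..<nat (- c i j)}"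
      then have jk: "c i j < 0" "k < nat (- c i j)" by auto
      show "osign i j * move ?y m (mesh_word i j k) u $ n
          = osign i j * (g ?q *\<^sub>v move x m (mesh_word i j k) (h (i, m) *\<^sub>v u)) $ n"
        using move_act[OF x(1) gh is_path_mesh_word[OF jk(1), of k], of u m] u path_deg_mesh_word[OF jk]
        by (simp add: path_tgt_mesh_word)
    qed
    also have "\<dots> = 0" by (rule relations_mesh_form[OF x l hu[OF u]])
    finally show ?thesis .
  qed
  ultimately show ?thesis unfolding relations_def by blast
qed

lemma crit_locus_act: "x \<in> crit_locus \<Longrightarrow> (g, h) \<in> automorphisms v \<Longrightarrow> act v (g, h) x \<in> crit_locus"
  using relations_act crit_locus_tuples act_stable unfolding crit_locus_def by blast

lemma comb_mult_mat:
  assumes A: "A \<in> carrier_mat (v q) n'" and u: "u \<in> carrier_vec n'"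
  shows "comb F q (A *\<^sub>v u) r p = (\<Sum>n<n'. u $ n * (\<Sum>k<v q. A $$ (k, n) * F q k r p))"
proof -
  have "comb F q (A *\<^sub>v u) r p = (\<Sum>k<v q. (\<Sum>n<n'. A $$ (k, n) * u $ n) * F q k r p)"
    unfolding comb_def by (intro sum.cong refl) (simp only: lessThan_iff mult_mat_vec_index[OF A u])
  also have "\<dots> = (\<Sum>n<n'. u $ n * (\<Sum>k<v q. A $$ (k, n) * F q k r p))"
    unfolding sum_distrib_right sum_distrib_left by (subst sum.swap) (simp add: mult_ac)
  finally show ?thesis .
qed

lemma base_change:
  assumes F: "independent_frame F" and G: "independent_frame G"
    and eq: "\<And>q. fam.span (F q ` {..<v q}) = fam.span (G q ` {..<v q})"
  obtains g h where "(g, h) \<in> automorphisms v"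
    "\<And>q u. u \<in> carrier_vec (v q) \<Longrightarrow> comb G q u = comb F q (h q *\<^sub>v u)"
proof -
  define T where "T F G q = mat (v q) (v q) (\<lambda>(k, n). coords_in F q (G q n) $ k)"
    for F G :: "'i \<times> int \<Rightarrow> nat \<Rightarrow> nat \<Rightarrow> 'i path \<Rightarrow> complex" and q
  have T: "T F G q \<in> carrier_mat (v q) (v q)" for F G q by (simp add: T_def)
  have comb: "comb F q (T F G q *\<^sub>v u) = comb G q u"
    if sp: "\<And>q. fam.span (F q ` {..<v q}) = fam.span (G q ` {..<v q})" and u: "u \<in> carrier_vec (v q)" for F G q u
  proof (rule ext)+
    fix r p
    have "(\<Sum>k<v q. T F G q $$ (k, n) * F q k r p) = G q n r p" if "n < v q" for n
    proof -
      have "G q n \<in> fam.span (F q ` {..<v q})" unfolding sp using that by (auto intro: fam.span_base)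
      from coords_in(2)[where F = F and q = q, OF this]
      have "comb F q (coords_in F q (G q n)) r p = G q n r p" by simp
      then show ?thesis using that unfolding comb_def T_def by simp
    qed
    then show "comb F q (T F G q *\<^sub>v u) r p = comb G q u r p"
      unfolding comb_mult_mat[OF T u] by (simp add: comb_def)
  qed
  have id: "T F G q * T G F q = 1\<^sub>m (v q)"
    if "independent_frame F" "\<And>q. fam.span (F q ` {..<v q}) = fam.span (G q ` {..<v q})" for F G q
  proof (rule eq_matI)
    fix r n assume "r < dim_row (1\<^sub>m (v q) :: complex mat)" "n < dim_col (1\<^sub>m (v q) :: complex mat)"
    then have rn: "r < v q" "n < v q" by auto
    let ?u = "unit_vec (v q) n :: complex vec"
    have u: "?u \<in> carrier_vec (v q)" by simp
    have Tu: "T G F q *\<^sub>v ?u \<in> carrier_vec (v q)" using T u by (rule mult_mat_vec_carrier)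
    have "T F G q *\<^sub>v (T G F q *\<^sub>v ?u) = ?u"
    proof (rule comb_inject[OF that(1) _ u])
      show "T F G q *\<^sub>v (T G F q *\<^sub>v ?u) \<in> carrier_vec (v q)" using T Tu by (rule mult_mat_vec_carrier)
      show "comb F q (T F G q *\<^sub>v (T G F q *\<^sub>v ?u)) = comb F q ?u"
        using comb[OF that(2) Tu] comb[OF that(2)[symmetric] u] by simp
    qed
    then have "((T F G q * T G F q) *\<^sub>v ?u) $ r = ?u $ r"
      using assoc_mult_mat_vec[OF T T u] by simp
    then show "(T F G q * T G F q) $$ (r, n) = 1\<^sub>m (v q) $$ (r, n)"
      using mult_mat_unit_vec_index[OF mult_carrier_mat[OF T T] rn] rn by simp
  qed (simp_all add: T_def)
  show ?thesis
  proof (rule that[of "T G F" "T F G"])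
    show "(T G F, T F G) \<in> automorphisms v"
      unfolding automorphisms_def using T id[OF F eq] id[OF G eq[symmetric]] by blast
    show "comb G q u = comb F q (T F G q *\<^sub>v u)" if "u \<in> carrier_vec (v q)" for q u
      using comb[OF eq that] by simp
  qed
qed

text \<open>An automorphism changes the frame but not its span. Conversely, two frames of one
  submodule differ by a base change in each degree, and a stable tuple is determined by its
  frame.\<close>

lemma orbit_eq_iff:
  assumes x: "x \<in> crit_locus" and y: "y \<in> crit_locus"
  shows "orbit v x = orbit v y \<longleftrightarrow> frame_span (psi x) = frame_span (psi y)"
proof
  have xs: "x \<in> stable v" and xt: "x \<in> tuples v" and ys: "y \<in> stable v" and yt: "y \<in> tuples v"
    using x y crit_locus_stable crit_locus_tuples by auto
  assume "orbit v x = orbit v y"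
  then have "y \<in> orbit v x" using orbit_refl[OF ys] by simp
  then obtain g h where gh: "(g, h) \<in> automorphisms v" "y = act v (g, h) x" by (rule orbitE)
  have "fam.span (psi y q ` {..<v q}) = fam.span (psi x q ` {..<v q})" for q
    unfolding span_psi[OF xt] span_psi[OF yt]
  proof (intro subset_antisym subsetI)
    fix f assume "f \<in> Psi y q ` carrier_vec (v q)"
    then obtain u where u: "u \<in> carrier_vec (v q)" "f = Psi y q u" by auto
    then have "f = Psi x q (h q *\<^sub>v u)" using Psi_act[OF xt gh(1)] gh(2) by simp
    then show "f \<in> Psi x q ` carrier_vec (v q)"
      using mult_mat_vec_carrier[OF automorphismsD(2)[OF gh(1), of q] u(1)] by blast
  next
    fix f assume "f \<in> Psi x q ` carrier_vec (v q)"
    then obtain u where u: "u \<in> carrier_vec (v q)" "f = Psi x q u" by auto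
    have gu: "g q *\<^sub>v u \<in> carrier_vec (v q)" using automorphismsD(1)[OF gh(1)] u(1) by (rule mult_mat_vec_carrier)
    then have "Psi y q (g q *\<^sub>v u) = f"
      using Psi_act[OF xt gh(1) gu] gh(2) automorphisms_cancel(2)[OF gh(1) u(1)] u(2) by simp
    then show "f \<in> Psi y q ` carrier_vec (v q)" using gu by blast
  qed
  then show "frame_span (psi x) = frame_span (psi y)" unfolding frame_span_alt by simp
next
  have xs: "x \<in> stable v" and xt: "x \<in> tuples v" and ys: "y \<in> stable v" and yt: "y \<in> tuples v"
    using x y crit_locus_stable crit_locus_tuples by auto
  assume eq: "frame_span (psi x) = frame_span (psi y)"
  have eq': "fam.span (psi x q ` {..<v q}) = fam.span (psi y q ` {..<v q})" for q
    using frame_span_psi_Int[OF x, of q] frame_span_psi_Int[OF y, of q] eq by simp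
  obtain g h where gh: "(g, h) \<in> automorphisms v"
    and comb: "\<And>q u. u \<in> carrier_vec (v q) \<Longrightarrow> comb (psi y) q u = comb (psi x) q (h q *\<^sub>v u)"
    using base_change[OF independent_psi[OF xs] independent_psi[OF ys] eq'] by metis
  have "act v (g, h) x = y"
  proof (rule tuple_eqI[OF act_stable[OF xs gh] yt], rule psi_eqI)
    fix q and u :: "complex vec" assume u: "u \<in> carrier_vec (v q)"
    have hu: "h q *\<^sub>v u \<in> carrier_vec (v q)" using automorphismsD(2)[OF gh] u by (rule mult_mat_vec_carrier)
    show "Psi (act v (g, h) x) q u = Psi y q u"
      using Psi_act[OF xt gh u] Psi_eq_comb[OF xt hu] Psi_eq_comb[OF yt u] comb[OF u] by simp
  qed
  then have "y \<in> orbit v x" using orbitI[OF gh, of x] by simp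
  then show "orbit v x = orbit v y" using orbit_eq[OF xs] by simp
qed

section \<open>The function on tuples as a sum of traces\<close>

definition word_trace :: "('i, 'w) tuple \<Rightarrow> 'i \<Rightarrow> int \<Rightarrow> 'i arrow list \<Rightarrow> complex" where
  "word_trace x i k w = (\<Sum>r<v (i, k). move x k w (unit_vec (v (i, k)) r) $ r)"

text \<open>The head acts first and \<open>Alpha i j\<close> acts as \<alpha>_ji, so this word acts
  as \<epsilon>_i^(-c_ij) \<alpha>_ij \<alpha>_ji, whose trace occurs in f_2.\<close>

definition potential_word :: "'i \<Rightarrow> 'i \<Rightarrow> 'i arrow list" where
  "potential_word i j = [Alpha i j, Alpha j i] @ replicate (nat (- c i j)) (Eps i)"

lemma is_path_potential_word: "c i j < 0 \<Longrightarrow> is_path (i, potential_word i j)"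
  and path_tgt_potential_word: "path_tgt (i, potential_word i j) = i"
  and path_deg_potential_word: "c i j < 0 \<Longrightarrow> path_deg (l, potential_word i j) = 0"
  using c_neg_sym[of i j] b_sym[of i j] by (auto simp: potential_word_def b_def is_path_append path_tgt_append)

lemma osign_eq_0: "\<not> c i j < 0 \<Longrightarrow> osign i j = 0"
  using orient c_neg_sym[of i j] unfolding orientation_def osign_def by auto

lemma ep_power_carrier:
  assumes "x \<in> tuples v"
  shows "ep_power v x i k n \<in> carrier_mat (v (i, k + 2 * d i * int n)) (v (i, k))"
proof (induction n)
  case (Suc n)
  have "ep x i (k + 2 * d i * int n) \<in> carrier_mat (v (i, k + 2 * d i * int n + 2 * d i)) (v (i, k + 2 * d i * int n))"
    using assms unfolding tuples_def by blast
  then have "ep_power v x i k (Suc n) \<in> carrier_mat (v (i, k + 2 * d i * int n + 2 * d i)) (v (i, k))"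
    using Suc by (auto intro: mult_carrier_mat)
  moreover have "k + 2 * d i * int n + 2 * d i = k + 2 * d i * int (Suc n)" by (simp add: algebra_simps)
  ultimately show ?case by simp
qed simp

lemma move_replicate_Eps:
  assumes x: "x \<in> tuples v" and u: "u \<in> carrier_vec (v (i, k))"
  shows "move x k (replicate n (Eps i)) u = ep_power v x i k n *\<^sub>v u"
proof (induction n)
  case (Suc n)
  have e: "ep x i (k + 2 * d i * int n) \<in> carrier_mat (v (i, k + 2 * d i * int n + 2 * d i)) (v (i, k + 2 * d i * int n))"
    using x unfolding tuples_def by blast
  have "move x k (replicate (Suc n) (Eps i)) u = move x k (replicate n (Eps i) @ [Eps i]) u"
    by (simp add: replicate_append_same)
  also have "\<dots> = ep x i (k + 2 * d i * int n) *\<^sub>v (ep_power v x i k n *\<^sub>v u)"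
    using move_append[of x k "replicate n (Eps i)" "[Eps i]" u i] Suc by simp
  finally show ?case using assoc_mult_mat_vec[OF e ep_power_carrier[OF x] u] by simp
qed (use u in simp)

lemma f2_tuple_eq:
  assumes x: "x \<in> tuples v"
  shows "f2_tuple v x = (\<Sum>i\<in>UNIV. \<Sum>j\<in>UNIV. osign i j * (\<Sum>k | v (i, k) \<noteq> 0. word_trace x i k (potential_word i j)))"
  unfolding f2_tuple_def
proof (intro sum.cong refl)
  fix i j
  show "osign i j * (\<Sum>k | v (i, k) \<noteq> 0. mat_trace (ep_power v x i (k + b i j + b i j) (nat (- c i j))
                * al x i j (k + b i j) * al x j i k))
    = osign i j * (\<Sum>k | v (i, k) \<noteq> 0. word_trace x i k (potential_word i j))"
  proof (cases "c i j < 0")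
    case True
    have "mat_trace (ep_power v x i (k + b i j + b i j) (nat (- c i j)) * al x i j (k + b i j) * al x j i k)
        = word_trace x i k (potential_word i j)" for k
    proof -
      let ?k = "k + b i j + b i j" and ?n = "nat (- c i j)"
      have k: "?k + 2 * d i * int ?n = k" using True by (simp add: b_def)
      have E: "ep_power v x i ?k ?n \<in> carrier_mat (v (i, k)) (v (i, ?k))"
        using ep_power_carrier[OF x, of i ?k ?n] unfolding k .
      have A: "al x i j (k + b i j) \<in> carrier_mat (v (i, ?k)) (v (j, k + b i j))"
        using conjunct1[OF x[unfolded tuples_def mem_Collect_eq]] True by presburger
      have B: "al x j i k \<in> carrier_mat (v (j, k + b i j)) (v (i, k))"
        using x True c_neg_sym[of i j] b_sym[of i j] unfolding tuples_def by auto
      let ?M = "ep_power v x i ?k ?n * al x i j (k + b i j) * al x j i k"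
      have M: "?M \<in> carrier_mat (v (i, k)) (v (i, k))" by (intro mult_carrier_mat[OF mult_carrier_mat[OF E A] B])
      have "?M *\<^sub>v u = move x k (potential_word i j) u" if u: "u \<in> carrier_vec (v (i, k))" for u
      proof -
        have Bu: "al x j i k *\<^sub>v u \<in> carrier_vec (v (j, k + b i j))" using B u by (rule mult_mat_vec_carrier)
        have ABu: "al x i j (k + b i j) *\<^sub>v (al x j i k *\<^sub>v u) \<in> carrier_vec (v (i, ?k))"
          using A Bu by (rule mult_mat_vec_carrier)
        have "?M *\<^sub>v u = ep_power v x i ?k ?n *\<^sub>v (al x i j (k + b i j) *\<^sub>v (al x j i k *\<^sub>v u))"
          using assoc_mult_mat_vec[OF mult_carrier_mat[OF E A] B u] assoc_mult_mat_vec[OF E A Bu] by simp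
        then show ?thesis
          using move_replicate_Eps[OF x ABu] b_sym[of j i] by (simp add: potential_word_def)
      qed
      then show ?thesis
        using M mult_mat_unit_vec_index[OF M] unfolding mat_trace_def word_trace_def
        by (auto intro!: sum.cong simp flip: mult_mat_unit_vec_index[OF M])
    qed
    then show ?thesis by simp
  qed (simp add: osign_eq_0)
qed

text \<open>A closed path of degree 0 acts as an endomorphism of one component of V, and an
  automorphism conjugates it.\<close>

lemma word_trace_act:
  assumes x: "x \<in> tuples v" and gh: "(g, h) \<in> automorphisms v"
    and w: "is_path (i, w)" "path_tgt (i, w) = i" "path_deg (i, w) = 0"
  shows "word_trace (act v (g, h) x) i k w = word_trace x i k w"
proof -
  let ?q = "(i, k)" and ?n = "v (i, k)"
  let ?e = "\<lambda>r. unit_vec ?n r :: complex vec"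
  note gq = automorphismsD(1)[OF gh, of ?q] and hq = automorphismsD(2)[OF gh, of ?q]
  have mc: "move x k w u \<in> carrier_vec ?n" if "u \<in> carrier_vec ?n" for u
    using move_carrier[OF x w(1), of u k] w(2,3) that by simp
  have "(\<Sum>r<?n. move (act v (g, h) x) k w (?e r) $ r)
      = (\<Sum>r<?n. \<Sum>l<?n. \<Sum>t<?n. g ?q $$ (r, l) * (h ?q $$ (t, r) * move x k w (?e t) $ l))"
  proof (intro sum.cong refl)
    fix r assume "r \<in> {..<?n}"
    then have r: "r < ?n" by simp
    have hu: "h ?q *\<^sub>v ?e r \<in> carrier_vec ?n" using hq by (rule mult_mat_vec_carrier) simp
    have "move (act v (g, h) x) k w (?e r) = g ?q *\<^sub>v move x k w (h ?q *\<^sub>v ?e r)"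
      using move_act[OF x gh w(1), of "?e r" k] w(2,3) by simp
    then have "move (act v (g, h) x) k w (?e r) $ r = (\<Sum>l<?n. g ?q $$ (r, l) * move x k w (h ?q *\<^sub>v ?e r) $ l)"
      using mult_mat_vec_index[OF gq mc[OF hu] r] by simp
    also have "\<dots> = (\<Sum>l<?n. \<Sum>t<?n. g ?q $$ (r, l) * (h ?q $$ (t, r) * move x k w (?e t) $ l))"
    proof (intro sum.cong refl)
      fix l assume "l \<in> {..<?n}"
      then have "linear_form ?n (\<lambda>u. move x k w u $ l)"
        using linear_form_move[OF x w(1), of k "\<lambda>u. u $ l"] w(2,3) linear_form_index by simp
      from linear_form_expand[OF this hu]
      have "move x k w (h ?q *\<^sub>v ?e r) $ l = (\<Sum>t<?n. h ?q $$ (t, r) * move x k w (?e t) $ l)"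
        using mult_mat_unit_vec_index[OF hq _ r] by simp
      then show "g ?q $$ (r, l) * move x k w (h ?q *\<^sub>v ?e r) $ l
          = (\<Sum>t<?n. g ?q $$ (r, l) * (h ?q $$ (t, r) * move x k w (?e t) $ l))"
        by (simp add: sum_distrib_left)
    qed
    finally show "move (act v (g, h) x) k w (?e r) $ r
        = (\<Sum>l<?n. \<Sum>t<?n. g ?q $$ (r, l) * (h ?q $$ (t, r) * move x k w (?e t) $ l))" .
  qed
  also have "\<dots> = (\<Sum>l<?n. \<Sum>t<?n. (\<Sum>r<?n. h ?q $$ (t, r) * g ?q $$ (r, l)) * move x k w (?e t) $ l)"
  proof -
    have "(\<Sum>r<?n. \<Sum>t<?n. g ?q $$ (r, l) * (h ?q $$ (t, r) * move x k w (?e t) $ l))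
        = (\<Sum>t<?n. (\<Sum>r<?n. h ?q $$ (t, r) * g ?q $$ (r, l)) * move x k w (?e t) $ l)" for l
      unfolding sum_distrib_right by (subst sum.swap) (simp add: mult_ac)
    then show ?thesis by (subst sum.swap) simp
  qed
  also have "\<dots> = (\<Sum>l<?n. \<Sum>t<?n. if t = l then move x k w (?e l) $ l else 0)"
  proof (intro sum.cong refl)
    fix l t assume "l \<in> {..<?n}" "t \<in> {..<?n}"
    then have "(\<Sum>r<?n. h ?q $$ (t, r) * g ?q $$ (r, l)) = (h ?q * g ?q) $$ (t, l)"
      using gq hq by (simp add: scalar_prod_def atLeast0LessThan)
    also have "\<dots> = (if t = l then 1 else 0)"
      using automorphismsD(4)[OF gh, of ?q] \<open>l \<in> _\<close> \<open>t \<in> _\<close> by simp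
    finally show "(\<Sum>r<?n. h ?q $$ (t, r) * g ?q $$ (r, l)) * move x k w (?e t) $ l
        = (if t = l then move x k w (?e l) $ l else 0)" by simp
  qed
  also have "\<dots> = word_trace x i k w" unfolding word_trace_def by simp
  finally show ?thesis unfolding word_trace_def .
qed

lemma f2_tuple_act:
  assumes x: "x \<in> tuples v" and gh: "(g, h) \<in> automorphisms v"
  shows "f2_tuple v (act v (g, h) x) = f2_tuple v x"
  unfolding f2_tuple_eq[OF x] f2_tuple_eq[OF act_tuples[OF x gh]]
proof (intro sum.cong refl)
  fix i j
  show "osign i j * (\<Sum>k | v (i, k) \<noteq> 0. word_trace (act v (g, h) x) i k (potential_word i j))
      = osign i j * (\<Sum>k | v (i, k) \<noteq> 0. word_trace x i k (potential_word i j))"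
    by (cases "c i j < 0") (simp_all add: osign_eq_0 word_trace_act[OF x gh] is_path_potential_word
        path_tgt_potential_word path_deg_potential_word)
qed

lemma f2_orbit:
  assumes "x \<in> stable v"
  shows "f2 v (orbit v x) = f2_tuple v x"
  unfolding f2_def
proof (rule the_equality)
  show "\<forall>y\<in>orbit v x. f2_tuple v y = f2_tuple v x"
    using f2_tuple_act[OF stable_tuples[OF assms]] by (metis orbitE)
  show "z = f2_tuple v x" if "\<forall>y\<in>orbit v x. f2_tuple v y = z" for z
    using that orbit_refl[OF assms] by auto
qed

end

section \<open>Algebras of functions\<close>

text \<open>The common closure property of polynomial, continuous, differentiable and regular
  functions. Determinants and adjugates can thus be treated once for all of them.\<close>

definition function_algebra :: "('x \<Rightarrow> complex) set \<Rightarrow> bool" where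
  "function_algebra A \<longleftrightarrow> (\<forall>z. (\<lambda>_. z) \<in> A) \<and>
     (\<forall>f\<in>A. \<forall>g\<in>A. (\<lambda>x. f x + g x) \<in> A) \<and> (\<forall>f\<in>A. \<forall>g\<in>A. (\<lambda>x. f x * g x) \<in> A)"

lemma function_algebraD:
  assumes "function_algebra A"
  shows "(\<lambda>_. z) \<in> A" "f \<in> A \<Longrightarrow> g \<in> A \<Longrightarrow> (\<lambda>x. f x + g x) \<in> A" "f \<in> A \<Longrightarrow> g \<in> A \<Longrightarrow> (\<lambda>x. f x * g x) \<in> A"
  using assms unfolding function_algebra_def by blast+

lemma function_algebra_scale: "function_algebra A \<Longrightarrow> f \<in> A \<Longrightarrow> (\<lambda>x. z * f x) \<in> A"
  using function_algebraD(3)[of A "\<lambda>_. z" f] function_algebraD(1)[of A z] by simp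

lemma function_algebra_diff:
  assumes "function_algebra A" "f \<in> A" "g \<in> A"
  shows "(\<lambda>x. f x - g x) \<in> A"
  using function_algebraD(2)[OF assms(1,2) function_algebra_scale[OF assms(1,3), of "-1"]] by simp

lemma function_algebra_sum:
  assumes "function_algebra A" "\<And>i. i \<in> I \<Longrightarrow> f i \<in> A"
  shows "(\<lambda>x. \<Sum>i\<in>I. f i x) \<in> A"
  using assms(2)
proof (induction I rule: infinite_finite_induct)
  case (insert i I)
  then have "(\<lambda>x. f i x + (\<Sum>i\<in>I. f i x)) \<in> A" using function_algebraD(2)[OF assms(1)] by auto
  then show ?case using insert by simp
qed (auto simp: function_algebraD(1)[OF assms(1)])

lemma function_algebra_prod:
  assumes "function_algebra A" "\<And>i. i \<in> I \<Longrightarrow> f i \<in> A"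
  shows "(\<lambda>x. \<Prod>i\<in>I. f i x) \<in> A"
  using assms(2)
proof (induction I rule: infinite_finite_induct)
  case (insert i I)
  then have "(\<lambda>x. f i x * (\<Prod>i\<in>I. f i x)) \<in> A" using function_algebraD(3)[OF assms(1)] by auto
  then show ?case using insert by simp
qed (auto simp: function_algebraD(1)[OF assms(1)])

lemma function_algebra_det:
  assumes A: "function_algebra A" and M: "\<And>x. M x \<in> carrier_mat n n"
    and entries: "\<And>i j. i < n \<Longrightarrow> j < n \<Longrightarrow> (\<lambda>x. M x $$ (i, j)) \<in> A"
  shows "(\<lambda>x. det (M x)) \<in> A"
proof -
  have "(\<lambda>x. det (M x)) = (\<lambda>x. \<Sum>p\<in>{p. p permutes {0..<n}}. signof p * (\<Prod>i=0..<n. M x $$ (i, p i)))"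
    using det_def'[OF M] by simp
  also have "\<dots> \<in> A"
  proof (intro function_algebra_sum[OF A] function_algebra_scale[OF A] function_algebra_prod[OF A] entries)
    fix p i assume "p \<in> {p. p permutes {0..<n}}" "i \<in> {0..<n}"
    then show "i < n" "p i < n" using permutes_in_image[of p "{0..<n}" i] by auto
  qed
  finally show ?thesis .
qed

lemma function_algebra_adj_mat:
  assumes A: "function_algebra A" and M: "\<And>x. M x \<in> carrier_mat n n"
    and entries: "\<And>i j. i < n \<Longrightarrow> j < n \<Longrightarrow> (\<lambda>x. M x $$ (i, j)) \<in> A"
    and ij: "i < n" "j < n"
  shows "(\<lambda>x. adj_mat (M x) $$ (i, j)) \<in> A"
proof -
  have "(\<lambda>x. adj_mat (M x) $$ (i, j)) = (\<lambda>x. (-1) ^ (j + i) * det (mat_delete (M x) j i))"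
    using carrier_matD[OF M] ij by (auto simp: adj_mat_def cofactor_def fun_eq_iff)
  also have "\<dots> \<in> A"
  proof (intro function_algebra_scale[OF A] function_algebra_det[OF A])
    show "mat_delete (M x) j i \<in> carrier_mat (n - 1) (n - 1)" for x by (rule mat_delete_carrier[OF M])
    fix i' j' assume lt: "i' < n - 1" "j' < n - 1"
    have "(\<lambda>x. mat_delete (M x) j i $$ (i', j'))
        = (\<lambda>x. M x $$ (if i' < j then i' else Suc i', if j' < i then j' else Suc j'))"
      using carrier_matD[OF M] lt by (auto simp: mat_delete_def fun_eq_iff)
    also have "\<dots> \<in> A" using lt by (intro entries) auto
    finally show "(\<lambda>x. mat_delete (M x) j i $$ (i', j')) \<in> A" .
  qed
  finally show ?thesis .
qed

lemma mat_mult_index: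
  assumes "A \<in> carrier_mat nr n" "B \<in> carrier_mat n nc" "i < nr" "j < nc"
  shows "(A * B) $$ (i, j) = (\<Sum>k<n. A $$ (i, k) * B $$ (k, j))"
  using assms by (simp add: scalar_prod_def atLeast0LessThan)

lemma function_algebra_polys: "function_algebra (polys X)"
  unfolding function_algebra_def by (blast intro: polys.intros)

text \<open>The new functional of the induction step evaluates at a point where the part of the new function
  outside the span of the others is nonzero.\<close>

lemma dual_family:
  fixes F :: "nat \<Rightarrow> 't \<Rightarrow> complex"
  assumes "\<And>u. (\<And>t. (\<Sum>m<n. u m * F m t) = 0) \<Longrightarrow> \<forall>m<n. u m = 0"
  shows "\<exists>T l. finite T \<and> (\<forall>m<n. \<forall>k<n. (\<Sum>t\<in>T. l m t * F k t) = (if m = k then 1 else 0))"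
  using assms
proof (induction n)
  case 0
  then show ?case by (intro exI[of _ "{}"]) auto
next
  case (Suc n)
  have "\<forall>m<n. u m = 0" if "\<And>t. (\<Sum>m<n. u m * F m t) = 0" for u
    using Suc.prems[of "\<lambda>m. if m < n then u m else 0"] that by (auto simp: less_Suc_eq)
  then obtain T l where T: "finite T" and l: "\<And>m k. m < n \<Longrightarrow> k < n \<Longrightarrow> (\<Sum>t\<in>T. l m t * F k t) = (if m = k then 1 else 0)"
    using Suc.IH by blast
  define co where "co m = (\<Sum>t\<in>T. l m t * F n t)" for m
  define G where "G t = F n t - (\<Sum>m<n. co m * F m t)" for t
  have "\<exists>t. G t \<noteq> 0"
  proof (rule ccontr)
    assume "\<nexists>t. G t \<noteq> 0"
    then have "(\<Sum>m<Suc n. (if m < n then - co m else 1) * F m t) = 0" for t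
      by (simp add: G_def sum_negf)
    from Suc.prems[OF this] show False by (auto dest: spec[of _ n])
  qed
  then obtain t0 where t0: "G t0 \<noteq> 0" by blast
  define T' where "T' = insert t0 T"
  define l0 where "l0 m t = (if t \<in> T then l m t else 0)" for m t
  define ev where "ev t = (if t = t0 then 1 else 0 :: complex)" for t
  have T': "finite T'" using T by (simp add: T'_def)
  have sum_l0: "(\<Sum>t\<in>T'. l0 m t * f t) = (\<Sum>t\<in>T. l m t * f t)" for m f
    by (rule sum.mono_neutral_cong_right) (use T in \<open>auto simp: T'_def l0_def\<close>)
  have sum_ev: "(\<Sum>t\<in>T'. ev t * f t) = f t0" for f :: "'t \<Rightarrow> complex"
  proof -
    have "(\<Sum>t\<in>T'. ev t * f t) = (\<Sum>t\<in>T'. if t = t0 then f t0 else 0)" by (intro sum.cong) (auto simp: ev_def)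
    then show ?thesis using T' by (simp add: T'_def)
  qed
  define ln where "ln t = (ev t - (\<Sum>m<n. F m t0 * l0 m t)) / G t0" for t
  \<comment> \<open>\<open>ln\<close> is evaluation at \<open>t0\<close>, corrected to vanish on the
    old functions and normalized on the new one; the old functionals are corrected in turn to vanish
    on the new function.\<close>
  define l' where "l' m t = (if m < n then l0 m t - co m * ln t else ln t)" for m t
  have sum_ln: "(\<Sum>t\<in>T'. ln t * f t) = (f t0 - (\<Sum>m<n. F m t0 * (\<Sum>t\<in>T. l m t * f t))) / G t0" for f
  proof -
    have "(\<Sum>t\<in>T'. ln t * f t) = (\<Sum>t\<in>T'. (ev t * f t - (\<Sum>m<n. F m t0 * (l0 m t * f t)))) / G t0"
      unfolding ln_def sum_divide_distrib by (intro sum.cong refl) (simp add: algebra_simps sum_distrib_left)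
    also have "(\<Sum>t\<in>T'. (ev t * f t - (\<Sum>m<n. F m t0 * (l0 m t * f t))))
        = f t0 - (\<Sum>m<n. F m t0 * (\<Sum>t\<in>T. l m t * f t))"
      unfolding sum_subtractf sum_ev sum_l0[symmetric] sum_distrib_left by (subst sum.swap) simp
    finally show ?thesis .
  qed
  have ln_old: "(\<Sum>t\<in>T'. ln t * F k t) = 0" if "k < n" for k
  proof -
    have "(\<Sum>m<n. F m t0 * (\<Sum>t\<in>T. l m t * F k t)) = (\<Sum>m<n. if m = k then F k t0 else 0)"
      using l that by (intro sum.cong refl) auto
    then show ?thesis using that by (simp add: sum_ln)
  qed
  have ln_new: "(\<Sum>t\<in>T'. ln t * F n t) = 1"
    using t0 unfolding sum_ln co_def[symmetric] by (simp add: G_def mult.commute)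
  have "(\<Sum>t\<in>T'. l' m t * F k t) = (if m = k then 1 else 0)" if "m < Suc n" "k < Suc n" for m k
  proof (cases "m < n")
    case True
    have "(\<Sum>t\<in>T'. l' m t * F k t) = (\<Sum>t\<in>T'. l0 m t * F k t) - co m * (\<Sum>t\<in>T'. ln t * F k t)"
      using True by (simp add: l'_def algebra_simps sum_subtractf sum_distrib_left)
    also have "\<dots> = (if m = k then 1 else 0)"
      using True that ln_old[of k] ln_new l[of m k] unfolding sum_l0 by (cases "k < n") (auto simp: co_def less_Suc_eq)
    finally show ?thesis .
  next
    case False
    then have "(\<Sum>t\<in>T'. l' m t * F k t) = (\<Sum>t\<in>T'. ln t * F k t)" by (simp add: l'_def)
    then show ?thesis using False that ln_old[of k] ln_new by (cases "k < n") (auto simp: less_Suc_eq)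
  qed
  then show ?case using T' by (intro exI[of _ T'] exI[of _ l']) auto
qed

section \<open>Topology\<close>

lemma continuous_map_mult:
  fixes f g :: "'x \<Rightarrow> complex"
  shows "continuous_map X euclidean f \<Longrightarrow> continuous_map X euclidean g \<Longrightarrow> continuous_map X euclidean (\<lambda>x. f x * g x)"
  by (simp add: continuous_map_atin tendsto_mult)

lemma function_algebra_continuous_map: "function_algebra {f. continuous_map X euclidean f}"
  unfolding function_algebra_def by (auto intro: continuous_map_add continuous_map_mult)

lemma polys_subset: "function_algebra A \<Longrightarrow> X \<subseteq> A \<Longrightarrow> polys X \<subseteq> A"
proof
  fix f assume A: "function_algebra A" "X \<subseteq> A" and "f \<in> polys X"
  from \<open>f \<in> polys X\<close> show "f \<in> A"
    by (induction rule: polys.induct) (use A function_algebraD[OF A(1)] in auto)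
qed

lemma continuous_map_initial_topology:
  assumes "f \<in> X"
  shows "continuous_map (initial_topology S X) euclidean f"
proof -
  have "continuous_map (initial_topology S X) euclidean ((\<lambda>h. h f) \<circ> (\<lambda>x. \<lambda>f\<in>X. f x))"
    unfolding initial_topology_def
    by (rule continuous_map_pullback) (use assms in \<open>rule continuous_map_product_projection\<close>)
  then show ?thesis using assms by (simp add: o_def)
qed

lemma continuous_map_polys: "f \<in> polys X \<Longrightarrow> continuous_map (initial_topology S X) euclidean f"
  using polys_subset[OF function_algebra_continuous_map, of X "initial_topology S X"]
    continuous_map_initial_topology by blast

lemma continuous_map_into_initial_topology:
  assumes "g ` topspace T \<subseteq> S" "\<And>f. f \<in> X \<Longrightarrow> continuous_map T euclidean (\<lambda>y. f (g y))"
  shows "continuous_map T (initial_topology S X) g"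
  unfolding initial_topology_def
proof (rule continuous_map_pullback')
  show "continuous_map T (product_topology (\<lambda>_. euclidean) X) ((\<lambda>x. \<lambda>f\<in>X. f x) \<circ> g)"
    unfolding continuous_map_componentwise
  proof (intro conjI ballI)
    fix f assume f: "f \<in> X"
    show "continuous_map T euclidean (\<lambda>y. ((\<lambda>x. \<lambda>f\<in>X. f x) \<circ> g) y f)"
      using assms(2)[OF f] f by simp
  qed auto
  show "topspace T \<subseteq> g -` S" using assms(1) by blast
qed

lemma quotient_map_final_topology: "quotient_map T (final_topology T q) q"
  unfolding quotient_map_def
  by (auto simp: topspace_final_topology openin_final_topology)

lemma continuous_map_into_fun:
  fixes f :: "'x \<Rightarrow> 'a \<Rightarrow> 'b::topological_space"
  shows "continuous_map T euclidean f \<longleftrightarrow> (\<forall>a. continuous_map T euclidean (\<lambda>x. f x a))"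
  unfolding euclidean_product_topology[symmetric] continuous_map_componentwise_UNIV ..

text \<open>The inverse maps \<open>f\<close> and \<open>g\<close> match the fibres of
  \<open>p\<close> and \<open>q\<close>, so both descend to the quotients, where the universal
  property gives continuity.\<close>

lemma homeomorphic_space_quotients:
  assumes p: "quotient_map X X' p" and q: "quotient_map Y Y' q"
    and f: "continuous_map X Y f" and g: "continuous_map Y X g"
    and gf: "\<And>x. x \<in> topspace X \<Longrightarrow> g (f x) = x" and fg: "\<And>y. y \<in> topspace Y \<Longrightarrow> f (g y) = y"
    and eq: "\<And>x x'. x \<in> topspace X \<Longrightarrow> x' \<in> topspace X \<Longrightarrow> p x = p x' \<longleftrightarrow> q (f x) = q (f x')"
  shows "X' homeomorphic_space Y'"
proof -
  have fX: "f x \<in> topspace Y" if "x \<in> topspace X" for x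
    using f that continuous_map_image_subset_topspace by blast
  have gY: "g y \<in> topspace X" if "y \<in> topspace Y" for y
    using g that continuous_map_image_subset_topspace by blast
  have "continuous_map X Y' (q \<circ> f)" using f quotient_imp_continuous_map[OF q] by (rule continuous_map_compose)
  then obtain F where F: "continuous_map X' Y' F" "\<And>x. x \<in> topspace X \<Longrightarrow> F (p x) = (q \<circ> f) x"
    by (rule quotient_map_lift_exists[OF p]) (use eq in auto)
  have "continuous_map Y X' (p \<circ> g)" using g quotient_imp_continuous_map[OF p] by (rule continuous_map_compose)
  then obtain G where G: "continuous_map Y' X' G" "\<And>y. y \<in> topspace Y \<Longrightarrow> G (q y) = (p \<circ> g) y"
  proof (rule quotient_map_lift_exists[OF q])
    show "(p \<circ> g) y = (p \<circ> g) y'" if "y \<in> topspace Y" "y' \<in> topspace Y" "q y = q y'" for y y'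
      using eq[OF gY[OF that(1)] gY[OF that(2)]] fg that by simp
  qed (use that in blast)
  have "homeomorphic_maps X' Y' F G"
    unfolding homeomorphic_maps_def
  proof (intro conjI F(1) G(1) ballI)
    fix x' assume "x' \<in> topspace X'"
    then obtain x where "x \<in> topspace X" "x' = p x" using quotient_imp_surjective_map[OF p] by blast
    then show "G (F x') = x'" using F(2) G(2)[OF fX] gf by simp
  next
    fix y' assume "y' \<in> topspace Y'"
    then obtain y where "y \<in> topspace Y" "y' = q y" using quotient_imp_surjective_map[OF q] by blast
    then show "F (G y') = y'" using G(2) F(2)[OF gY] fg by simp
  qed
  then show ?thesis unfolding homeomorphic_space_def by blast
qed

lemma homeomorphic_space_sum_topology:
  assumes "\<And>i. i \<in> I \<Longrightarrow> X i homeomorphic_space Y i"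
  shows "sum_topology X I homeomorphic_space sum_topology Y I"
proof -
  have "\<forall>i\<in>I. \<exists>f g. homeomorphic_maps (X i) (Y i) f g" using assms unfolding homeomorphic_space_def by blast
  then obtain f where "\<forall>i\<in>I. \<exists>g. homeomorphic_maps (X i) (Y i) (f i) g" by metis
  then obtain g where fg: "\<And>i. i \<in> I \<Longrightarrow> homeomorphic_maps (X i) (Y i) (f i) (g i)" by metis
  have cont: "continuous_map (sum_topology X I) (sum_topology Y I) (\<lambda>(i, x). (i, f i x))"
    if f: "\<And>i. i \<in> I \<Longrightarrow> continuous_map (X i) (Y i) (f i)" for X Y f
    unfolding continuous_map_def
  proof (intro conjI allI impI)
    show "(\<lambda>(i, x). (i, f i x)) \<in> topspace (sum_topology X I) \<rightarrow> topspace (sum_topology Y I)"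
      using f continuous_map_image_subset_topspace by (fastforce simp: o_def)
    fix U assume U: "openin (sum_topology Y I) U"
    show "openin (sum_topology X I) {x \<in> topspace (sum_topology X I). (case x of (i, x) \<Rightarrow> (i, f i x)) \<in> U}"
      unfolding openin_sum_topology
    proof (intro conjI ballI)
      fix i assume i: "i \<in> I"
      have "{x. (i, x) \<in> {x \<in> topspace (sum_topology X I). (case x of (i, x) \<Rightarrow> (i, f i x)) \<in> U}}
          = {x \<in> topspace (X i). f i x \<in> {y. (i, y) \<in> U}}" using i by auto
      moreover have "openin (Y i) {y. (i, y) \<in> U}" using U i unfolding openin_sum_topology by blast
      ultimately show "openin (X i) {x. (i, x) \<in> {x \<in> topspace (sum_topology X I). (case x of (i, x) \<Rightarrow> (i, f i x)) \<in> U}}"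
        using openin_continuous_map_preimage[OF f[OF i], of "{y. (i, y) \<in> U}"] by (simp only:)
    qed auto
  qed
  have "homeomorphic_maps (sum_topology X I) (sum_topology Y I) (\<lambda>(i, x). (i, f i x)) (\<lambda>(i, y). (i, g i y))"
    unfolding homeomorphic_maps_def
  proof (intro conjI cont)
    show "continuous_map (X i) (Y i) (f i)" "continuous_map (Y i) (X i) (g i)" if "i \<in> I" for i
      using fg[OF that] unfolding homeomorphic_maps_def by auto
  qed (use fg in \<open>auto simp: homeomorphic_maps_def\<close>)
  then show ?thesis unfolding homeomorphic_space_def by blast
qed

context framed_quiver
begin

text \<open>The elements of \<open>polys X\<close> are functions on all records, also on those that are not tuples, whose matrices
  may have other dimensions.\<close>

definition poly_funs_over :: "(('i, 'w) tuple \<Rightarrow> complex) set \<Rightarrow> (('i, 'w) tuple \<Rightarrow> complex) set" where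
  "poly_funs_over X = {f. \<exists>P\<in>polys X. \<forall>y\<in>tuples v. f y = P y}"

abbreviation poly_funs :: "(('i, 'w) tuple \<Rightarrow> complex) set" where
  "poly_funs \<equiv> poly_funs_over (coords v)"

lemma function_algebra_poly_funs: "function_algebra (poly_funs_over X)"
  unfolding function_algebra_def poly_funs_over_def
proof (intro conjI allI ballI CollectI)
  show "\<exists>P\<in>polys X. \<forall>y\<in>tuples v. z = P y" for z by (rule bexI[of _ "\<lambda>_. z"]) (auto intro: polys.const)
next
  fix f g assume "f \<in> {f. \<exists>P\<in>polys X. \<forall>y\<in>tuples v. f y = P y}"
    "g \<in> {f. \<exists>P\<in>polys X. \<forall>y\<in>tuples v. f y = P y}"
  then obtain P Q where "P \<in> polys X" "Q \<in> polys X" "\<forall>y\<in>tuples v. f y = P y" "\<forall>y\<in>tuples v. g y = Q y"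
    by blast
  then show "\<exists>P\<in>polys X. \<forall>y\<in>tuples v. f y + g y = P y" "\<exists>P\<in>polys X. \<forall>y\<in>tuples v. f y * g y = P y"
    by (auto intro: bexI[OF _ polys.add] bexI[OF _ polys.mult])
qed

section \<open>Matrix entries and polynomial functions of a tuple\<close>

definition slot :: "'i arrow \<Rightarrow> int \<Rightarrow> nat \<Rightarrow> nat \<Rightarrow> bool" where
  "slot a m r n \<longleftrightarrow> is_arrow a \<and> r < v (arrow_src a, m + arrow_deg a) \<and> n < v (arrow_tgt a, m)"

lemma slot_coords:
  assumes "slot a m r n"
  shows "(\<lambda>x. op_mat x a m $$ (r, n)) \<in> coords v"
proof (cases a)
  case (Alpha i j)
  then have "c j i < 0" "r < v (j, m + b j i)" "n < v (i, m)"
    using assms c_neg_sym[of i j] b_sym[of i j] by (auto simp: slot_def)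
  then show ?thesis unfolding coords_def Alpha op_mat.simps by blast
next
  case (Eps i)
  then have "r < v (i, m + 2 * d i)" "n < v (i, m)" using assms by (auto simp: slot_def)
  then show ?thesis unfolding coords_def Eps op_mat.simps by blast
qed

lemma coords_cases:
  assumes "f \<in> coords v"
  obtains (slot) a m r n where "slot a m r n" "f = (\<lambda>x. op_mat x a m $$ (r, n))"
  | (ar) l i k u where "Vector_Spaces.linear sc (*) l" "u \<in> carrier_vec (v (i, k))" "f = (\<lambda>x. l (ar x i k u))"
proof -
  consider (al) i j k m n where "c i j < 0" "m < v (i, k + b i j)" "n < v (j, k)" "f = (\<lambda>x. al x i j k $$ (m, n))"
    | (ep) i k m n where "m < v (i, k + 2 * d i)" "n < v (i, k)" "f = (\<lambda>x. ep x i k $$ (m, n))"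
    | (ar') l i k u where "Vector_Spaces.linear sc (*) l" "u \<in> carrier_vec (v (i, k))" "f = (\<lambda>x. l (ar x i k u))"
    using assms unfolding coords_def by blast
  then show ?thesis
  proof cases
    case al
    then show ?thesis using slot[of "Alpha j i" k m n] c_neg_sym[of i j] b_sym[of i j] by (simp add: slot_def)
  next
    case ep
    then show ?thesis using slot[of "Eps i" k m n] by (simp add: slot_def)
  next
    case ar'
    then show ?thesis by (rule ar)
  qed
qed

lemma poly_funs_coords: "f \<in> X \<Longrightarrow> f \<in> poly_funs_over X"
  unfolding poly_funs_over_def by (auto intro: polys.coord)

lemma poly_funs_cong: "f \<in> poly_funs_over X \<Longrightarrow> (\<And>y. y \<in> tuples v \<Longrightarrow> g y = f y) \<Longrightarrow> g \<in> poly_funs_over X"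
  unfolding poly_funs_over_def by auto

definition slots :: "('i arrow \<times> int \<times> nat \<times> nat) set" where
  "slots = {(a, m, r, n). slot a m r n}"

fun entry :: "'i arrow \<times> int \<times> nat \<times> nat \<Rightarrow> ('i, 'w) tuple \<Rightarrow> complex" where
  "entry (a, m, r, n) x = op_mat x a m $$ (r, n)"

text \<open>Polynomials in the arrow entries alone. There are finitely many of these entries, which
  keeps the Taylor expansion of f_2 finite; \<open>coords\<close> also contains all linear forms of
  the framing maps.\<close>

abbreviation slot_funs :: "(('i, 'w) tuple \<Rightarrow> complex) set" where
  "slot_funs \<equiv> poly_funs_over (entry ` slots)"

lemma entry_coords: "entry ` slots \<subseteq> coords v"
proof -
  have "entry (a, m, r, n) = (\<lambda>x. op_mat x a m $$ (r, n))" for a m r n by (simp add: fun_eq_iff)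
  then show ?thesis using slot_coords by (auto simp: slots_def)
qed

lemma slot_funs_poly_funs: "f \<in> slot_funs \<Longrightarrow> f \<in> poly_funs"
  using polys_subset[OF function_algebra_polys, of "entry ` slots" "coords v"] entry_coords polys.coord
  unfolding poly_funs_over_def by blast

lemma slot_funs_entry: "slot a m r n \<Longrightarrow> (\<lambda>x. op_mat x a m $$ (r, n)) \<in> slot_funs"
  by (rule poly_funs_coords) (force simp: slots_def fun_eq_iff image_iff intro!: bexI[of _ "(a, m, r, n)"])

lemma slot_funs_move:
  assumes "is_path (i, w)" "u \<in> carrier_vec (v (path_tgt (i, w), m))" "r < v (i, m + path_deg (i, w))"
  shows "(\<lambda>x. move x m w u $ r) \<in> slot_funs"
  using assms
proof (induction w arbitrary: i r rule: rev_induct)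
  case Nil
  then show ?case using function_algebraD(1)[OF function_algebra_poly_funs] by simp
next
  case (snoc a w)
  have a: "is_arrow a" "arrow_src a = i" "is_path (arrow_tgt a, w)" "path_tgt (i, w @ [a]) = path_tgt (arrow_tgt a, w)"
    using snoc.prems(1) by (auto simp: is_path_append path_tgt_append)
  have dw: "path_deg (arrow_tgt a, w) = path_deg (i, w)" by (rule path_deg_src)
  let ?q = "(arrow_tgt a, m + path_deg (i, w))"
  have u: "u \<in> carrier_vec (v (path_tgt (arrow_tgt a, w), m))" using snoc.prems(2) a(4) by simp
  have "(\<lambda>x. \<Sum>n<v ?q. op_mat x a (m + path_deg (i, w)) $$ (r, n) * move x m w u $ n) \<in> slot_funs"
  proof (intro function_algebra_sum function_algebra_poly_funs function_algebraD(3))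
    fix n assume "n \<in> {..<v ?q}"
    then have n: "n < v ?q" by simp
    show "(\<lambda>x. op_mat x a (m + path_deg (i, w)) $$ (r, n)) \<in> slot_funs"
      by (intro slot_funs_entry) (use snoc.prems(3) a n in \<open>simp add: slot_def add.assoc\<close>)
    show "(\<lambda>x. move x m w u $ n) \<in> slot_funs"
      by (rule snoc.IH[OF a(3) u]) (use n dw in simp)
  qed
  then show ?case
  proof (rule poly_funs_cong)
    fix x assume x: "x \<in> tuples v"
    have A: "op_mat x a (m + path_deg (i, w)) \<in> carrier_mat (v (i, m + path_deg (i, w @ [a]))) (v ?q)"
      using op_mat_carrier[OF x a(1), of "m + path_deg (i, w)"] a(2) by (simp add: add.assoc)
    have y: "move x m w u \<in> carrier_vec (v ?q)" using move_carrier[OF x a(3) u] dw by simp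
    show "move x m (w @ [a]) u $ r = (\<Sum>n<v ?q. op_mat x a (m + path_deg (i, w)) $$ (r, n) * move x m w u $ n)"
      using mult_mat_vec_index[OF A y snoc.prems(3)] move_append[of x m w "[a]" u i] by simp
  qed
qed

lemmas poly_funs_move = slot_funs_poly_funs[OF slot_funs_move]

lemma poly_funs_Psi:
  assumes u: "u \<in> carrier_vec (v q)"
  shows "(\<lambda>x. Psi x q u r p) \<in> poly_funs"
proof (cases "r \<in> {1..s} \<and> is_path p \<and> fst p = ii r \<and> path_tgt p = fst q \<and> snd q + path_deg p = dg r")
  case True
  obtain w where p: "p = (ii r, w)" using True by (cases p) auto
  obtain m where q: "q = (path_tgt (ii r, w), m)" using True p by (cases q) auto
  have w: "is_path (ii r, w)" "m + path_deg (ii r, w) = dg r" using True p q by auto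
  have u': "u \<in> carrier_vec (v (path_tgt (ii r, w), m))" using u q by simp
  let ?n = "v (ii r, dg r)"
  have "(\<lambda>x. \<Sum>n<?n. move x m w u $ n * ph r (ar x (ii r) (dg r) (unit_vec ?n n))) \<in> poly_funs"
  proof (intro function_algebra_sum function_algebra_poly_funs function_algebraD(3))
    fix n assume "n \<in> {..<?n}"
    then show "(\<lambda>x. move x m w u $ n) \<in> poly_funs" using w by (intro poly_funs_move[OF _ u']) auto
    have "(\<lambda>x. ph r (ar x (ii r) (dg r) (unit_vec ?n n))) \<in> coords v"
      unfolding coords_def using ph_linear[of r] unit_vec_carrier by blast
    then show "(\<lambda>x. ph r (ar x (ii r) (dg r) (unit_vec ?n n))) \<in> poly_funs" by (rule poly_funs_coords)
  qed
  then show ?thesis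
  proof (rule poly_funs_cong)
    fix x assume x: "x \<in> tuples v"
    have "move x m w u \<in> carrier_vec ?n" using move_carrier[OF x w(1) u'] w(2) by simp
    from linear_form_expand[OF linear_form_frame_form[OF x] this]
    show "Psi x q u r p = (\<Sum>n<?n. move x m w u $ n * ph r (ar x (ii r) (dg r) (unit_vec ?n n)))"
      using True w p q by (simp add: Psi_def coeff_def frame_form_def del: atLeastAtMost_iff)
  qed
next
  case False
  then have "(\<lambda>x. Psi x q u r p) = (\<lambda>_. 0)" by (auto simp: Psi_def coeff_def fun_eq_iff)
  then show ?thesis using function_algebraD(1)[OF function_algebra_poly_funs] by simp
qed

section \<open>The correspondence between tuples and frames as a homeomorphism\<close>

abbreviation stable_top :: "('i, 'w) tuple topology" where
  "stable_top \<equiv> initial_topology (stable v) (coords v)"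

lemma continuous_map_poly_funs:
  assumes "f \<in> poly_funs"
  shows "continuous_map stable_top euclidean f"
proof -
  obtain P where P: "P \<in> polys (coords v)" "\<And>y. y \<in> tuples v \<Longrightarrow> f y = P y"
    using assms unfolding poly_funs_over_def by blast
  show ?thesis
    by (rule continuous_map_eq[OF continuous_map_polys[OF P(1), of "stable v"]])
      (use P(2) stable_tuples in \<open>auto simp: topspace_initial_topology\<close>)
qed

text \<open>The relations are polynomial equations in the coordinates. Closedness is what permits
  the quotient map of the group to be restricted to this locus.\<close>

lemma closedin_crit_locus: "closedin stable_top crit_locus"
proof -
  define A where "A = {(\<lambda>x. move x m (replicate (nat (- c i j)) (Eps i) @ [Alpha i j]) u $ n
      - move x m (Alpha i j # replicate (nat (- c j i)) (Eps j)) u $ n) | i j m u n.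
      c i j < 0 \<and> u \<in> carrier_vec (v (i, m)) \<and>
      n < v (j, m + path_deg (j, Alpha i j # replicate (nat (- c j i)) (Eps j)))}"
  define B where "B = {(\<lambda>x. \<Sum>j | c i j < 0. \<Sum>k<nat (- c i j). osign i j * move x m (mesh_word i j k) u $ n) | i m u n.
      u \<in> carrier_vec (v (i, m)) \<and> n < v (i, m - 2 * d i)}"
  have paths: "is_path (j, w) \<and> path_tgt (j, w) = i \<and> is_path (j, w') \<and> path_tgt (j, w') = i \<and> path_deg (j, w) = path_deg (j, w')"
    if "c i j < 0" "w = replicate (nat (- c i j)) (Eps i) @ [Alpha i j]" "w' = Alpha i j # replicate (nat (- c j i)) (Eps j)"
    for i j w w'
  proof -
    have "2 * d i * int (nat (- c i j)) = 2 * d j * int (nat (- c j i))"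
      using b_sym[of i j] that(1) c_neg_sym[of i j] by (simp add: b_def)
    then show ?thesis using word_eq_comm[OF that(1)] that by (auto simp: word_eq_def)
  qed
  have AB: "f \<in> poly_funs" if "f \<in> A \<union> B" for f
  proof -
    from that consider "f \<in> A" | "f \<in> B" by blast
    then show ?thesis
    proof cases
      case 1
      then obtain i j m u n where f: "f = (\<lambda>x. move x m (replicate (nat (- c i j)) (Eps i) @ [Alpha i j]) u $ n
        - move x m (Alpha i j # replicate (nat (- c j i)) (Eps j)) u $ n)"
        and c: "c i j < 0" "u \<in> carrier_vec (v (i, m))"
        "n < v (j, m + path_deg (j, Alpha i j # replicate (nat (- c j i)) (Eps j)))" unfolding A_def by blast
      show ?thesis unfolding f
        using paths[OF c(1) refl refl] c(2,3)
        by (intro function_algebra_diff function_algebra_poly_funs poly_funs_move[of j]) (simp_all only:)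
    next
      case 2
      then obtain i m u n where f: "f = (\<lambda>x. \<Sum>j | c i j < 0. \<Sum>k<nat (- c i j). osign i j * move x m (mesh_word i j k) u $ n)"
        and c: "u \<in> carrier_vec (v (i, m))" "n < v (i, m - 2 * d i)" unfolding B_def by blast
      show ?thesis unfolding f
      proof (intro function_algebra_sum function_algebra_scale function_algebra_poly_funs poly_funs_move[of i])
        fix j k assume "j \<in> {j. c i j < 0}" "k \<in> {..<nat (- c i j)}"
        then have jk: "c i j < 0" "k < nat (- c i j)" by auto
        show "is_path (i, mesh_word i j k)" by (rule is_path_mesh_word[OF jk(1)])
        show "u \<in> carrier_vec (v (path_tgt (i, mesh_word i j k), m))" using c(1) by (simp add: path_tgt_mesh_word)
        show "n < v (i, m + path_deg (i, mesh_word i j k))" using c(2) path_deg_mesh_word[OF jk] by simp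
      qed
    qed
  qed
  have "crit_locus = {x \<in> stable v. \<forall>f\<in>A \<union> B. f x = 0}"
  proof (intro subset_antisym subsetI CollectI conjI ballI)
    fix x f assume x: "x \<in> crit_locus" and f: "f \<in> A \<union> B"
    note R = crit_locus_relations[OF x, unfolded relations_def]
    from f show "f x = 0"
    proof
      assume "f \<in> A"
      then obtain i j m u n where f: "f = (\<lambda>x. move x m (replicate (nat (- c i j)) (Eps i) @ [Alpha i j]) u $ n
        - move x m (Alpha i j # replicate (nat (- c j i)) (Eps j)) u $ n)"
        and c: "c i j < 0" "u \<in> carrier_vec (v (i, m))" unfolding A_def by blast
      have "move x m (replicate (nat (- c i j)) (Eps i) @ [Alpha i j]) u
          = move x m (Alpha i j # replicate (nat (- c j i)) (Eps j)) u" using R c by blast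
      then show ?thesis unfolding f by (simp only: diff_self)
    next
      assume "f \<in> B"
      then obtain i m u n where f: "f = (\<lambda>x. \<Sum>j | c i j < 0. \<Sum>k<nat (- c i j). osign i j * move x m (mesh_word i j k) u $ n)"
        and c: "u \<in> carrier_vec (v (i, m))" "n < v (i, m - 2 * d i)" unfolding B_def by blast
      show ?thesis unfolding f using conjunct2[OF R] c by simp
    qed
  next
    fix x assume x: "x \<in> {x \<in> stable v. \<forall>f\<in>A \<union> B. f x = 0}"
    then have xs: "x \<in> stable v" and xt: "x \<in> tuples v" using stable_tuples by auto
    have "move x m (replicate (nat (- c i j)) (Eps i) @ [Alpha i j]) u = move x m (Alpha i j # replicate (nat (- c j i)) (Eps j)) u"
      if c: "c i j < 0" and u: "u \<in> carrier_vec (v (i, m))" for i j m u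
    proof -
      define w w' where w: "w = replicate (nat (- c i j)) (Eps i) @ [Alpha i j]" "w' = Alpha i j # replicate (nat (- c j i)) (Eps j)"
      note P = paths[OF c w]
      have cw: "move x m w u \<in> carrier_vec (v (j, m + path_deg (j, w')))" "move x m w' u \<in> carrier_vec (v (j, m + path_deg (j, w')))"
        using move_carrier[OF xt, of j w u m] move_carrier[OF xt, of j w' u m] P u by auto
      have "move x m w u = move x m w' u"
      proof (rule eq_vecI)
        fix n assume "n < dim_vec (move x m w' u)"
        then have "n < v (j, m + path_deg (j, w'))" using cw by auto
        then have "(\<lambda>x. move x m w u $ n - move x m w' u $ n) \<in> A" using c u unfolding A_def w
          by (intro CollectI exI[of _ i] exI[of _ j] exI[of _ m] exI[of _ u] exI[of _ n] conjI refl)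
        then have "(\<lambda>x. move x m w u $ n - move x m w' u $ n) \<in> A \<union> B" by (rule UnI1)
        with x have "(\<lambda>x. move x m w u $ n - move x m w' u $ n) x = 0" by (elim CollectE conjE bspec)
        then show "move x m w u $ n = move x m w' u $ n" by (rule iffD2[OF eq_iff_diff_eq_0])
      qed (use cw in auto)
      then show ?thesis unfolding w .
    qed
    moreover have "(\<Sum>j | c i j < 0. \<Sum>k<nat (- c i j). osign i j * move x m (mesh_word i j k) u $ n) = 0"
      if "u \<in> carrier_vec (v (i, m))" "n < v (i, m - 2 * d i)" for i m u n
    proof -
      have "(\<lambda>x. \<Sum>j | c i j < 0. \<Sum>k<nat (- c i j). osign i j * move x m (mesh_word i j k) u $ n) \<in> B"
        using that unfolding B_def by blast
      then show ?thesis using x by fastforce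
    qed
    ultimately show "x \<in> crit_locus" using xs unfolding crit_locus_def relations_def by blast
  qed (auto simp: crit_locus_stable)
  \<comment> \<open>The zero function is inserted so that the family is nonempty and its
    intersection stays in the stable locus even without any equation.\<close>
  also have "\<dots> = \<Inter>((\<lambda>f. {x \<in> topspace stable_top. f x \<in> {0}}) ` (insert (\<lambda>_. 0) (A \<union> B)))"
    by (auto simp: topspace_initial_topology)
  also have "closedin stable_top \<dots>"
  proof (rule closedin_Inter)
    fix C assume "C \<in> (\<lambda>f. {x \<in> topspace stable_top. f x \<in> {0}}) ` (insert (\<lambda>_. 0) (A \<union> B))"
    then obtain f where f: "f \<in> insert (\<lambda>_. 0) (A \<union> B)" "C = {x \<in> topspace stable_top. f x \<in> {0}}" by blast
    then have "f \<in> poly_funs" using AB function_algebraD(1)[OF function_algebra_poly_funs] by auto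
    then show "closedin stable_top C"
      unfolding f(2) by (intro closedin_continuous_map_preimage[OF continuous_map_poly_funs]) auto
  qed simp
  finally show ?thesis .
qed

text \<open>A quotient map restricts to a quotient map over a closed subset of its target. The
  preimage of the critical orbits is the critical locus itself because automorphisms preserve the
  relations.\<close>

lemma quotient_map_crit_locus:
  "quotient_map (subtopology stable_top crit_locus) (subtopology (M_component v) (orbit v ` crit_locus)) (orbit v)"
proof (rule quotient_map_restriction)
  show quo: "quotient_map stable_top (M_component v) (orbit v)"
    unfolding M_component_def by (rule quotient_map_final_topology)
  show U: "{x \<in> topspace stable_top. orbit v x \<in> orbit v ` crit_locus} = crit_locus"
  proof (intro subset_antisym subsetI)
    fix x assume "x \<in> {x \<in> topspace stable_top. orbit v x \<in> orbit v ` crit_locus}"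
    then obtain y where x: "x \<in> stable v" and y: "y \<in> crit_locus" "orbit v x = orbit v y"
      by (auto simp: topspace_initial_topology)
    then have "x \<in> orbit v y" using orbit_refl by blast
    then show "x \<in> crit_locus" using crit_locus_act[OF y(1)] by (metis orbitE)
  qed (auto simp: topspace_initial_topology crit_locus_stable)
  have "orbit v ` crit_locus \<subseteq> topspace (M_component v)"
    using crit_locus_stable unfolding M_component_def topspace_final_topology by (auto simp: topspace_initial_topology)
  then have "closedin (M_component v) (orbit v ` crit_locus)"
    using spec[OF conjunct2[OF quo[unfolded quotient_map_closedin]], of "orbit v ` crit_locus"] closedin_crit_locus
    unfolding U by (simp only: simp_thms)
  then show "openin (M_component v) (orbit v ` crit_locus) \<or> closedin (M_component v) (orbit v ` crit_locus)" ..
qed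

lemma continuous_map_psi: "continuous_map (subtopology stable_top crit_locus) (subtopology euclidean Frames) psi"
proof -
  have "continuous_map stable_top euclidean psi"
    unfolding continuous_map_into_fun
  proof (intro allI)
    fix q n r p
    show "continuous_map stable_top euclidean (\<lambda>x. psi x q n r p)"
      using continuous_map_poly_funs[OF poly_funs_Psi[of "unit_vec (v q) n" q r p]]
      by (cases "n < v q") (simp_all add: psi_def)
  qed
  then have "continuous_map (subtopology stable_top crit_locus) euclidean psi" by (rule continuous_map_from_subtopology)
  then show ?thesis
    unfolding continuous_map_in_subtopology using psi_Frames by auto
qed

lemma continuous_on_coordinate: "continuous_on S (\<lambda>F. F q n r p)" for S :: "('i \<times> int \<Rightarrow> nat \<Rightarrow> nat \<Rightarrow> 'i path \<Rightarrow> complex) set"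
proof -
  have "continuous_map (top_of_set S) euclidean (\<lambda>F. F)" by simp
  then have "continuous_map (top_of_set S) euclidean (\<lambda>F. F q n r p)"
    unfolding continuous_map_into_fun by blast
  then show ?thesis by simp
qed

lemma function_algebra_continuous_on: "function_algebra {f :: 'x::topological_space \<Rightarrow> complex. continuous_on S f}"
  unfolding function_algebra_def by (auto intro: continuous_intros)

lemma frame_dual:
  assumes "independent_frame F"
  obtains T l where "finite T" "\<And>m k. m < v q \<Longrightarrow> k < v q \<Longrightarrow>
    (\<Sum>t\<in>T. l m t * F q k (fst t) (snd t)) = (if m = k then 1 else 0)"
proof -
  have "\<exists>T l. finite T \<and> (\<forall>m<v q. \<forall>k<v q. (\<Sum>t\<in>T. l m t * (\<lambda>t. F q k (fst t) (snd t)) t) = (if m = k then 1 else 0))"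
  proof (rule dual_family)
    fix u assume u: "\<And>t. (\<Sum>m<v q. u m * F q m (fst t) (snd t)) = 0"
    have "comb F q (vec (v q) u) = 0"
      using u[of "(_, _)"] by (simp add: comb_def fun_eq_iff)
    then have "vec (v q) u = 0\<^sub>v (v q)"
      using assms vec_carrier[of "v q" u] unfolding independent_frame_def by blast
    then show "\<forall>m<v q. u m = 0" by (metis index_vec index_zero_vec(1))
  qed
  then show ?thesis using that by blast
qed

text \<open>Cramer's rule for the matrix of an arrow in the frame, tested against finitely many evaluations.\<close>

lemma continuous_on_op_mat_theta:
  assumes sl: "slot a m r0 n0"
  shows "continuous_on Frames (\<lambda>F. op_mat (theta F) a m $$ (r0, n0))"
  unfolding continuous_on_def
proof
  fix F0 assume F0: "F0 \<in> Frames"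
  let ?q = "(arrow_src a, m + arrow_deg a)" and ?q' = "(arrow_tgt a, m)"
  have a: "is_arrow a" "r0 < v ?q" "n0 < v ?q'" using sl by (auto simp: slot_def)
  obtain T l where T: "finite T" and l: "\<And>k k'. k < v ?q \<Longrightarrow> k' < v ?q \<Longrightarrow>
    (\<Sum>t\<in>T. l k t * F0 ?q k' (fst t) (snd t)) = (if k = k' then 1 else 0)"
    using frame_dual[OF FramesE(1)[OF F0], of ?q] by blast
  define G where "G F = mat (v ?q) (v ?q) (\<lambda>(k, k'). \<Sum>t\<in>T. l k t * F ?q k' (fst t) (snd t))"
    for F :: "'i \<times> int \<Rightarrow> nat \<Rightarrow> nat \<Rightarrow> 'i path \<Rightarrow> complex"
  define D where "D F = mat (v ?q) (v ?q') (\<lambda>(k, n). \<Sum>t\<in>T. l k t * shift a (F ?q' n) (fst t) (snd t))"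
    for F :: "'i \<times> int \<Rightarrow> nat \<Rightarrow> nat \<Rightarrow> 'i path \<Rightarrow> complex"
  have G: "G F \<in> carrier_mat (v ?q) (v ?q)" and D: "D F \<in> carrier_mat (v ?q) (v ?q')" for F
    by (simp_all add: G_def D_def)
  have A: "op_mat (theta F) a m \<in> carrier_mat (v ?q) (v ?q')" for F
    by (rule op_mat_carrier[OF theta_tuples a(1)])
  have GA: "G F * op_mat (theta F) a m = D F" if F: "F \<in> Frames" for F
  proof (rule eq_matI)
    fix k n assume "k < dim_row (D F)" "n < dim_col (D F)"
    then have kn: "k < v ?q" "n < v ?q'" by (auto simp: D_def)
    have col: "(\<Sum>k'<v ?q. op_mat (theta F) a m $$ (k', n) * F ?q k' r p) = shift a (F ?q' n) r p" for r p
    proof -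
      have u: "unit_vec (v ?q') n \<in> carrier_vec (v ?q')" by simp
      have "comb F ?q (op_mat (theta F) a m *\<^sub>v unit_vec (v ?q') n) r p = shift a (F ?q' n) r p"
        unfolding shift_comb[OF F a(1) u] comb_unit_vec[OF kn(2)] ..
      then show ?thesis unfolding comb_def using mult_mat_unit_vec_index[OF A _ kn(2)] by simp
    qed
    have "(G F * op_mat (theta F) a m) $$ (k, n)
        = (\<Sum>k'<v ?q. (\<Sum>t\<in>T. l k t * F ?q k' (fst t) (snd t)) * op_mat (theta F) a m $$ (k', n))"
      unfolding mat_mult_index[OF G A kn] using kn by (intro sum.cong refl) (simp add: G_def)
    also have "\<dots> = (\<Sum>t\<in>T. l k t * (\<Sum>k'<v ?q. op_mat (theta F) a m $$ (k', n) * F ?q k' (fst t) (snd t)))"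
      unfolding sum_distrib_left sum_distrib_right by (subst sum.swap) (simp add: mult_ac)
    also have "\<dots> = D F $$ (k, n)" unfolding col using kn by (simp add: D_def)
    finally show "(G F * op_mat (theta F) a m) $$ (k, n) = D F $$ (k, n)" .
  qed (simp_all add: G_def D_def carrier_matD[OF A])
  have cramer: "det (G F) * op_mat (theta F) a m $$ (r0, n0) = (\<Sum>k<v ?q. adj_mat (G F) $$ (r0, k) * D F $$ (k, n0))"
    if F: "F \<in> Frames" for F
  proof -
    have "adj_mat (G F) * D F = (adj_mat (G F) * G F) * op_mat (theta F) a m"
      unfolding GA[OF F, symmetric] by (rule assoc_mult_mat[OF adj_mat(1)[OF G] G A, symmetric])
    also have "\<dots> = det (G F) \<cdot>\<^sub>m op_mat (theta F) a m"
      unfolding adj_mat(3)[OF G] by (simp add: mult_smult_assoc_mat[OF one_carrier_mat A] left_mult_one_mat[OF A])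
    finally have "(adj_mat (G F) * D F) $$ (r0, n0) = det (G F) * op_mat (theta F) a m $$ (r0, n0)"
      using a carrier_matD[OF A, of F] by simp
    then show ?thesis unfolding mat_mult_index[OF adj_mat(1)[OF G] D a(2,3)] by simp
  qed
  let ?C = "{f. continuous_on Frames f}"
  note alg = function_algebra_continuous_on[of Frames]
  have Gc: "(\<lambda>F. G F $$ (i, j)) \<in> ?C" if "i < v ?q" "j < v ?q" for i j
  proof -
    have "(\<lambda>F. \<Sum>t\<in>T. l i t * F ?q j (fst t) (snd t)) \<in> ?C"
      by (intro function_algebra_sum[OF alg] function_algebra_scale[OF alg]) (simp add: continuous_on_coordinate)
    then show ?thesis using that by (simp add: G_def)
  qed
  have Dc: "(\<lambda>F. D F $$ (i, j)) \<in> ?C" if "i < v ?q" "j < v ?q'" for i j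
  proof -
    have "(\<lambda>F. \<Sum>t\<in>T. l i t * shift a (F ?q' j) (fst t) (snd t)) \<in> ?C"
    proof (intro function_algebra_sum[OF alg] function_algebra_scale[OF alg])
      fix t
      show "(\<lambda>F. shift a (F ?q' j) (fst t) (snd t)) \<in> ?C"
        by (cases "is_path (fst (snd t), a # snd (snd t))") (simp_all only: shift_def if_True if_False mem_Collect_eq
            continuous_on_coordinate continuous_on_const)
    qed
    then show ?thesis using that by (simp add: D_def)
  qed
  have det: "continuous_on Frames (\<lambda>F. det (G F))"
    using function_algebra_det[OF alg G Gc] by simp
  have num: "continuous_on Frames (\<lambda>F. \<Sum>k<v ?q. adj_mat (G F) $$ (r0, k) * D F $$ (k, n0))"
    using function_algebra_sum[OF alg, of "{..<v ?q}" "\<lambda>k F. adj_mat (G F) $$ (r0, k) * D F $$ (k, n0)"]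
      function_algebraD(3)[OF alg function_algebra_adj_mat[OF alg G Gc] Dc] a by auto
  \<comment> \<open>At \<open>F0\<close> the functionals are dual to the frame, so the linear system
    for the matrix has determinant 1 there and remains solvable nearby.\<close>
  have "G F0 = 1\<^sub>m (v ?q)" using l by (intro eq_matI) (auto simp: G_def)
  then have d0: "det (G F0) \<noteq> 0" by simp
  have lim: "((\<lambda>F. (\<Sum>k<v ?q. adj_mat (G F) $$ (r0, k) * D F $$ (k, n0)) / det (G F))
      \<longlongrightarrow> (\<Sum>k<v ?q. adj_mat (G F0) $$ (r0, k) * D F0 $$ (k, n0)) / det (G F0)) (at F0 within Frames)"
    using num det F0 d0 unfolding continuous_on_def by (intro tendsto_divide) auto
  have "((\<lambda>F. det (G F)) \<longlongrightarrow> det (G F0)) (at F0 within Frames)" using det F0 unfolding continuous_on_def by blast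
  then have ev: "\<forall>\<^sub>F F in at F0 within Frames. det (G F) \<noteq> 0" using d0 by (rule tendsto_imp_eventually_ne)
  have "\<forall>\<^sub>F F in at F0 within Frames. (\<Sum>k<v ?q. adj_mat (G F) $$ (r0, k) * D F $$ (k, n0)) / det (G F)
      = op_mat (theta F) a m $$ (r0, n0)"
  proof -
    have "\<forall>\<^sub>F F in at F0 within Frames. F \<in> Frames" by (simp add: eventually_at_filter)
    with ev show ?thesis by eventually_elim (simp add: cramer[symmetric])
  qed
  from Lim_transform_eventually[OF lim this]
  have "((\<lambda>F. op_mat (theta F) a m $$ (r0, n0))
      \<longlongrightarrow> (\<Sum>k<v ?q. adj_mat (G F0) $$ (r0, k) * D F0 $$ (k, n0)) / det (G F0)) (at F0 within Frames)" .
  then show "((\<lambda>F. op_mat (theta F) a m $$ (r0, n0)) \<longlongrightarrow> op_mat (theta F0) a m $$ (r0, n0)) (at F0 within Frames)"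
    unfolding cramer[OF F0, symmetric] nonzero_mult_div_cancel_left[OF d0] .
qed

lemma continuous_map_theta: "continuous_map (subtopology euclidean Frames) (subtopology stable_top crit_locus) theta"
  unfolding continuous_map_in_subtopology
proof
  show "continuous_map (subtopology euclidean Frames) stable_top theta"
  proof (rule continuous_map_into_initial_topology)
    show "theta ` topspace (subtopology euclidean Frames) \<subseteq> stable v" using theta_stable by auto
    fix f assume "f \<in> coords v"
    then show "continuous_map (subtopology euclidean Frames) euclidean (\<lambda>F. f (theta F))"
    proof (cases rule: coords_cases)
      case (slot a m r n)
      then show ?thesis using continuous_on_op_mat_theta by simp
    next
      case (ar l i k u)
      interpret l: Vector_Spaces.linear sc "(*)" l by (rule ar(1))
      have eq: "(\<lambda>F. f (theta F)) = (\<lambda>F. \<Sum>r\<in>{r\<in>{1..s}. (ii r, kk r) = (i, k - d i)}.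
          (\<Sum>n<v (i, k). u $ n * F (i, k) n r (i, [])) * l (e r))"
        using ar by (simp add: theta_def l.sum l.scale comb_def)
      show ?thesis
        unfolding eq continuous_map_iff_continuous by (intro continuous_intros continuous_on_coordinate)
    qed
  qed
  show "theta \<in> topspace (subtopology euclidean Frames) \<rightarrow> crit_locus" using theta_crit_locus by auto
qed

lemma crit_component_homeomorphic:
  "subtopology (M_component v) (orbit v ` crit_locus) homeomorphic_space Gr_component s ii dg v"
proof (rule homeomorphic_space_quotients[OF quotient_map_crit_locus _ continuous_map_psi continuous_map_theta])
  show "quotient_map (subtopology euclidean Frames) (Gr_component s ii dg v) frame_span"
    unfolding Gr_component_def by (rule quotient_map_final_topology)
  have top: "topspace (subtopology stable_top crit_locus) = crit_locus"
    using crit_locus_stable by (auto simp: topspace_initial_topology)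
  show "theta (psi x) = x" if "x \<in> topspace (subtopology stable_top crit_locus)" for x
    using that theta_psi unfolding top by blast
  show "psi (theta F) = F" if "F \<in> topspace (subtopology euclidean Frames)" for F
    using that psi_theta by simp
  show "orbit v x = orbit v y \<longleftrightarrow> frame_span (psi x) = frame_span (psi y)"
    if "x \<in> topspace (subtopology stable_top crit_locus)" "y \<in> topspace (subtopology stable_top crit_locus)" for x y
    using that orbit_eq_iff unfolding top by blast
qed

section \<open>Derivatives along matrix entries\<close>

definition elem_mat :: "'i arrow \<Rightarrow> int \<Rightarrow> nat \<Rightarrow> nat \<Rightarrow> complex \<Rightarrow> complex mat" where
  "elem_mat a m r n t = mat (v (arrow_src a, m + arrow_deg a)) (v (arrow_tgt a, m))
     (\<lambda>(r', n'). if r' = r \<and> n' = n then t else 0)"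

text \<open>Adds \<open>t\<close> to a single matrix entry of an arrow. The framing maps are kept
  fixed because f_2 does not depend on them.\<close>

definition vary :: "('i, 'w) tuple \<Rightarrow> 'i arrow \<Rightarrow> int \<Rightarrow> nat \<Rightarrow> nat \<Rightarrow> complex \<Rightarrow> ('i, 'w) tuple" where
  "vary y a m r n t = \<lparr>
     al = (\<lambda>i j k. if a = Alpha j i \<and> k = m then al y i j k + elem_mat a m r n t else al y i j k),
     ar = ar y,
     ep = (\<lambda>i k. if a = Eps i \<and> k = m then ep y i k + elem_mat a m r n t else ep y i k)\<rparr>"

lemma op_mat_vary: "op_mat (vary y a m r n t) a' m' =
    (if a' = a \<and> m' = m then op_mat y a m + elem_mat a m r n t else op_mat y a' m')"
  by (cases a') (auto simp: vary_def)

lemma ar_vary [simp]: "ar (vary y a m r n t) = ar y"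
  by (simp add: vary_def)

lemma elem_mat_carrier: "elem_mat a m r n t \<in> carrier_mat (v (arrow_src a, m + arrow_deg a)) (v (arrow_tgt a, m))"
  by (simp add: elem_mat_def)

lemma op_mat_vary_index:
  assumes y: "y \<in> tuples v" and a': "is_arrow a'" "r' < v (arrow_src a', m' + arrow_deg a')" "n' < v (arrow_tgt a', m')"
  shows "op_mat (vary y a m r n t) a' m' $$ (r', n') =
    op_mat y a' m' $$ (r', n') + (if a' = a \<and> m' = m \<and> r' = r \<and> n' = n then t else 0)"
  using a' elem_mat_carrier[of a m r n t] op_mat_carrier[OF y a'(1), of m']
  by (auto simp: op_mat_vary) (auto simp: elem_mat_def)

lemma vary_tuples:
  assumes y: "y \<in> tuples v" and a: "is_arrow a"
  shows "vary y a m r n t \<in> tuples v"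
proof -
  have "op_mat (vary y a m r n t) a' m' \<in> carrier_mat (v (arrow_src a', m' + arrow_deg a')) (v (arrow_tgt a', m'))"
    if "is_arrow a'" for a' m'
    using op_mat_carrier[OF y that, of m'] elem_mat_carrier[of a m r n t] by (auto simp: op_mat_vary)
  note c = this
  have 1: "al (vary y a m r n t) i j k \<in> carrier_mat (v (i, k + b i j)) (v (j, k))" if "c i j < 0" for i j k
    using c[of "Alpha j i" k] that c_neg_sym[of i j] b_sym[of i j] by simp
  have 2: "ep (vary y a m r n t) i k \<in> carrier_mat (v (i, k + 2 * d i)) (v (i, k))" for i k
    using c[of "Eps i" k] by simp
  have 3: "al (vary y a m r n t) i j k = 0\<^sub>m 0 0" if "\<not> c i j < 0" for i j k
  proof -
    have "a \<noteq> Alpha j i" using a that c_neg_sym[of i j] by auto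
    then show ?thesis using y that unfolding tuples_def vary_def by auto
  qed
  have "\<forall>i j k. if c i j < 0 then al (vary y a m r n t) i j k \<in> carrier_mat (v (i, k + b i j)) (v (j, k))
      else al (vary y a m r n t) i j k = 0\<^sub>m 0 0" using 1 3 by simp
  moreover have "\<forall>i k. ep (vary y a m r n t) i k \<in> carrier_mat (v (i, k + 2 * d i)) (v (i, k))" using 2 by simp
  ultimately show ?thesis
    using y unfolding tuples_def mem_Collect_eq ar_vary by (elim conjE, intro conjI)
qed

lemma vary_0:
  assumes y: "y \<in> tuples v" and a: "is_arrow a"
  shows "vary y a m r n 0 = y"
proof -
  have z: "elem_mat a m r n 0 = 0\<^sub>m (v (arrow_src a, m + arrow_deg a)) (v (arrow_tgt a, m))"
    by (rule eq_matI) (auto simp: elem_mat_def)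
  have "op_mat (vary y a m r n 0) a' m' = op_mat y a' m'" for a' m'
    using op_mat_carrier[OF y a, of m] z by (auto simp: op_mat_vary)
  from this[of "Alpha _ _"] this[of "Eps _"] show ?thesis by (intro tuple.equality ext) auto
qed

lemma poly_funs_differentiable:
  assumes y: "y \<in> tuples v" and sl: "slot a m r n" and f: "f \<in> poly_funs"
  shows "\<exists>D. ((\<lambda>t. f (vary y a m r n t)) has_field_derivative D) (at 0)"
proof -
  let ?A = "{f. \<exists>D. ((\<lambda>t. f (vary y a m r n t)) has_field_derivative D) (at 0)}"
  have a: "is_arrow a" using sl by (simp add: slot_def)
  have alg: "function_algebra ?A"
    unfolding function_algebra_def
  proof (intro conjI allI ballI)
    show "(\<lambda>_. z) \<in> ?A" for z by (auto intro: DERIV_const)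
  next
    fix f g assume "f \<in> ?A" "g \<in> ?A"
    then obtain D D' where D: "((\<lambda>t. f (vary y a m r n t)) has_field_derivative D) (at 0)"
      "((\<lambda>t. g (vary y a m r n t)) has_field_derivative D') (at 0)" by blast
    show "(\<lambda>x. f x + g x) \<in> ?A" "(\<lambda>x. f x * g x) \<in> ?A"
      using DERIV_add[OF D] DERIV_mult[OF D] by blast+
  qed
  have "coords v \<subseteq> ?A"
  proof
    fix g assume "g \<in> coords v"
    then show "g \<in> ?A"
    proof (cases rule: coords_cases)
      case (slot a' m' r' n')
      then have "(\<lambda>t. g (vary y a m r n t)) = (\<lambda>t. op_mat y a' m' $$ (r', n') + (if a' = a \<and> m' = m \<and> r' = r \<and> n' = n then t else 0))"
        using op_mat_vary_index[OF y] by (simp add: slot_def)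
      then show ?thesis
        by (cases "a' = a \<and> m' = m \<and> r' = r \<and> n' = n") (auto intro!: exI derivative_eq_intros)
    next
      case (ar l i k u)
      then show ?thesis by (auto intro!: exI derivative_eq_intros)
    qed
  qed
  from polys_subset[OF alg this] obtain P where P: "P \<in> polys (coords v)" "P \<in> ?A" "\<And>z. z \<in> tuples v \<Longrightarrow> f z = P z"
    using f unfolding poly_funs_over_def by blast
  then show ?thesis using vary_tuples[OF y a] by simp
qed

text \<open>The Leibniz term for the letter at position \<open>l\<close> of the word. The prefix is
  read off at the column \<open>n\<close> of the varied entry, and the suffix is applied to the unit
  vector of its row \<open>r\<close>. The term is zero unless that letter is \<open>a\<close> and
  acts in degree \<open>m\<close>.\<close>

definition split_term :: "('i, 'w) tuple \<Rightarrow> 'i arrow \<Rightarrow> int \<Rightarrow> nat \<Rightarrow> nat \<Rightarrow> int \<Rightarrow> 'i arrow list \<Rightarrow> complex vec \<Rightarrow> nat \<Rightarrow> nat \<Rightarrow> complex" where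
  "split_term y a m r n k w u q l = (if w ! l = a \<and> k + path_deg (arrow_src a, take l w) = m
     then move y k (take l w) u $ n * move y (m + arrow_deg a) (drop (Suc l) w) (unit_vec (v (arrow_src a, m + arrow_deg a)) r) $ q
     else 0)"

text \<open>The Leibniz rule. The induction adds letters at the end of the word because these act
  last, so that one step differentiates a single matrix product.\<close>

lemma move_deriv:
  assumes y: "y \<in> tuples v" and sl: "slot a m r n"
    and w: "is_path (i, w)" and u: "u \<in> carrier_vec (v (path_tgt (i, w), k))" and q: "q < v (i, k + path_deg (i, w))"
  shows "((\<lambda>t. move (vary y a m r n t) k w u $ q) has_field_derivative
    (\<Sum>l<length w. split_term y a m r n k w u q l)) (at 0)"
  using w u q
proof (induction w arbitrary: i q rule: rev_induct)
  case Nil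
  then show ?case by simp
next
  case (snoc a' w)
  have a: "is_arrow a" using sl by (simp add: slot_def)
  have a': "is_arrow a'" "arrow_src a' = i" "is_path (arrow_tgt a', w)" "path_tgt (i, w @ [a']) = path_tgt (arrow_tgt a', w)"
    using snoc.prems(1) by (auto simp: is_path_append path_tgt_append)
  have dw: "path_deg (arrow_tgt a', w) = path_deg (i, w)" by (rule path_deg_src)
  let ?k = "k + path_deg (i, w)"
  let ?q = "(arrow_tgt a', ?k)" and ?q' = "(i, k + path_deg (i, w @ [a']))"
  have u: "u \<in> carrier_vec (v (path_tgt (arrow_tgt a', w), k))" using snoc.prems(2) a'(4) by simp
  have mc: "move z k w u \<in> carrier_vec (v ?q)" if "z \<in> tuples v" for z
    using move_carrier[OF that a'(3) u] dw by simp
  have A: "op_mat z a' ?k \<in> carrier_mat (v ?q') (v ?q)" if "z \<in> tuples v" for z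
    using op_mat_carrier[OF that a'(1), of ?k] a'(2) by (simp add: add.assoc)
  have q': "q < v ?q'" using snoc.prems(3) .
  have q'': "q < v (arrow_src a', ?k + arrow_deg a')" using q' a'(2) by (simp add: add.assoc)
  have step: "move z k (w @ [a']) u $ q = (\<Sum>p<v ?q. op_mat z a' ?k $$ (q, p) * move z k w u $ p)"
    if "z \<in> tuples v" for z
    using mult_mat_vec_index[OF A[OF that] mc[OF that] q'] move_append[of z k w "[a']" u i] by simp
  let ?\<delta> = "\<lambda>p. if a' = a \<and> ?k = m \<and> q = r \<and> p = n then 1 else (0::complex)"
  have "((\<lambda>t. \<Sum>p<v ?q. op_mat (vary y a m r n t) a' ?k $$ (q, p) * move (vary y a m r n t) k w u $ p) has_field_derivative
     (\<Sum>p<v ?q. ?\<delta> p * move y k w u $ p + op_mat y a' ?k $$ (q, p) * (\<Sum>l<length w. split_term y a m r n k w u p l))) (at 0)"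
  proof (rule DERIV_sum)
    fix p assume "p \<in> {..<v ?q}"
    then have p: "p < v ?q" by simp
    have "((\<lambda>t. op_mat y a' ?k $$ (q, p) + (if a' = a \<and> ?k = m \<and> q = r \<and> p = n then t else 0)) has_field_derivative ?\<delta> p) (at 0)"
      by (cases "a' = a \<and> ?k = m \<and> q = r \<and> p = n") (auto intro!: derivative_eq_intros)
    then have D1: "((\<lambda>t. op_mat (vary y a m r n t) a' ?k $$ (q, p)) has_field_derivative ?\<delta> p) (at 0)"
      using op_mat_vary_index[OF y a'(1) q'', of p a m r n] p by simp
    have D2: "((\<lambda>t. move (vary y a m r n t) k w u $ p) has_field_derivative (\<Sum>l<length w. split_term y a m r n k w u p l)) (at 0)"
      by (rule snoc.IH[OF a'(3) u]) (use p dw in simp)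
    show "((\<lambda>t. op_mat (vary y a m r n t) a' ?k $$ (q, p) * move (vary y a m r n t) k w u $ p) has_field_derivative
       (?\<delta> p * move y k w u $ p + op_mat y a' ?k $$ (q, p) * (\<Sum>l<length w. split_term y a m r n k w u p l))) (at 0)"
      using DERIV_mult[OF D1 D2] by (simp add: vary_0[OF y a] add.commute mult.commute)
  qed
  also have "(\<Sum>p<v ?q. ?\<delta> p * move y k w u $ p + op_mat y a' ?k $$ (q, p) * (\<Sum>l<length w. split_term y a m r n k w u p l))
     = split_term y a m r n k (w @ [a']) u q (length w) + (\<Sum>l<length w. split_term y a m r n k (w @ [a']) u q l)"
  proof -
    have e1: "(\<Sum>p<v ?q. ?\<delta> p * move y k w u $ p) = split_term y a m r n k (w @ [a']) u q (length w)"
    proof (cases "a' = a \<and> ?k = m")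
      case True
      then have n: "n < v ?q" and r: "r < v ?q'" using sl a'(2) by (auto simp: slot_def add.assoc)
      have "(\<Sum>p<v ?q. ?\<delta> p * move y k w u $ p) = (\<Sum>p<v ?q. if p = n then (if q = r then move y k w u $ n else 0) else 0)"
        using True by (intro sum.cong) auto
      also have "\<dots> = (if q = r then move y k w u $ n else 0)" using n by simp
      also have "\<dots> = split_term y a m r n k (w @ [a']) u q (length w)"
        using True a'(2) q'' r unfolding split_term_def by (auto simp: add.assoc)
      finally show ?thesis .
    next
      case False
      then show ?thesis using path_deg_src[of "arrow_src a" w i] by (auto simp: split_term_def)
    qed
    have e2: "(\<Sum>p<v ?q. op_mat y a' ?k $$ (q, p) * split_term y a m r n k w u p l) = split_term y a m r n k (w @ [a']) u q l"
      if l: "l < length w" for l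
    proof (cases "w ! l = a \<and> k + path_deg (arrow_src a, take l w) = m")
      case False
      then show ?thesis using l by (auto simp: split_term_def nth_append)
    next
      case True
      let ?e = "unit_vec (v (arrow_src a, m + arrow_deg a)) r :: complex vec"
      let ?w' = "drop (Suc l) w"
      have ws: "w = take l w @ a # ?w'" using True l by (metis id_take_nth_drop)
      then have "is_path (arrow_tgt a', take l w @ a # ?w')" using a'(3) by simp
      then have w': "is_path (arrow_tgt a', ?w')" "path_tgt (arrow_tgt a', ?w') = arrow_src a"
        by (auto simp: is_path_append)
      have "path_deg (i, w) = path_deg (i, take l w) + arrow_deg a + path_deg (i, ?w')"
        by (subst ws) simp
      then have dk: "m + arrow_deg a + path_deg (i, ?w') = ?k"
        using True path_deg_src[of "arrow_src a" "take l w" i] by simp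
      have zc: "move y (m + arrow_deg a) ?w' ?e \<in> carrier_vec (v ?q)"
        using move_carrier[OF y w'(1), of ?e "m + arrow_deg a"] w'(2) dk path_deg_src[of "arrow_tgt a'" ?w' i] by simp
      have "(\<Sum>p<v ?q. op_mat y a' ?k $$ (q, p) * split_term y a m r n k w u p l)
          = move y k (take l w) u $ n * (\<Sum>p<v ?q. op_mat y a' ?k $$ (q, p) * move y (m + arrow_deg a) ?w' ?e $ p)"
        using True by (simp add: split_term_def sum_distrib_left mult_ac)
      also have "(\<Sum>p<v ?q. op_mat y a' ?k $$ (q, p) * move y (m + arrow_deg a) ?w' ?e $ p)
          = move y (m + arrow_deg a) (?w' @ [a']) ?e $ q"
        using mult_mat_vec_index[OF A[OF y] zc q'] move_append[of y "m + arrow_deg a" ?w' "[a']" ?e i] dk by simp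
      also have "move y k (take l w) u $ n * \<dots> = split_term y a m r n k (w @ [a']) u q l"
        using True l by (simp add: split_term_def nth_append)
      finally show ?thesis .
    qed
    have "(\<Sum>p<v ?q. op_mat y a' ?k $$ (q, p) * (\<Sum>l<length w. split_term y a m r n k w u p l))
        = (\<Sum>l<length w. split_term y a m r n k (w @ [a']) u q l)"
      unfolding sum_distrib_left by (subst sum.swap) (simp add: e2)
    then show ?thesis unfolding sum.distrib e1 by simp
  qed
  also have "\<dots> = (\<Sum>l<length (w @ [a']). split_term y a m r n k (w @ [a']) u q l)" by simp
  finally show ?case using step[OF vary_tuples[OF y a]] by simp
qed

text \<open>An entry of the cyclic derivative of the potential: the word is rotated so that the
  letter at position \<open>l\<close> comes first, and this letter is deleted.\<close>

definition cyclic_term :: "('i, 'w) tuple \<Rightarrow> 'i arrow \<Rightarrow> int \<Rightarrow> nat \<Rightarrow> nat \<Rightarrow> 'i arrow list \<Rightarrow> nat \<Rightarrow> complex" where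
  "cyclic_term y a m r n w l = (if w ! l = a
     then move y (m + arrow_deg a) (drop (Suc l) w @ take l w) (unit_vec (v (arrow_src a, m + arrow_deg a)) r) $ n else 0)"

text \<open>Differentiating a trace at one letter cyclically rotates the word, so that only that letter is left out.\<close>

lemma split_term_trace:
  assumes y: "y \<in> tuples v" and sl: "slot a m r n"
    and w: "is_path (i, w)" "path_tgt (i, w) = i" "path_deg (i, w) = 0" and l: "l < length w"
  shows "(\<Sum>q<v (i, k). split_term y a m r n k w (unit_vec (v (i, k)) q) q l)
      = (if k = m - path_deg (i, take l w) then cyclic_term y a m r n w l else 0)" (is ?thesis1)
    and "v (i, m - path_deg (i, take l w)) = 0 \<Longrightarrow> cyclic_term y a m r n w l = 0"
proof -
  let ?e = "unit_vec (v (arrow_src a, m + arrow_deg a)) r :: complex vec"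
  let ?w' = "drop (Suc l) w" and ?k = "m - path_deg (i, take l w)"
  have src: "path_deg (arrow_src a, take l w) = path_deg (i, take l w)" by (rule path_deg_src)
  have main: "move y (m + arrow_deg a) (?w' @ take l w) ?e $ n
      = (\<Sum>q<v (i, ?k). move y ?k (take l w) (unit_vec (v (i, ?k)) q) $ n * move y (m + arrow_deg a) ?w' ?e $ q)"
    if a: "w ! l = a"
  proof -
    have ws: "w = take l w @ a # ?w'" using a l by (metis id_take_nth_drop)
    then have "is_path (i, take l w @ a # ?w')" using w(1) by simp
    then have w': "is_path (i, ?w')" "path_tgt (i, ?w') = arrow_src a" "is_path (arrow_tgt a, take l w)"
      by (auto simp: is_path_append)
    have tgt: "path_tgt (arrow_tgt a, take l w) = i"
      using w(2) path_tgt_append[of i "take l w" "a # ?w'"] ws by simp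
    have "path_deg (i, w) = path_deg (i, take l w) + arrow_deg a + path_deg (i, ?w')"
      by (subst ws) simp
    then have dk: "m + arrow_deg a + path_deg (i, ?w') = ?k" using w(3) by simp
    have zc: "move y (m + arrow_deg a) ?w' ?e \<in> carrier_vec (v (i, ?k))"
      using move_carrier[OF y w'(1), of ?e "m + arrow_deg a"] w'(2) dk by simp
    have "n < v (arrow_tgt a, m)" using sl by (simp add: slot_def)
    then have lf: "linear_form (v (i, ?k)) (\<lambda>z. move y ?k (take l w) z $ n)"
      using linear_form_move[OF y w'(3), of ?k "\<lambda>z. z $ n"] tgt path_deg_src[of "arrow_tgt a" "take l w" i]
      by (simp add: linear_form_index)
    show ?thesis
      using linear_form_expand[OF lf zc] move_append[of y "m + arrow_deg a" ?w' "take l w" ?e i] dk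
      by (simp add: mult.commute)
  qed
  show ?thesis1
  proof (cases "w ! l = a \<and> k = ?k")
    case True
    then show ?thesis using main src by (simp add: split_term_def cyclic_term_def)
  next
    case False
    then show ?thesis using src by (auto simp: split_term_def cyclic_term_def)
  qed
  show "cyclic_term y a m r n w l = 0" if "v (i, ?k) = 0"
    using main that by (simp add: cyclic_term_def)
qed

definition gradient :: "('i, 'w) tuple \<Rightarrow> 'i arrow \<Rightarrow> int \<Rightarrow> nat \<Rightarrow> nat \<Rightarrow> complex" where
  "gradient y a m r n = (\<Sum>i\<in>UNIV. \<Sum>j\<in>UNIV. osign i j *
     (\<Sum>l<length (potential_word i j). cyclic_term y a m r n (potential_word i j) l))"

lemma f2_tuple_deriv:
  assumes y: "y \<in> tuples v" and sl: "slot a m r n"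
  shows "((\<lambda>t. f2_tuple v (vary y a m r n t)) has_field_derivative gradient y a m r n) (at 0)"
proof -
  have a: "is_arrow a" using sl by (simp add: slot_def)
  have fin: "finite {k. v (i, k) \<noteq> 0}" for i
  proof -
    have "{k. v (i, k) \<noteq> 0} \<subseteq> snd ` {q. v q \<noteq> 0}" by force
    then show ?thesis using finite_v by (metis finite_imageI finite_subset)
  qed
  have "((\<lambda>t. osign i j * (\<Sum>k | v (i, k) \<noteq> 0. word_trace (vary y a m r n t) i k (potential_word i j))) has_field_derivative
      osign i j * (\<Sum>l<length (potential_word i j). cyclic_term y a m r n (potential_word i j) l)) (at 0)" for i j
  proof (cases "c i j < 0")
    case False
    then show ?thesis by (simp add: osign_eq_0)
  next
    case True
    let ?w = "potential_word i j"
    note w = is_path_potential_word[OF True] path_tgt_potential_word[of i j] path_deg_potential_word[OF True, of i]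
    have "((\<lambda>t. \<Sum>k | v (i, k) \<noteq> 0. word_trace (vary y a m r n t) i k ?w) has_field_derivative
        (\<Sum>k | v (i, k) \<noteq> 0. \<Sum>q<v (i, k). \<Sum>l<length ?w. split_term y a m r n k ?w (unit_vec (v (i, k)) q) q l)) (at 0)"
      unfolding word_trace_def
    proof (intro DERIV_sum move_deriv[OF y sl w(1)])
      fix k q assume "q \<in> {..<v (i, k)}"
      then show "unit_vec (v (i, k)) q \<in> carrier_vec (v (path_tgt (i, ?w), k))" "q < v (i, k + path_deg (i, ?w))"
        using w(2,3) by simp_all
    qed
    also have "(\<Sum>k | v (i, k) \<noteq> 0. \<Sum>q<v (i, k). \<Sum>l<length ?w. split_term y a m r n k ?w (unit_vec (v (i, k)) q) q l)
        = (\<Sum>k | v (i, k) \<noteq> 0. \<Sum>l<length ?w. if k = m - path_deg (i, take l ?w) then cyclic_term y a m r n ?w l else 0)"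
    proof (rule sum.cong[OF refl])
      fix k
      show "(\<Sum>q<v (i, k). \<Sum>l<length ?w. split_term y a m r n k ?w (unit_vec (v (i, k)) q) q l)
          = (\<Sum>l<length ?w. if k = m - path_deg (i, take l ?w) then cyclic_term y a m r n ?w l else 0)"
        by (subst sum.swap) (simp add: split_term_trace(1)[OF y sl w])
    qed
    also have "\<dots> = (\<Sum>l<length ?w. \<Sum>k | v (i, k) \<noteq> 0. if k = m - path_deg (i, take l ?w) then cyclic_term y a m r n ?w l else 0)"
      by (rule sum.swap)
    also have "\<dots> = (\<Sum>l<length ?w. cyclic_term y a m r n ?w l)"
    proof (intro sum.cong refl)
      fix l assume "l \<in> {..<length ?w}"
      then have l: "l < length ?w" by simp
      \<comment> \<open>The sum runs over the support of \<open>v\<close> only. If the one degree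
        that could contribute lies outside, the cyclic term is itself zero.\<close>
      show "(\<Sum>k | v (i, k) \<noteq> 0. if k = m - path_deg (i, take l ?w) then cyclic_term y a m r n ?w l else 0)
          = cyclic_term y a m r n ?w l"
        using split_term_trace(2)[OF y sl w l] fin[of i] by (simp add: sum.delta)
    qed
    finally show ?thesis by (rule DERIV_cmult)
  qed
  then have "((\<lambda>t. \<Sum>i\<in>UNIV. \<Sum>j\<in>UNIV. osign i j * (\<Sum>k | v (i, k) \<noteq> 0. word_trace (vary y a m r n t) i k (potential_word i j)))
      has_field_derivative gradient y a m r n) (at 0)"
    unfolding gradient_def by (intro DERIV_sum)
  then show ?thesis using f2_tuple_eq[OF vary_tuples[OF y a]] by simp
qed

lemma potential_word_nth:
  "potential_word i j ! 0 = Alpha i j" "potential_word i j ! Suc 0 = Alpha j i"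
  "k < nat (- c i j) \<Longrightarrow> potential_word i j ! Suc (Suc k) = Eps i"
  "length (potential_word i j) = Suc (Suc (nat (- c i j)))"
  by (auto simp: potential_word_def)

lemma sum_potential_word:
  "(\<Sum>l<length (potential_word i j). f l) = f 0 + f (Suc 0) + (\<Sum>k<nat (- c i j). f (Suc (Suc k)))"
  unfolding potential_word_nth(4) sum.lessThan_Suc_shift by (simp add: add.assoc)

lemma sum_delta2: "(\<Sum>i\<in>(UNIV::'i set). \<Sum>j\<in>(UNIV::'i set). if i = i0 \<and> j = j0 then f i j else 0) = (f i0 j0 :: complex)"
proof -
  have "(\<Sum>i\<in>(UNIV::'i set). \<Sum>j\<in>(UNIV::'i set). if i = i0 \<and> j = j0 then f i j else 0)
      = (\<Sum>i\<in>UNIV. if i = i0 then (\<Sum>j\<in>UNIV. if j = j0 then f i j else 0) else 0)"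
    by (intro sum.cong refl) auto
  then show ?thesis by simp
qed

text \<open>\<open>Alpha i0 j0\<close> is the first letter in the word of the pair (i0, j0) and the
  second in that of (j0, i0). The opposite signs of the two pairs turn the rotated words into the
  difference in a commutation relation.\<close>

lemma gradient_Alpha:
  assumes "c i0 j0 < 0"
  shows "gradient y (Alpha i0 j0) m r n = osign i0 j0 *
    (move y (m + b i0 j0) (Alpha j0 i0 # replicate (nat (- c i0 j0)) (Eps i0)) (unit_vec (v (j0, m + b i0 j0)) r) $ n
   - move y (m + b i0 j0) (replicate (nat (- c j0 i0)) (Eps j0) @ [Alpha j0 i0]) (unit_vec (v (j0, m + b i0 j0)) r) $ n)"
proof -
  let ?M = "\<lambda>w. move y (m + b i0 j0) w (unit_vec (v (j0, m + b i0 j0)) r) $ n"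
  let ?A = "?M (Alpha j0 i0 # replicate (nat (- c i0 j0)) (Eps i0))"
  let ?B = "?M (replicate (nat (- c j0 i0)) (Eps j0) @ [Alpha j0 i0])"
  have ne: "i0 \<noteq> j0" using c_neg_neq[OF assms] .
  have "gradient y (Alpha i0 j0) m r n = (\<Sum>i\<in>UNIV. \<Sum>j\<in>UNIV.
      (if i = i0 \<and> j = j0 then osign i j * ?A else 0) + (if i = j0 \<and> j = i0 then osign i j * ?B else 0))"
    unfolding gradient_def sum_potential_word
  proof (intro sum.cong refl)
    fix i j :: 'i
    let ?w = "potential_word i j"
    have "(\<Sum>k<nat (- c i j). cyclic_term y (Alpha i0 j0) m r n ?w (Suc (Suc k))) = 0"
      by (intro sum.neutral) (auto simp: cyclic_term_def potential_word_nth(3))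
    moreover have "cyclic_term y (Alpha i0 j0) m r n ?w 0 = (if i = i0 \<and> j = j0 then ?A else 0)"
      by (auto simp: cyclic_term_def potential_word_def)
    moreover have "cyclic_term y (Alpha i0 j0) m r n ?w (Suc 0) = (if i = j0 \<and> j = i0 then ?B else 0)"
      by (auto simp: cyclic_term_def potential_word_def)
    ultimately show "osign i j * (cyclic_term y (Alpha i0 j0) m r n ?w 0 + cyclic_term y (Alpha i0 j0) m r n ?w (Suc 0) +
        (\<Sum>k<nat (- c i j). cyclic_term y (Alpha i0 j0) m r n ?w (Suc (Suc k)))) =
        (if i = i0 \<and> j = j0 then osign i j * ?A else 0) + (if i = j0 \<and> j = i0 then osign i j * ?B else 0)"
      using ne by auto
  qed
  also have "\<dots> = osign i0 j0 * ?A + osign j0 i0 * ?B"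
    unfolding sum.distrib sum_delta2 ..
  also have "osign j0 i0 = - osign i0 j0"
    using orient assms ne unfolding orientation_def osign_def by auto
  finally show ?thesis by (simp add: algebra_simps)
qed

lemma gradient_Eps:
  "gradient y (Eps i0) m r n = (\<Sum>j | c i0 j < 0. \<Sum>k<nat (- c i0 j). osign i0 j *
     move y (m + 2 * d i0) (mesh_word i0 j k) (unit_vec (v (i0, m + 2 * d i0)) r) $ n)"
proof -
  let ?M = "\<lambda>w. move y (m + 2 * d i0) w (unit_vec (v (i0, m + 2 * d i0)) r) $ n"
  have cyc: "(\<Sum>l<length (potential_word i0 j). cyclic_term y (Eps i0) m r n (potential_word i0 j) l)
      = (\<Sum>k<nat (- c i0 j). ?M (mesh_word i0 j k))" for j
  proof -
    let ?n = "nat (- c i0 j)"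
    have "cyclic_term y (Eps i0) m r n (potential_word i0 j) (Suc (Suc k)) = ?M (mesh_word i0 j (?n - Suc k))"
      if "k < ?n" for k
    proof -
      \<comment> \<open>Behind the deleted loop \<open>?n - Suc k\<close> loops remain, and the
        rotation brings them in front of the two arrows; the \<open>k\<close> loops before it end up
        behind them.\<close>
      have "drop (Suc (Suc (Suc k))) (potential_word i0 j) @ take (Suc (Suc k)) (potential_word i0 j) = mesh_word i0 j (?n - Suc k)"
        using that by (simp add: potential_word_def mesh_word_def min_def)
      then show ?thesis using that by (simp add: cyclic_term_def potential_word_nth(3))
    qed
    then have "(\<Sum>l<length (potential_word i0 j). cyclic_term y (Eps i0) m r n (potential_word i0 j) l)
        = (\<Sum>k<?n. ?M (mesh_word i0 j (?n - Suc k)))"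
      unfolding sum_potential_word by (simp add: cyclic_term_def potential_word_nth(1,2))
    also have "\<dots> = (\<Sum>k<?n. ?M (mesh_word i0 j k))" by (rule sum.nat_diff_reindex)
    finally show ?thesis .
  qed
  have "gradient y (Eps i0) m r n = (\<Sum>i\<in>UNIV. if i = i0 then (\<Sum>j\<in>UNIV. osign i0 j * (\<Sum>k<nat (- c i0 j). ?M (mesh_word i0 j k))) else 0)"
    unfolding gradient_def
  proof (intro sum.cong refl)
    fix i
    have "(\<Sum>l<length (potential_word i j). cyclic_term y (Eps i0) m r n (potential_word i j) l) = 0" if "i \<noteq> i0" for j
      unfolding sum_potential_word using that
      by (simp add: cyclic_term_def potential_word_nth(1,2,3))
    then show "(\<Sum>j\<in>UNIV. osign i j * (\<Sum>l<length (potential_word i j). cyclic_term y (Eps i0) m r n (potential_word i j) l))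
      = (if i = i0 then (\<Sum>j\<in>UNIV. osign i0 j * (\<Sum>k<nat (- c i0 j). ?M (mesh_word i0 j k))) else 0)"
      using cyc by simp
  qed
  also have "\<dots> = (\<Sum>j | c i0 j < 0. osign i0 j * (\<Sum>k<nat (- c i0 j). ?M (mesh_word i0 j k)))"
    by simp (rule sum.mono_neutral_right, auto simp: osign_eq_0)
  finally show ?thesis by (simp add: sum_distrib_left)
qed

lemma osign_neq_0: "c i j < 0 \<Longrightarrow> osign i j \<noteq> 0"
  using orient c_neg_neq[of i j] unfolding orientation_def osign_def by auto

lemma relations_iff_gradient:
  assumes y: "y \<in> tuples v"
  shows "relations v y \<longleftrightarrow> (\<forall>a m r n. slot a m r n \<longrightarrow> gradient y a m r n = 0)"
proof
  assume R: "relations v y"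
  show "\<forall>a m r n. slot a m r n \<longrightarrow> gradient y a m r n = 0"
  proof (intro allI impI)
    fix a m r n assume sl: "slot a m r n"
    show "gradient y a m r n = 0"
    proof (cases a)
      case (Alpha i0 j0)
      then have c0: "c i0 j0 < 0" "c j0 i0 < 0" using sl c_neg_sym[of i0 j0] by (auto simp: slot_def)
      have "move y (m + b i0 j0) (replicate (nat (- c j0 i0)) (Eps j0) @ [Alpha j0 i0]) (unit_vec (v (j0, m + b i0 j0)) r)
          = move y (m + b i0 j0) (Alpha j0 i0 # replicate (nat (- c i0 j0)) (Eps i0)) (unit_vec (v (j0, m + b i0 j0)) r)"
        using conjunct1[OF R[unfolded relations_def]] c0(2) unit_vec_carrier by blast
      then show ?thesis unfolding Alpha gradient_Alpha[OF c0(1)] by (simp only: diff_self mult_zero_right)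
    next
      case (Eps i0)
      have "n < v (i0, (m + 2 * d i0) - 2 * d i0)" using sl Eps by (simp add: slot_def)
      then show ?thesis
        unfolding Eps gradient_Eps using conjunct2[OF R[unfolded relations_def]] unit_vec_carrier by blast
    qed
  qed
next
  assume G: "\<forall>a m r n. slot a m r n \<longrightarrow> gradient y a m r n = 0"
  have "move y m (replicate (nat (- c i j)) (Eps i) @ [Alpha i j]) u = move y m (Alpha i j # replicate (nat (- c j i)) (Eps j)) u"
    if c0: "c i j < 0" and u: "u \<in> carrier_vec (v (i, m))" for i j m u
  proof -
    define w w' where w: "w = replicate (nat (- c i j)) (Eps i) @ [Alpha i j]" "w' = Alpha i j # replicate (nat (- c j i)) (Eps j)"
    have "2 * d i * int (nat (- c i j)) = 2 * d j * int (nat (- c j i))"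
      using b_sym[of i j] c0 c_neg_sym[of i j] by (simp add: b_def)
    then have P: "is_path (j, w)" "path_tgt (j, w) = i" "is_path (j, w')" "path_tgt (j, w') = i" "path_deg (j, w) = path_deg (j, w')"
      using word_eq_comm[OF c0] by (auto simp: word_eq_def w)
    let ?m = "m + path_deg (j, w')"
    \<comment> \<open>The loops have total degree -2 b_ij. Hence a variation of
      \<open>Alpha j i\<close> in degree \<open>?m\<close> tests words that start in degree
      \<open>m\<close>.\<close>
    have dd: "path_deg (j, w') = b i j - 2 * b i j"
      using c0 c_neg_sym[of i j] b_sym[of i j] by (simp add: w b_def algebra_simps)
    then have mm: "?m + b j i = m" using b_sym[of i j] by simp
    have cw: "move y m w z \<in> carrier_vec (v (j, ?m))" "move y m w' z \<in> carrier_vec (v (j, ?m))"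
      if "z \<in> carrier_vec (v (i, m))" for z
      using move_carrier[OF y P(1), of z m] move_carrier[OF y P(3), of z m] P that by auto
    have "move y m w u = move y m w' u"
    proof (rule eq_vecI)
      fix n assume "n < dim_vec (move y m w' u)"
      then have n: "n < v (j, ?m)" using cw[OF u] by auto
      have lf: "linear_form (v (i, m)) (\<lambda>z. move y m w z $ n)" "linear_form (v (i, m)) (\<lambda>z. move y m w' z $ n)"
        using linear_form_move[OF y P(1), of m "\<lambda>z. z $ n"] linear_form_move[OF y P(3), of m "\<lambda>z. z $ n"] P(2,4,5)
          linear_form_index[OF n] by simp_all
      have "move y m w (unit_vec (v (i, m)) r) $ n = move y m w' (unit_vec (v (i, m)) r) $ n" if r: "r < v (i, m)" for r
      proof -
        have "r < v (i, ?m + b j i)" using r unfolding mm .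
        then have "slot (Alpha j i) ?m r n" using n c0 c_neg_sym[of i j] by (simp add: slot_def)
        then have "gradient y (Alpha j i) ?m r n = 0" using G by blast
        moreover have "c j i < 0" using c0 c_neg_sym[of i j] by simp
        ultimately show ?thesis
          using gradient_Alpha[of j i y ?m r n] osign_neq_0[of j i] unfolding mm w[symmetric] by simp
      qed
      then show "move y m w u $ n = move y m w' u $ n"
        using linear_form_expand[OF lf(1) u] linear_form_expand[OF lf(2) u] by simp
    qed (use cw[OF u] in auto)
    then show ?thesis unfolding w .
  qed
  moreover have "(\<Sum>j | c i j < 0. \<Sum>k<nat (- c i j). osign i j * move y m (mesh_word i j k) u $ n) = 0"
    if u: "u \<in> carrier_vec (v (i, m))" and n: "n < v (i, m - 2 * d i)" for i m u n
  proof -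
    let ?f = "\<lambda>u. \<Sum>j | c i j < 0. \<Sum>k<nat (- c i j). osign i j * move y m (mesh_word i j k) u $ n"
    have lf: "linear_form (v (i, m)) (\<lambda>z. move y m (mesh_word i j k) z $ n)" if "c i j < 0" "k < nat (- c i j)" for j k
      using linear_form_move[OF y is_path_mesh_word[OF that(1), of k], of m "\<lambda>z. z $ n"] path_deg_mesh_word[OF that]
        linear_form_index[OF n] by (simp add: path_tgt_mesh_word)
    have "linear_form (v (i, m)) ?f"
      unfolding linear_form_def
    proof (intro conjI ballI allI)
      fix u u' :: "complex vec" assume "u \<in> carrier_vec (v (i, m))" "u' \<in> carrier_vec (v (i, m))"
      then show "?f (u + u') = ?f u + ?f u'"
        using lf unfolding linear_form_def by (simp add: sum.distrib[symmetric] distrib_left)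
    next
      fix z and u :: "complex vec" assume "u \<in> carrier_vec (v (i, m))"
      then show "?f (z \<cdot>\<^sub>v u) = z * ?f u"
        using lf unfolding linear_form_def by (simp add: sum_distrib_left mult.left_commute)
    qed
    from linear_form_expand[OF this u] have "?f u = (\<Sum>r<v (i, m). u $ r * ?f (unit_vec (v (i, m)) r))" .
    also have "\<dots> = 0"
    proof (intro sum.neutral ballI)
      fix r assume "r \<in> {..<v (i, m)}"
      then have "slot (Eps i) (m - 2 * d i) r n" using n by (simp add: slot_def)
      then have "gradient y (Eps i) (m - 2 * d i) r n = 0" using G by blast
      then show "u $ r * ?f (unit_vec (v (i, m)) r) = 0" unfolding gradient_Eps by simp
    qed
    finally show ?thesis .
  qed
  ultimately show "relations v y" unfolding relations_def by blast
qed

section \<open>Critical points\<close>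

lemma finite_slots: "finite slots"
proof -
  define B where "B = (\<Sum>q | v q \<noteq> 0. v q)"
  have B: "v q \<le> B" for q
    using member_le_sum[of q "{q. v q \<noteq> 0}" v] finite_v by (cases "v q = 0") (auto simp: B_def)
  have "slots \<subseteq> (range (\<lambda>(i, j). Alpha i j) \<union> range Eps) \<times> (snd ` {q. v q \<noteq> 0}) \<times> {..<B} \<times> {..<B}"
  proof
    fix z assume "z \<in> slots"
    then obtain a m r n where z: "z = (a, m, r, n)" and s: "slot a m r n" by (auto simp: slots_def)
    have "a \<in> range (\<lambda>(i, j). Alpha i j) \<union> range Eps" by (cases a) (auto simp: image_iff)
    moreover have "m \<in> snd ` {q. v q \<noteq> 0}"
      using s by (intro image_eqI[of _ _ "(arrow_tgt a, m)"]) (auto simp: slot_def)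
    moreover have "r < B" "n < B" using s B unfolding slot_def by (metis less_le_trans)+
    ultimately show "z \<in> (range (\<lambda>(i, j). Alpha i j) \<union> range Eps) \<times> (snd ` {q. v q \<noteq> 0}) \<times> {..<B} \<times> {..<B}"
      using z by simp
  qed
  then show ?thesis by (rule finite_subset) (use finite_v in auto)
qed

lemma f2_tuple_slot_funs: "f2_tuple v \<in> slot_funs"
proof -
  note alg = function_algebra_poly_funs[of "entry ` slots"]
  have "(\<lambda>x. \<Sum>i\<in>UNIV. \<Sum>j\<in>UNIV. osign i j * (\<Sum>k | v (i, k) \<noteq> 0. word_trace x i k (potential_word i j))) \<in> slot_funs"
  proof (intro function_algebra_sum[OF alg])
    fix i j
    show "(\<lambda>x. osign i j * (\<Sum>k | v (i, k) \<noteq> 0. word_trace x i k (potential_word i j))) \<in> slot_funs"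
    proof (cases "c i j < 0")
      case True
      show ?thesis unfolding word_trace_def
        by (intro function_algebra_scale[OF alg] function_algebra_sum[OF alg] slot_funs_move[of i])
          (simp_all add: is_path_potential_word path_tgt_potential_word path_deg_potential_word True)
    next
      case False
      then show ?thesis using function_algebraD(1)[OF alg, of 0] by (simp add: osign_eq_0)
    qed
  qed
  then show ?thesis by (rule poly_funs_cong) (rule f2_tuple_eq)
qed

end

text \<open>Taylor expansion at \<open>x\<close> modulo the square of the ideal of polynomials that vanish at \<open>x\<close>.\<close>

lemma polys_taylor:
  fixes x :: 'x and P :: "'x \<Rightarrow> complex" and co :: "'k \<Rightarrow> 'x \<Rightarrow> complex"
  assumes P: "P \<in> polys (co ` S)" and S: "finite S"
  shows "\<exists>a gh. (\<forall>(G, H)\<in>set gh. G \<in> polys (co ` S) \<and> H \<in> polys (co ` S) \<and> G x = 0 \<and> H x = 0) \<and>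
    (\<forall>y. P y = P x + (\<Sum>k\<in>S. a k * (co k y - co k x)) + (\<Sum>(G, H)\<leftarrow>gh. G y * H y))"
  using P
proof (induction rule: polys.induct)
  case (const z)
  show ?case by (intro exI[of _ "\<lambda>_. 0"] exI[of _ "[]"]) simp
next
  case (coord f)
  then obtain k where k: "k \<in> S" "f = co k" by blast
  have "(\<Sum>l\<in>S. (if l = k then 1 else 0) * (co l y - co l x)) = co k y - co k x" for y
  proof -
    have "(\<Sum>l\<in>S. (if l = k then 1 else 0) * (co l y - co l x)) = (\<Sum>l\<in>S. if l = k then co k y - co k x else 0)"
      by (intro sum.cong) auto
    then show ?thesis using k S by simp
  qed
  then show ?case using k by (intro exI[of _ "\<lambda>l. if l = k then 1 else 0"] exI[of _ "[]"]) simp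
next
  case (add f g)
  obtain a gh where f: "\<forall>(G, H)\<in>set gh. G \<in> polys (co ` S) \<and> H \<in> polys (co ` S) \<and> G x = 0 \<and> H x = 0"
    "\<And>y. f y = f x + (\<Sum>k\<in>S. a k * (co k y - co k x)) + (\<Sum>(G, H)\<leftarrow>gh. G y * H y)" using add.IH(1) by blast
  obtain a' gh' where g: "\<forall>(G, H)\<in>set gh'. G \<in> polys (co ` S) \<and> H \<in> polys (co ` S) \<and> G x = 0 \<and> H x = 0"
    "\<And>y. g y = g x + (\<Sum>k\<in>S. a' k * (co k y - co k x)) + (\<Sum>(G, H)\<leftarrow>gh'. G y * H y)" using add.IH(2) by blast
  show ?case
  proof (intro exI[of _ "\<lambda>k. a k + a' k"] exI[of _ "gh @ gh'"] conjI allI)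
    show "\<forall>(G, H)\<in>set (gh @ gh'). G \<in> polys (co ` S) \<and> H \<in> polys (co ` S) \<and> G x = 0 \<and> H x = 0"
      using f(1) g(1) by auto
    fix y
    show "f y + g y = f x + g x + (\<Sum>k\<in>S. (a k + a' k) * (co k y - co k x)) + (\<Sum>(G, H)\<leftarrow>gh @ gh'. G y * H y)"
      using f(2)[of y] g(2)[of y] by (simp add: distrib_right sum.distrib)
  qed
next
  case (mult f g)
  obtain a gh where f: "\<forall>(G, H)\<in>set gh. G \<in> polys (co ` S) \<and> H \<in> polys (co ` S) \<and> G x = 0 \<and> H x = 0"
    "\<And>y. f y = f x + (\<Sum>k\<in>S. a k * (co k y - co k x)) + (\<Sum>(G, H)\<leftarrow>gh. G y * H y)" using mult.IH(1) by blast
  obtain a' gh' where g: "\<forall>(G, H)\<in>set gh'. G \<in> polys (co ` S) \<and> H \<in> polys (co ` S) \<and> G x = 0 \<and> H x = 0"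
    "\<And>y. g y = g x + (\<Sum>k\<in>S. a' k * (co k y - co k x)) + (\<Sum>(G, H)\<leftarrow>gh'. G y * H y)" using mult.IH(2) by blast
  note alg = function_algebra_polys[of "co ` S"]
  define sca where "sca z = map (\<lambda>(G :: 'x \<Rightarrow> complex, H :: 'x \<Rightarrow> complex). (\<lambda>y. z * G y, H))" for z :: complex
  have sca: "(\<Sum>(G, H)\<leftarrow>sca z l. G y * H y) = z * (\<Sum>(G, H)\<leftarrow>l. G y * H y)" for z l y
    unfolding sca_def by (induction l) (auto simp: algebra_simps)
  have sca_set: "\<forall>(G, H)\<in>set (sca z l). G \<in> polys (co ` S) \<and> H \<in> polys (co ` S) \<and> G x = 0 \<and> H x = 0"
    if "\<forall>(G, H)\<in>set l. G \<in> polys (co ` S) \<and> H \<in> polys (co ` S) \<and> G x = 0 \<and> H x = 0" for z l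
    using that function_algebra_scale[OF alg] unfolding sca_def by fastforce
  \<comment> \<open>From f g = f(x) g(x) + f(x) (g - g(x)) + g(x) (f - f(x)) + (f - f(x)) (g -
    g(x)): the last product lies in the square of the ideal, and the middle terms use the two given
    expansions.\<close>
  let ?l = "sca (f x) gh' @ sca (g x) gh @ [(\<lambda>y. f y - f x, \<lambda>y. g y - g x)]"
  show ?case
  proof (intro exI[of _ "\<lambda>k. f x * a' k + g x * a k"] exI[of _ ?l] conjI allI)
    have "(\<lambda>y. f y - f x) \<in> polys (co ` S)" "(\<lambda>y. g y - g x) \<in> polys (co ` S)"
      using function_algebra_diff[OF alg mult.hyps(1) function_algebraD(1)[OF alg]]
        function_algebra_diff[OF alg mult.hyps(2) function_algebraD(1)[OF alg]] by auto
    then show "\<forall>(G, H)\<in>set ?l. G \<in> polys (co ` S) \<and> H \<in> polys (co ` S) \<and> G x = 0 \<and> H x = 0"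
      using sca_set[OF f(1), of "g x"] sca_set[OF g(1), of "f x"] by auto
    fix y
    define L L' Q Q' where LQ: "L = (\<Sum>k\<in>S. a k * (co k y - co k x))" "L' = (\<Sum>k\<in>S. a' k * (co k y - co k x))"
      "Q = (\<Sum>(G, H)\<leftarrow>gh. G y * H y)" "Q' = (\<Sum>(G, H)\<leftarrow>gh'. G y * H y)"
    have 1: "(\<Sum>k\<in>S. (f x * a' k + g x * a k) * (co k y - co k x)) = f x * L' + g x * L"
      unfolding LQ by (simp only: distrib_right sum.distrib sum_distrib_left mult.assoc)
    have 2: "(\<Sum>(G, H)\<leftarrow>?l. G y * H y) = f x * Q' + g x * Q + (f y - f x) * (g y - g x)"
      by (simp add: sca LQ)
    have fy: "f y = f x + L + Q" and gy: "g y = g x + L' + Q'" using f(2)[of y] g(2)[of y] unfolding LQ by simp_all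
    show "f y * g y = f x * g x + (\<Sum>k\<in>S. (f x * a' k + g x * a k) * (co k y - co k x)) + (\<Sum>(G, H)\<leftarrow>?l. G y * H y)"
      unfolding 1 2 fy gy by (simp add: algebra_simps)
  qed
qed

text \<open>The functionals \<open>l q\<close>, combinations of evaluations at the points \<open>T q\<close>, are dual to the frame of \<open>x\<close>.
  The matrices of their values on the frame of a nearby tuple normalize that tuple; this is a section of
  the quotient by the group near \<open>x\<close>.\<close>

locale stable_point = framed_quiver c d Or sc W s ii kk e ph v
  for c :: "'i::finite \<Rightarrow> 'i \<Rightarrow> int" and d :: "'i \<Rightarrow> int" and Or :: "('i \<times> 'i) set"
    and sc :: "complex \<Rightarrow> 'w::ab_group_add \<Rightarrow> 'w" and W :: "'i \<times> int \<Rightarrow> 'w set"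
    and s :: nat and ii :: "nat \<Rightarrow> 'i" and kk :: "nat \<Rightarrow> int"
    and e :: "nat \<Rightarrow> 'w" and ph :: "nat \<Rightarrow> 'w \<Rightarrow> complex" and v :: "'i \<times> int \<Rightarrow> nat" +
  fixes x :: "('i, 'w) tuple" and T :: "'i \<times> int \<Rightarrow> (nat \<times> 'i path) set"
    and l :: "'i \<times> int \<Rightarrow> nat \<Rightarrow> nat \<times> 'i path \<Rightarrow> complex"
  assumes x_stable: "x \<in> stable v"
    and finite_T: "finite (T q)"
    and dual: "m < v q \<Longrightarrow> k < v q \<Longrightarrow>
      (\<Sum>t\<in>T q. l q m t * psi x q k (fst t) (snd t)) = (if m = k then 1 else 0)"
begin

lemma x_tuples: "x \<in> tuples v"
  using x_stable by (rule stable_tuples)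

section \<open>The slice of the group action near a stable tuple\<close>

definition Phi :: "('i, 'w) tuple \<Rightarrow> 'i \<times> int \<Rightarrow> complex mat" where
  "Phi y q = mat (v q) (v q) (\<lambda>(m, n). \<Sum>t\<in>T q. l q m t * psi y q n (fst t) (snd t))"

lemma Phi_carrier: "Phi y q \<in> carrier_mat (v q) (v q)"
  by (simp add: Phi_def)

lemma Phi_x: "Phi x q = 1\<^sub>m (v q)"
  using dual by (intro eq_matI) (auto simp: Phi_def)

lemma Phi_mult_vec:
  assumes y: "y \<in> tuples v" and u: "u \<in> carrier_vec (v q)" and m: "m < v q"
  shows "(Phi y q *\<^sub>v u) $ m = (\<Sum>t\<in>T q. l q m t * Psi y q u (fst t) (snd t))"
proof -
  have "(Phi y q *\<^sub>v u) $ m = (\<Sum>n<v q. (\<Sum>t\<in>T q. l q m t * psi y q n (fst t) (snd t)) * u $ n)"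
    unfolding mult_mat_vec_index[OF Phi_carrier u m] using m by (intro sum.cong refl) (simp add: Phi_def)
  also have "\<dots> = (\<Sum>t\<in>T q. l q m t * (\<Sum>n<v q. u $ n * psi y q n (fst t) (snd t)))"
    unfolding sum_distrib_left sum_distrib_right by (subst sum.swap) (simp add: mult_ac)
  finally show ?thesis unfolding Psi_eq_comb[OF y u] by (simp add: comb_def)
qed

lemma Phi_entry: "m < v q \<Longrightarrow> n < v q \<Longrightarrow> (\<lambda>y. Phi y q $$ (m, n)) \<in> poly_funs"
proof -
  assume mn: "m < v q" "n < v q"
  have "(\<lambda>y. \<Sum>t\<in>T q. l q m t * Psi y q (unit_vec (v q) n) (fst t) (snd t)) \<in> poly_funs"
    by (intro function_algebra_sum function_algebra_scale function_algebra_poly_funs poly_funs_Psi) simp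
  then show ?thesis using mn by (simp add: Phi_def psi_def)
qed

text \<open>Its nonvanishing is the domain of the slice. The product is finite, polynomial on
  tuples, equal to 1 at \<open>x\<close>, and by \<open>disc_act\<close> its zero set among the
  tuples is invariant.\<close>

definition disc :: "('i, 'w) tuple \<Rightarrow> complex" where
  "disc y = (\<Prod>q | v q \<noteq> 0. det (Phi y q))"

lemma det_Phi_poly_funs: "(\<lambda>y. det (Phi y q)) \<in> poly_funs"
  by (rule function_algebra_det[OF function_algebra_poly_funs Phi_carrier Phi_entry])

lemma disc_poly_funs: "disc \<in> poly_funs"
  unfolding disc_def by (intro function_algebra_prod function_algebra_poly_funs det_Phi_poly_funs)

lemma disc_x: "disc x = 1"
  by (simp add: disc_def Phi_x)

lemma det_Phi_neq_0:
  assumes "disc y \<noteq> 0"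
  shows "det (Phi y q) \<noteq> 0"
proof (cases "v q = 0")
  case True
  then show ?thesis using Phi_carrier[of y q] det_dim_zero by simp
next
  case False
  have "\<forall>q\<in>{q. v q \<noteq> 0}. det (Phi y q) \<noteq> 0"
    using assms finite_v unfolding disc_def by (metis prod_zero)
  then show ?thesis using False by blast
qed

text \<open>\<open>Phi y q\<close> is computed from the values of \<open>Psi y q\<close>, so its
  invertibility makes \<open>Psi\<close> injective. In particular small variations of
  \<open>x\<close> remain stable.\<close>

lemma disc_stable:
  assumes y: "y \<in> tuples v" and "disc y \<noteq> 0"
  shows "y \<in> stable v"
  unfolding stable_iff
proof (intro conjI y allI ballI impI)
  fix q u assume u: "u \<in> carrier_vec (v q)" and z: "Psi y q u = 0"
  have "Phi y q *\<^sub>v u = 0\<^sub>v (v q)"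
  proof (rule eq_vecI)
    fix m assume "m < dim_vec (0\<^sub>v (v q) :: complex vec)"
    then show "(Phi y q *\<^sub>v u) $ m = 0\<^sub>v (v q) $ m" using Phi_mult_vec[OF y u, of m] z by simp
  qed (simp add: Phi_def)
  then have "(adj_mat (Phi y q) * Phi y q) *\<^sub>v u = adj_mat (Phi y q) *\<^sub>v 0\<^sub>v (v q)"
    using assoc_mult_mat_vec[OF adj_mat(1)[OF Phi_carrier] Phi_carrier u] by simp
  also have "\<dots> = 0\<^sub>v (v q)" using adj_mat(1)[OF Phi_carrier, of y q] by auto
  finally have *: "(det (Phi y q) \<cdot>\<^sub>m 1\<^sub>m (v q)) *\<^sub>v u = 0\<^sub>v (v q)"
    unfolding adj_mat(3)[OF Phi_carrier] .
  have "det (Phi y q) * u $ m = 0" if m: "m < v q" for m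
  proof -
    have "((det (Phi y q) \<cdot>\<^sub>m 1\<^sub>m (v q)) *\<^sub>v u) $ m = (\<Sum>n<v q. if n = m then det (Phi y q) * u $ m else 0)"
      unfolding mult_mat_vec_index[OF smult_carrier_mat[OF one_carrier_mat] u m] using m by (intro sum.cong) auto
    then show ?thesis using * m by simp
  qed
  then show "u = 0\<^sub>v (v q)" using det_Phi_neq_0[OF assms(2), of q] u by (intro eq_vecI) auto
qed

definition Phi_inv :: "('i, 'w) tuple \<Rightarrow> 'i \<times> int \<Rightarrow> complex mat" where
  "Phi_inv y q = (1 / det (Phi y q)) \<cdot>\<^sub>m adj_mat (Phi y q)"

lemma Phi_automorphism:
  assumes "disc y \<noteq> 0"
  shows "(Phi y, Phi_inv y) \<in> automorphisms v"
proof -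
  have c: "Phi_inv y q \<in> carrier_mat (v q) (v q)" for q
    unfolding Phi_inv_def using adj_mat(1)[OF Phi_carrier] by simp
  have "Phi y q * Phi_inv y q = 1\<^sub>m (v q)" for q
    unfolding Phi_inv_def mult_smult_distrib[OF Phi_carrier adj_mat(1)[OF Phi_carrier]] adj_mat(2)[OF Phi_carrier]
    using det_Phi_neq_0[OF assms, of q] by (intro eq_matI) auto
  moreover have "Phi_inv y q * Phi y q = 1\<^sub>m (v q)" for q
    unfolding Phi_inv_def mult_smult_assoc_mat[OF adj_mat(1)[OF Phi_carrier] Phi_carrier] adj_mat(3)[OF Phi_carrier]
    using det_Phi_neq_0[OF assms, of q] by (intro eq_matI) auto
  ultimately show ?thesis unfolding automorphisms_def using Phi_carrier c by blast
qed

text \<open>The representative of the orbit at which \<open>Phi\<close> becomes the identity: acting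
  by (g, h) multiplies \<open>Phi\<close> by \<open>h\<close> on the right, so \<open>h\<close> has
  to be the inverse of \<open>Phi y\<close>.\<close>

definition sigma :: "('i, 'w) tuple \<Rightarrow> ('i, 'w) tuple" where
  "sigma y = act v (Phi y, Phi_inv y) y"

lemma Phi_act:
  assumes y: "y \<in> tuples v" and gh: "(g, h) \<in> automorphisms v"
  shows "Phi (act v (g, h) y) q = Phi y q * h q"
proof (rule eq_matI)
  note hq = automorphismsD(2)[OF gh, of q]
  fix m n assume "m < dim_row (Phi y q * h q)" "n < dim_col (Phi y q * h q)"
  then have mn: "m < v q" "n < v q" using hq by (auto simp: Phi_def)
  let ?e = "unit_vec (v q) n :: complex vec"
  have u: "?e \<in> carrier_vec (v q)" by simp
  have hu: "h q *\<^sub>v ?e \<in> carrier_vec (v q)" using hq u by (rule mult_mat_vec_carrier)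
  have "Phi (act v (g, h) y) q $$ (m, n) = (Phi (act v (g, h) y) q *\<^sub>v ?e) $ m"
    by (rule mult_mat_unit_vec_index[OF Phi_carrier mn, symmetric])
  also have "\<dots> = (Phi y q *\<^sub>v (h q *\<^sub>v ?e)) $ m"
    unfolding Phi_mult_vec[OF act_tuples[OF y gh] u mn(1)] Phi_mult_vec[OF y hu mn(1)] Psi_act[OF y gh u] ..
  also have "\<dots> = ((Phi y q * h q) *\<^sub>v ?e) $ m" unfolding assoc_mult_mat_vec[OF Phi_carrier hq u] ..
  also have "\<dots> = (Phi y q * h q) $$ (m, n)"
    by (rule mult_mat_unit_vec_index[OF mult_carrier_mat[OF Phi_carrier hq] mn])
  finally show "Phi (act v (g, h) y) q $$ (m, n) = (Phi y q * h q) $$ (m, n)" .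
qed (use automorphismsD(2)[OF gh, of q] in \<open>auto simp: Phi_def\<close>)

lemma disc_act:
  assumes y: "y \<in> tuples v" and gh: "(g, h) \<in> automorphisms v" and "disc y \<noteq> 0"
  shows "disc (act v (g, h) y) \<noteq> 0"
proof -
  have "det (h q) \<noteq> 0" for q
    using det_mult[OF automorphismsD(1,2)[OF gh, of q]] automorphismsD(3)[OF gh, of q] by auto
  then have "det (Phi y q * h q) \<noteq> 0" for q
    using det_mult[OF Phi_carrier automorphismsD(2)[OF gh, of q]] det_Phi_neq_0[OF assms(3), of q] by simp
  then show ?thesis unfolding disc_def Phi_act[OF y gh] using finite_v by simp
qed

lemma sigma_stable: "y \<in> stable v \<Longrightarrow> disc y \<noteq> 0 \<Longrightarrow> sigma y \<in> stable v"
  unfolding sigma_def by (intro act_stable Phi_automorphism)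

lemma sigma_act:
  assumes y: "y \<in> stable v" and gh: "(g, h) \<in> automorphisms v" and dy: "disc y \<noteq> 0"
  shows "sigma (act v (g, h) y) = sigma y"
proof (rule tuple_eqI)
  have yt: "y \<in> tuples v" using y by (rule stable_tuples)
  have dz: "disc (act v (g, h) y) \<noteq> 0" by (rule disc_act[OF yt gh dy])
  have zt: "act v (g, h) y \<in> tuples v" by (rule act_tuples[OF yt gh])
  show "sigma (act v (g, h) y) \<in> stable v" by (intro sigma_stable act_stable y gh dz)
  show "sigma y \<in> tuples v" by (intro stable_tuples sigma_stable y dy)
  show "psi (sigma (act v (g, h) y)) = psi (sigma y)"
  proof (rule psi_eqI)
    fix q and u :: "complex vec" assume u: "u \<in> carrier_vec (v q)"
    note A = Phi_automorphism[OF dy] and B = Phi_automorphism[OF dz]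
    let ?w = "h q *\<^sub>v (Phi_inv (act v (g, h) y) q *\<^sub>v u)"
    have c1: "Phi_inv (act v (g, h) y) q *\<^sub>v u \<in> carrier_vec (v q)"
      using automorphismsD(2)[OF B] u by (rule mult_mat_vec_carrier)
    have c2: "?w \<in> carrier_vec (v q)" using automorphismsD(2)[OF gh] c1 by (rule mult_mat_vec_carrier)
    have "Phi y q *\<^sub>v ?w = Phi (act v (g, h) y) q *\<^sub>v (Phi_inv (act v (g, h) y) q *\<^sub>v u)"
      unfolding Phi_act[OF yt gh] assoc_mult_mat_vec[OF Phi_carrier automorphismsD(2)[OF gh] c1] ..
    also have "\<dots> = u" by (rule automorphisms_cancel(1)[OF B u])
    finally have "?w = Phi_inv y q *\<^sub>v u" using automorphisms_cancel(2)[OF A c2] by simp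
    then show "Psi (sigma (act v (g, h) y)) q u = Psi (sigma y) q u"
      unfolding sigma_def using Psi_act[OF zt B u] Psi_act[OF yt gh c1] Psi_act[OF yt A u] by simp
  qed
qed

lemma sigma_x: "sigma x = x"
proof -
  have "Phi_inv x q = 1\<^sub>m (v q)" for q
  proof -
    have "adj_mat (1\<^sub>m (v q)) = (1\<^sub>m (v q) :: complex mat)"
      using adj_mat(1,3)[OF one_carrier_mat[of "v q"], where ?'a = complex]
      by (simp, intro eq_matI) auto
    then show ?thesis unfolding Phi_inv_def Phi_x by (intro eq_matI) auto
  qed
  then have "Phi x = (\<lambda>q. 1\<^sub>m (v q))" "Phi_inv x = (\<lambda>q. 1\<^sub>m (v q))" using Phi_x by blast+
  then have "sigma x = act v (\<lambda>q. 1\<^sub>m (v q), \<lambda>q. 1\<^sub>m (v q)) x"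
    unfolding sigma_def by simp
  then show ?thesis using act_one[OF x_stable] by simp
qed

text \<open>A single fraction represents the function on the whole domain of the slice. This gives
  the local fractions of \<open>regular_on\<close> and is preserved by sums and products.\<close>

definition regular_funs :: "(('i, 'w) tuple \<Rightarrow> complex) set" where
  "regular_funs = {f. \<exists>P\<in>polys (coords v). \<exists>Q\<in>polys (coords v).
     \<forall>y\<in>stable v. disc y \<noteq> 0 \<longrightarrow> Q y \<noteq> 0 \<and> f y = P y / Q y}"

lemma regular_funsI:
  assumes "P \<in> poly_funs" "Q \<in> poly_funs"
    "\<And>y. y \<in> stable v \<Longrightarrow> disc y \<noteq> 0 \<Longrightarrow> Q y \<noteq> 0 \<and> f y = P y / Q y"
  shows "f \<in> regular_funs"
proof -
  obtain P' Q' where PQ: "P' \<in> polys (coords v)" "Q' \<in> polys (coords v)" "\<And>y. y \<in> tuples v \<Longrightarrow> P y = P' y"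
    "\<And>y. y \<in> tuples v \<Longrightarrow> Q y = Q' y" using assms(1,2) unfolding poly_funs_over_def by blast
  show ?thesis unfolding regular_funs_def
    by (intro CollectI bexI[OF _ PQ(1)] bexI[OF _ PQ(2)]) (use assms(3) PQ(3,4) stable_tuples in auto)
qed

lemma function_algebra_regular_funs: "function_algebra regular_funs"
  unfolding function_algebra_def
proof (intro conjI allI ballI)
  show "(\<lambda>_. z) \<in> regular_funs" for z
    by (rule regular_funsI[OF function_algebraD(1)[OF function_algebra_poly_funs, of z] function_algebraD(1)[OF function_algebra_poly_funs, of 1]]) auto
  fix f g assume "f \<in> regular_funs" "g \<in> regular_funs"
  note fg = this[unfolded regular_funs_def mem_Collect_eq]
  obtain P Q where P: "P \<in> polys (coords v)" "Q \<in> polys (coords v)"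
    "\<forall>y\<in>stable v. disc y \<noteq> 0 \<longrightarrow> Q y \<noteq> 0 \<and> f y = P y / Q y"
    using fg(1) by (elim bexE)
  obtain P' Q' where P': "P' \<in> polys (coords v)" "Q' \<in> polys (coords v)"
    "\<forall>y\<in>stable v. disc y \<noteq> 0 \<longrightarrow> Q' y \<noteq> 0 \<and> g y = P' y / Q' y"
    using fg(2) by (elim bexE)
  note PQ = P(1,2) P'(1,2) P(3)[THEN bspec, THEN mp] P'(3)[THEN bspec, THEN mp]
  have pf: "R \<in> poly_funs" if "R \<in> polys (coords v)" for R
    using that unfolding poly_funs_over_def by blast
  note alg = function_algebraD[OF function_algebra_poly_funs[of "coords v"]]
  show "(\<lambda>y. f y + g y) \<in> regular_funs"
  proof (rule regular_funsI[OF alg(2)[OF alg(3)[OF pf pf] alg(3)[OF pf pf]] alg(3)[OF pf pf], OF PQ(1,4,3,2,2,4)])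
    fix y assume "y \<in> stable v" "disc y \<noteq> 0"
    from PQ(5,6)[OF this] show "Q y * Q' y \<noteq> 0 \<and> f y + g y = (P y * Q' y + P' y * Q y) / (Q y * Q' y)"
      by (simp add: field_simps)
  qed
  show "(\<lambda>y. f y * g y) \<in> regular_funs"
  proof (rule regular_funsI[OF alg(3)[OF pf pf] alg(3)[OF pf pf], OF PQ(1,3,2,4)])
    fix y assume "y \<in> stable v" "disc y \<noteq> 0"
    from PQ(5,6)[OF this] show "Q y * Q' y \<noteq> 0 \<and> f y * g y = (P y * P' y) / (Q y * Q' y)" by simp
  qed
qed

text \<open>Normalization multiplies the matrix by \<open>Phi\<close> on the left and by
  \<open>Phi_inv\<close> on the right. By the adjugate formula the only denominator is the
  determinant of \<open>Phi\<close> at the component where the map starts.\<close>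

lemma entry_sigma_regular:
  assumes "slot a m r n"
  shows "(\<lambda>y. op_mat (sigma y) a m $$ (r, n)) \<in> regular_funs"
proof -
  let ?q = "(arrow_src a, m + arrow_deg a)" and ?q' = "(arrow_tgt a, m)"
  have a: "is_arrow a" "r < v ?q" "n < v ?q'" using assms by (auto simp: slot_def)
  note alg = function_algebra_poly_funs[of "coords v"]
  have num: "(\<lambda>y. \<Sum>k<v ?q'. (\<Sum>k'<v ?q. Phi y ?q $$ (r, k') * op_mat y a m $$ (k', k)) * adj_mat (Phi y ?q') $$ (k, n)) \<in> poly_funs"
  proof (intro function_algebra_sum[OF alg] function_algebraD(3)[OF alg])
    fix k k' assume k: "k \<in> {..<v ?q'}" "k' \<in> {..<v ?q}"
    show "(\<lambda>y. Phi y ?q $$ (r, k')) \<in> poly_funs" using k a by (intro Phi_entry) auto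
    show "(\<lambda>y. op_mat y a m $$ (k', k)) \<in> poly_funs"
      using k a by (intro poly_funs_coords slot_coords) (simp add: slot_def)
  next
    fix k assume k: "k \<in> {..<v ?q'}"
    show "(\<lambda>y. adj_mat (Phi y ?q') $$ (k, n)) \<in> poly_funs"
      using k a by (intro function_algebra_adj_mat[OF alg Phi_carrier Phi_entry]) auto
  qed
  show ?thesis
  proof (rule regular_funsI[OF num det_Phi_poly_funs[of ?q']], rule conjI)
    fix y assume y: "y \<in> stable v" and dy: "disc y \<noteq> 0"
    show "det (Phi y ?q') \<noteq> 0" by (rule det_Phi_neq_0[OF dy])
    have A: "op_mat y a m \<in> carrier_mat (v ?q) (v ?q')" by (rule op_mat_carrier[OF stable_tuples[OF y] a(1)])
    have B: "Phi y ?q * op_mat y a m \<in> carrier_mat (v ?q) (v ?q')" by (rule mult_carrier_mat[OF Phi_carrier A])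
    have "op_mat (sigma y) a m = (1 / det (Phi y ?q')) \<cdot>\<^sub>m (Phi y ?q * op_mat y a m * adj_mat (Phi y ?q'))"
      unfolding sigma_def op_mat_act[OF a(1)] Phi_inv_def by (rule mult_smult_distrib[OF B adj_mat(1)[OF Phi_carrier]])
    moreover have "(z \<cdot>\<^sub>m C) $$ (r, n) = z * C $$ (r, n)" if "C \<in> carrier_mat (v ?q) (v ?q')" for z and C :: "complex mat"
      using that a(2,3) by auto
    note this[OF mult_carrier_mat[OF B adj_mat(1)[OF Phi_carrier[of y ?q']]]]
    moreover have "(Phi y ?q * op_mat y a m * adj_mat (Phi y ?q')) $$ (r, n)
        = (\<Sum>k<v ?q'. (\<Sum>k'<v ?q. Phi y ?q $$ (r, k') * op_mat y a m $$ (k', k)) * adj_mat (Phi y ?q') $$ (k, n))"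
      unfolding mat_mult_index[OF B adj_mat(1)[OF Phi_carrier] a(2,3)]
      by (intro sum.cong refl) (simp only: lessThan_iff mat_mult_index[OF Phi_carrier A a(2)])
    ultimately show "op_mat (sigma y) a m $$ (r, n) = (\<Sum>k<v ?q'. (\<Sum>k'<v ?q. Phi y ?q $$ (r, k') *
        op_mat y a m $$ (k', k)) * adj_mat (Phi y ?q') $$ (k, n)) / det (Phi y ?q')"
      by simp
  qed
qed

lemma polys_sigma_regular:
  assumes "G \<in> polys (entry ` slots)"
  shows "(\<lambda>y. G (sigma y)) \<in> regular_funs"
proof -
  have alg: "function_algebra {G. (\<lambda>y. G (sigma y)) \<in> regular_funs}"
    using function_algebraD[OF function_algebra_regular_funs] unfolding function_algebra_def by simp
  have "entry ` slots \<subseteq> {G. (\<lambda>y. G (sigma y)) \<in> regular_funs}"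
    using entry_sigma_regular by (auto simp: slots_def)
  from polys_subset[OF alg this] show ?thesis using assms by blast
qed

definition chart :: "('i, 'w) tuple set set" where
  "chart = orbit v ` {y \<in> stable v. disc y \<noteq> 0}"

lemma orbit_in_chart:
  assumes y: "y \<in> stable v"
  shows "orbit v y \<in> chart \<longleftrightarrow> disc y \<noteq> 0"
proof
  assume "orbit v y \<in> chart"
  then obtain z where z: "z \<in> stable v" "disc z \<noteq> 0" "orbit v y = orbit v z" unfolding chart_def by auto
  then have "y \<in> orbit v z" using orbit_refl[OF y] by simp
  then show "disc y \<noteq> 0" using disc_act[OF stable_tuples[OF z(1)]] z(2) by (metis orbitE)
qed (use y in \<open>auto simp: chart_def\<close>)

lemma zariski_open_chart: "zariski_open v chart"
  unfolding zariski_open_def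
proof (intro conjI ballI impI)
  show "chart \<subseteq> M v" by (auto simp: chart_def M_def)
  obtain P where P: "P \<in> polys (coords v)" "\<And>y. y \<in> tuples v \<Longrightarrow> disc y = P y"
    using disc_poly_funs unfolding poly_funs_over_def by blast
  fix y assume y: "y \<in> stable v" "orbit v y \<in> chart"
  then show "\<exists>P\<in>polys (coords v). P y \<noteq> 0 \<and> (\<forall>y\<in>stable v. P y \<noteq> 0 \<longrightarrow> orbit v y \<in> chart)"
    using P orbit_in_chart stable_tuples by (intro bexI[OF _ P(1)]) metis
qed

text \<open>Restriction of \<open>G\<close> to the slice, viewed as a function of orbits. The chosen
  representative does not matter on \<open>chart\<close>, where \<open>sigma\<close> is constant on
  each orbit.\<close>

definition descend :: "(('i, 'w) tuple \<Rightarrow> complex) \<Rightarrow> ('i, 'w) tuple set \<Rightarrow> complex" where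
  "descend G p = G (sigma (SOME y. y \<in> p))"

lemma descend_orbit:
  assumes y: "y \<in> stable v" "disc y \<noteq> 0"
  shows "descend G (orbit v y) = G (sigma y)"
proof -
  have "(SOME z. z \<in> orbit v y) \<in> orbit v y" using orbit_refl[OF y(1)] by (rule someI)
  then obtain g h where "(g, h) \<in> automorphisms v" "(SOME z. z \<in> orbit v y) = act v (g, h) y" by (rule orbitE)
  then show ?thesis unfolding descend_def using sigma_act[OF y(1) _ y(2)] by simp
qed

lemma regular_on_descend:
  assumes "G \<in> polys (entry ` slots)"
  shows "regular_on v chart (descend G)"
proof -
  obtain P Q where PQ: "P \<in> polys (coords v)" "Q \<in> polys (coords v)"
    "\<And>y. y \<in> stable v \<Longrightarrow> disc y \<noteq> 0 \<Longrightarrow> Q y \<noteq> 0 \<and> G (sigma y) = P y / Q y"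
    using polys_sigma_regular[OF assms] unfolding regular_funs_def by blast
  show ?thesis
    unfolding regular_on_def using PQ orbit_in_chart descend_orbit[of _ G]
    by (intro ballI impI bexI[OF _ PQ(1)] bexI[OF _ PQ(2)]) metis
qed

section \<open>Criticality in the local ring and the relations\<close>

lemma eventually_poly_funs_neq_0:
  assumes sl: "slot a m r n" and f: "f \<in> poly_funs" "f x \<noteq> 0"
  shows "\<forall>\<^sub>F t in nhds 0. f (vary x a m r n t) \<noteq> 0"
proof -
  obtain D where "((\<lambda>t. f (vary x a m r n t)) has_field_derivative D) (at 0)"
    using poly_funs_differentiable[OF x_tuples sl f(1)] by blast
  then have "isCont (\<lambda>t. f (vary x a m r n t)) 0" by (rule DERIV_isCont)
  moreover have "f (vary x a m r n 0) \<noteq> 0"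
    using vary_0[OF x_tuples, of a m r n] sl f(2) by (simp add: slot_def)
  ultimately show ?thesis
    unfolding isCont_def tendsto_at_iff_tendsto_nhds[of "\<lambda>t. f (vary x a m r n t)" 0] by (rule tendsto_imp_eventually_ne)
qed

text \<open>The products in the definition of a critical point pull back to products of fractions of
  polynomials in the tuple. Varying one entry stays in the stable locus for small \<open>t\<close>,
  and both factors of each product vanish at \<open>t = 0\<close>. So the derivative of the sum is
  0, and it is also the gradient of f_2.\<close>

lemma critical_imp_relations:
  assumes crit: "critical_point v (f2 v) (orbit v x)"
  shows "relations v x"
  unfolding relations_iff_gradient[OF x_tuples]
proof (intro allI impI)
  fix a m r n assume sl: "slot a m r n"
  then have a: "is_arrow a" by (simp add: slot_def)
  let ?y = "vary x a m r n"
  have y0: "?y 0 = x" by (rule vary_0[OF x_tuples a])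
  have yt: "?y t \<in> tuples v" for t by (rule vary_tuples[OF x_tuples a])
  obtain N K g h where N: "zariski_open v N" "orbit v x \<in> N"
    and gh: "\<And>i. i < (K::nat) \<Longrightarrow> regular_on v N (g i) \<and> regular_on v N (h i) \<and> g i (orbit v x) = 0 \<and> h i (orbit v x) = 0"
    and eq: "\<And>q. q \<in> N \<Longrightarrow> f2 v q - f2 v (orbit v x) = (\<Sum>i<K. g i q * h i q)"
    using crit unfolding critical_point_def by blast
  obtain P0 where P0: "P0 \<in> polys (coords v)" "P0 x \<noteq> 0" "\<And>y. y \<in> stable v \<Longrightarrow> P0 y \<noteq> 0 \<Longrightarrow> orbit v y \<in> N"
    using N x_stable unfolding zariski_open_def by blast
  have reg: "\<exists>P Q. P \<in> polys (coords v) \<and> Q \<in> polys (coords v) \<and> Q x \<noteq> 0 \<and> P x = 0 \<and>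
      (\<forall>y\<in>stable v. orbit v y \<in> N \<and> Q y \<noteq> 0 \<longrightarrow> f (orbit v y) = P y / Q y)"
    if f: "regular_on v N f" "f (orbit v x) = 0" for f
  proof -
    have "\<exists>P\<in>polys (coords v). \<exists>Q\<in>polys (coords v). Q x \<noteq> 0 \<and>
        (\<forall>y\<in>stable v. orbit v y \<in> N \<and> Q y \<noteq> 0 \<longrightarrow> f (orbit v y) = P y / Q y)"
      by (rule mp[OF bspec[OF f(1)[unfolded regular_on_def] x_stable] N(2)])
    then obtain P Q where PQ: "P \<in> polys (coords v)" "Q \<in> polys (coords v)" "Q x \<noteq> 0"
      "\<forall>y\<in>stable v. orbit v y \<in> N \<and> Q y \<noteq> 0 \<longrightarrow> f (orbit v y) = P y / Q y"
      by (elim bexE conjE)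
    have "f (orbit v x) = P x / Q x" by (rule mp[OF bspec[OF PQ(4) x_stable] conjI[OF N(2) PQ(3)]])
    then have "P x = 0" using f(2) PQ(3) by simp
    then show ?thesis using PQ by (intro exI[of _ P] exI[of _ Q] conjI)
  qed
  let ?rat = "\<lambda>f P Q. P \<in> polys (coords v) \<and> Q \<in> polys (coords v) \<and> Q x \<noteq> 0 \<and> P x = 0 \<and>
      (\<forall>y\<in>stable v. orbit v y \<in> N \<and> Q y \<noteq> 0 \<longrightarrow> f (orbit v y) = P y / Q y)"
  have rat: "\<exists>P Q. \<forall>i<K. ?rat (f i) (P i) (Q i)" if f: "\<forall>i<K. \<exists>P Q. ?rat (f i) P Q" for f
  proof (intro exI allI impI)
    fix i assume "i < K"
    with f have "\<exists>PQ. ?rat (f i) (fst PQ) (snd PQ)" by simp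
    then show "?rat (f i) (fst (SOME PQ. ?rat (f i) (fst PQ) (snd PQ))) (snd (SOME PQ. ?rat (f i) (fst PQ) (snd PQ)))"
      by (rule someI_ex)
  qed
  have "\<forall>i<K. \<exists>P Q. ?rat (g i) P Q" "\<forall>i<K. \<exists>P Q. ?rat (h i) P Q"
    using gh reg by blast+
  note gr = rat[OF this(1)] and hr = rat[OF this(2)]
  obtain P Q where PQ: "\<forall>i<K. ?rat (g i) (P i) (Q i)" using gr by (elim exE)
  obtain P' Q' where PQ': "\<forall>i<K. ?rat (h i) (P' i) (Q' i)" using hr by (elim exE)
  note PQ = PQ[rule_format (no_asm)] and PQ' = PQ'[rule_format (no_asm)]
  have pf: "P \<in> poly_funs" if "P \<in> polys (coords v)" for P
    using that unfolding poly_funs_over_def by blast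
  have diff: "\<exists>D. ((\<lambda>t. P (?y t) / Q (?y t)) has_field_derivative D) (at 0)"
    if R: "P \<in> polys (coords v)" "Q \<in> polys (coords v)" "Q x \<noteq> 0" for P Q
  proof -
    obtain D where D: "((\<lambda>t. P (?y t)) has_field_derivative D) (at 0)"
      using poly_funs_differentiable[OF x_tuples sl pf[OF R(1)]] by (elim exE)
    obtain D' where D': "((\<lambda>t. Q (?y t)) has_field_derivative D') (at 0)"
      using poly_funs_differentiable[OF x_tuples sl pf[OF R(2)]] by (elim exE)
    have "Q (?y 0) \<noteq> 0" unfolding y0 by (rule R(3))
    from DERIV_divide[OF D D' this] show ?thesis by (rule exI)
  qed
  let ?R = "\<lambda>t. f2 v (orbit v x) + (\<Sum>i<K. (P i (?y t) / Q i (?y t)) * (P' i (?y t) / Q' i (?y t)))"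
  have "((\<lambda>t. (P i (?y t) / Q i (?y t)) * (P' i (?y t) / Q' i (?y t))) has_field_derivative 0) (at 0)" if i: "i < K" for i
  proof -
    obtain D where D: "((\<lambda>t. P i (?y t) / Q i (?y t)) has_field_derivative D) (at 0)" using diff PQ[OF i] by blast
    obtain D' where D': "((\<lambda>t. P' i (?y t) / Q' i (?y t)) has_field_derivative D') (at 0)" using diff PQ'[OF i] by blast
    show ?thesis using DERIV_mult[OF D D'] PQ[OF i] PQ'[OF i] y0 by simp
  qed
  then have "((\<lambda>t. \<Sum>i<K. (P i (?y t) / Q i (?y t)) * (P' i (?y t) / Q' i (?y t))) has_field_derivative (\<Sum>i<K. 0)) (at 0)"
    by (intro DERIV_sum) auto
  from DERIV_add[OF DERIV_const this] have R: "(?R has_field_derivative 0) (at 0)" by simp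
  have "\<forall>\<^sub>F t in nhds 0. disc (?y t) \<noteq> 0 \<and> P0 (?y t) \<noteq> 0 \<and> (\<forall>i\<in>{..<K}. Q i (?y t) \<noteq> 0 \<and> Q' i (?y t) \<noteq> 0)"
    using disc_x P0 PQ PQ'
    by (intro eventually_conj eventually_ball_finite ballI eventually_poly_funs_neq_0[OF sl] disc_poly_funs pf) auto
  then have "\<forall>\<^sub>F t in nhds 0. f2_tuple v (?y t) = ?R t"
  proof eventually_elim
    case (elim t)
    have st: "?y t \<in> stable v" using disc_stable[OF yt] elim by simp
    then have oN: "orbit v (?y t) \<in> N" using P0(3) elim by simp
    have "f2_tuple v (?y t) = f2 v (orbit v x) + (\<Sum>i<K. g i (orbit v (?y t)) * h i (orbit v (?y t)))"
      using eq[OF oN] f2_orbit[OF st] by (simp add: algebra_simps)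
    also have "(\<Sum>i<K. g i (orbit v (?y t)) * h i (orbit v (?y t))) = (\<Sum>i<K. (P i (?y t) / Q i (?y t)) * (P' i (?y t) / Q' i (?y t)))"
    proof (rule sum.cong[OF refl])
      fix i assume i: "i \<in> {..<K}"
      then have Qi: "Q i (?y t) \<noteq> 0" "Q' i (?y t) \<noteq> 0" using elim by simp_all
      have "g i (orbit v (?y t)) = P i (?y t) / Q i (?y t)" "h i (orbit v (?y t)) = P' i (?y t) / Q' i (?y t)"
        using PQ[of i] PQ'[of i] i st oN Qi by simp_all
      then show "g i (orbit v (?y t)) * h i (orbit v (?y t)) = (P i (?y t) / Q i (?y t)) * (P' i (?y t) / Q' i (?y t))"
        by simp
    qed
    finally show ?case .
  qed
  then have "((\<lambda>t. f2_tuple v (?y t)) has_field_derivative 0) (at 0) \<longleftrightarrow> (?R has_field_derivative 0) (at 0)"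
    by (intro DERIV_cong_ev refl)
  then show "gradient x a m r n = 0"
    using R f2_tuple_deriv[OF x_tuples sl] DERIV_unique by blast
qed

text \<open>With vanishing gradient the Taylor expansion of f_2 at \<open>x\<close> has no linear
  part. Evaluated on the slice, the remaining products become products of regular functions on
  \<open>chart\<close>; they represent f_2 since it is constant on orbits, and the factors vanish at
  the orbit of \<open>x\<close> because \<open>sigma x = x\<close>.\<close>

lemma relations_imp_critical:
  assumes rel: "relations v x"
  shows "critical_point v (f2 v) (orbit v x)"
proof -
  obtain P where P: "P \<in> polys (entry ` slots)" "\<And>y. y \<in> tuples v \<Longrightarrow> f2_tuple v y = P y"
    using f2_tuple_slot_funs unfolding poly_funs_over_def by blast
  obtain a gh where gh: "\<forall>(G, H)\<in>set gh. G \<in> polys (entry ` slots) \<and> H \<in> polys (entry ` slots) \<and> G x = 0 \<and> H x = 0"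
    and taylor: "\<And>y. P y = P x + (\<Sum>k\<in>slots. a k * (entry k y - entry k x)) + (\<Sum>(G, H)\<leftarrow>gh. G y * H y)"
    using polys_taylor[OF P(1) finite_slots, of x] by (elim exE conjE) (rule that, assumption, erule spec)
  define G H where "G i = fst (gh ! i)" and "H i = snd (gh ! i)" for i
  have GH: "G i \<in> polys (entry ` slots)" "H i \<in> polys (entry ` slots)" "G i x = 0" "H i x = 0" if "i < length gh" for i
    using gh nth_mem[OF that] unfolding G_def H_def by (auto simp: case_prod_unfold)
  have sum: "(\<Sum>(G, H)\<leftarrow>gh. G y * H y) = (\<Sum>i<length gh. G i y * H i y)" for y
    by (simp add: sum_list_sum_nth atLeast0LessThan case_prod_unfold G_def H_def)
  \<comment> \<open>When the entry \<open>k\<close> alone is varied, the products have derivative 0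
    at \<open>x\<close>, so the coefficient \<open>a k\<close> is the partial derivative of
    f_2.\<close>
  have a0: "a k = 0" if k: "k \<in> slots" for k
  proof -
    obtain a' m r n where k': "k = (a', m, r, n)" and sl: "slot a' m r n" using k by (auto simp: slots_def)
    let ?y = "vary x a' m r n"
    have ar: "is_arrow a'" using sl by (simp add: slot_def)
    have y0: "?y 0 = x" by (rule vary_0[OF x_tuples ar])
    have ent: "entry l (?y t) - entry l x = (if l = k then t else 0)" if "l \<in> slots" for l t
      using that op_mat_vary_index[OF x_tuples] unfolding k' by (cases l) (auto simp: slots_def slot_def)
    have "(\<Sum>l\<in>slots. a l * (entry l (?y t) - entry l x)) = a k * t" for t
    proof -
      have "(\<Sum>l\<in>slots. a l * (entry l (?y t) - entry l x)) = (\<Sum>l\<in>slots. if l = k then a k * t else 0)"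
        by (intro sum.cong refl) (simp only: ent, simp)
      then show ?thesis using finite_slots k by simp
    qed
    then have Py: "f2_tuple v (?y t) = P x + a k * t + (\<Sum>i<length gh. G i (?y t) * H i (?y t))" for t
      using taylor[of "?y t"] P(2)[OF vary_tuples[OF x_tuples ar]] unfolding sum by simp
    have "((\<lambda>t. G i (?y t) * H i (?y t)) has_field_derivative 0) (at 0)" if i: "i < length gh" for i
    proof -
      have pf: "F \<in> poly_funs" if "F \<in> polys (entry ` slots)" for F
        by (rule slot_funs_poly_funs) (use that in \<open>unfold poly_funs_over_def, blast\<close>)
      obtain D D' where D: "((\<lambda>t. G i (?y t)) has_field_derivative D) (at 0)" "((\<lambda>t. H i (?y t)) has_field_derivative D') (at 0)"
        using poly_funs_differentiable[OF x_tuples sl pf[OF GH(1)[OF i]]] poly_funs_differentiable[OF x_tuples sl pf[OF GH(2)[OF i]]]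
        by (elim exE)
      show ?thesis using DERIV_mult[OF D] GH[OF i] y0 by simp
    qed
    then have "((\<lambda>t. \<Sum>i<length gh. G i (?y t) * H i (?y t)) has_field_derivative (\<Sum>i<length gh. 0)) (at 0)"
      by (intro DERIV_sum) auto
    moreover have "((\<lambda>t. P x + a k * t) has_field_derivative a k) (at 0)"
      by (auto intro!: derivative_eq_intros)
    ultimately have "((\<lambda>t. P x + a k * t + (\<Sum>i<length gh. G i (?y t) * H i (?y t))) has_field_derivative a k + (\<Sum>i<length gh. 0)) (at 0)"
      by (rule DERIV_add[rotated])
    then have "((\<lambda>t. f2_tuple v (?y t)) has_field_derivative a k) (at 0)" using Py by simp
    then have "a k = gradient x a' m r n" using f2_tuple_deriv[OF x_tuples sl] DERIV_unique by blast
    then show ?thesis using rel sl unfolding relations_iff_gradient[OF x_tuples] by simp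
  qed
  have f2: "f2 v q - f2 v (orbit v x) = (\<Sum>i<length gh. descend (G i) q * descend (H i) q)" if q: "q \<in> chart" for q
  proof -
    obtain y where y: "y \<in> stable v" "disc y \<noteq> 0" "q = orbit v y" using q unfolding chart_def by auto
    have "f2 v q = f2_tuple v (sigma y)"
      unfolding y(3) f2_orbit[OF y(1)] sigma_def using f2_tuple_act[OF stable_tuples[OF y(1)] Phi_automorphism[OF y(2)]] by simp
    also have "\<dots> = P (sigma y)" using P(2) sigma_stable[OF y(1,2)] stable_tuples by blast
    also have "\<dots> = P x + (\<Sum>i<length gh. G i (sigma y) * H i (sigma y))"
      using taylor[of "sigma y"] a0 unfolding sum by simp
    finally show ?thesis
      using f2_orbit[OF x_stable] P(2)[OF x_tuples] descend_orbit[OF y(1,2)] y(3) by simp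
  qed
  have dx: "descend G (orbit v x) = G x" for G
    using descend_orbit[OF x_stable] disc_x sigma_x by simp
  show ?thesis
    unfolding critical_point_def
  proof (rule conjI, use x_stable in \<open>simp add: M_def\<close>, rule exI[of _ chart], rule exI[of _ "length gh"],
      rule exI[of _ "\<lambda>i. descend (G i)"], rule exI[of _ "\<lambda>i. descend (H i)"], intro conjI allI impI ballI)
    show "orbit v x \<in> chart" using orbit_in_chart[OF x_stable] disc_x by simp
  qed (use zariski_open_chart regular_on_descend GH dx f2 in auto)
qed

end

context framed_quiver
begin

lemma critical_point_iff:
  assumes x: "x \<in> stable v"
  shows "critical_point v (f2 v) (orbit v x) \<longleftrightarrow> relations v x"
proof -
  have "\<forall>q. \<exists>Tl. finite (fst Tl) \<and> (\<forall>m<v q. \<forall>k<v q. (\<Sum>t\<in>fst Tl. snd Tl m t * psi x q k (fst t) (snd t)) = (if m = k then 1 else 0))"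
  proof
    fix q
    obtain T l where "finite T" "\<And>m k. m < v q \<Longrightarrow> k < v q \<Longrightarrow> (\<Sum>t\<in>T. l m t * psi x q k (fst t) (snd t)) = (if m = k then 1 else 0)"
      using frame_dual[OF independent_psi[OF x], of q] by blast
    then show "\<exists>Tl. finite (fst Tl) \<and> (\<forall>m<v q. \<forall>k<v q. (\<Sum>t\<in>fst Tl. snd Tl m t * psi x q k (fst t) (snd t)) = (if m = k then 1 else 0))"
      by (intro exI[of _ "(T, l)"]) simp
  qed
  from choice[OF this] obtain Tl where *: "\<forall>q. finite (fst (Tl q)) \<and>
      (\<forall>m<v q. \<forall>k<v q. (\<Sum>t\<in>fst (Tl q). snd (Tl q) m t * psi x q k (fst t) (snd t)) = (if m = k then 1 else 0))"
    by (elim exE)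
  note Tl = spec[OF *, THEN conjunct1] spec[OF *, THEN conjunct2, rule_format]
  interpret stable_point c d Or sc W s ii kk e ph v x "\<lambda>q. fst (Tl q)" "\<lambda>q. snd (Tl q)"
  proof unfold_locales
    show "x \<in> stable v" by (rule x)
    show "finite (fst (Tl q))" for q by (rule Tl(1))
  qed (rule Tl(2))
  show ?thesis using critical_imp_relations relations_imp_critical by blast
qed

lemma critical_locus: "{p. critical_point v (f2 v) p} = orbit v ` crit_locus"
proof (rule subset_antisym, rule subsetI)
  fix p assume "p \<in> {p. critical_point v (f2 v) p}"
  then have p: "critical_point v (f2 v) p" by simp
  then have "p \<in> M v" unfolding critical_point_def by (rule conjunct1)
  then obtain x where x: "p = orbit v x" "x \<in> stable v" unfolding M_def by (rule imageE)
  then have "x \<in> crit_locus" using p critical_point_iff[OF x(2)] unfolding crit_locus_def by simp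
  then show "p \<in> orbit v ` crit_locus" using x(1) by (rule rev_image_eqI)
qed (use critical_point_iff in \<open>auto simp: crit_locus_def\<close>)

end

section \<open>The fibre over zero\<close>

context vector_space
begin

text \<open>A basis of one step of the filtration is extended to the next, so the part of the final
  basis inside each earlier step still spans that step.\<close>

lemma filtration_basis:
  fixes K :: "nat \<Rightarrow> 'b set"
  assumes sub: "\<And>n. subspace (K n)" and mono: "mono K"
  shows "\<exists>B. B \<subseteq> K L \<and> independent B \<and> (\<forall>n\<le>L. K n \<subseteq> span (B \<inter> K n))"
proof (induction L)
  case 0
  obtain B where "B \<subseteq> K 0" "independent B" "K 0 \<subseteq> span B" by (rule maximal_independent_subset)
  moreover from this have "B \<inter> K 0 = B" by blast
  ultimately show ?case by (intro exI[of _ B]) simp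
next
  case (Suc L)
  then obtain B where B: "B \<subseteq> K L" "independent B" "\<And>n. n \<le> L \<Longrightarrow> K n \<subseteq> span (B \<inter> K n)" by blast
  have "B \<subseteq> K (Suc L)" using B(1) monoD[OF mono, of L "Suc L"] by auto
  then obtain B' where B': "B \<subseteq> B'" "B' \<subseteq> K (Suc L)" "independent B'" "K (Suc L) \<subseteq> span B'"
    using maximal_independent_subset_extend[OF _ B(2)] by metis
  have "K n \<subseteq> span (B' \<inter> K n)" if "n \<le> Suc L" for n
  proof (cases "n = Suc L")
    case True
    then have "B' \<inter> K n = B'" using B'(2) by blast
    then show ?thesis using B'(4) True by simp
  next
    case False
    then have "K n \<subseteq> span (B \<inter> K n)" using B(3) that by simp
    also have "\<dots> \<subseteq> span (B' \<inter> K n)" using B'(1) by (intro span_mono) blast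
    finally show ?thesis .
  qed
  then show ?case using B'(2,3) by blast
qed

end

context framed_quiver
begin

section \<open>Filtration by path length and contraction to zero\<close>

text \<open>The strict inequality makes step 0 the zero space. Nonzero elements thus have positive
  level, and the levels can serve as positive weights of a one-parameter subgroup.\<close>

definition length_filtration :: "nat \<Rightarrow> (nat \<Rightarrow> 'i path \<Rightarrow> complex) set" where
  "length_filtration n = {f. \<forall>r i w. f r (i, w) \<noteq> 0 \<longrightarrow> length w < n}"

definition level :: "(nat \<Rightarrow> 'i path \<Rightarrow> complex) \<Rightarrow> nat" where
  "level f = (LEAST n. f \<in> length_filtration n)"

lemma subspace_length_filtration: "fam.subspace (length_filtration n)"
proof (rule fam.subspaceI)
  show "0 \<in> length_filtration n" unfolding length_filtration_def by simp
  fix f g assume fg: "f \<in> length_filtration n" "g \<in> length_filtration n"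
  have "length w < n" if "f r (i, w) + g r (i, w) \<noteq> 0" for r i w
    using fg that unfolding length_filtration_def mem_Collect_eq by (metis add_0)
  then show "f + g \<in> length_filtration n" unfolding length_filtration_def by simp
  show "scale_fam z f \<in> length_filtration n" for z
    using fg(1) unfolding length_filtration_def by (simp, blast)
qed

lemma mono_length_filtration: "mono length_filtration"
  unfolding length_filtration_def by (rule monoI) (use order_less_le_trans in blast)

lemma sum_mod_bounded:
  assumes "f \<in> sum_mod s ii"
  shows "\<exists>L. f \<in> length_filtration L"
proof -
  have "\<exists>L. \<forall>p. f r p \<noteq> 0 \<longrightarrow> length (snd p) \<le> L" for r
  proof (cases "r \<in> {1..s}")
    case True
    then have "f r \<in> I_mod (ii r)" using assms unfolding sum_mod_def by blast
    then show ?thesis by (rule I_mod_bounded)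
  next
    case False
    then have "f r = 0" using assms unfolding sum_mod_def by blast
    then show ?thesis by simp
  qed
  then obtain L where L: "\<And>r p. f r p \<noteq> 0 \<Longrightarrow> length (snd p) \<le> L r" by metis
  have "length w < Suc (\<Sum>r=1..s. L r)" if "f r (i, w) \<noteq> 0" for r i w
  proof -
    have "r \<in> {1..s}" using assms that unfolding sum_mod_def by (metis (mono_tags, lifting) mem_Collect_eq zero_fun_def)
    then have "L r \<le> (\<Sum>r=1..s. L r)" by (intro member_le_sum) auto
    then show ?thesis using L[OF that] by simp
  qed
  then show ?thesis unfolding length_filtration_def by blast
qed

lemma length_filtration_level: "f \<in> sum_mod s ii \<Longrightarrow> f \<in> length_filtration (level f)"
  unfolding level_def by (rule LeastI_ex[OF sum_mod_bounded])

lemma level_le: "f \<in> length_filtration n \<Longrightarrow> level f \<le> n"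
  unfolding level_def by (rule Least_le)

lemma level_pos:
  assumes "f \<in> sum_mod s ii" "f \<noteq> 0"
  shows "level f > 0"
proof -
  obtain r i w where "f r (i, w) \<noteq> 0" using assms(2) by (metis ext prod.exhaust zero_fun_def)
  then have "length w < level f" using length_filtration_level[OF assms(1)] unfolding length_filtration_def by blast
  then show ?thesis by simp
qed

lemma shift_length_filtration: "f \<in> length_filtration (Suc n) \<Longrightarrow> shift a f \<in> length_filtration n"
  unfolding length_filtration_def shift_def by simp (metis Suc_less_eq length_Cons)

definition adapted :: "('i \<times> int \<Rightarrow> nat \<Rightarrow> nat \<Rightarrow> 'i path \<Rightarrow> complex) \<Rightarrow> bool" where
  "adapted F \<longleftrightarrow> (\<forall>q n. frame_span F \<inter> sum_comp s ii dg q \<inter> length_filtration n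
     \<subseteq> fam.span (F q ` {r. r < v q \<and> F q r \<in> length_filtration n}))"

text \<open>A homogeneous component of the submodule is finite dimensional, hence contained in one
  step of the filtration by path length, and there a compatible basis exists. The bound on path
  lengths in \<open>I_mod_bounded\<close> is what makes the filtration exhaustive.\<close>

lemma adapted_frame:
  assumes F: "F \<in> Frames"
  shows "\<exists>G\<in>Frames. frame_span G = frame_span F \<and> adapted G"
proof -
  let ?S = "\<lambda>q. frame_span F \<inter> sum_comp s ii dg q"
  have ind: "inj_on (F q) {..<v q}" "fam.independent (F q ` {..<v q})" for q
    using FramesE(1)[OF F] unfolding independent_frame_iff by blast+
  have S: "fam.span (F q ` {..<v q}) = ?S q" for q by (rule FramesE(3)[OF F])
  have "\<exists>h. bij_betw h {..<v q} (h ` {..<v q}) \<and> fam.independent (h ` {..<v q}) \<and> fam.span (h ` {..<v q}) = ?S q \<and>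
      (\<forall>n. ?S q \<inter> length_filtration n \<subseteq> fam.span (h ` {..<v q} \<inter> length_filtration n))" for q
  proof -
    have "\<exists>L. F q n \<in> length_filtration L" if "n < v q" for n
    proof -
      have "F q n \<in> ?S q" unfolding S[symmetric] using that by (intro fam.span_base) simp
      then show ?thesis using sum_mod_bounded unfolding sum_comp_def by blast
    qed
    then obtain l where l: "\<And>n. n < v q \<Longrightarrow> F q n \<in> length_filtration (l n)" by metis
    define L where "L = (\<Sum>n<v q. l n)"
    have "F q ` {..<v q} \<subseteq> length_filtration L"
    proof (rule image_subsetI)
      fix n assume n: "n \<in> {..<v q}"
      have "l n \<le> L" unfolding L_def using n by (intro member_le_sum) auto
      then show "F q n \<in> length_filtration L" using l n monoD[OF mono_length_filtration] by blast
    qed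
    then have SL: "?S q \<subseteq> length_filtration L"
      unfolding S[symmetric] using subspace_length_filtration by (rule fam.span_minimal)
    have "fam.subspace (?S q \<inter> length_filtration n)" for n
      unfolding S[symmetric] using subspace_length_filtration by (intro fam.subspace_inter fam.subspace_span)
    then have "\<exists>B\<subseteq>?S q \<inter> length_filtration L. fam.independent B \<and>
        (\<forall>n\<le>L. ?S q \<inter> length_filtration n \<subseteq> fam.span (B \<inter> (?S q \<inter> length_filtration n)))"
      by (rule fam.filtration_basis) (use mono_length_filtration in \<open>unfold mono_def, blast\<close>)
    then obtain B where B: "B \<subseteq> ?S q \<inter> length_filtration L" "fam.independent B"
      "\<forall>n\<le>L. ?S q \<inter> length_filtration n \<subseteq> fam.span (B \<inter> (?S q \<inter> length_filtration n))"
      by (elim exE conjE)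
    have filt: "?S q \<inter> length_filtration n \<subseteq> fam.span (B \<inter> length_filtration n)" for n
    proof -
      have "?S q \<inter> length_filtration n \<subseteq> ?S q \<inter> length_filtration (min n L)" using SL by (auto simp: min_def)
      also have "\<dots> \<subseteq> fam.span (B \<inter> (?S q \<inter> length_filtration (min n L)))" using B(3) by simp
      also have "\<dots> \<subseteq> fam.span (B \<inter> length_filtration n)"
        using monoD[OF mono_length_filtration, of "min n L" n] by (intro fam.span_mono) auto
      finally show ?thesis .
    qed
    have spB: "fam.span B = ?S q"
    proof
      show "fam.span B \<subseteq> ?S q" unfolding S[symmetric]
        by (rule fam.span_minimal) (use B(1) S fam.subspace_span in blast)+
      show "?S q \<subseteq> fam.span B" using filt[of L] SL fam.span_mono[of "B \<inter> length_filtration L" B] by blast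
    qed
    have "finite B" using fam.independent_span_bound[of "F q ` {..<v q}" B] B(1,2) S by auto
    moreover have "card B = v q"
      using fam.dim_span_eq_card_independent[OF B(2)] fam.dim_span_eq_card_independent[OF ind(2), of q]
        spB S[of q] card_image[OF ind(1), of q] by simp
    ultimately obtain h where h: "bij_betw h {0..<v q} B" using ex_bij_betw_nat_finite by metis
    then have "h ` {..<v q} = B" by (simp add: bij_betw_def atLeast0LessThan)
    then show ?thesis using h B(2) spB filt by (intro exI[of _ h]) (simp add: atLeast0LessThan)
  qed
  then have "\<forall>q. \<exists>h. inj_on h {..<v q} \<and> fam.independent (h ` {..<v q}) \<and> fam.span (h ` {..<v q}) = ?S q \<and>
      (\<forall>n. ?S q \<inter> length_filtration n \<subseteq> fam.span (h ` {..<v q} \<inter> length_filtration n))"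
    unfolding bij_betw_def by blast
  from choice[OF this] obtain h where h: "\<forall>q. inj_on (h q) {..<v q} \<and> fam.independent (h q ` {..<v q}) \<and> fam.span (h q ` {..<v q}) = ?S q \<and>
      (\<forall>n. ?S q \<inter> length_filtration n \<subseteq> fam.span (h q ` {..<v q} \<inter> length_filtration n))" by (elim exE)
  define G where "G q n = (if n < v q then h q n else 0)" for q n
  have im: "G q ` {..<v q} = h q ` {..<v q}" for q by (intro image_cong) (auto simp: G_def)
  have inj: "inj_on (G q) {..<v q}" for q using h[rule_format, of q] inj_on_cong[of "{..<v q}" "G q" "h q"] by (simp add: G_def)
  have G0: "\<forall>n\<ge>v q. G q n = 0" for q by (simp add: G_def)
  have G: "G \<in> Frames" unfolding Gr_frames_def
    by (intro CollectI bexI[OF _ FramesE(2)[OF F]] allI conjI) (use h inj G0 im in \<open>simp_all only:, auto\<close>)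
  have "frame_span G = frame_span F"
    unfolding frame_span_alt using h S im by (simp only:)
  moreover have "adapted G" unfolding adapted_def calculation
  proof (intro allI)
    fix q n
    have "G q ` {r. r < v q \<and> G q r \<in> length_filtration n} = G q ` {..<v q} \<inter> length_filtration n" by auto
    then show "?S q \<inter> length_filtration n \<subseteq> fam.span (G q ` {r. r < v q \<and> G q r \<in> length_filtration n})"
      using h im by (simp only:)
  qed
  ultimately show ?thesis using G by blast
qed

lemma frame_level_pos:
  assumes F: "F \<in> Frames" and n: "n < v q"
  shows "F q n \<in> sum_mod s ii" "level (F q n) > 0"
proof -
  have "comb F q (unit_vec (v q) n) \<in> frame_span F \<inter> sum_comp s ii dg q" by (rule comb_in_comp[OF F]) simp
  then show sm: "F q n \<in> sum_mod s ii" unfolding comb_unit_vec[OF n] sum_comp_def by blast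
  have "fam.independent (F q ` {..<v q})" using FramesE(1)[OF F] unfolding independent_frame_iff by blast
  then have "F q n \<noteq> 0" using fam.dependent_zero[of "F q ` {..<v q}"] n by (metis imageI lessThan_iff)
  then show "level (F q n) > 0" by (rule level_pos[OF sm])
qed

text \<open>Shifting by an arrow removes a letter and so lowers the level. In an adapted frame the
  result is a combination of frame vectors of smaller level, and by independence no other
  coordinates occur.\<close>

lemma op_mat_theta_level:
  assumes F: "F \<in> Frames" "adapted F" and sl: "slot a m r n"
    and nz: "op_mat (theta F) a m $$ (r, n) \<noteq> 0"
  shows "level (F (arrow_src a, m + arrow_deg a) r) < level (F (arrow_tgt a, m) n)"
proof -
  let ?q = "(arrow_src a, m + arrow_deg a)" and ?q' = "(arrow_tgt a, m)"
  have a: "is_arrow a" "r < v ?q" "n < v ?q'" using sl by (auto simp: slot_def)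
  let ?e = "unit_vec (v ?q') n :: complex vec"
  have A: "op_mat (theta F) a m \<in> carrier_mat (v ?q) (v ?q')" by (rule op_mat_carrier[OF theta_tuples a(1)])
  obtain l where l: "level (F ?q' n) = Suc l" using frame_level_pos(2)[OF F(1) a(3)] gr0_implies_Suc by blast
  let ?g = "shift a (F ?q' n)"
  have "F ?q' n \<in> length_filtration (Suc l)"
    using length_filtration_level[OF frame_level_pos(1)[OF F(1) a(3)]] unfolding l .
  then have "?g \<in> length_filtration l" by (rule shift_length_filtration)
  moreover have "?g \<in> frame_span F \<inter> sum_comp s ii dg ?q"
    using comb_in_comp[OF F(1), of ?e ?q'] unfolding comb_unit_vec[of n ?q' F, OF a(3)] by (intro shift_comp[OF F(1) a(1)]) simp
  ultimately have g: "?g \<in> fam.span (F ?q ` {r. r < v ?q \<and> F ?q r \<in> length_filtration l})"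
    using F(2) unfolding adapted_def by blast
  \<comment> \<open>The frame vectors of small level with zeros in the other places, so that the
    combination keeps the index set of the full frame.\<close>
  define G where "G q k = (if F q k \<in> length_filtration l then F q k else 0)" for q k
  have "F ?q ` {r. r < v ?q \<and> F ?q r \<in> length_filtration l} \<subseteq> G ?q ` {..<v ?q}"
  proof (rule image_subsetI)
    fix k assume "k \<in> {r. r < v ?q \<and> F ?q r \<in> length_filtration l}"
    then have "F ?q k = G ?q k" "k \<in> {..<v ?q}" by (simp_all add: G_def)
    then show "F ?q k \<in> G ?q ` {..<v ?q}" by (rule image_eqI)
  qed
  then have "?g \<in> fam.span (G ?q ` {..<v ?q})" using g fam.span_mono by blast
  then obtain u where u: "u \<in> carrier_vec (v ?q)" "?g = comb G ?q u" unfolding span_frame by blast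
  define u' where "u' = vec (v ?q) (\<lambda>k. if F ?q k \<in> length_filtration l then u $ k else 0)"
  have "comb F ?q u' = comb G ?q u"
    unfolding comb_def u'_def by (intro ext sum.cong refl) (auto simp: G_def)
  moreover have "comb F ?q (op_mat (theta F) a m *\<^sub>v ?e) = ?g"
    using shift_comb[OF F(1) a(1), of ?e m] comb_unit_vec[of n ?q' F, OF a(3)] by simp
  ultimately have "op_mat (theta F) a m *\<^sub>v ?e = u'"
    using u(2) op_mat_mult_carrier[OF theta_tuples a(1), of ?e m]
    by (intro comb_inject[OF FramesE(1)[OF F(1)], of _ ?q]) (simp_all only:, simp_all add: u'_def)
  then have "u' $ r \<noteq> 0" using nz mult_mat_unit_vec_index[OF A a(2,3)] by simp
  then have "F ?q r \<in> length_filtration l" using a(2) by (auto simp: u'_def split: if_splits)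
  then show ?thesis unfolding l using level_le by (simp add: less_Suc_eq_le)
qed

definition torus :: "('i \<times> int \<Rightarrow> nat \<Rightarrow> nat) \<Rightarrow> complex \<Rightarrow> 'i \<times> int \<Rightarrow> complex mat" where
  "torus w t q = mat_diag (v q) (\<lambda>n. t ^ w q n)"

lemma torus_automorphism:
  assumes "t \<noteq> 0"
  shows "(torus w (inverse t), torus w t) \<in> automorphisms v"
proof -
  have "mat_diag n (\<lambda>k. inverse t ^ f k * t ^ f k) = 1\<^sub>m n" "mat_diag n (\<lambda>k. t ^ f k * inverse t ^ f k) = 1\<^sub>m n" for n and f :: "nat \<Rightarrow> nat"
    using assms by (simp_all add: power_inverse)
  then show ?thesis unfolding automorphisms_def torus_def by (simp add: mat_diag_diag)
qed

text \<open>An arrow entry is multiplied by \<open>t\<close> to the difference of two weights, which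
  is positive wherever the entry is nonzero. A framing coordinate is multiplied by \<open>t\<close>
  to one weight, hence the demand that all weights be positive.\<close>

lemma torus_limit:
  assumes x: "x \<in> tuples v" and w: "\<And>q n. n < v q \<Longrightarrow> w q n > 0"
    and dec: "\<And>a m r n. slot a m r n \<Longrightarrow> op_mat x a m $$ (r, n) \<noteq> 0 \<Longrightarrow>
      w (arrow_src a, m + arrow_deg a) r < w (arrow_tgt a, m) n"
    and P: "P \<in> polys (coords v)"
  shows "((\<lambda>t. P (act v (torus w (inverse t), torus w t) x)) \<longlongrightarrow> P (zero_tuple v)) (at 0)"
proof -
  let ?y = "\<lambda>t. act v (torus w (inverse t), torus w t) x"
  let ?A = "{P. ((\<lambda>t. P (?y t)) \<longlongrightarrow> P (zero_tuple v)) (at 0)}"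
  have "function_algebra ?A"
    unfolding function_algebra_def by (auto intro: tendsto_intros)
  moreover have "coords v \<subseteq> ?A"
  proof
    fix f assume "f \<in> coords v"
    then show "f \<in> ?A"
    proof (cases rule: coords_cases)
      case (slot a m r n)
      let ?q = "(arrow_src a, m + arrow_deg a)" and ?q' = "(arrow_tgt a, m)"
      have a: "is_arrow a" "r < v ?q" "n < v ?q'" using slot(1) by (auto simp: slot_def)
      have A: "op_mat x a m \<in> carrier_mat (v ?q) (v ?q')" by (rule op_mat_carrier[OF x a(1)])
      have z: "op_mat (zero_tuple v) a m $$ (r, n) = 0"
        using a c_neg_sym b_sym by (cases a) (auto simp: zero_tuple_def)
      have eq: "op_mat (?y t) a m $$ (r, n) = inverse t ^ w ?q r * op_mat x a m $$ (r, n) * t ^ w ?q' n" for t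
        using A a(2,3) unfolding op_mat_act[OF a(1)] torus_def by (simp add: mat_diag_mult_left[OF A] mat_diag_mult_right[of _ "v ?q"])
      have "((\<lambda>t. inverse t ^ w ?q r * op_mat x a m $$ (r, n) * t ^ w ?q' n) \<longlongrightarrow> 0) (at 0)"
      proof (cases "op_mat x a m $$ (r, n) = 0")
        case False
        \<comment> \<open>The exponent of \<open>t\<close> that is left after cancelling the inverse
          power is \<open>Suc k\<close>; the first factor 0 of its limit comes from this strict drop
          of the weight.\<close>
        then obtain k where k: "w ?q' n = w ?q r + Suc k" using dec[OF slot(1)] less_imp_Suc_add by fastforce
        have "\<forall>\<^sub>F t in at 0. (op_mat x a m $$ (r, n) * t ^ Suc k) = inverse t ^ w ?q r * op_mat x a m $$ (r, n) * t ^ w ?q' n"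
          unfolding k by (rule eventually_at_filter[THEN iffD2], rule always_eventually) (simp add: power_add power_inverse)
        moreover have "((\<lambda>t. op_mat x a m $$ (r, n) * t ^ Suc k) \<longlongrightarrow> op_mat x a m $$ (r, n) * 0 ^ Suc k) (at 0)"
          by (intro tendsto_intros)
        ultimately have "((\<lambda>t. inverse t ^ w ?q r * op_mat x a m $$ (r, n) * t ^ w ?q' n) \<longlongrightarrow> op_mat x a m $$ (r, n) * 0 ^ Suc k) (at 0)"
          by (rule Lim_transform_eventually[rotated])
        then show ?thesis by simp
      qed simp
      then show ?thesis unfolding slot(2) by (simp add: eq z)
    next
      case (ar l i k u)
      interpret l: Vector_Spaces.linear sc "(*)" l by (rule ar(1))
      have "linear_form (v (i, k)) (\<lambda>u. l (Defs.ar x i k u))"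
        using x unfolding linear_form_def tuples_def by (auto simp: l.add l.scale)
      note lf = linear_form_expand[OF this]
      have "l (Defs.ar (?y t) i k u) = (\<Sum>n<v (i, k). t ^ w (i, k) n * u $ n * l (Defs.ar x i k (unit_vec (v (i, k)) n)))" for t
      proof -
        have "torus w t (i, k) *\<^sub>v u = vec (v (i, k)) (\<lambda>n. t ^ w (i, k) n * u $ n)"
          using ar(2) by (intro eq_vecI) (auto simp: torus_def mat_diag_def scalar_prod_def if_distrib[of "\<lambda>z. z * _"] cong: if_cong)
        then show ?thesis using ar(2) lf[of "vec (v (i, k)) (\<lambda>n. t ^ w (i, k) n * u $ n)"] by (simp add: act_def)
      qed
      moreover have "((\<lambda>t. \<Sum>n<v (i, k). t ^ w (i, k) n * u $ n * l (Defs.ar x i k (unit_vec (v (i, k)) n)))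
          \<longlongrightarrow> (\<Sum>n<v (i, k). 0 ^ w (i, k) n * u $ n * l (Defs.ar x i k (unit_vec (v (i, k)) n)))) (at 0)"
        by (intro tendsto_intros)
      moreover have "(\<Sum>n<v (i, k). 0 ^ w (i, k) n * u $ n * l (Defs.ar x i k (unit_vec (v (i, k)) n))) = 0"
        using w by (intro sum.neutral) auto
      ultimately show ?thesis unfolding ar(3) by (simp add: zero_tuple_def l.zero)
    qed
  qed
  ultimately show ?thesis using polys_subset P by blast
qed

lemma crit_locus_nilpotent:
  assumes x: "x \<in> crit_locus" and P: "P \<in> invariant_polys v"
  shows "P x = P (zero_tuple v)"
proof -
  obtain F where F: "F \<in> Frames" "frame_span F = frame_span (psi x)" "adapted F"
    using adapted_frame[OF psi_Frames[OF x]] by blast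
  let ?w = "\<lambda>q n. level (F q n)"
  have inv: "P (act v gh y) = P y" if "gh \<in> automorphisms v" "y \<in> tuples v" for gh y
    using P that unfolding invariant_polys_def by blast
  have "orbit v x = orbit v (theta F)"
    unfolding orbit_eq_iff[OF x theta_crit_locus[OF F(1)]] psi_theta[OF F(1)] F(2) ..
  then have "x \<in> orbit v (theta F)" using orbit_refl[OF crit_locus_stable[OF x]] by simp
  then obtain g h where "(g, h) \<in> automorphisms v" "x = act v (g, h) (theta F)" by (rule orbitE)
  then have Px: "P x = P (theta F)" using inv theta_tuples by blast
  have "((\<lambda>t. P (act v (torus ?w (inverse t), torus ?w t) (theta F))) \<longlongrightarrow> P (zero_tuple v)) (at 0)"
    using P unfolding invariant_polys_def
    by (intro torus_limit[OF theta_tuples] frame_level_pos(2)[OF F(1)] op_mat_theta_level[OF F(1,3)]) auto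
  moreover have "\<forall>\<^sub>F t in at 0. P (act v (torus ?w (inverse t), torus ?w t) (theta F)) = P x"
    unfolding Px by (rule eventually_at_filter[THEN iffD2], rule always_eventually) (use inv torus_automorphism theta_tuples in blast)
  ultimately have "((\<lambda>t::complex. P x) \<longlongrightarrow> P (zero_tuple v)) (at 0)" by (rule Lim_transform_eventually)
  then show ?thesis by (simp add: tendsto_const_iff)
qed

end

context quiver_datum
begin

text \<open>The coordinate forms have to be linear on the whole ambient space. They are therefore
  taken as coordinates in a basis of that space which extends the basis of the component of W in
  question.\<close>

lemma framing_basis:
  fixes s :: nat
  assumes dim: "\<forall>q. has_dim sc (W q) (\<Sum>r=1..s. dirac (ii r, kk r) q)"
  shows "\<exists>e ph. (\<forall>r\<in>{1..s}. e r \<in> W (ii r, kk r)) \<and> (\<forall>r. Vector_Spaces.linear sc (*) (ph r)) \<and>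
    (\<forall>r\<in>{1..s}. \<forall>r'\<in>{1..s}. ii r = ii r' \<longrightarrow> kk r = kk r' \<longrightarrow> ph r (e r') = (if r = r' then 1 else 0)) \<and>
    (\<forall>q. \<forall>y\<in>W q. y = (\<Sum>r\<in>{r\<in>{1..s}. (ii r, kk r) = q}. sc (ph r y) (e r)))"
proof -
  let ?R = "\<lambda>q. {r\<in>{1..s}. (ii r, kk r) = q}"
  have card: "(\<Sum>r=1..s. dirac (ii r, kk r) q) = card (?R q)" for q
  proof -
    have "(\<Sum>r=1..s. dirac (ii r, kk r) q) = (\<Sum>r\<in>?R q. 1)"
      unfolding dirac_def by (rule sum.mono_neutral_cong_right) auto
    then show ?thesis by simp
  qed
  have "\<forall>q. \<exists>Bf. framing.independent (fst Bf) \<and> framing.span (fst Bf) = W q \<and> finite (fst Bf) \<and> bij_betw (snd Bf) (?R q) (fst Bf)"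
  proof
    fix q
    obtain B where B: "finite B" "card B = card (?R q)" "framing.independent B" "framing.span B = W q"
      using dim unfolding card has_dim_def by blast
    moreover obtain f where "bij_betw f (?R q) B" using finite_same_card_bij[of "?R q" B] B(1,2) by auto
    ultimately show "\<exists>Bf. framing.independent (fst Bf) \<and> framing.span (fst Bf) = W q \<and> finite (fst Bf) \<and> bij_betw (snd Bf) (?R q) (fst Bf)"
      by (intro exI[of _ "(B, f)"]) simp
  qed
  from choice[OF this] obtain Bf where Bf: "\<And>q. framing.independent (fst (Bf q)) \<and> framing.span (fst (Bf q)) = W q \<and>
      finite (fst (Bf q)) \<and> bij_betw (snd (Bf q)) (?R q) (fst (Bf q))" by blast
  define B f where "B q = fst (Bf q)" and "f q = snd (Bf q)" for q
  have B: "framing.independent (B q)" "framing.span (B q) = W q" "finite (B q)"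
    and f: "bij_betw (f q) (?R q) (B q)" for q
    using Bf[of q] by (simp_all add: B_def f_def)
  define e where "e r = f (ii r, kk r) r" for r
  define E where "E q = framing.extend_basis (B q)" for q
  have E: "framing.independent (E q)" "y \<in> framing.span (E q)" "B q \<subseteq> E q" for q y
    unfolding E_def using framing.independent_extend_basis[OF B(1)] framing.span_extend_basis[OF B(1)]
      framing.extend_basis_superset[OF B(1)] by auto
  define ph where "ph r y = framing.representation (E (ii r, kk r)) y (e r)" for r y
  have e: "bij_betw e (?R q) (B q)" for q
    using f[of q] by (rule bij_betw_cong[THEN iffD1, rotated]) (auto simp: e_def)
  have eB: "e r \<in> B (ii r, kk r)" if "r \<in> {1..s}" for r using bij_betwE[OF e] that by blast
  have "Vector_Spaces.linear sc (*) (ph r)" for r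
    unfolding ph_def by unfold_locales
      (simp_all add: framing.representation_add[OF E(1,2,2)] framing.representation_scale[OF E(1,2)] algebra_simps)
  moreover have "ph r (e r') = (if r = r' then 1 else 0)"
    if r: "r \<in> {1..s}" "r' \<in> {1..s}" "ii r = ii r'" "kk r = kk r'" for r r'
  proof -
    have "ph r (e r') = (if e r = e r' then 1 else 0)"
      unfolding ph_def r(3,4) framing.representation_basis[OF E(1) subsetD[OF E(3) eB[OF r(2)]]] ..
    moreover have "e r = e r' \<longleftrightarrow> r = r'"
      using inj_on_eq_iff[OF bij_betw_imp_inj_on[OF e], of r "(ii r, kk r)" r'] r by auto
    ultimately show ?thesis by simp
  qed
  moreover have "y = (\<Sum>r\<in>?R q. sc (ph r y) (e r))" if y: "y \<in> W q" for q y
  proof -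
    have "y = (\<Sum>b\<in>B q. sc (framing.representation (B q) y b) b)"
      using framing.sum_representation_eq[OF B(1) _ B(3), of y q] y B(2) by simp
    also have "\<dots> = (\<Sum>b\<in>B q. sc (framing.representation (E q) y b) b)"
      using framing.representation_extend[OF E(1) _ E(3), of y q] y B(2) by simp
    also have "\<dots> = (\<Sum>r\<in>?R q. sc (framing.representation (E q) y (e r)) (e r))"
      by (rule sum.reindex_bij_betw[OF e, symmetric])
    also have "\<dots> = (\<Sum>r\<in>?R q. sc (ph r y) (e r))" by (intro sum.cong refl) (auto simp: ph_def)
    finally show ?thesis .
  qed
  moreover have "e r \<in> W (ii r, kk r)" if "r \<in> {1..s}" for r
    using eB[OF that] B(2) framing.span_base by blast
  ultimately show ?thesis by blast
qed

end

theorem proposition5p8: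
  fixes c :: "'i::finite \<Rightarrow> 'i \<Rightarrow> int" and d :: "'i \<Rightarrow> int" and Or :: "('i \<times> 'i) set"
    and sc :: "complex \<Rightarrow> 'w::ab_group_add \<Rightarrow> 'w" and W :: "'i \<times> int \<Rightarrow> 'w set"
    and s :: nat and ii :: "nat \<Rightarrow> 'i" and kk :: "nat \<Rightarrow> int"
  assumes "quiver_datum c d Or sc W"
    and "\<forall>q. has_dim sc (W q) (\<Sum>r=1..s. dirac (ii r, kk r) q)"
  shows "subtopology (quiver_datum.M_space c d sc W) (quiver_datum.crit_f2 c d Or sc W)
           homeomorphic_space
         cartan_datum.Gr_space c d Or s ii (\<lambda>r. kk r + d (ii r))
         \<and> quiver_datum.crit_f2 c d Or sc W \<subseteq> quiver_datum.L_space c d sc W"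
proof -
  interpret quiver_datum c d Or sc W by (rule assms(1))
  \<comment> \<open>The bases of W and their coordinate forms are chosen once, independently of the
    dimension vector \<open>v\<close>, which then varies over the summands of both spaces.\<close>
  obtain e ph where framing: "\<forall>r\<in>{1..s}. e r \<in> W (ii r, kk r)" "\<forall>r. Vector_Spaces.linear sc (*) (ph r)"
    "\<forall>r\<in>{1..s}. \<forall>r'\<in>{1..s}. ii r = ii r' \<longrightarrow> kk r = kk r' \<longrightarrow> ph r (e r') = (if r = r' then 1 else 0)"
    "\<forall>q. \<forall>y\<in>W q. y = (\<Sum>r\<in>{r\<in>{1..s}. (ii r, kk r) = q}. sc (ph r y) (e r))"
    using framing_basis[OF assms(2)] by (elim exE conjE)
  let ?I = "{v :: 'i \<times> int \<Rightarrow> nat. finite {q. v q \<noteq> 0}}"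
  let ?Z = "\<lambda>v. {x \<in> stable v. relations v x}"
  have fq: "framed_quiver c d Or sc W s ii kk e ph v" if v: "v \<in> ?I" for v
  proof (rule framed_quiver.intro[OF assms(1)], rule framed_quiver_axioms.intro)
    show "finite {q. v q \<noteq> 0}" using v by simp
  qed (use framing in blast)+
  have crit: "{p. critical_point v (f2 v) p} = orbit v ` ?Z v" if "v \<in> ?I" for v
    using framed_quiver.critical_locus[OF fq[OF that]] unfolding framed_quiver.crit_locus_def[OF fq[OF that]] .
  have "crit_f2 = Sigma ?I (\<lambda>v. {p. critical_point v (f2 v) p})" unfolding crit_f2_def by auto
  also have "\<dots> = Sigma ?I (\<lambda>v. orbit v ` ?Z v)" by (rule Sigma_cong[OF refl crit])
  finally have crit_f2: "crit_f2 = Sigma ?I (\<lambda>v. orbit v ` ?Z v)" .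
  show ?thesis
  proof
    have "subtopology (M_component v) (orbit v ` ?Z v) homeomorphic_space Gr_component s ii (\<lambda>r. kk r + d (ii r)) v"
      if "v \<in> ?I" for v
      using framed_quiver.crit_component_homeomorphic[OF fq[OF that]] unfolding framed_quiver.crit_locus_def[OF fq[OF that]] .
    then show "subtopology M_space crit_f2 homeomorphic_space Gr_space s ii (\<lambda>r. kk r + d (ii r))"
      unfolding M_space_def Gr_space_def crit_f2 subtopology_sum_topology
      by (rule homeomorphic_space_sum_topology)
    show "crit_f2 \<subseteq> L_space"
    proof
      fix z assume "z \<in> crit_f2"
      then obtain v x where v: "v \<in> ?I" and x: "x \<in> stable v" "relations v x" and z: "z = (v, orbit v x)"
        unfolding crit_f2 by blast
      have "P x = P (zero_tuple v)" if "P \<in> invariant_polys v" for P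
        using framed_quiver.crit_locus_nilpotent[OF fq[OF v] _ that] framed_quiver.crit_locus_def[OF fq[OF v]] x by blast
      then show "z \<in> L_space" unfolding L_space_def z using v x(1) by blast
    qed
  qed
qed

end
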